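(* For any integer $m\ge 1$ there exist absolute constants $c_m,d_m>0$ (depending only on $m$) such that the restriction of the Birkhoff map $\Omega$ to $H^m_r$ satisfies, for all $\varphi\in H^m_r$, the two-sided estimates (i) $\displaystyle \|\Omega(\varphi)\|_m\le c_m\bigl(\|\varphi\|_m+(1+\|\varphi\|_1)^{2m}\|\varphi\|_0\bigr)$, (ii) $\displaystyle \|\varphi\|_m\le d_m\bigl(\|\Omega(\varphi)\|_m+(1+\|\Omega(\varphi)\|_1)^{4m-3}\|\Omega(\varphi)\|_0\bigr)$.
   Context: Spaces. $\mathbb T=\mathbb R/\mathbb Z$, $\langle x\rangle=1+|x|$. $L^2_c=L^2(\mathbb T,\mathbb C)\times L^2(\mathbb T,\mathbb C)$ with elements $\varphi=(\varphi_-,\varphi_+)$ and Fourier series $\varphi=\sum_{n\in\mathbb Z}(\varphi^-_{2n}e^{-2in\pi x},\varphi^+_{2n}e^{2in\pi x})$. For $s\ge 0$, $\|\varphi\|_s^2=\sum_n\langle 2n\pi\rangle^{2s}(|\varphi^-_{2n}|^2+|\varphi^+_{2n}|^2)$, $H^s_c=\{\varphi\in L^2_c:\|\varphi\|_s<\infty\}$. Real type: $L^2_r=\{\varphi\in L^2_c:\varphi_-=\overline{\varphi_+}\}$, $H^s_r=L^2_r\cap H^s_c$. Model space: $h^s_r$ is the space of real sequences $(x,y)=(x_n,y_n)_{n\in\mathbb Z}$ with $\|(x,y)\|_s=(\|x\|_s^2+\|y\|_s^2)^{1/2}<\infty$, $\|x\|_s^2=\sum_n\langle 2n\pi\rangle^{2s}|x_n|^2$.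 Spectrum. For $\varphi\in L^2_c$ let $L(\varphi)=\begin{pmatrix} i&0\\0&-i\end{pmatrix}\frac{d}{dx}+\begin{pmatrix}0&\varphi_-\\ \varphi_+&0\end{pmatrix}$ on $[0,2]$ with periodic boundary conditions. For $\varphi\in L^2_r$ its spectrum is a sequence of real eigenvalues (with multiplicity) $\dots\le\lambda_{n-1}^+<\lambda_n^-\le\lambda_n^+<\lambda_{n+1}^-\le\dots$ with $\lambda_n^\pm=n\pi+\ell^2_n$. Put $\gamma_n=\lambda_n^+-\lambda_n^-$, $\tau_n=(\lambda_n^-+\lambda_n^+)/2$. Let $M(x,\lambda,\varphi)$ be the fundamental solution of $L(\varphi)M=\lambda M$ with $M(0)=\mathrm{Id}$, $\Delta(\lambda)=\operatorname{tr}M(1,\lambda,\varphi)$, $\Delta^\bullet=\partial_\lambda\Delta$. Actions. The standard root $\varsigma_n(\lambda)$ is the analytic function on $\mathbb C\setminus[\lambda_n^-,\lambda_n^+]$ with $\varsigma_n(\lambda)^2=(\lambda_n^+-\lambda)(\lambda_n^--\lambda)$ and $\varsigma_n(\lambda)=(\tau_n-\lambda)\sqrt{1-\gamma_n^2/(4(\tau_n-\lambda)^2)}$ for $|\lambda|$ large (principal root). With $\pi_n=n\pi$ for $n\ne0$, $\pi_0=1$, the canonical root is $\sqrt[c]{\Delta^2(\lambda)-4}=2i\prod_{m\in\mathbb Z}\varsigma_m(\lambda)/\pi_m$. The actions are $I_n=\frac1\pi\int_{\Gamma_n}\frac{\lambda\Delta^\bullet(\lambda)}{\sqrt[c]{\Delta^2(\lambda)-4}}\,d\lambda$,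 with $\Gamma_n$ any counterclockwise circuit sufficiently close to and around $[\lambda_n^-,\lambda_n^+]$. Birkhoff map. $\Omega:H^0_r\to h^0_r$, $\varphi\mapsto(x_n,y_n)_{n\in\mathbb Z}$, is the (known) Birkhoff map of the defocusing NLS equation $i\partial_tu=-\partial_x^2u+2|u|^2u$ on $\mathbb T$: a bi-analytic diffeomorphism, canonical with respect to the bracket $\{F,G\}=-i\int_{\mathbb T}(\partial_{\varphi_-}F\,\partial_{\varphi_+}G-\partial_{\varphi_+}F\,\partial_{\varphi_-}G)\,dx$ and the bracket $\{x_n,y_m\}=-\delta_{n,m}$ (all others zero), whose restrictions $\Omega:H^m_r\to h^m_r$, $m\ge1$ integer, are again bi-analytic diffeomorphisms, and such that $(x_n^2+y_n^2)/2=I_n(\varphi)$ for all $n\in\mathbb Z$. *)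

theory Defs
  imports
    "HOL-Complex_Analysis.Complex_Analysis"
    "HOL-Library.Function_Algebras"
begin

section \<open>Real analytic maps between seminormed function spaces\<close>

instantiation "fun" :: (type, real_vector) real_vector
begin

definition scaleR_fun :: "real \<Rightarrow> ('a \<Rightarrow> 'b) \<Rightarrow> 'a \<Rightarrow> 'b"
  where "scaleR_fun c f = (\<lambda>x. c *\<^sub>R f x)"

instance
  by standard (simp_all add: scaleR_fun_def fun_eq_iff algebra_simps)

end

text \<open>
  A space is given by a carrier \<open>E\<close> (a linear subspace) and a seminorm \<open>p\<close>. Elements of
  \<open>L\<^sup>2\<close>-type spaces are represented by functions, two of which denote the same element iff
  the seminorm of their difference vanishes (equality almost everywhere); identities
  between vectors of such a space are stated modulo the kernel of the seminorm.
\<close>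

definition bounded_multilinear_form ::
  "'a::real_vector set \<Rightarrow> ('a \<Rightarrow> real) \<Rightarrow> 'b::real_vector set \<Rightarrow> ('b \<Rightarrow> real) \<Rightarrow>
    nat \<Rightarrow> real \<Rightarrow> ('a list \<Rightarrow> 'b) \<Rightarrow> bool"
  where "bounded_multilinear_form E p G q k C A \<longleftrightarrow>
    (\<forall>hs. set hs \<subseteq> E \<and> length hs = k \<longrightarrow>
       A hs \<in> G \<and> q (A hs) \<le> C * (\<Prod>h\<leftarrow>hs. p h) \<and>
       (\<forall>i<k. \<forall>u\<in>E. \<forall>v\<in>E. \<forall>a b.
          q (A (hs[i := a *\<^sub>R u + b *\<^sub>R v]) - (a *\<^sub>R A (hs[i := u]) + b *\<^sub>R A (hs[i := v]))) = 0))"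

text \<open>
  Near every point \<open>x\<close> the map is the sum of a power series with \<open>k\<close>-th term
  \<open>A k (h, \<dots>, h)\<close> and positive radius of convergence.
\<close>

definition real_analytic_map ::
  "'a::real_vector set \<Rightarrow> ('a \<Rightarrow> real) \<Rightarrow> 'b::real_vector set \<Rightarrow> ('b \<Rightarrow> real) \<Rightarrow> ('a \<Rightarrow> 'b) \<Rightarrow> bool"
  where "real_analytic_map E p G q F \<longleftrightarrow>
    (\<forall>x\<in>E. F x \<in> G) \<and>
    (\<forall>x\<in>E. \<exists>r>0. \<exists>C A.
       (\<forall>k. bounded_multilinear_form E p G q k (C k) (A k)) \<and>
       summable (\<lambda>k. C k * r ^ k) \<and>
       (\<forall>h\<in>E. p h < r \<longrightarrow>
          (\<lambda>N. q (F (x + h) - (\<Sum>k<N. A k (replicate k h)))) \<longlonglongrightarrow> 0))"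

definition bianalytic_diffeo ::
  "'a::real_vector set \<Rightarrow> ('a \<Rightarrow> real) \<Rightarrow> 'b::real_vector set \<Rightarrow> ('b \<Rightarrow> real) \<Rightarrow> ('a \<Rightarrow> 'b) \<Rightarrow> bool"
  where "bianalytic_diffeo E p G q F \<longleftrightarrow>
    real_analytic_map E p G q F \<and>
    (\<exists>F'. real_analytic_map G q E p F' \<and>
       (\<forall>x\<in>E. p (F' (F x) - x) = 0) \<and> (\<forall>y\<in>G. q (F (F' y) - y) = 0))"


section \<open>Function and sequence spaces\<close>

text \<open>
  A potential \<open>\<phi> = (\<phi>\<^sub>-, \<phi>\<^sub>+)\<close> on the circle is a 1-periodic function on the line, with
  \<open>\<phi>\<^sub>-\<close> the first and \<open>\<phi>\<^sub>+\<close> the second component.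
\<close>

type_synonym potential = "real \<Rightarrow> complex \<times> complex"
type_synonym coords = "int \<Rightarrow> real \<times> real"

definition weight :: "real \<Rightarrow> int \<Rightarrow> real"
  where "weight s n = (1 + \<bar>2 * of_int n * pi\<bar>) powr (2 * s)"

definition L2c :: "potential set"
  where "L2c = {\<phi>. \<phi> \<in> borel_measurable borel \<and> (\<forall>x. \<phi> (x + 1) = \<phi> x) \<and>
    set_integrable lborel {0..1} (\<lambda>x. (norm (\<phi> x))\<^sup>2)}"

definition fourier_minus :: "potential \<Rightarrow> int \<Rightarrow> complex"
  where "fourier_minus \<phi> n =
    (LINT x:{0..1}|lborel. fst (\<phi> x) * exp (2 * \<i> * of_int n * of_real (pi * x)))"

definition fourier_plus :: "potential \<Rightarrow> int \<Rightarrow> complex"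
  where "fourier_plus \<phi> n =
    (LINT x:{0..1}|lborel. snd (\<phi> x) * exp (- (2 * \<i> * of_int n * of_real (pi * x))))"

definition sobolev_term :: "real \<Rightarrow> potential \<Rightarrow> int \<Rightarrow> real"
  where "sobolev_term s \<phi> n =
    weight s n * ((norm (fourier_minus \<phi> n))\<^sup>2 + (norm (fourier_plus \<phi> n))\<^sup>2)"

definition sobolev_norm :: "real \<Rightarrow> potential \<Rightarrow> real"
  where "sobolev_norm s \<phi> = sqrt (\<Sum>\<^sub>\<infinity>n. sobolev_term s \<phi> n)"

definition Hc :: "real \<Rightarrow> potential set"
  where "Hc s = {\<phi> \<in> L2c. sobolev_term s \<phi> summable_on UNIV}"

definition L2r :: "potential set"
  where "L2r = {\<phi> \<in> L2c. AE x in lborel. fst (\<phi> x) = cnj (snd (\<phi> x))}"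

definition Hr :: "real \<Rightarrow> potential set"
  where "Hr s = L2r \<inter> Hc s"

definition seq_norm :: "real \<Rightarrow> (int \<Rightarrow> real) \<Rightarrow> real"
  where "seq_norm s x = sqrt (\<Sum>\<^sub>\<infinity>n. weight s n * \<bar>x n\<bar>\<^sup>2)"

definition coords_norm :: "real \<Rightarrow> coords \<Rightarrow> real"
  where "coords_norm s z =
    sqrt ((seq_norm s (\<lambda>n. fst (z n)))\<^sup>2 + (seq_norm s (\<lambda>n. snd (z n)))\<^sup>2)"

definition hr :: "real \<Rightarrow> coords set"
  where "hr s = {z. (\<lambda>n. weight s n * \<bar>fst (z n)\<bar>\<^sup>2) summable_on UNIV \<and>
                    (\<lambda>n. weight s n * \<bar>snd (z n)\<bar>\<^sup>2) summable_on UNIV}"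


section \<open>The Zakharov-Shabat operator and its periodic spectrum\<close>

definition H1_derivative :: "real \<Rightarrow> (real \<Rightarrow> complex ^ 2) \<Rightarrow> (real \<Rightarrow> complex ^ 2) \<Rightarrow> bool"
  where "H1_derivative b f f' \<longleftrightarrow>
    f' \<in> borel_measurable borel \<and>
    set_integrable lborel {0..b} (\<lambda>x. (norm (f' x))\<^sup>2) \<and>
    (\<forall>x\<in>{0..b}. f x = f 0 + (LINT t:{0..x}|lborel. f' t))"

text \<open>The value of \<open>L(\<phi>) f\<close> at a point, in terms of the derivative \<open>f'\<close> of \<open>f\<close>.\<close>

definition ZS_op ::
  "potential \<Rightarrow> (real \<Rightarrow> complex ^ 2) \<Rightarrow> (real \<Rightarrow> complex ^ 2) \<Rightarrow> real \<Rightarrow> complex ^ 2"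
  where "ZS_op \<phi> f f' x =
    vector [\<i> * f' x $ 1 + fst (\<phi> x) * f x $ 2, - \<i> * f' x $ 2 + snd (\<phi> x) * f x $ 1]"

definition ZS_solution :: "real \<Rightarrow> potential \<Rightarrow> complex \<Rightarrow> (real \<Rightarrow> complex ^ 2) \<Rightarrow> bool"
  where "ZS_solution b \<phi> \<mu> f \<longleftrightarrow>
    (\<exists>f'. H1_derivative b f f' \<and>
       (AE x in lborel. x \<in> {0..b} \<longrightarrow> ZS_op \<phi> f f' x = \<mu> *s f x))"

text \<open>
  Functions on \<open>[0,2]\<close> are extended by zero, so that each of them has exactly one
  representative and dimensions of eigenspaces make sense.
\<close>

definition periodic_eigenspace :: "potential \<Rightarrow> complex \<Rightarrow> (real \<Rightarrow> complex ^ 2) set"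
  where "periodic_eigenspace \<phi> \<mu> =
    {f. (\<forall>x. x \<notin> {0..2} \<longrightarrow> f x = 0) \<and> f 0 = f 2 \<and> ZS_solution 2 \<phi> \<mu> f}"

definition cscale :: "complex \<Rightarrow> (real \<Rightarrow> complex ^ 2) \<Rightarrow> real \<Rightarrow> complex ^ 2"
  where "cscale c f = (\<lambda>x. c *s f x)"

lemma vector_space_cscale: "vector_space cscale"
  by standard
    (auto simp: cscale_def fun_eq_iff vector_add_ldistrib vector_sadd_rdistrib vector_smult_assoc)

definition eigenvalue_mult :: "potential \<Rightarrow> complex \<Rightarrow> nat"
  where "eigenvalue_mult \<phi> \<mu> = vector_space.dim cscale (periodic_eigenspace \<phi> \<mu>)"

text \<open>
  Enumeration of the periodic spectrum with multiplicities. For potentials of real type the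
  operator is self-adjoint, so geometric and algebraic multiplicities agree; the asymptotics
  fix the numbering.
\<close>

definition is_periodic_spectrum :: "potential \<Rightarrow> (int \<Rightarrow> real) \<Rightarrow> (int \<Rightarrow> real) \<Rightarrow> bool"
  where "is_periodic_spectrum \<phi> lm lp \<longleftrightarrow>
    (\<forall>n. lm n \<le> lp n \<and> lp n < lm (n + 1)) \<and>
    (\<forall>\<mu>. card {n. complex_of_real (lm n) = \<mu>} + card {n. complex_of_real (lp n) = \<mu>}
          = eigenvalue_mult \<phi> \<mu>) \<and>
    (\<lambda>n. (lm n - of_int n * pi)\<^sup>2) summable_on UNIV \<and>
    (\<lambda>n. (lp n - of_int n * pi)\<^sup>2) summable_on UNIV"

definition periodic_spectrum :: "potential \<Rightarrow> (int \<Rightarrow> real) \<times> (int \<Rightarrow> real)"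
  where "periodic_spectrum \<phi> = (THE l. is_periodic_spectrum \<phi> (fst l) (snd l))"

definition lam_minus :: "potential \<Rightarrow> int \<Rightarrow> real"
  where "lam_minus \<phi> = fst (periodic_spectrum \<phi>)"

definition lam_plus :: "potential \<Rightarrow> int \<Rightarrow> real"
  where "lam_plus \<phi> = snd (periodic_spectrum \<phi>)"

definition gap_length :: "potential \<Rightarrow> int \<Rightarrow> real"
  where "gap_length \<phi> n = lam_plus \<phi> n - lam_minus \<phi> n"

definition gap_mid :: "potential \<Rightarrow> int \<Rightarrow> real"
  where "gap_mid \<phi> n = (lam_minus \<phi> n + lam_plus \<phi> n) / 2"

definition gap :: "potential \<Rightarrow> int \<Rightarrow> complex set"
  where "gap \<phi> n = closed_segment (of_real (lam_minus \<phi> n)) (of_real (lam_plus \<phi> n))"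

definition fundamental_solution :: "real \<Rightarrow> complex \<Rightarrow> potential \<Rightarrow> complex ^ 2 ^ 2"
  where "fundamental_solution x \<mu> \<phi> =
    (THE N. \<exists>M. M 0 = mat 1 \<and> (\<forall>j. ZS_solution x \<phi> \<mu> (\<lambda>t. column j (M t))) \<and> M x = N)"

definition discriminant :: "potential \<Rightarrow> complex \<Rightarrow> complex"
  where "discriminant \<phi> \<mu> = trace (fundamental_solution 1 \<mu> \<phi>)"


section \<open>Actions\<close>

text \<open>Only meaningful for \<open>\<mu>\<close> outside \<open>gap \<phi> n\<close>.\<close>

definition standard_root :: "potential \<Rightarrow> int \<Rightarrow> complex \<Rightarrow> complex"
  where "standard_root \<phi> n \<mu> = (THE w. \<exists>f.
     f holomorphic_on (- gap \<phi> n) \<and>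
     (\<forall>z \<in> - gap \<phi> n.
        (f z)\<^sup>2 = (of_real (lam_plus \<phi> n) - z) * (of_real (lam_minus \<phi> n) - z)) \<and>
     (\<forall>\<^sub>F z in at_infinity. f z = (of_real (gap_mid \<phi> n) - z) *
        csqrt (1 - of_real ((gap_length \<phi> n)\<^sup>2) / (4 * (of_real (gap_mid \<phi> n) - z)\<^sup>2))) \<and>
     f \<mu> = w)"

definition pi_idx :: "int \<Rightarrow> complex"
  where "pi_idx n = (if n = 0 then 1 else of_int n * of_real pi)"

text \<open>
  The product over the integers converges only conditionally and is understood as the limit of
  the symmetric partial products.
\<close>

definition canonical_root :: "potential \<Rightarrow> complex \<Rightarrow> complex"
  where "canonical_root \<phi> \<mu> =
    2 * \<i> * lim (\<lambda>N. \<Prod>m\<in>{- int N..int N}. standard_root \<phi> m \<mu> / pi_idx m)"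

text \<open>Counterclockwise circuits around the \<open>n\<close>-th gap within distance \<open>\<epsilon>\<close> from it.\<close>

definition gap_circuit :: "potential \<Rightarrow> int \<Rightarrow> real \<Rightarrow> (real \<Rightarrow> complex) \<Rightarrow> bool"
  where "gap_circuit \<phi> n \<epsilon> \<Gamma> \<longleftrightarrow>
    valid_path \<Gamma> \<and> simple_path \<Gamma> \<and> pathfinish \<Gamma> = pathstart \<Gamma> \<and>
    (\<forall>z\<in>path_image \<Gamma>. z \<notin> gap \<phi> n \<and> infdist z (gap \<phi> n) < \<epsilon>) \<and>
    (\<forall>z\<in>gap \<phi> n. winding_number \<Gamma> z = 1)"

definition action :: "potential \<Rightarrow> int \<Rightarrow> complex"
  where "action \<phi> n = (1 / of_real pi) * (THE v. \<exists>\<epsilon>>0. \<forall>\<Gamma>. gap_circuit \<phi> n \<epsilon> \<Gamma> \<longrightarrow>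
    ((\<lambda>\<mu>. \<mu> * deriv (discriminant \<phi>) \<mu> / canonical_root \<phi> \<mu>) has_contour_integral v) \<Gamma>)"


section \<open>The Birkhoff map\<close>

text \<open>
  \<open>L\<^sup>2\<close>-gradient \<open>(\<partial>F/\<partial>\<phi>\<^sub>-, \<partial>F/\<partial>\<phi>\<^sub>+)\<close> of a functional on potentials of real type. Increments
  \<open>h\<close> of real type determine it almost everywhere, since \<open>L2c\<close> is the complexification of
  \<open>L2r\<close>.
\<close>

definition has_L2_gradient :: "(potential \<Rightarrow> real) \<Rightarrow> potential \<Rightarrow> potential \<Rightarrow> bool"
  where "has_L2_gradient F \<phi> g \<longleftrightarrow> g \<in> L2c \<and>
    (\<forall>e>0. \<exists>d>0. \<forall>h\<in>L2r. sobolev_norm 0 h < d \<longrightarrow>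
       norm (of_real (F (\<phi> + h) - F \<phi>)
             - (LINT x:{0..1}|lborel. fst (g x) * fst (h x) + snd (g x) * snd (h x)))
         \<le> e * sobolev_norm 0 h)"

definition L2_gradient :: "(potential \<Rightarrow> real) \<Rightarrow> potential \<Rightarrow> potential"
  where "L2_gradient F \<phi> = (SOME g. has_L2_gradient F \<phi> g)"

definition poisson :: "(potential \<Rightarrow> real) \<Rightarrow> (potential \<Rightarrow> real) \<Rightarrow> potential \<Rightarrow> complex"
  where "poisson F G \<phi> = - \<i> * (LINT x:{0..1}|lborel.
     fst (L2_gradient F \<phi> x) * snd (L2_gradient G \<phi> x)
     - snd (L2_gradient F \<phi> x) * fst (L2_gradient G \<phi> x))"

definition birkhoff_map :: "(potential \<Rightarrow> coords) \<Rightarrow> bool"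
  where "birkhoff_map \<Omega> \<longleftrightarrow>
    (\<forall>m::nat. bianalytic_diffeo (Hr (real m)) (sobolev_norm (real m))
                (hr (real m)) (coords_norm (real m)) \<Omega>) \<and>
    (\<forall>\<phi>\<in>Hr 0. \<forall>n k.
       poisson (\<lambda>\<psi>. fst (\<Omega> \<psi> n)) (\<lambda>\<psi>. snd (\<Omega> \<psi> k)) \<phi> = (if n = k then - 1 else 0) \<and>
       poisson (\<lambda>\<psi>. fst (\<Omega> \<psi> n)) (\<lambda>\<psi>. fst (\<Omega> \<psi> k)) \<phi> = 0 \<and>
       poisson (\<lambda>\<psi>. snd (\<Omega> \<psi> n)) (\<lambda>\<psi>. snd (\<Omega> \<psi> k)) \<phi> = 0) \<and>
    (\<forall>\<phi>\<in>Hr 0. \<forall>n. of_real (((fst (\<Omega> \<phi> n))\<^sup>2 + (snd (\<Omega> \<phi> n))\<^sup>2) / 2) = action \<phi> n)"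

end

theory Submission imports Defs begin

text \<open>
  Both sides are continuous in \<open>\<phi>\<close>, so it suffices to treat trigonometric polynomials. For those, the
  periodic solution of the Riccati equation in the upper half plane yields a quasi-momentum \<open>k\<close> with
  \<open>\<Delta> = 2 cos k\<close> and nonnegative imaginary part, and \<open>\<bar>I\<^sub>n\<bar>\<close> is the limit of \<open>2/\<pi> \<integral> Im k\<close> over lines approaching
  the \<open>n\<close>-th gap. Integrating the large-\<open>z\<close> expansion of \<open>z\<^bsup>2l\<^esup> k\<close> gives trace formulas which identify the
  sums of \<open>(n \<pi>)\<^bsup>2l\<^esup> I\<^sub>n\<close>, up to the displacement of the gaps, with \<open>4\<^bsup>-l\<^esup>\<close> times the squared
  \<open>L\<^sup>2\<close> norm of the \<open>l\<close>-th derivative of the potential plus terms of lower order. These are homogeneous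
  differential polynomials, controlled by interpolation between \<open>L\<^sup>2\<close> and the top derivative; for \<open>m = 1\<close>
  the remainder is the quartic integral, whose sign yields the sharper power in the second estimate.
\<close>

section \<open>The fundamental solution\<close>

text \<open>Nonnegativity of \<open>Im k\<close> is what makes both inequalities accessible: the
  actions become masses of one positive density, weights are compared pointwise on intervals around
  the gaps, and no gap is ever computed. Such an interval stays within \<open>pi\<close> plus the L1
  norm of the potential of \<open>n * pi\<close>; hence the moment of order 0, the squared L2 norm,
  enters beside that of order \<open>m\<close>. The obstacle is that spectrum, roots and actions are
  definite descriptions: each needs existence and uniqueness, and the canonical root has to be
  matched with \<open>sin k\<close>, hence a product formula for
  \<open>1 - \<Delta>\<^sup>2 / 4\<close>. The powers come from scaling. If a derivative costs
  \<open>\<kappa>\<^sup>2\<close> in L2, a remainder term with \<open>r + 2\<close> factors is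
  \<open>(A / \<kappa>) ^ r\<close> times the leading size
  \<open>A\<^sup>2 * \<kappa> ^ (4 * m)\<close>. It is absorbed when \<open>\<kappa>\<close> is
  large against \<open>1 + A\<close> and otherwise is at most a multiple of
  \<open>A\<^sup>2 * (1 + A) ^ (4 * m)\<close>; taking roots leaves \<open>2 * m\<close>. As
  \<open>2 * m \<le> 4 * m - 3\<close> fails only for \<open>m = 1\<close>, that case needs the
  sign.\<close>

abbreviation symi :: "nat \<Rightarrow> int set" where "symi N \<equiv> {- int N..int N}"

section \<open>Picard series for the fundamental matrix\<close>

lemma has_real_derivative_cmod_power2:
  assumes "(f has_vector_derivative f') (at x within S)"
  shows "((\<lambda>x. (cmod (f x))\<^sup>2) has_real_derivative 2 * Re (cnj (f x) * f')) (at x within S)"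
proof -
  have R: "((\<lambda>x. Re (f x)) has_real_derivative Re f') (at x within S)"
    and I: "((\<lambda>x. Im (f x)) has_real_derivative Im f') (at x within S)"
    using assms has_vector_derivative_complex_iff has_real_derivative_iff_has_vector_derivative by blast+
  show ?thesis unfolding cmod_power2
    by (rule derivative_eq_intros R I refl)+ (simp add: algebra_simps)
qed

text \<open>\<open>q k\<close> is the \<open>k\<close>-th derivative: carrying the whole jet as data
  turns every later differentiation into a shift of the index.\<close>

locale smooth_potential =
  fixes q :: "nat \<Rightarrow> real \<Rightarrow> complex"
  assumes q_deriv: "\<And>k x. (q k has_vector_derivative q (Suc k) x) (at x)"
    and q_periodic: "\<And>k x. q k (x + 1) = q k x"
begin

text \<open>Components are indexed by booleans, \<open>True\<close> for the first. With
  \<open>Qb\<close> and the sign factor \<open>sb\<close>, both rows of the system take the single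
  form that the derivative of \<open>f b\<close> is
  \<open>sb b * (\<mu> * f b - Qb b * f (\<not> b))\<close>.\<close>

definition Qb :: "bool \<Rightarrow> real \<Rightarrow> complex"
  where "Qb b x = (if b then cnj (q 0 x) else q 0 x)"

definition sb :: "bool \<Rightarrow> complex"
  where "sb b = (if b then - \<i> else \<i>)"

lemma continuous_on_q [continuous_intros]: "continuous_on S (q k)"
  by (meson continuous_at_imp_continuous_on has_vector_derivative_continuous q_deriv)

lemma continuous_on_Qb [continuous_intros]: "continuous_on S (Qb b)"
  unfolding Qb_def by (cases b) (auto intro!: continuous_intros)

lemma norm_sb [simp]: "norm (sb b) = 1" by (simp add: sb_def)

lemma norm_Qb: "norm (Qb b x) = norm (q 0 x)" by (simp add: Qb_def)

text \<open>The coefficient of \<open>\<mu> ^ j\<close> in entry \<open>(b, c)\<close> of the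
  \<open>k\<close>-th Picard iterate. Splitting by powers makes each iterate visibly a polynomial in
  the spectral parameter, from which the sum inherits holomorphy.\<close>

primrec pic :: "nat \<Rightarrow> nat \<Rightarrow> bool \<Rightarrow> bool \<Rightarrow> real \<Rightarrow> complex" where
  "pic 0 = (\<lambda>j b c x. if j = 0 \<and> b = c then 1 else 0)"
| "pic (Suc k) = (\<lambda>j b c x. integral {0..x} (\<lambda>t. sb b *
     ((if j = 0 then 0 else pic k (j - 1) b c t) - Qb b t * pic k j (\<not> b) c t)))"

lemma continuous_on_pic [continuous_intros]: "continuous_on {0..2} (pic k j b c)"
proof (induction k arbitrary: j b)
  case (Suc k)
  have "continuous_on {0..2} (\<lambda>t. sb b *
     ((if j = 0 then 0 else pic k (j - 1) b c t) - Qb b t * pic k j (\<not> b) c t))"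
    using Suc by (cases j) (auto intro!: continuous_intros)
  thus ?case
    unfolding pic.simps by (intro indefinite_integral_continuous_1 integrable_continuous_real)
qed auto

lemma pic_eq_0: "j > k \<Longrightarrow> pic k j b c x = 0" by (induction k arbitrary: j b x) auto

definition pterm :: "nat \<Rightarrow> bool \<Rightarrow> bool \<Rightarrow> complex \<Rightarrow> real \<Rightarrow> complex"
  where "pterm k b c \<mu> x = (\<Sum>j\<le>k. \<mu> ^ j * pic k j b c x)"

lemma pterm_0 [simp]: "pterm 0 b c \<mu> x = (if b = c then 1 else 0)" by (simp add: pterm_def)

lemma continuous_on_pterm [continuous_intros]: "continuous_on {0..2} (pterm k b c \<mu>)"
  unfolding pterm_def by (auto intro!: continuous_intros)

lemma pterm_Suc:
  assumes "x \<in> {0..2}"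
  shows "pterm (Suc k) b c \<mu> x =
    integral {0..x} (\<lambda>t. sb b * (\<mu> * pterm k b c \<mu> t - Qb b t * pterm k (\<not> b) c \<mu> t))"
proof -
  have sub: "{0..x} \<subseteq> {0..2}" using assms by auto
  have c: "continuous_on {0..x} (pic k j b c)" for j b
    using continuous_on_pic continuous_on_subset sub by blast
  let ?g = "\<lambda>j t. \<mu> ^ j * (sb b * ((if j = 0 then 0 else pic k (j - 1) b c t) - Qb b t * pic k j (\<not> b) c t))"
  have cg: "continuous_on {0..x} (?g j)" for j using c by (cases j) (auto intro!: continuous_intros)
  have "pterm (Suc k) b c \<mu> x = (\<Sum>j\<le>Suc k. integral {0..x} (?g j))" unfolding pterm_def by simp
  also have "... = integral {0..x} (\<lambda>t. \<Sum>j\<le>Suc k. ?g j t)"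
    by (rule integral_sum [symmetric]) (auto intro!: integrable_continuous_real cg)
  also have "(\<lambda>t. \<Sum>j\<le>Suc k. ?g j t) = (\<lambda>t. sb b * (\<mu> * pterm k b c \<mu> t - Qb b t * pterm k (\<not> b) c \<mu> t))"
  proof
    fix t
    have "(\<Sum>j\<le>Suc k. ?g j t) = sb b * ((\<Sum>j\<le>Suc k. \<mu> ^ j * (if j = 0 then 0 else pic k (j - 1) b c t))
       - Qb b t * (\<Sum>j\<le>Suc k. \<mu> ^ j * pic k j (\<not> b) c t))"
      by (simp only: sum_distrib_left sum_subtractf [symmetric]) (simp add: algebra_simps)
    moreover have "(\<Sum>j\<le>Suc k. \<mu> ^ j * (if j = 0 then 0 else pic k (j - 1) b c t)) = \<mu> * pterm k b c \<mu> t"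
      unfolding sum.atMost_Suc_shift pterm_def by (simp add: sum_distrib_left mult.assoc)
    moreover have "(\<Sum>j\<le>Suc k. \<mu> ^ j * pic k j (\<not> b) c t) = pterm k (\<not> b) c \<mu> t"
      by (simp add: pterm_def pic_eq_0)
    ultimately show "(\<Sum>j\<le>Suc k. ?g j t) = sb b * (\<mu> * pterm k b c \<mu> t - Qb b t * pterm k (\<not> b) c \<mu> t)"
      by simp
  qed
  finally show ?thesis .
qed

text \<open>The usual factorial gain from iterated integrals. It is uniform for bounded
  \<open>\<mu>\<close>, so the Weierstrass test applies jointly in \<open>\<mu>\<close> and
  \<open>x\<close>.\<close>

lemma pterm_bound:
  assumes L: "\<And>t. t \<in> {0..2} \<Longrightarrow> norm \<mu> + norm (q 0 t) \<le> L" and "x \<in> {0..2}"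
  shows "norm (pterm k b c \<mu> x) \<le> (L * x) ^ k / fact k" using assms(2)
proof (induction k arbitrary: b x)
  case (Suc k)
  have L0: "L \<ge> 0" using L[of 0] norm_ge_zero[of \<mu>] norm_ge_zero[of "q 0 0"]
    by (smt (verit) atLeastAtMost_iff)
  have hi: "((\<lambda>t. L * ((L * t) ^ k / fact k)) has_integral (L * x) ^ Suc k / fact (Suc k)) {0..x}"
  proof -
    have "((\<lambda>t. L * ((L * t) ^ k / fact k)) has_integral
       (L * x) ^ Suc k / fact (Suc k) - (L * 0) ^ Suc k / fact (Suc k)) {0..x}"
    proof (rule fundamental_theorem_of_calculus)
      show "((\<lambda>t. (L * t) ^ Suc k / fact (Suc k)) has_vector_derivative L * ((L * t) ^ k / fact k)) (at t within {0..x})" for t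
      proof -
        have "((\<lambda>t. (L * t) ^ Suc k / fact (Suc k)) has_real_derivative
            (of_nat (Suc k) * (L * (L * t) ^ (Suc k - Suc 0))) / fact (Suc k)) (at t within {0..x})"
          by (intro DERIV_cdivide DERIV_power DERIV_cmult_Id)
        moreover have "(of_nat (Suc k) * (L * (L * t) ^ (Suc k - Suc 0))) / fact (Suc k) = L * ((L * t) ^ k / fact k)"
          by (simp add: field_simps del: of_nat_Suc)
        ultimately show ?thesis unfolding has_real_derivative_iff_has_vector_derivative by metis
      qed
    qed (use Suc in auto)
    thus ?thesis by simp
  qed
  have sub: "{0..x} \<subseteq> {0..2}" using Suc.prems by auto
  have c: "continuous_on {0..x} (pterm k b c \<mu>)" for b
    using continuous_on_pterm continuous_on_subset sub by blast
  have "norm (pterm (Suc k) b c \<mu> x) \<le> integral {0..x} (\<lambda>t. L * ((L * t) ^ k / fact k))"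
    unfolding pterm_Suc[OF Suc.prems]
  proof (rule integral_norm_bound_integral)
    show "(\<lambda>t. sb b * (\<mu> * pterm k b c \<mu> t - Qb b t * pterm k (\<not> b) c \<mu> t)) integrable_on {0..x}"
      by (intro integrable_continuous_real continuous_intros c)
    show "(\<lambda>t. L * ((L * t) ^ k / fact k)) integrable_on {0..x}" using hi by blast
    fix t assume t: "t \<in> {0..x}"
    hence t2: "t \<in> {0..2}" using sub by auto
    have "norm (\<mu> * pterm k b c \<mu> t - Qb b t * pterm k (\<not> b) c \<mu> t)
      \<le> norm \<mu> * norm (pterm k b c \<mu> t) + norm (q 0 t) * norm (pterm k (\<not> b) c \<mu> t)"
      by (metis norm_Qb norm_mult norm_triangle_ineq4)
    also have "... \<le> norm \<mu> * ((L * t) ^ k / fact k) + norm (q 0 t) * ((L * t) ^ k / fact k)"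
      by (intro add_mono mult_left_mono Suc.IH t2) auto
    also have "... = (norm \<mu> + norm (q 0 t)) * ((L * t) ^ k / fact k)" by (simp only: distrib_right)
    also have "... \<le> L * ((L * t) ^ k / fact k)"
      using L[OF t2] L0 t2 by (intro mult_right_mono) auto
    finally show "norm (sb b * (\<mu> * pterm k b c \<mu> t - Qb b t * pterm k (\<not> b) c \<mu> t)) \<le> L * ((L * t) ^ k / fact k)"
      by (simp add: norm_mult)
  qed
  also have "... = (L * x) ^ Suc k / fact (Suc k)" using hi by (rule integral_unique)
  finally show ?case .
qed auto

lemma q_bounded_on: obtains B where "B \<ge> 0" "\<And>t. t \<in> {0..2} \<Longrightarrow> norm (q k t) \<le> B"
proof -
  have "bounded (q k ` {0..2})"
    by (intro compact_imp_bounded compact_continuous_image continuous_intros) auto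
  thus ?thesis using that bounded_pos by (metis image_eqI less_eq_real_def)
qed

definition fm :: "bool \<Rightarrow> bool \<Rightarrow> complex \<Rightarrow> real \<Rightarrow> complex"
  where "fm b c \<mu> x = (\<Sum>k. pterm k b c \<mu> x)"

lemma uniform_limit_fm:
  "uniform_limit (cball 0 R \<times> {0..2}) (\<lambda>n p. \<Sum>k<n. pterm k b c (fst p) (snd p))
     (\<lambda>p. fm b c (fst p) (snd p)) sequentially"
proof -
  obtain B where B: "B \<ge> 0" "\<And>t. t \<in> {0..2} \<Longrightarrow> norm (q 0 t) \<le> B" using q_bounded_on by blast
  have *: "norm (pterm k b c (fst p) (snd p)) \<le> inverse (fact k) * ((R + B) * 2) ^ k"
    if "p \<in> cball 0 R \<times> {0..2}" for k p
  proof -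
    have p: "norm (fst p) \<le> R" "snd p \<in> {0..2}" using that by (auto simp: mem_Times_iff)
    have "norm (pterm k b c (fst p) (snd p)) \<le> ((R + B) * snd p) ^ k / fact k"
      by (rule pterm_bound) (use p B in \<open>auto intro!: add_mono\<close>)
    also have "... \<le> ((R + B) * 2) ^ k / fact k" using p B order_trans[OF norm_ge_zero p(1)]
      by (intro divide_right_mono power_mono mult_left_mono) auto
    finally show ?thesis by (simp add: field_simps)
  qed
  show ?thesis unfolding fm_def by (rule Weierstrass_m_test[OF *]) (use summable_exp in auto)
qed

text \<open>Uniform convergence is available for bounded \<open>\<mu>\<close> only; continuity is
  local, so each point is treated inside a slightly larger ball.\<close>

lemma continuous_on_fm: "continuous_on (UNIV \<times> {0..2}) (\<lambda>p. fm b c (fst p) (snd p))"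
proof -
  have R: "continuous_on (cball 0 R \<times> {0..2}) (\<lambda>p. fm b c (fst p) (snd p))" for R
  proof (rule uniform_limit_theorem[OF _ uniform_limit_fm])
    have "continuous_on (cball 0 R \<times> {0..2}) (\<lambda>p. \<Sum>k<n. pterm k b c (fst p) (snd p))" for n
      unfolding pterm_def
      by (intro continuous_intros continuous_on_compose2[OF continuous_on_pic]) auto
    thus "\<forall>\<^sub>F n in sequentially. continuous_on (cball 0 R \<times> {0..2}) (\<lambda>p. \<Sum>k<n. pterm k b c (fst p) (snd p))"
      by auto
  qed auto
  show ?thesis unfolding continuous_on_eq_continuous_within
  proof
    fix p :: "complex \<times> real" assume p: "p \<in> UNIV \<times> {0..2}"
    let ?R = "norm (fst p) + 1"
    have "continuous_on (ball 0 ?R \<times> {0..2}) (\<lambda>p. fm b c (fst p) (snd p))"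
      by (rule continuous_on_subset[OF R[of ?R]]) auto
    hence "continuous (at p within (ball 0 ?R \<times> {0..2})) (\<lambda>p. fm b c (fst p) (snd p))"
      unfolding continuous_on_eq_continuous_within by (rule bspec) (use p in \<open>auto simp: mem_Times_iff\<close>)
    moreover have "at p within (ball 0 ?R \<times> {0..2}) = at p within (UNIV \<times> {0..2})"
      using p by (intro at_within_nhd[of _ "ball 0 ?R \<times> UNIV"]) (auto simp: mem_Times_iff open_Times)
    ultimately show "continuous (at p within UNIV \<times> {0..2}) (\<lambda>p. fm b c (fst p) (snd p))" by simp
  qed
qed

lemma continuous_on_fm_compose [continuous_intros]:
  assumes "continuous_on S f" "continuous_on S g" "\<And>x. x \<in> S \<Longrightarrow> g x \<in> {0..2}"
  shows "continuous_on S (\<lambda>x. fm b c (f x) (g x))"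
  using continuous_on_compose2[OF continuous_on_fm[of b c], of S "\<lambda>x. (f x, g x)"] assms
  by (auto intro!: continuous_intros simp: image_subset_iff)

lemma holomorphic_fm [holomorphic_intros]:
  assumes "x \<in> {0..2}"
  shows "(\<lambda>\<mu>. fm b c \<mu> x) holomorphic_on S"
proof -
  have "(\<lambda>\<mu>. fm b c \<mu> x) holomorphic_on UNIV"
  proof (rule holomorphic_uniform_sequence[of UNIV "\<lambda>n \<mu>. \<Sum>k<n. pterm k b c \<mu> x"])
    show "(\<lambda>\<mu>. \<Sum>k<n. pterm k b c \<mu> x) holomorphic_on UNIV" for n
      unfolding pterm_def by (intro holomorphic_intros)
    fix z :: complex
    have "uniform_limit (cball z 1) (\<lambda>n \<mu>. \<Sum>k<n. pterm k b c \<mu> x) (\<lambda>\<mu>. fm b c \<mu> x) sequentially"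
    proof (rule uniform_limitI)
      fix e :: real assume "e > 0"
      have "cball z 1 \<subseteq> cball 0 (norm z + 1)" by (simp add: cball_subset_cball_iff)
      hence sub: "(\<mu>, x) \<in> cball 0 (norm z + 1) \<times> {0..2}" if "\<mu> \<in> cball z 1" for \<mu>
        using that assms by auto
      show "\<forall>\<^sub>F n in sequentially. \<forall>\<mu>\<in>cball z 1. dist (\<Sum>k<n. pterm k b c \<mu> x) (fm b c \<mu> x) < e"
        using uniform_limitD[OF uniform_limit_fm[where R="norm z + 1" and b=b and c=c] \<open>e > 0\<close>]
        by eventually_elim (use sub in force)
    qed
    thus "\<exists>d>0. cball z d \<subseteq> UNIV \<and>
        uniform_limit (cball z d) (\<lambda>n \<mu>. \<Sum>k<n. pterm k b c \<mu> x) (\<lambda>\<mu>. fm b c \<mu> x) sequentially"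
      by (intro exI[of _ 1]) auto
  qed auto
  thus ?thesis using holomorphic_on_subset by blast
qed

lemma uniform_limit_fm_x:
  "uniform_limit {0..2} (\<lambda>n x. \<Sum>k<n. pterm k b c \<mu> x) (\<lambda>x. fm b c \<mu> x) sequentially"
proof (rule uniform_limitI)
  fix e :: real assume "e > 0"
  show "\<forall>\<^sub>F n in sequentially. \<forall>x\<in>{0..2}. dist (\<Sum>k<n. pterm k b c \<mu> x) (fm b c \<mu> x) < e"
    using uniform_limitD[OF uniform_limit_fm[where R="norm \<mu>" and b=b and c=c] \<open>e > 0\<close>]
    by eventually_elim force
qed

lemma fm_integral_eq:
  assumes x: "x \<in> {0..2}"
  shows "fm b c \<mu> x = (if b = c then 1 else 0) +
    integral {0..x} (\<lambda>t. sb b * (\<mu> * fm b c \<mu> t - Qb b t * fm (\<not> b) c \<mu> t))"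
proof -
  have sub: "{0..x} \<subseteq> {0..2}" using assms by auto
  have ul: "uniform_limit {0..x} (\<lambda>n x. \<Sum>k<n. pterm k b c \<mu> x) (\<lambda>x. fm b c \<mu> x) sequentially" for b
    using uniform_limit_fm_x uniform_limit_on_subset sub by blast
  have c: "continuous_on {0..x} (pterm k b c \<mu>)" for k b
    using continuous_on_pterm continuous_on_subset sub by blast
  have bd: "bounded ((\<lambda>t. fm b c \<mu> t) ` {0..x})" for b
    by (intro compact_imp_bounded compact_continuous_image continuous_intros) (use sub in auto)
  have bQ: "bounded (Qb b ` {0..x})"
    by (intro compact_imp_bounded compact_continuous_image continuous_intros) auto
  let ?G = "\<lambda>n t. sb b * (\<mu> * (\<Sum>k<n. pterm k b c \<mu> t) - Qb b t * (\<Sum>k<n. pterm k (\<not> b) c \<mu> t))"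
  have cst: "uniform_limit {0..x} (\<lambda>n t. g t) g sequentially" for g :: "real \<Rightarrow> complex"
    by (rule uniform_limit_const)
  have bconst: "bounded ((\<lambda>t. w) ` {0..x})" for w :: complex by (simp add: image_constant_conv)
  have bG: "bounded ((\<lambda>t. \<mu> * fm b c \<mu> t - Qb b t * fm (\<not> b) c \<mu> t) ` {0..x})"
    by (intro compact_imp_bounded compact_continuous_image continuous_intros) (use sub in auto)
  have ulG: "uniform_limit {0..x} ?G (\<lambda>t. sb b * (\<mu> * fm b c \<mu> t - Qb b t * fm (\<not> b) c \<mu> t)) sequentially"
    by (rule uniform_lim_mult[OF cst uniform_limit_minus[OF uniform_lim_mult[OF cst ul bconst bd]
          uniform_lim_mult[OF cst ul bQ bd]] bconst bG])
  have cG: "continuous_on {0..x} (?G n)" for n by (intro continuous_intros c)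
  obtain I J where IJ: "\<And>n. (?G n has_integral I n) {0..x}"
    "((\<lambda>t. sb b * (\<mu> * fm b c \<mu> t - Qb b t * fm (\<not> b) c \<mu> t)) has_integral J) {0..x}"
    "I \<longlonglongrightarrow> J" by (rule uniform_limit_integral[OF ulG cG trivial_limit_sequentially]) (rule that)
  have eq: "(\<Sum>k<Suc n. pterm k b c \<mu> x) = (if b = c then 1 else 0) + I n" for n
  proof -
    have "(\<Sum>k<Suc n. pterm k b c \<mu> x) = (if b = c then 1 else 0) + (\<Sum>k<n. pterm (Suc k) b c \<mu> x)"
      by (simp only: sum.lessThan_Suc_shift) simp
    also have "(\<Sum>k<n. pterm (Suc k) b c \<mu> x) = (\<Sum>k<n. integral {0..x} (\<lambda>t. sb b * (\<mu> * pterm k b c \<mu> t - Qb b t * pterm k (\<not> b) c \<mu> t)))"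
      by (simp add: pterm_Suc[OF x])
    also have "... = integral {0..x} (\<lambda>t. \<Sum>k<n. sb b * (\<mu> * pterm k b c \<mu> t - Qb b t * pterm k (\<not> b) c \<mu> t))"
      by (intro integral_sum [symmetric] integrable_continuous_real continuous_intros c) auto
    also have "... = integral {0..x} (?G n)"
      by (simp only: sum_distrib_left sum_subtractf [symmetric])
    also have "... = I n" using IJ(1) by (rule integral_unique)
    finally show ?thesis .
  qed
  have "(\<lambda>n. \<Sum>k<n. pterm k b c \<mu> x) \<longlonglongrightarrow> fm b c \<mu> x"
    by (rule tendsto_uniform_limitI[OF uniform_limit_fm_x x])
  hence "(\<lambda>n. \<Sum>k<Suc n. pterm k b c \<mu> x) \<longlonglongrightarrow> fm b c \<mu> x" by (rule LIMSEQ_Suc)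
  moreover have "(\<lambda>n. \<Sum>k<Suc n. pterm k b c \<mu> x) \<longlonglongrightarrow> (if b = c then 1 else 0) + J"
    unfolding eq by (intro tendsto_intros IJ)
  ultimately have "fm b c \<mu> x = (if b = c then 1 else 0) + J" using LIMSEQ_unique by blast
  thus ?thesis using integral_unique[OF IJ(2)] by simp
qed

lemma fm_0 [simp]: "fm b c \<mu> 0 = (if b = c then 1 else 0)" using fm_integral_eq[of 0 b c \<mu>] by simp

lemma fm_deriv:
  assumes x: "x \<in> {0..2}"
  shows "((\<lambda>x. fm b c \<mu> x) has_vector_derivative sb b * (\<mu> * fm b c \<mu> x - Qb b x * fm (\<not> b) c \<mu> x))
    (at x within {0..2})"
proof -
  let ?g = "\<lambda>t. sb b * (\<mu> * fm b c \<mu> t - Qb b t * fm (\<not> b) c \<mu> t)"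
  have "((\<lambda>x. (if b = c then 1 else 0) + integral {0..x} ?g) has_vector_derivative 0 + ?g x) (at x within {0..2})"
    by (intro has_vector_derivative_add integral_has_vector_derivative continuous_intros x) auto
  thus ?thesis using has_vector_derivative_transform[OF x fm_integral_eq] by simp
qed

definition is_sol :: "real \<Rightarrow> complex \<Rightarrow> (bool \<Rightarrow> real \<Rightarrow> complex) \<Rightarrow> bool"
  where "is_sol T \<mu> f \<longleftrightarrow> (\<forall>b. \<forall>x\<in>{0..T}.
    (f b has_vector_derivative sb b * (\<mu> * f b x - Qb b x * f (\<not> b) x)) (at x within {0..T}))"

lemma is_solD:
  "is_sol T \<mu> f \<Longrightarrow> x \<in> {0..T} \<Longrightarrow>
    (f b has_vector_derivative sb b * (\<mu> * f b x - Qb b x * f (\<not> b) x)) (at x within {0..T})"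
  by (auto simp: is_sol_def)

lemma is_sol_continuous: "is_sol T \<mu> f \<Longrightarrow> continuous_on {0..T} (f b)"
  by (meson continuous_on_eq_continuous_within has_vector_derivative_continuous is_solD)

lemma is_sol_diff:
  assumes "is_sol T \<mu> f" "is_sol T \<mu> g"
  shows "is_sol T \<mu> (\<lambda>b x. f b x - g b x)" unfolding is_sol_def
proof (intro allI ballI)
  fix b x assume x: "x \<in> {0..T}"
  show "((\<lambda>x. f b x - g b x) has_vector_derivative
     sb b * (\<mu> * (f b x - g b x) - Qb b x * (f (\<not> b) x - g (\<not> b) x))) (at x within {0..T})"
    using has_vector_derivative_diff[OF is_solD[OF assms(1) x, of b] is_solD[OF assms(2) x, of b]]
    by (simp add: algebra_simps)
qed

lemma is_sol_comb:
  assumes "is_sol T \<mu> f" "is_sol T \<mu> g"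
  shows "is_sol T \<mu> (\<lambda>b x. u * f b x + v * g b x)" unfolding is_sol_def
proof (intro allI ballI)
  fix b x assume x: "x \<in> {0..T}"
  show "((\<lambda>x. u * f b x + v * g b x) has_vector_derivative
     sb b * (\<mu> * (u * f b x + v * g b x) - Qb b x * (u * f (\<not> b) x + v * g (\<not> b) x))) (at x within {0..T})"
    using has_vector_derivative_add[OF
        has_vector_derivative_mult_right[OF is_solD[OF assms(1) x, of b], of u]
        has_vector_derivative_mult_right[OF is_solD[OF assms(2) x, of b], of v]]
    by (simp add: algebra_simps)
qed

lemma is_sol_fm:
  assumes "T \<le> 2" shows "is_sol T \<mu> (\<lambda>b. fm b c \<mu>)"
  unfolding is_sol_def
  by (intro allI ballI has_vector_derivative_within_subset[OF fm_deriv]) (use assms in auto)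

text \<open>Gronwall: the derivative of the squared length is at most \<open>2 * L\<close> times the
  squared length, so after damping by \<open>exp (- 2 * L * x)\<close> it cannot increase, and it
  starts at zero.\<close>

lemma is_sol_zero:
  assumes sol: "is_sol T \<mu> f" and T: "T \<le> 2" and f0: "\<And>b. f b 0 = 0" and x: "x \<in> {0..T}"
  shows "f b x = 0"
proof (cases "x = 0")
  case False
  hence x0: "0 < x" "x \<le> T" using x by auto
  obtain B where B: "B \<ge> 0" "\<And>t. t \<in> {0..2} \<Longrightarrow> norm (q 0 t) \<le> B" using q_bounded_on by blast
  define L where "L = norm \<mu> + B"
  define D where "D = (\<lambda>x. (cmod (f True x))\<^sup>2 + (cmod (f False x))\<^sup>2)"
  have "D x * exp (- 2 * L * x) \<le> D 0 * exp (- 2 * L * 0)"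
  proof (rule DERIV_nonpos_imp_decreasing_open[OF less_imp_le[OF x0(1)]])
    show "continuous_on {0..x} (\<lambda>x. D x * exp (- 2 * L * x))" unfolding D_def
      by (intro continuous_intros continuous_on_subset[OF is_sol_continuous[OF sol]]) (use x0 in auto)
    fix t assume t: "0 < t" "t < x"
    define d where "d = (\<lambda>b. 2 * Re (cnj (f b t) * (sb b * (\<mu> * f b t - Qb b t * f (\<not> b) t))))"
    have "((\<lambda>x. (cmod (f b x))\<^sup>2) has_real_derivative d b) (at t)" for b
    proof -
      have "((\<lambda>x. (cmod (f b x))\<^sup>2) has_real_derivative d b) (at t within {0..T})"
        unfolding d_def using is_solD[OF sol, of t b] t x0 by (intro has_real_derivative_cmod_power2) auto
      moreover have "at t within {0..T} = at t" using t x0 by (intro at_within_Icc_at) auto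
      ultimately show ?thesis by simp
    qed
    hence D: "(D has_real_derivative d True + d False) (at t)" unfolding D_def by (intro DERIV_add)
    have dle: "\<bar>d b\<bar> \<le> 2 * (norm \<mu> * (norm (f b t))\<^sup>2 + B * (norm (f b t) * norm (f (\<not> b) t)))" for b
    proof -
      have "\<bar>d b\<bar> \<le> 2 * norm (cnj (f b t) * (sb b * (\<mu> * f b t - Qb b t * f (\<not> b) t)))"
        unfolding d_def abs_mult by (intro mult_mono abs_Re_le_cmod) auto
      also have "... = 2 * (norm (f b t) * norm (\<mu> * f b t - Qb b t * f (\<not> b) t))"
        by (simp add: norm_mult)
      also have "... \<le> 2 * (norm (f b t) * (norm \<mu> * norm (f b t) + B * norm (f (\<not> b) t)))"
      proof (intro mult_left_mono)
        have "norm (\<mu> * f b t - Qb b t * f (\<not> b) t) \<le> norm \<mu> * norm (f b t) + norm (q 0 t) * norm (f (\<not> b) t)"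
          by (metis norm_Qb norm_mult norm_triangle_ineq4)
        also have "norm (q 0 t) * norm (f (\<not> b) t) \<le> B * norm (f (\<not> b) t)"
          using t x0 T by (intro mult_right_mono B) auto
        finally show "norm (\<mu> * f b t - Qb b t * f (\<not> b) t) \<le> norm \<mu> * norm (f b t) + B * norm (f (\<not> b) t)"
          by simp
      qed auto
      finally show ?thesis by (simp add: algebra_simps power2_eq_square)
    qed
    have "d True + d False \<le> 2 * L * D t"
    proof -
      have "2 * (norm (f True t) * norm (f False t)) \<le> (norm (f True t))\<^sup>2 + (norm (f False t))\<^sup>2"
        using sum_squares_bound[of "norm (f True t)" "norm (f False t)"] by (simp add: mult.assoc)
      hence "B * (2 * (norm (f True t) * norm (f False t))) \<le> B * ((norm (f True t))\<^sup>2 + (norm (f False t))\<^sup>2)"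
        using B(1) by (rule mult_left_mono)
      thus ?thesis using dle[of True] dle[of False] unfolding L_def D_def
        by (simp add: algebra_simps abs_le_iff)
    qed
    moreover have "((\<lambda>x. D x * exp (- 2 * L * x)) has_real_derivative
        (d True + d False - 2 * L * D t) * exp (- 2 * L * t)) (at t)"
      by (rule derivative_eq_intros D refl)+ (simp add: algebra_simps)
    ultimately show "\<exists>y. ((\<lambda>x. D x * exp (- 2 * L * x)) has_real_derivative y) (at t) \<and> y \<le> 0"
      by (meson diff_le_0_iff_le exp_ge_zero mult_nonpos_nonneg)
  qed
  moreover have "D 0 = 0" using f0 by (simp add: D_def)
  ultimately have "D x \<le> 0" by (simp add: mult_le_0_iff not_exp_le_zero)
  hence "D x = 0" unfolding D_def by (smt (verit) zero_le_power2)
  hence "f True x = 0" "f False x = 0" by (auto simp: D_def add_nonneg_eq_0_iff)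
  thus ?thesis by (cases b) auto
qed (use f0 in auto)

lemma is_sol_unique:
  assumes sol: "is_sol T \<mu> f" and T: "T \<le> 2" and x: "x \<in> {0..T}"
  shows "f b x = f True 0 * fm b True \<mu> x + f False 0 * fm b False \<mu> x"
proof -
  have "is_sol T \<mu> (\<lambda>b x. f b x - (f True 0 * fm b True \<mu> x + f False 0 * fm b False \<mu> x))"
    by (intro is_sol_diff is_sol_comb is_sol_fm sol T)
  moreover have "f b 0 - (f True 0 * fm b True \<mu> 0 + f False 0 * fm b False \<mu> 0) = 0" for b
    by (cases b) auto
  ultimately have "f b x - (f True 0 * fm b True \<mu> x + f False 0 * fm b False \<mu> x) = 0"
    using is_sol_zero[OF _ T _ x] by blast
  thus ?thesis by simp
qed

text \<open>For a potential of real type, conjugating a solution and exchanging its components gives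
  a solution for the conjugate parameter; uniqueness identifies it.\<close>

lemma fm_cnj:
  assumes x: "x \<in> {0..2}"
  shows "fm (\<not> b) (\<not> c) (cnj \<mu>) x = cnj (fm b c \<mu> x)"
proof -
  have sol: "is_sol 2 (cnj \<mu>) (\<lambda>b x. cnj (fm (\<not> b) c \<mu> x))" unfolding is_sol_def
  proof (intro allI ballI)
    fix b :: bool and x :: real assume x: "x \<in> {0..2}"
    have "cnj (sb (\<not> b) * (\<mu> * fm (\<not> b) c \<mu> x - Qb (\<not> b) x * fm (\<not> \<not> b) c \<mu> x)) =
       sb b * (cnj \<mu> * cnj (fm (\<not> b) c \<mu> x) - Qb b x * cnj (fm (\<not> \<not> b) c \<mu> x))"
      by (cases b) (auto simp: sb_def Qb_def)
    thus "((\<lambda>x. cnj (fm (\<not> b) c \<mu> x)) has_vector_derivative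
       sb b * (cnj \<mu> * cnj (fm (\<not> b) c \<mu> x) - Qb b x * cnj (fm (\<not> \<not> b) c \<mu> x))) (at x within {0..2})"
      using has_vector_derivative_cnj[OF fm_deriv[OF x, of "\<not> b" c \<mu>]] by simp
  qed
  show ?thesis using is_sol_unique[OF sol _ x, of "\<not> b"] by (cases c) auto
qed

text \<open>The Wronskian is constant because the coefficient matrix of the system has trace
  zero.\<close>

lemma fm_det:
  assumes x: "x \<in> {0..2}"
  shows "fm True True \<mu> x * fm False False \<mu> x - fm True False \<mu> x * fm False True \<mu> x = 1"
proof -
  let ?W = "\<lambda>x. fm True True \<mu> x * fm False False \<mu> x - fm True False \<mu> x * fm False True \<mu> x"
  have "(?W has_vector_derivative 0) (at t within {0..2})" if t: "t \<in> {0..2}" for t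
    by (rule derivative_eq_intros has_vector_derivative_mult fm_deriv t)+
      (simp add: sb_def Qb_def algebra_simps)
  then obtain k where k: "\<And>t. t \<in> {0..2} \<Longrightarrow> ?W t = k"
    using has_vector_derivative_zero_constant[of "{0..2}" ?W] by auto
  have "?W x = ?W 0" using k[OF x] k[of 0] by simp
  thus ?thesis by simp
qed

text \<open>Floquet: a translate by the period solves the same system, hence is the fundamental
  matrix applied to its value at 0, the monodromy matrix.\<close>

lemma fm_shift:
  assumes x: "x \<in> {0..1}"
  shows "fm b c \<mu> (1 + x) = fm True c \<mu> 1 * fm b True \<mu> x + fm False c \<mu> 1 * fm b False \<mu> x"
proof -
  have sol: "is_sol 1 \<mu> (\<lambda>b x. fm b c \<mu> (1 + x))" unfolding is_sol_def
  proof (intro allI ballI)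
    fix b :: bool and x :: real assume x: "x \<in> {0..1}"
    have per: "Qb b (1 + x) = Qb b x" using q_periodic[of 0 x] by (simp add: Qb_def add.commute)
    have "((\<lambda>x. fm b c \<mu> (1 + x)) has_vector_derivative
        1 *\<^sub>R (sb b * (\<mu> * fm b c \<mu> (1 + x) - Qb b (1 + x) * fm (\<not> b) c \<mu> (1 + x)))) (at x within {0..1})"
    proof (rule vector_diff_chain_within[of "\<lambda>x. 1 + x" 1 x "{0..1}" "fm b c \<mu>", unfolded o_def])
      show "((+) 1 has_vector_derivative 1) (at x within {0..1})"
        by (auto intro!: derivative_eq_intros)
      show "(fm b c \<mu> has_vector_derivative sb b * (\<mu> * fm b c \<mu> (1 + x) - Qb b (1 + x) * fm (\<not> b) c \<mu> (1 + x)))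
          (at (1 + x) within (+) 1 ` {0..1})"
        by (rule has_vector_derivative_within_subset[OF fm_deriv]) (use x in auto)
    qed
    thus "((\<lambda>x. fm b c \<mu> (1 + x)) has_vector_derivative
        sb b * (\<mu> * fm b c \<mu> (1 + x) - Qb b x * fm (\<not> b) c \<mu> (1 + x))) (at x within {0..1})"
      by (simp add: per)
  qed
  show ?thesis using is_sol_unique[OF sol _ x, of b] by auto
qed

section \<open>Agreement with the weak formulation, and multiplicities of eigenvalues\<close>

definition pot :: potential
  where "pot = (\<lambda>x. (cnj (q 0 x), q 0 x))"

definition cmp :: "(real \<Rightarrow> complex ^ 2) \<Rightarrow> bool \<Rightarrow> real \<Rightarrow> complex"
  where "cmp f b x = f x $ (if b then 1 else 2)"

definition rhs :: "complex \<Rightarrow> (real \<Rightarrow> complex ^ 2) \<Rightarrow> real \<Rightarrow> complex ^ 2"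
  where "rhs \<mu> f x = vector [sb True * (\<mu> * f x $ 1 - Qb True x * f x $ 2),
                        sb False * (\<mu> * f x $ 2 - Qb False x * f x $ 1)]"

lemma ZS_op_iff: "ZS_op pot f f' x = \<mu> *s f x \<longleftrightarrow> f' x = rhs \<mu> f x"
proof -
  have i: "\<i> * \<i> = -1" by simp
  have 1: "(\<i> * a + b = c) \<longleftrightarrow> a = - (\<i> * (c - b))" for a b c :: complex using i by algebra
  have 2: "(b - \<i> * a = c) \<longleftrightarrow> a = \<i> * (c - b)" for a b c :: complex using i by algebra
  show ?thesis by (simp add: vec_eq_iff forall_2 ZS_op_def rhs_def pot_def sb_def Qb_def 1 2)
qed

lemma rhs_cmp: "rhs \<mu> f x $ (if b then 1 else 2) = sb b * (\<mu> * cmp f b x - Qb b x * cmp f (\<not> b) x)"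
  by (cases b) (auto simp: rhs_def cmp_def)

lemma continuous_on_rhs:
  assumes "continuous_on S f" shows "continuous_on S (rhs \<mu> f)"
proof -
  have "continuous_on S (\<lambda>x. \<chi> i. rhs \<mu> f x $ i)"
  proof (rule continuous_on_vec_lambda)
    fix i :: 2
    have "continuous_on S (\<lambda>x. sb True * (\<mu> * f x $ 1 - Qb True x * f x $ 2))"
      "continuous_on S (\<lambda>x. sb False * (\<mu> * f x $ 2 - Qb False x * f x $ 1))"
      by (intro continuous_intros assms)+
    thus "continuous_on S (\<lambda>x. rhs \<mu> f x $ i)" using exhaust_2[of i] by (auto simp: rhs_def)
  qed
  thus ?thesis by simp
qed

lemma square_set_integrable_imp_set_integrable:
  fixes f :: "real \<Rightarrow> 'a :: {banach, second_countable_topology}"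
  assumes "f \<in> borel_measurable borel" "set_integrable lborel {a..b} (\<lambda>x. (norm (f x))\<^sup>2)"
  shows "set_integrable lborel {a..b} f"
proof -
  have "set_integrable lborel {a..b} (\<lambda>x. 1 + (norm (f x))\<^sup>2)"
    by (intro set_integral_add assms borel_integrable_atLeastAtMost' continuous_on_const)
  thus ?thesis unfolding set_integrable_def
  proof (rule Bochner_Integration.integrable_bound)
    show "AE x in lborel. norm (indicat_real {a..b} x *\<^sub>R f x) \<le> norm (indicat_real {a..b} x *\<^sub>R (1 + (norm (f x))\<^sup>2))"
    proof (rule AE_I2)
      fix x
      have "2 * norm (f x) \<le> 1 + (norm (f x))\<^sup>2" using sum_squares_bound[of 1 "norm (f x)"] by simp
      hence "norm (f x) \<le> 1 + (norm (f x))\<^sup>2" using norm_ge_zero[of "f x"] by linarith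
      thus "norm (indicat_real {a..b} x *\<^sub>R f x) \<le> norm (indicat_real {a..b} x *\<^sub>R (1 + (norm (f x))\<^sup>2))"
        by (simp add: indicator_def)
    qed
  qed (use assms in measurable)
qed

lemma AE_lborel_negligible:
  assumes "AE x in lborel. P x" obtains N where "negligible N" "\<And>x. x \<notin> N \<Longrightarrow> P x"
proof -
  obtain N where "{x \<in> space lborel. \<not> P x} \<subseteq> N" "emeasure lborel N = 0" "N \<in> sets lborel"
    using assms by (rule AE_E)
  moreover from this have "negligible N"
    by (simp add: negligible_iff_null_sets null_sets_completionI null_setsI)
  ultimately show ?thesis using that by auto
qed

lemma H1D:
  assumes "H1_derivative T f f'"
  shows "f' \<in> borel_measurable borel" "set_integrable lborel {0..T} (\<lambda>x. (norm (f' x))\<^sup>2)"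
  by (rule assms[unfolded H1_derivative_def, THEN conjunct1]
      assms[unfolded H1_derivative_def, THEN conjunct2, THEN conjunct1])+

lemma H1D_eq:
  "H1_derivative T f f' \<Longrightarrow> x \<in> {0..T} \<Longrightarrow> f x = f 0 + (LINT t:{0..x}|lborel. f' t)"
  unfolding H1_derivative_def by (elim conjE, erule bspec)

text \<open>A weak solution is continuous as an indefinite integral, so the almost everywhere
  equation can be inserted under the integral and gives a classical derivative at every point.
  Conversely the derivative of a classical solution is continuous, hence square integrable.\<close>

lemma ZS_solution_iff:
  assumes T: "0 \<le> T"
  shows "ZS_solution T pot \<mu> f \<longleftrightarrow> is_sol T \<mu> (cmp f)"
proof
  assume "ZS_solution T pot \<mu> f"
  then obtain f' where H: "H1_derivative T f f'"
    and AE: "AE x in lborel. x \<in> {0..T} \<longrightarrow> ZS_op pot f f' x = \<mu> *s f x"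
    unfolding ZS_solution_def by blast
  have f': "set_integrable lborel {0..T} f'"
    by (rule square_set_integrable_imp_set_integrable[OF H1D(1,2)[OF H]])
  obtain N where N: "negligible N" "\<And>x. x \<notin> N \<Longrightarrow> x \<in> {0..T} \<Longrightarrow> f' x = rhs \<mu> f x"
    by (rule AE_lborel_negligible[OF AE[unfolded ZS_op_iff[of f f' _ \<mu>]]]) blast
  have sub: "set_integrable lborel {0..x} f'" if "x \<in> {0..T}" for x
    by (rule set_integrable_subset[OF f']) (use that in auto)
  have eq: "f x = f 0 + integral {0..x} f'" if "x \<in> {0..T}" for x
    unfolding set_borel_integral_eq_integral(2)[OF sub[OF that], symmetric]
    by (rule H1D_eq[OF H that])
  have "continuous_on {0..T} (\<lambda>x. f 0 + integral {0..x} f')"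
    by (intro continuous_intros indefinite_integral_continuous_1 set_borel_integral_eq_integral f')
  hence cf: "continuous_on {0..T} f"
    using continuous_on_cong[OF refl, of "{0..T}" f "\<lambda>x. f 0 + integral {0..x} f'"] eq by blast
  have eq2: "f x = f 0 + integral {0..x} (rhs \<mu> f)" if "x \<in> {0..T}" for x
  proof -
    have "integral {0..x} f' = integral {0..x} (rhs \<mu> f)"
      by (rule integral_spike[OF N(1)]) (use N that in auto)
    thus ?thesis using eq[OF that] by simp
  qed
  have d: "(f has_vector_derivative rhs \<mu> f x) (at x within {0..T})" if x: "x \<in> {0..T}" for x
  proof -
    have "((\<lambda>x. f 0 + integral {0..x} (rhs \<mu> f)) has_vector_derivative 0 + rhs \<mu> f x) (at x within {0..T})"
      by (rule has_vector_derivative_add[OF has_vector_derivative_const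
            integral_has_vector_derivative[OF continuous_on_rhs[OF cf] x]])
    hence "((\<lambda>x. f 0 + integral {0..x} (rhs \<mu> f)) has_vector_derivative rhs \<mu> f x) (at x within {0..T})"
      by simp
    with x eq2 show ?thesis by (rule has_vector_derivative_transform[where S = "{0..T}" and g = f
          and f = "\<lambda>x. f 0 + integral {0..x} (rhs \<mu> f)"])
  qed
  show "is_sol T \<mu> (cmp f)" unfolding is_sol_def
  proof (intro allI ballI)
    fix b x assume x: "x \<in> {0..T}"
    show "(cmp f b has_vector_derivative sb b * (\<mu> * cmp f b x - Qb b x * cmp f (\<not> b) x)) (at x within {0..T})"
      using bounded_linear.has_vector_derivative[OF bounded_linear_vec_nth d[OF x], of "if b then 1 else 2"]
      unfolding rhs_cmp by (simp add: cmp_def[abs_def])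
  qed
next
  assume sol: "is_sol T \<mu> (cmp f)"
  have "continuous_on {0..T} (\<lambda>x. \<chi> i. f x $ i)"
  proof (rule continuous_on_vec_lambda)
    fix i :: 2
    show "continuous_on {0..T} (\<lambda>x. f x $ i)"
      using exhaust_2[of i] is_sol_continuous[OF sol, of True] is_sol_continuous[OF sol, of False]
      by (auto simp: cmp_def)
  qed
  hence cf: "continuous_on {0..T} f" by simp
  have d: "((\<lambda>x. f x $ i) has_vector_derivative rhs \<mu> f x $ i) (at x within {0..T})" if x: "x \<in> {0..T}" for x i
    using exhaust_2[of i] is_solD[OF sol x, of True] is_solD[OF sol x, of False]
    by (auto simp: cmp_def[abs_def] rhs_def)
  \<comment> \<open>The derivative is cut off outside the interval because measurability is demanded
    on the whole line, where \<open>f\<close> is arbitrary.\<close>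
  define f' where "f' = (\<lambda>x. indicat_real {0..T} x *\<^sub>R rhs \<mu> f x)"
  have f'm: "f' \<in> borel_measurable borel"
    unfolding f'_def by (intro borel_measurable_continuous_on_indicator continuous_on_rhs cf) auto
  have f'eq: "x \<in> {0..T} \<Longrightarrow> f' x = rhs \<mu> f x" for x by (simp add: f'_def)
  have sq: "set_integrable lborel {0..T} (\<lambda>x. (norm (f' x))\<^sup>2)"
  proof -
    have "set_integrable lborel {0..T} (\<lambda>x. (norm (rhs \<mu> f x))\<^sup>2)"
      by (intro borel_integrable_atLeastAtMost' continuous_intros continuous_on_rhs cf)
    thus ?thesis by (rule set_integrable_cong[THEN iffD1, rotated -1]) (auto simp: f'eq)
  qed
  have f'int: "set_integrable lborel {0..T} f'"
    by (rule square_set_integrable_imp_set_integrable[OF f'm sq])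
  have "f x = f 0 + (LINT t:{0..x}|lborel. f' t)" if x: "x \<in> {0..T}" for x
  proof -
    have "set_integrable lborel {0..x} f'" by (rule set_integrable_subset[OF f'int]) (use x in auto)
    hence "(LINT t:{0..x}|lborel. f' t) = integral {0..x} f'"
      by (rule set_borel_integral_eq_integral)
    also have "... = integral {0..x} (rhs \<mu> f)" by (rule integral_cong) (use x in \<open>auto simp: f'eq\<close>)
    also have "integral {0..x} (rhs \<mu> f) = f x - f 0"
    proof -
      have int: "rhs \<mu> f integrable_on {0..x}"
        by (rule integrable_continuous_real[OF continuous_on_rhs[OF continuous_on_subset[OF cf]]]) (use x in auto)
      have "integral {0..x} (rhs \<mu> f) $ i = f x $ i - f 0 $ i" for i
      proof -
        have "integral {0..x} (rhs \<mu> f) $ i = integral {0..x} (\<lambda>t. rhs \<mu> f t $ i)"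
          using integral_linear[OF int bounded_linear_vec_nth, of i] by (simp add: o_def)
        also have "... = f x $ i - f 0 $ i"
          by (intro integral_unique fundamental_theorem_of_calculus has_vector_derivative_within_subset[OF d])
            (use x in auto)
        finally show ?thesis .
      qed
      thus ?thesis by (simp add: vec_eq_iff)
    qed
    finally show ?thesis by simp
  qed
  hence "H1_derivative T f f'" unfolding H1_derivative_def using f'm sq by blast
  moreover have "AE x in lborel. x \<in> {0..T} \<longrightarrow> ZS_op pot f f' x = \<mu> *s f x"
    unfolding ZS_op_iff[of f f' _ \<mu>] by (auto simp: f'eq)
  ultimately show "ZS_solution T pot \<mu> f" unfolding ZS_solution_def by blast
qed

definition bi :: "2 \<Rightarrow> bool" where "bi i = (i = 1)"

lemma fundamental_solution_eq:
  "fundamental_solution 1 \<mu> pot = (\<chi> i j. fm (bi i) (bi j) \<mu> 1)" unfolding fundamental_solution_def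
proof (rule the_equality)
  let ?M = "\<lambda>x. (\<chi> i j. fm (bi i) (bi j) \<mu> x) :: complex ^ 2 ^ 2"
  have bi: "bi (if b then 1 else 2) = b" for b by (simp add: bi_def)
  have c: "cmp (\<lambda>t. column j (?M t)) = (\<lambda>b. fm b (bi j) \<mu>)" for j
    by (intro ext) (simp only: cmp_def column_def vec_lambda_beta bi)
  have bij: "bi i = bi j \<longleftrightarrow> i = j" for i j
    using exhaust_2[of i] exhaust_2[of j] by (auto simp: bi_def)
  have 0: "?M 0 = mat 1" by (simp only: vec_eq_iff mat_def vec_lambda_beta fm_0 bij) simp
  have 1: "\<forall>j. ZS_solution 1 pot \<mu> (\<lambda>t. column j (?M t))"
    by (intro allI) (simp only: ZS_solution_iff zero_le_one c is_sol_fm one_le_numeral)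
  show "\<exists>M. M 0 = mat 1 \<and> (\<forall>j. ZS_solution 1 pot \<mu> (\<lambda>t. column j (M t))) \<and> M 1 = ?M 1"
    by (rule exI[of _ ?M], intro conjI 0 1 refl)
next
  fix N :: "complex ^ 2 ^ 2"
  assume "\<exists>M. M 0 = mat 1 \<and> (\<forall>j. ZS_solution 1 pot \<mu> (\<lambda>t. column j (M t))) \<and> M 1 = N"
  then obtain M :: "real \<Rightarrow> complex ^ 2 ^ 2" where M: "M 0 = mat 1" "\<And>j. ZS_solution 1 pot \<mu> (\<lambda>t. column j (M t))" "M 1 = N"
    by blast
  have "N $ i $ j = fm (bi i) (bi j) \<mu> 1" for i j
  proof -
    have sol: "is_sol 1 \<mu> (cmp (\<lambda>t. column j (M t)))"
      using M(2)[of j] by (simp add: ZS_solution_iff)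
    have i: "(if bi i then 1 else 2) = i" using exhaust_2[of i] by (auto simp: bi_def)
    have "cmp (\<lambda>t. column j (M t)) (bi i) 1 = N $ i $ j"
      unfolding cmp_def i column_def using M(3) by simp
    moreover have "cmp (\<lambda>t. column j (M t)) True 0 = (if bi j then 1 else 0)"
      "cmp (\<lambda>t. column j (M t)) False 0 = (if bi j then 0 else 1)"
      using exhaust_2[of j] by (auto simp: cmp_def column_def M(1) mat_def bi_def)
    ultimately show ?thesis using is_sol_unique[OF sol, of 1 "bi i"] by (cases "bi j") auto
  qed
  thus "N = (\<chi> i j. fm (bi i) (bi j) \<mu> 1)" by (simp add: vec_eq_iff)
qed

definition \<Delta> :: "complex \<Rightarrow> complex"
  where "\<Delta> \<mu> = fm True True \<mu> 1 + fm False False \<mu> 1"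

lemma discriminant_eq: "discriminant pot = \<Delta>"
  by (simp add: fun_eq_iff discriminant_def fundamental_solution_eq \<Delta>_def trace_def sum_2 bi_def)

text \<open>The solution with value \<open>v\<close> at 0, extended by zero: the one representative
  that \<open>periodic_eigenspace\<close> admits.\<close>

definition esol :: "complex \<Rightarrow> complex \<times> complex \<Rightarrow> real \<Rightarrow> complex ^ 2"
  where "esol \<mu> v x = (if x \<in> {0..2} then
     vector [fst v * fm True True \<mu> x + snd v * fm True False \<mu> x,
             fst v * fm False True \<mu> x + snd v * fm False False \<mu> x] else 0)"

lemma fm_2: "fm b c \<mu> 2 = fm True c \<mu> 1 * fm b True \<mu> 1 + fm False c \<mu> 1 * fm b False \<mu> 1"
  using fm_shift[of 1 b c \<mu>] by simp

lemma is_sol_transform: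
  assumes sol: "is_sol T \<mu> g" and eq: "\<And>b x. x \<in> {0..T} \<Longrightarrow> f b x = g b x"
  shows "is_sol T \<mu> f" unfolding is_sol_def
proof (intro allI ballI)
  fix b x assume x: "x \<in> {0..T}"
  show "(f b has_vector_derivative sb b * (\<mu> * f b x - Qb b x * f (\<not> b) x)) (at x within {0..T})"
    unfolding eq[OF x] by (rule has_vector_derivative_transform[OF x eq is_solD[OF sol x]])
qed

lemma periodic_eigenspace_eq:
  "periodic_eigenspace pot \<mu> = esol \<mu> ` {(u, v). u * fm True True \<mu> 2 + v * fm True False \<mu> 2 = u \<and>
       u * fm False True \<mu> 2 + v * fm False False \<mu> 2 = v}" (is "_ = esol \<mu> ` ?V")
proof (intro equalityI subsetI)
  fix f assume "f \<in> periodic_eigenspace pot \<mu>"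
  hence f: "\<And>x. x \<notin> {0..2} \<Longrightarrow> f x = 0" "f 0 = f 2" "is_sol 2 \<mu> (cmp f)"
    by (auto simp: periodic_eigenspace_def ZS_solution_iff)
  let ?u = "f 0 $ 1" and ?v = "f 0 $ 2"
  have eq: "cmp f b x = ?u * fm b True \<mu> x + ?v * fm b False \<mu> x" if "x \<in> {0..2}" for b x
    using is_sol_unique[OF f(3) _ that, of b] by (auto simp: cmp_def)
  have "f x = esol \<mu> (?u, ?v) x" for x
  proof (cases "x \<in> {0..2}")
    case True
    thus ?thesis using eq[OF True, of True] eq[OF True, of False]
      by (simp add: esol_def vec_eq_iff forall_2 cmp_def)
  qed (use f(1) in \<open>auto simp: esol_def\<close>)
  hence "f = esol \<mu> (?u, ?v)" by blast
  moreover have "(?u, ?v) \<in> ?V" using eq[of 2 True] eq[of 2 False] f(2) by (auto simp: cmp_def)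
  ultimately show "f \<in> esol \<mu> ` ?V" by blast
next
  fix f assume "f \<in> esol \<mu> ` ?V"
  then obtain u v where uv: "(u, v) \<in> ?V" "f = esol \<mu> (u, v)" by auto
  have "is_sol 2 \<mu> (\<lambda>b x. u * fm b True \<mu> x + v * fm b False \<mu> x)"
    by (intro is_sol_comb is_sol_fm) auto
  hence "is_sol 2 \<mu> (cmp f)" by (rule is_sol_transform) (auto simp: uv cmp_def esol_def)
  moreover have "f 0 = f 2" using uv by (auto simp: esol_def vec_eq_iff forall_2)
  ultimately show "f \<in> periodic_eigenspace pot \<mu>"
    using uv by (auto simp: periodic_eigenspace_def ZS_solution_iff esol_def)
qed

interpretation cs: vector_space cscale by (rule vector_space_cscale)

lemma esol_scale: "esol \<mu> (a * u, a * v) = cscale a (esol \<mu> (u, v))"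
  by (auto simp: fun_eq_iff esol_def cscale_def vec_eq_iff forall_2 algebra_simps)

lemma esol_add: "esol \<mu> (u + u', v + v') = esol \<mu> (u, v) + esol \<mu> (u', v')"
  by (auto simp: fun_eq_iff esol_def vec_eq_iff forall_2 algebra_simps)

lemma esol_eq_iff: "esol \<mu> (u, v) = esol \<mu> (u', v') \<longleftrightarrow> u = u' \<and> v = v'"
proof
  assume "esol \<mu> (u, v) = esol \<mu> (u', v')"
  hence "esol \<mu> (u, v) 0 = esol \<mu> (u', v') 0" by simp
  thus "u = u' \<and> v = v'" by (simp add: esol_def vec_eq_iff forall_2)
qed auto

lemma esol_0: "esol \<mu> (0, 0) = 0" by (auto simp: fun_eq_iff esol_def vec_eq_iff forall_2)

text \<open>The interval has length two, so eigenfunctions correspond to fixed vectors of the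
  squared monodromy matrix. By Cayley-Hamilton and determinant one this square is
  \<open>\<Delta> \<mu>\<close> times the monodromy matrix minus the identity. If
  \<open>\<Delta> \<mu> = 2 * e\<close> with \<open>e * e = 1\<close>, it fixes exactly the
  eigenvectors for \<open>e\<close>, a space of dimension two only when both off-diagonal entries
  vanish.\<close>

lemma eigenvalue_mult_eq:
  "eigenvalue_mult pot \<mu> = (if (\<Delta> \<mu>)\<^sup>2 \<noteq> 4 then 0
     else if fm True False \<mu> 1 = 0 \<and> fm False True \<mu> 1 = 0 then 2 else 1)"
proof -
  define A B C D where ABCD: "A = fm True True \<mu> 1" "B = fm True False \<mu> 1"
    "C = fm False True \<mu> 1" "D = fm False False \<mu> 1"
  have det: "A * D - B * C = 1" using fm_det[of 1 \<mu>] by (simp add: ABCD)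
  have \<Delta>: "\<Delta> \<mu> = A + D" by (simp add: \<Delta>_def ABCD)
  let ?d = "A + D"
  have M2: "fm True True \<mu> 2 = ?d * A - 1" "fm True False \<mu> 2 = ?d * B"
    "fm False True \<mu> 2 = ?d * C" "fm False False \<mu> 2 = ?d * D - 1"
    using det unfolding fm_2 ABCD by algebra+
  define V where "V = {(u, v). u * (?d * A - 1) + v * (?d * B) = u \<and> u * (?d * C) + v * (?d * D - 1) = v}"
  have E: "periodic_eigenspace pot \<mu> = esol \<mu> ` V" unfolding periodic_eigenspace_eq M2 V_def ..
  show ?thesis
  proof (cases "?d\<^sup>2 = 4")
    case False
    have "u = 0 \<and> v = 0" if "(u, v) \<in> V" for u v
    proof -
      have e: "u * (?d * A - 1) + v * (?d * B) = u" "u * (?d * C) + v * (?d * D - 1) = v"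
        using that by (auto simp: V_def)
      \<comment> \<open>Cramer's rule: \<open>4 - ?d\<^sup>2\<close> is the determinant of the
        linear system once \<open>A * D - B * C = 1\<close> is used.\<close>
      have "u * (4 - ?d\<^sup>2) = (u * (?d * A - 1) + v * (?d * B) - u) * (?d * D - 2)
          - (u * (?d * C) + v * (?d * D - 1) - v) * (?d * B) + u * ?d\<^sup>2 * (1 - (A * D - B * C))"
        by (simp add: algebra_simps power2_eq_square)
      hence "u * (4 - ?d\<^sup>2) = 0" by (simp only: e det) simp
      moreover have "v * (4 - ?d\<^sup>2) = (u * (?d * C) + v * (?d * D - 1) - v) * (?d * A - 2)
          - (u * (?d * A - 1) + v * (?d * B) - u) * (?d * C) + v * ?d\<^sup>2 * (1 - (A * D - B * C))"
        by (simp add: algebra_simps power2_eq_square)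
      hence "v * (4 - ?d\<^sup>2) = 0" by (simp only: e det) simp
      ultimately show ?thesis using False by auto
    qed
    moreover have "(0, 0) \<in> V" by (simp add: V_def)
    ultimately have "V = {(0, 0)}" by auto
    hence "eigenvalue_mult pot \<mu> = cs.dim {0}" unfolding eigenvalue_mult_def E by (simp add: esol_0)
    also have "... = card ({} :: (real \<Rightarrow> complex ^ 2) set)"
      by (rule cs.dim_eq_card) (auto simp: cs.independent_empty)
    finally show ?thesis using False by (simp add: \<Delta>)
  next
    case True
    then obtain e where e: "?d = 2 * e" "e * e = 1"
      using that[of "?d / 2"] by (auto simp: power2_eq_square field_simps)
    have V: "V = {(u, v). u * (A - e) + v * B = 0 \<and> u * C + v * (D - e) = 0}"
    proof -
      have "(u * (?d * A - 1) + v * (?d * B) = u) \<longleftrightarrow> u * (A - e) + v * B = 0" for u v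
      proof -
        have "u * (?d * A - 1) + v * (?d * B) - u = ?d * (u * (A - e) + v * B)"
          unfolding e(1) using e(2) by algebra
        moreover have "?d \<noteq> 0" using e by auto
        ultimately show ?thesis by (metis eq_iff_diff_eq_0 mult_eq_0_iff)
      qed
      moreover have "(u * (?d * C) + v * (?d * D - 1) = v) \<longleftrightarrow> u * C + v * (D - e) = 0" for u v
      proof -
        have "u * (?d * C) + v * (?d * D - 1) - v = ?d * (u * C + v * (D - e))"
          unfolding e(1) using e(2) by algebra
        moreover have "?d \<noteq> 0" using e by auto
        ultimately show ?thesis by (metis eq_iff_diff_eq_0 mult_eq_0_iff)
      qed
      ultimately show ?thesis unfolding V_def by auto
    qed
    have dt: "(A - e) * (D - e) = B * C" using e det by algebra
    show ?thesis
    proof (cases "B = 0 \<and> C = 0")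
      case BC: True
      hence "(A - e) * (D - e) = 0" "(A - e) + (D - e) = 0" using dt e by auto
      hence "A = e" "D = e" by (auto simp: add_eq_0_iff)
      hence "V = UNIV" using BC by (auto simp: V)
      let ?b = "{esol \<mu> (1, 0), esol \<mu> (0, 1)}"
      have comb: "esol \<mu> (u, v) = cscale u (esol \<mu> (1, 0)) + cscale v (esol \<mu> (0, 1))" for u v
        by (simp flip: esol_scale esol_add)
      have ne: "esol \<mu> (1, 0) \<noteq> esol \<mu> (0, 1)" by (simp add: esol_eq_iff)
      have "cs.dim (esol \<mu> ` V) = card ?b"
      proof (rule cs.dim_eq_card)
        show "cs.independent ?b"
        proof (rule cs.independent_insertI)
          show "esol \<mu> (1, 0) \<notin> cs.span {esol \<mu> (0, 1)}"
          proof
            assume "esol \<mu> (1, 0) \<in> cs.span {esol \<mu> (0, 1)}"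
            then obtain k where "esol \<mu> (1, 0) = cscale k (esol \<mu> (0, 1))"
              by (auto simp: cs.span_singleton)
            thus False by (simp flip: esol_scale add: esol_eq_iff)
          qed
          show "cs.independent {esol \<mu> (0, 1)}"
            using esol_eq_iff[of \<mu> 0 1 0 0] by (intro cs.independent_insertI) (auto simp: esol_0 cs.independent_empty)
        qed
        show "cs.span ?b = cs.span (esol \<mu> ` V)"
        proof (rule antisym)
          show "cs.span ?b \<subseteq> cs.span (esol \<mu> ` V)" by (rule cs.span_mono) (auto simp: \<open>V = UNIV\<close>)
          have "cscale u (esol \<mu> (1, 0)) + cscale v (esol \<mu> (0, 1)) \<in> cs.span ?b" for u v
            by (intro cs.span_add cs.span_scale cs.span_base) auto
          hence "esol \<mu> (u, v) \<in> cs.span ?b" for u v by (subst comb)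
          thus "cs.span (esol \<mu> ` V) \<subseteq> cs.span ?b" by (intro cs.span_minimal) auto
        qed
      qed
      hence "eigenvalue_mult pot \<mu> = 2" unfolding eigenvalue_mult_def E using ne by simp
      thus ?thesis using True BC by (simp add: \<Delta> ABCD)
    next
      case BC: False
      \<comment> \<open>The matrix has rank one; a kernel vector is read off from a row whose
        off-diagonal entry is nonzero.\<close>
      obtain u0 v0 where uv: "(u0, v0) \<noteq> (0, 0)" "(u0, v0) \<in> V"
        "\<And>u v. (u, v) \<in> V \<Longrightarrow> \<exists>k. u = k * u0 \<and> v = k * v0"
      proof (cases "B = 0")
        case False
        have 1: "(B, e - A) \<in> V" unfolding V using dt by (auto simp: algebra_simps)
        have 2: "\<exists>k. u = k * B \<and> v = k * (e - A)" if "(u, v) \<in> V" for u v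
        proof (intro exI conjI)
          show "u = (u / B) * B" using False by simp
          have "v * B = u * (e - A)" using that unfolding V by (auto simp: algebra_simps add_eq_0_iff2)
          thus "v = (u / B) * (e - A)" using False by (simp add: field_simps)
        qed
        show ?thesis by (rule that[OF _ 1 2]) (use False in auto)
      next
        case B: True
        hence C: "C \<noteq> 0" using BC by auto
        have 1: "(e - D, C) \<in> V" unfolding V using dt by (auto simp: algebra_simps)
        have 2: "\<exists>k. u = k * (e - D) \<and> v = k * C" if "(u, v) \<in> V" for u v
        proof (intro exI conjI)
          show "v = (v / C) * C" using C by simp
          have "u * C = v * (e - D)" using that unfolding V by (auto simp: algebra_simps add_eq_0_iff2)
          thus "u = (v / C) * (e - D)" using C by (simp add: field_simps)
        qed
        show ?thesis by (rule that[OF _ 1 2]) (use C in auto)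
      qed
      have ne: "esol \<mu> (u0, v0) \<noteq> 0" using esol_eq_iff[of \<mu> u0 v0 0 0] uv(1) by (auto simp: esol_0)
      have "cs.dim (esol \<mu> ` V) = card {esol \<mu> (u0, v0)}"
      proof (rule cs.dim_eq_card)
        show "cs.independent {esol \<mu> (u0, v0)}"
          using ne by (intro cs.independent_insertI) (auto simp: cs.independent_empty)
        show "cs.span {esol \<mu> (u0, v0)} = cs.span (esol \<mu> ` V)"
        proof (rule antisym)
          show "cs.span {esol \<mu> (u0, v0)} \<subseteq> cs.span (esol \<mu> ` V)"
            by (rule cs.span_mono) (use uv in auto)
          have "esol \<mu> p \<in> cs.span {esol \<mu> (u0, v0)}" if "p \<in> V" for p
          proof -
            have "\<exists>k. fst p = k * u0 \<and> snd p = k * v0" by (rule uv(3)) (use that in simp)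
            then obtain k where "fst p = k * u0 \<and> snd p = k * v0" by blast
            hence "p = (k * u0, k * v0)" by (simp add: prod_eq_iff)
            hence "esol \<mu> p = cscale k (esol \<mu> (u0, v0))" by (simp only: esol_scale)
            also have "... \<in> cs.span {esol \<mu> (u0, v0)}"
              by (rule cs.span_scale, rule cs.span_base) simp
            finally show ?thesis .
          qed
          thus "cs.span (esol \<mu> ` V) \<subseteq> cs.span {esol \<mu> (u0, v0)}" by (intro cs.span_minimal) auto
        qed
      qed
      hence "eigenvalue_mult pot \<mu> = 1" unfolding eigenvalue_mult_def E by simp
      thus ?thesis using True BC by (simp add: \<Delta> ABCD)
    qed
  qed
qed

end

section \<open>The periodic Riccati equation\<close>

context smooth_potential
begin

text \<open>The solution with initial vector \<open>(1, c)\<close>. The number \<open>c\<close> is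
  an affine coordinate on initial directions and becomes the initial value of the Riccati
  equation.\<close>

definition uu :: "bool \<Rightarrow> complex \<Rightarrow> complex \<Rightarrow> real \<Rightarrow> complex"
  where "uu b \<mu> c x = fm b True \<mu> x + c * fm b False \<mu> x"

lemma uu_0: "uu True \<mu> c 0 = 1" "uu False \<mu> c 0 = c" by (auto simp: uu_def)

lemma is_sol_uu: "T \<le> 2 \<Longrightarrow> is_sol T \<mu> (\<lambda>b. uu b \<mu> c)"
  using is_sol_comb[OF is_sol_fm[of T \<mu> True] is_sol_fm[of T \<mu> False], of 1 c]
  unfolding uu_def by simp

lemma continuous_on_uu [continuous_intros]:
  assumes "continuous_on S f" "continuous_on S g" "continuous_on S h" "\<And>x. x \<in> S \<Longrightarrow> h x \<in> {0..2}"
  shows "continuous_on S (\<lambda>x. uu b (f x) (g x) (h x))"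
  unfolding uu_def by (intro continuous_intros assms)

lemma uu_deriv:
  "x \<in> {0..2} \<Longrightarrow> (uu b \<mu> c has_vector_derivative
     sb b * (\<mu> * uu b \<mu> c x - Qb b x * uu (\<not> b) \<mu> c x)) (at x within {0..2})"
  using is_solD[OF is_sol_uu[OF order_refl]] by blast

lemma uu_nonzero:
  assumes "x \<in> {0..2}" shows "uu True \<mu> c x \<noteq> 0 \<or> uu False \<mu> c x \<noteq> 0"
proof (rule ccontr)
  assume "\<not> ?thesis"
  hence "fm True True \<mu> x = - c * fm True False \<mu> x" "fm False True \<mu> x = - c * fm False False \<mu> x"
    by (auto simp: uu_def add_eq_0_iff2)
  thus False using fm_det[OF assms, of \<mu>] by simp
qed

text \<open>The Hermitian form of signature (1,1) that is conserved for real \<open>\<mu>\<close>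
  and grows for \<open>\<mu>\<close> in the upper half plane. Its sign says whether the ratio of the
  components lies in the unit disc.\<close>

definition EE :: "complex \<Rightarrow> complex \<Rightarrow> real \<Rightarrow> real"
  where "EE \<mu> c x = (cmod (uu True \<mu> c x))\<^sup>2 - (cmod (uu False \<mu> c x))\<^sup>2"

lemma EE_deriv:
  assumes x: "x \<in> {0..2}"
  shows "(EE \<mu> c has_real_derivative 2 * Im \<mu> * ((cmod (uu True \<mu> c x))\<^sup>2 + (cmod (uu False \<mu> c x))\<^sup>2))
    (at x within {0..2})"
proof -
  define a b where "a = uu True \<mu> c x" and "b = uu False \<mu> c x"
  have "(EE \<mu> c has_real_derivative
      2 * Re (cnj a * (sb True * (\<mu> * a - Qb True x * b))) - 2 * Re (cnj b * (sb False * (\<mu> * b - Qb False x * a))))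
      (at x within {0..2})"
    unfolding EE_def[abs_def] a_def b_def
    using has_real_derivative_cmod_power2[OF uu_deriv[OF x, of True \<mu> c]]
      has_real_derivative_cmod_power2[OF uu_deriv[OF x, of False \<mu> c]] by (auto intro: DERIV_diff)
  moreover have "2 * Re (cnj a * (sb True * (\<mu> * a - Qb True x * b))) - 2 * Re (cnj b * (sb False * (\<mu> * b - Qb False x * a)))
     = 2 * Im \<mu> * ((cmod a)\<^sup>2 + (cmod b)\<^sup>2)"
    unfolding cmod_power2 by (simp add: sb_def Qb_def algebra_simps power2_eq_square)
  ultimately show ?thesis by (simp add: a_def b_def)
qed

lemma EE_deriv_at:
  assumes x: "0 < x" "x < 2"
  shows "(EE \<mu> c has_real_derivative 2 * Im \<mu> * ((cmod (uu True \<mu> c x))\<^sup>2 + (cmod (uu False \<mu> c x))\<^sup>2)) (at x)"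
  using EE_deriv[of x \<mu> c] x by (simp add: at_within_Icc_at)

lemma continuous_on_EE: "S \<subseteq> {0..2} \<Longrightarrow> continuous_on S (EE \<mu> c)"
  unfolding EE_def[abs_def] by (intro continuous_intros) auto

lemma EE_0: "EE \<mu> c 0 = 1 - (cmod c)\<^sup>2" by (simp add: EE_def uu_0)

lemma EE_mono:
  assumes "Im \<mu> \<ge> 0" "0 \<le> x" "x \<le> y" "y \<le> 2"
  shows "EE \<mu> c x \<le> EE \<mu> c y"
proof (rule DERIV_nonneg_imp_increasing_open[OF assms(3)])
  fix z assume z: "x < z" "z < y"
  have "0 \<le> 2 * Im \<mu> * ((cmod (uu True \<mu> c z))\<^sup>2 + (cmod (uu False \<mu> c z))\<^sup>2)" using assms by simp
  thus "\<exists>y. (EE \<mu> c has_real_derivative y) (at z) \<and> 0 \<le> y"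
    using EE_deriv_at[of z \<mu> c] z assms by (meson le_less_trans less_le_trans)
qed (use assms in \<open>auto intro!: continuous_on_EE\<close>)

lemma EE_strict_mono:
  assumes "Im \<mu> > 0" "0 \<le> x" "x < y" "y \<le> 2"
  shows "EE \<mu> c x < EE \<mu> c y"
proof (rule DERIV_pos_imp_increasing_open[OF assms(3)])
  fix z assume z: "x < z" "z < y"
  hence z2: "z \<in> {0..2}" using assms by auto
  have "0 < (cmod (uu True \<mu> c z))\<^sup>2 + (cmod (uu False \<mu> c z))\<^sup>2"
    using uu_nonzero[OF z2, of \<mu> c] by (simp add: sum_power2_gt_zero_iff)
  hence "0 < 2 * Im \<mu> * ((cmod (uu True \<mu> c z))\<^sup>2 + (cmod (uu False \<mu> c z))\<^sup>2)" using assms by simp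
  thus "\<exists>y. (EE \<mu> c has_real_derivative y) (at z) \<and> 0 < y"
    using EE_deriv_at[of z \<mu> c] z assms by (meson le_less_trans less_le_trans)
qed (use assms in \<open>auto intro!: continuous_on_EE\<close>)

lemma uu_le:
  assumes "Im \<mu> \<ge> 0" "cmod c \<le> 1" "x \<in> {0..2}"
  shows "cmod (uu False \<mu> c x) \<le> cmod (uu True \<mu> c x)"
proof -
  have "0 \<le> EE \<mu> c 0" using assms by (simp add: EE_0 power_le_one)
  also have "... \<le> EE \<mu> c x" using assms by (intro EE_mono) auto
  finally show ?thesis by (simp add: EE_def)
qed

lemma uu_True_nonzero:
  assumes "Im \<mu> \<ge> 0" "cmod c \<le> 1" "x \<in> {0..2}"
  shows "uu True \<mu> c x \<noteq> 0" using uu_le[OF assms] uu_nonzero[OF assms(3), of \<mu> c] by auto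

text \<open>The Riccati solution with value \<open>c\<close> at 0. Obtaining it from the linear
  system makes it global: for \<open>c\<close> in the closed unit disc the denominator never
  vanishes.\<close>

definition \<sigma> :: "complex \<Rightarrow> complex \<Rightarrow> real \<Rightarrow> complex"
  where "\<sigma> \<mu> c x = uu False \<mu> c x / uu True \<mu> c x"

lemma \<sigma>_0: "\<sigma> \<mu> c 0 = c" by (simp add: \<sigma>_def uu_0)

lemma \<sigma>_le:
  assumes "Im \<mu> \<ge> 0" "cmod c \<le> 1" "x \<in> {0..2}"
  shows "cmod (\<sigma> \<mu> c x) \<le> 1"
  using uu_le[OF assms] uu_True_nonzero[OF assms] by (simp add: \<sigma>_def norm_divide divide_le_eq_1)

lemma \<sigma>_deriv:
  assumes "Im \<mu> \<ge> 0" "cmod c \<le> 1" "x \<in> {0..2}"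
  shows "(\<sigma> \<mu> c has_vector_derivative
     2 * \<i> * \<mu> * \<sigma> \<mu> c x - \<i> * q 0 x - \<i> * cnj (q 0 x) * (\<sigma> \<mu> c x)\<^sup>2) (at x within {0..2})"
proof -
  define a b where "a = uu True \<mu> c x" and "b = uu False \<mu> c x"
  have a0: "a \<noteq> 0" using uu_True_nonzero[OF assms] by (simp add: a_def)
  have da: "(uu True \<mu> c has_vector_derivative sb True * (\<mu> * a - Qb True x * b)) (at x within {0..2})"
    and db: "(uu False \<mu> c has_vector_derivative sb False * (\<mu> * b - Qb False x * a)) (at x within {0..2})"
    using uu_deriv[OF assms(3), of True \<mu> c] uu_deriv[OF assms(3), of False \<mu> c] by (auto simp: a_def b_def)
  have i: "((\<lambda>x. inverse (uu True \<mu> c x)) has_vector_derivative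
      - (sb True * (\<mu> * a - Qb True x * b)) * inverse (a\<^sup>2)) (at x within {0..2})"
  proof -
    have "(inverse has_field_derivative - (inverse (uu True \<mu> c x) ^ Suc (Suc 0))) (at (uu True \<mu> c x) within S)" for S
      by (rule DERIV_inverse) (use a0 in \<open>auto simp: a_def\<close>)
    from field_vector_diff_chain_within[OF da this] show ?thesis
      by (simp add: o_def a_def power2_eq_square algebra_simps)
  qed
  have "((\<lambda>x. uu False \<mu> c x * inverse (uu True \<mu> c x)) has_vector_derivative
     b * (- (sb True * (\<mu> * a - Qb True x * b)) * inverse (a\<^sup>2)) +
     sb False * (\<mu> * b - Qb False x * a) * inverse a) (at x within {0..2})"
    using has_vector_derivative_mult[OF db i] by (simp add: a_def b_def)
  moreover have "b * (- (sb True * (\<mu> * a - Qb True x * b)) * inverse (a\<^sup>2)) +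
     sb False * (\<mu> * b - Qb False x * a) * inverse a
    = 2 * \<i> * \<mu> * (b / a) - \<i> * q 0 x - \<i> * cnj (q 0 x) * (b / a)\<^sup>2"
    using a0 by (simp add: sb_def Qb_def field_simps power2_eq_square)
  ultimately show ?thesis unfolding \<sigma>_def[abs_def] by (simp add: divide_inverse a_def b_def)
qed

lemma continuous_on_\<sigma> [continuous_intros]:
  assumes "continuous_on S f" "continuous_on S g" "continuous_on S h"
    "\<And>x. x \<in> S \<Longrightarrow> h x \<in> {0..2}" "\<And>x. x \<in> S \<Longrightarrow> Im (f x) \<ge> 0" "\<And>x. x \<in> S \<Longrightarrow> cmod (g x) \<le> 1"
  shows "continuous_on S (\<lambda>x. \<sigma> (f x) (g x) (h x))"
  unfolding \<sigma>_def by (intro continuous_intros ballI uu_True_nonzero assms)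

text \<open>A logarithm of the first component after one period, up to the factor
  \<open>- \<i>\<close>: the logarithmic derivative of that component is
  \<open>- \<i> * (\<mu> - cnj (q 0 x) * \<sigma> \<mu> c x)\<close>. Written as an integral it
  comes with a continuous branch and with bounds.\<close>

definition K :: "complex \<Rightarrow> complex \<Rightarrow> complex"
  where "K \<mu> c = \<mu> - integral {0..1} (\<lambda>x. cnj (q 0 x) * \<sigma> \<mu> c x)"

lemma continuous_on_K:
  "continuous_on ({\<mu>. Im \<mu> \<ge> 0} \<times> cball 0 1) (\<lambda>p. K (fst p) (snd p))" unfolding K_def
proof (intro continuous_intros)
  have "continuous_on (({\<mu>. Im \<mu> \<ge> 0} \<times> cball 0 1) \<times> cbox 0 1)
     (\<lambda>(p, t). cnj (q 0 t) * \<sigma> (fst p) (snd p) t)"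
    unfolding case_prod_beta
    by (intro continuous_intros continuous_on_compose2[OF continuous_on_q[of UNIV 0]]) auto
  from integral_continuous_on_param[OF this]
  show "continuous_on ({\<mu>. Im \<mu> \<ge> 0} \<times> cball 0 1)
     (\<lambda>p. integral {0..1} (\<lambda>x. cnj (q 0 x) * \<sigma> (fst p) (snd p) x))"
    by simp
qed

lemma continuous_on_K_compose [continuous_intros]:
  assumes "continuous_on S f" "continuous_on S g"
    "\<And>x. x \<in> S \<Longrightarrow> Im (f x) \<ge> 0" "\<And>x. x \<in> S \<Longrightarrow> cmod (g x) \<le> 1"
  shows "continuous_on S (\<lambda>x. K (f x) (g x))"
  using continuous_on_compose2[OF continuous_on_K, of S "\<lambda>x. (f x, g x)"] assms
  by (auto intro!: continuous_intros simp: image_subset_iff)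

lemma exp_K:
  assumes "Im \<mu> \<ge> 0" "cmod c \<le> 1"
  shows "exp (- \<i> * K \<mu> c) = uu True \<mu> c 1"
proof -
  let ?L = "\<lambda>x. integral {0..x} (\<lambda>x. cnj (q 0 x) * \<sigma> \<mu> c x)"
  let ?W = "\<lambda>x. uu True \<mu> c x * exp (\<i> * \<mu> * x - \<i> * ?L x)"
  have cont: "continuous_on {0..1} (\<lambda>x. cnj (q 0 x) * \<sigma> \<mu> c x)"
    by (intro continuous_intros assms) auto
  have d: "(?W has_vector_derivative 0) (at x within {0..1})" if x: "x \<in> {0..1}" for x
  proof -
    define a b where "a = uu True \<mu> c x" and "b = uu False \<mu> c x"
    have a0: "a \<noteq> 0" using uu_True_nonzero[OF assms, of x] x by (simp add: a_def)
    have da: "(uu True \<mu> c has_vector_derivative - \<i> * (\<mu> * a - cnj (q 0 x) * b)) (at x within {0..1})"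
      using has_vector_derivative_within_subset[OF uu_deriv[of x True \<mu> c], of "{0..1}"] x
      by (simp add: a_def b_def sb_def Qb_def)
    have dL: "(?L has_vector_derivative cnj (q 0 x) * (b / a)) (at x within {0..1})"
      using integral_has_vector_derivative[OF cont x] by (simp add: \<sigma>_def a_def b_def)
    have "((\<lambda>x. \<i> * \<mu> * of_real x - \<i> * ?L x) has_vector_derivative
        \<i> * \<mu> * 1 - \<i> * (cnj (q 0 x) * (b / a))) (at x within {0..1})"
      by (intro has_vector_derivative_diff has_vector_derivative_mult_right dL)
         (auto simp: has_vector_derivative_def scaleR_conv_of_real intro!: derivative_eq_intros)
    from field_vector_diff_chain_within[OF this DERIV_exp[THEN DERIV_subset[OF _ subset_UNIV]]]
    have "((\<lambda>x. exp (\<i> * \<mu> * x - \<i> * ?L x)) has_vector_derivative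
        (\<i> * \<mu> * 1 - \<i> * (cnj (q 0 x) * (b / a))) * exp (\<i> * \<mu> * x - \<i> * ?L x)) (at x within {0..1})"
      by (simp add: o_def)
    from has_vector_derivative_mult[OF da this] show ?thesis
      using a0 by (simp add: a_def[symmetric] field_simps)
  qed
  obtain k where k: "\<And>x. x \<in> {0..1} \<Longrightarrow> ?W x = k"
    using has_vector_derivative_zero_constant[of "{0..1}" ?W] d by auto
  have "?W 1 = ?W 0" using k[of 0] k[of 1] by simp
  hence "uu True \<mu> c 1 * exp (\<i> * K \<mu> c) = 1" by (simp add: uu_0 K_def algebra_simps)
  thus ?thesis by (simp add: exp_minus field_simps)
qed

definition Q1 :: real where "Q1 = integral {0..1} (\<lambda>x. cmod (q 0 x))"

lemma norm_integral_le:
  fixes w :: "real \<Rightarrow> complex"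
  assumes "continuous_on {0..1} w" "continuous_on {0..1} h" "\<And>x. x \<in> {0..1} \<Longrightarrow> cmod (h x) \<le> 1"
  shows "cmod (integral {0..1} (\<lambda>x. w x * h x)) \<le> integral {0..1} (\<lambda>x. cmod (w x))"
proof (rule integral_norm_bound_integral)
  show "(\<lambda>x. w x * h x) integrable_on {0..1}" "(\<lambda>x. cmod (w x)) integrable_on {0..1}"
    by (intro integrable_continuous_real continuous_intros assms)+
  show "cmod (w x * h x) \<le> cmod (w x)" if "x \<in> {0..1}" for x
    using mult_left_mono[OF assms(3)[OF that], of "cmod (w x)"] by (simp add: norm_mult)
qed

lemma K_bound:
  assumes "Im \<mu> \<ge> 0" "cmod c \<le> 1"
  shows "cmod (K \<mu> c - \<mu>) \<le> Q1"
proof -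
  have "cmod (integral {0..1} (\<lambda>x. cnj (q 0 x) * \<sigma> \<mu> c x)) \<le> integral {0..1} (\<lambda>x. cmod (cnj (q 0 x)))"
    by (rule norm_integral_le) (auto intro!: continuous_intros assms \<sigma>_le)
  thus ?thesis by (simp add: K_def Q1_def)
qed

text \<open>Integrates the derivative of \<open>w * \<sigma> ^ p\<close>, the Riccati equation
  replacing the derivative of \<open>\<sigma>\<close>. Solved for the term with
  \<open>2 * \<i> * \<mu>\<close>, it gains one power of \<open>1 / \<mu>\<close> at the price of
  moving \<open>p\<close> by at most one; every expansion for large parameter rests on it.\<close>

lemma parts:
  assumes \<mu>: "Im \<mu> \<ge> 0" "cmod c \<le> 1" and p: "p \<ge> 1"
    and w: "\<And>x. x \<in> {0..1} \<Longrightarrow> (w has_vector_derivative w' x) (at x within {0..1})"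
    and w': "continuous_on {0..1} w'"
  shows "w 1 * \<sigma> \<mu> c 1 ^ p - w 0 * c ^ p =
    integral {0..1} (\<lambda>x. w' x * \<sigma> \<mu> c x ^ p) +
    of_nat p * (2 * \<i> * \<mu> * integral {0..1} (\<lambda>x. w x * \<sigma> \<mu> c x ^ p)
      - \<i> * integral {0..1} (\<lambda>x. w x * q 0 x * \<sigma> \<mu> c x ^ (p - 1))
      - \<i> * integral {0..1} (\<lambda>x. w x * cnj (q 0 x) * \<sigma> \<mu> c x ^ (p + 1)))"
proof -
  let ?s = "\<sigma> \<mu> c"
  have cw: "continuous_on {0..1} w"
    using w by (meson continuous_on_eq_continuous_within has_vector_derivative_continuous)
  have cs: "continuous_on {0..1} ?s" by (intro continuous_intros \<mu>) auto
  have ci: "(\<lambda>x. w x * ?s x ^ p) integrable_on {0..1}" "(\<lambda>x. w x * q 0 x * ?s x ^ (p - 1)) integrable_on {0..1}"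
    "(\<lambda>x. w x * cnj (q 0 x) * ?s x ^ (p + 1)) integrable_on {0..1}" "(\<lambda>x. w' x * ?s x ^ p) integrable_on {0..1}"
    by (intro integrable_continuous_real continuous_intros cw cs w')+
  have "((\<lambda>x. w' x * ?s x ^ p + of_nat p * (2 * \<i> * \<mu> * (w x * ?s x ^ p) - \<i> * (w x * q 0 x * ?s x ^ (p - 1))
     - \<i> * (w x * cnj (q 0 x) * ?s x ^ (p + 1)))) has_integral w 1 * ?s 1 ^ p - w 0 * ?s 0 ^ p) {0..1}"
  proof (rule fundamental_theorem_of_calculus)
    fix x :: real assume x: "x \<in> {0..1}"
    let ?d = "2 * \<i> * \<mu> * ?s x - \<i> * q 0 x - \<i> * cnj (q 0 x) * (?s x)\<^sup>2"
    have ds: "(?s has_vector_derivative ?d) (at x within {0..1})"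
      by (rule has_vector_derivative_within_subset[OF \<sigma>_deriv[OF \<mu>]]) (use x in auto)
    have "((\<lambda>z. z ^ p) has_field_derivative of_nat p * ?s x ^ (p - 1)) (at (?s x) within S)" for S
      by (auto intro!: derivative_eq_intros)
    from field_vector_diff_chain_within[OF ds this]
    have "((\<lambda>x. ?s x ^ p) has_vector_derivative ?d * (of_nat p * ?s x ^ (p - 1))) (at x within {0..1})"
      by (simp add: o_def)
    from has_vector_derivative_mult[OF w[OF x] this]
    have "((\<lambda>x. w x * ?s x ^ p) has_vector_derivative
      w x * (?d * (of_nat p * ?s x ^ (p - 1))) + w' x * ?s x ^ p) (at x within {0..1})" .
    moreover obtain p' where p': "p = Suc p'" using p by (cases p) auto
    have "w x * (?d * (of_nat p * ?s x ^ (p - 1))) + w' x * ?s x ^ p =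
      w' x * ?s x ^ p + of_nat p * (2 * \<i> * \<mu> * (w x * ?s x ^ p) - \<i> * (w x * q 0 x * ?s x ^ (p - 1))
     - \<i> * (w x * cnj (q 0 x) * ?s x ^ (p + 1)))"
      by (simp add: p' algebra_simps power2_eq_square)
    ultimately show "((\<lambda>x. w x * ?s x ^ p) has_vector_derivative w' x * ?s x ^ p + of_nat p * (2 * \<i> * \<mu> * (w x * ?s x ^ p) - \<i> * (w x * q 0 x * ?s x ^ (p - 1))
     - \<i> * (w x * cnj (q 0 x) * ?s x ^ (p + 1)))) (at x within {0..1})"
      by (rule has_vector_derivative_eq_rhs)
  qed auto
  moreover have "((\<lambda>x. w' x * ?s x ^ p + of_nat p * (2 * \<i> * \<mu> * (w x * ?s x ^ p) - \<i> * (w x * q 0 x * ?s x ^ (p - 1))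
     - \<i> * (w x * cnj (q 0 x) * ?s x ^ (p + 1)))) has_integral
    integral {0..1} (\<lambda>x. w' x * ?s x ^ p) +
    of_nat p * (2 * \<i> * \<mu> * integral {0..1} (\<lambda>x. w x * ?s x ^ p)
      - \<i> * integral {0..1} (\<lambda>x. w x * q 0 x * ?s x ^ (p - 1))
      - \<i> * integral {0..1} (\<lambda>x. w x * cnj (q 0 x) * ?s x ^ (p + 1)))) {0..1}"
    by (intro has_integral_add has_integral_diff has_integral_mult_right integrable_integral ci)
  ultimately show ?thesis unfolding \<sigma>_0 by (rule has_integral_unique)
qed

definition C0 :: real where
  "C0 = (2 * cmod (q 0 0) + integral {0..1} (\<lambda>x. cmod (q 1 x)) + 2 * integral {0..1} (\<lambda>x. (cmod (q 0 x))\<^sup>2)) / 2"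

lemma q_1_eq_0: "q k 1 = q k 0" using q_periodic[of k 0] by simp

lemma q_deriv_within: "(q k has_vector_derivative q (Suc k) x) (at x within S)"
  using q_deriv has_vector_derivative_at_within by blast

text \<open>One integration by parts with \<open>w = cnj (q 0)\<close> and \<open>p = 1\<close>.
  Since \<open>c\<close> is any point of the disc, the boundary terms need not cancel, but they are
  bounded by \<open>cmod (q 0 0)\<close> each.\<close>

lemma K_asymp:
  assumes \<mu>: "Im \<mu> \<ge> 0" "cmod c \<le> 1" "\<mu> \<noteq> 0"
  shows "cmod (K \<mu> c - \<mu>) \<le> C0 / cmod \<mu>"
proof -
  let ?s = "\<sigma> \<mu> c"
  have eq: "cnj (q 0 1) * ?s 1 ^ 1 - cnj (q 0 0) * c ^ 1 =
    integral {0..1} (\<lambda>x. cnj (q 1 x) * ?s x ^ 1) +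
    of_nat 1 * (2 * \<i> * \<mu> * integral {0..1} (\<lambda>x. cnj (q 0 x) * ?s x ^ 1)
      - \<i> * integral {0..1} (\<lambda>x. cnj (q 0 x) * q 0 x * ?s x ^ (1 - 1))
      - \<i> * integral {0..1} (\<lambda>x. cnj (q 0 x) * cnj (q 0 x) * ?s x ^ (1 + 1)))"
    by (rule parts[OF \<mu>(1,2)])
      (auto intro!: continuous_intros has_vector_derivative_cnj q_deriv_within[of 0, simplified])
  define A B D F where "A = integral {0..1} (\<lambda>x. cnj (q 1 x) * ?s x)"
    and "B = integral {0..1} (\<lambda>x. cnj (q 0 x) * ?s x)"
    and "D = integral {0..1} (\<lambda>x. cnj (q 0 x) * q 0 x)"
    and "F = integral {0..1} (\<lambda>x. cnj (q 0 x) * cnj (q 0 x) * (?s x)\<^sup>2)"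
  have "2 * \<i> * \<mu> * B = cnj (q 0 1) * ?s 1 - cnj (q 0 0) * c - A + \<i> * D + \<i> * F"
    using eq by (simp add: A_def B_def D_def F_def power2_eq_square algebra_simps)
  moreover have tri: "cmod (a1 - a2 - a3 + a4 + a5) \<le> cmod a1 + cmod a2 + cmod a3 + cmod a4 + cmod a5" for a1 a2 a3 a4 a5
    by (smt (verit, best) norm_triangle_ineq norm_triangle_ineq4)
  ultimately have "cmod (2 * \<i> * \<mu> * B) \<le> cmod (cnj (q 0 1) * ?s 1) + cmod (cnj (q 0 0) * c) + cmod A + cmod (\<i> * D) + cmod (\<i> * F)"
    by (simp only: tri)
  moreover have "cmod (cnj (q 0 1) * ?s 1) \<le> cmod (q 0 0)"
    using mult_left_mono[OF \<sigma>_le[OF \<mu>(1,2), of 1], of "cmod (q 0 0)"] by (simp add: norm_mult q_1_eq_0)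
  moreover have "cmod (cnj (q 0 0) * c) \<le> cmod (q 0 0)"
    using mult_left_mono[OF \<mu>(2), of "cmod (q 0 0)"] by (simp add: norm_mult)
  moreover have "cmod A \<le> integral {0..1} (\<lambda>x. cmod (cnj (q 1 x)))"
    unfolding A_def by (rule norm_integral_le) (auto intro!: continuous_intros \<mu> \<sigma>_le)
  moreover have "cmod F \<le> integral {0..1} (\<lambda>x. cmod (cnj (q 0 x) * cnj (q 0 x)))" unfolding F_def
    by (rule norm_integral_le) (auto intro!: continuous_intros \<mu> \<sigma>_le power_le_one simp: norm_power)
  moreover have "cmod (integral {0..1} (\<lambda>x. (cnj (q 0 x) * q 0 x) * 1)) \<le> integral {0..1} (\<lambda>x. cmod (cnj (q 0 x) * q 0 x))"
    by (rule norm_integral_le) (auto intro!: continuous_intros)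
  ultimately have "2 * cmod \<mu> * cmod B \<le> 2 * C0"
    by (simp add: C0_def norm_mult D_def power2_eq_square)
  hence "cmod B \<le> C0 / cmod \<mu>" using \<mu>(3) by (simp add: field_simps)
  thus ?thesis by (simp add: K_def B_def)
qed

end

text \<open>Near \<open>x\<close> a continuous logarithm differs from \<open>g x\<close> by less
  than \<open>pi\<close>, so it is \<open>g x\<close> plus the principal logarithm of the quotient.
  The general domain lets it serve for a real and for a complex parameter.\<close>

lemma has_derivative_log:
  fixes F g :: "'a :: real_normed_vector \<Rightarrow> complex"
  assumes g: "continuous (at x within S) g" and eq: "\<And>y. y \<in> S \<Longrightarrow> exp (g y) = F y" and x: "x \<in> S"
    and F: "(F has_derivative F') (at x within S)"
  shows "(g has_derivative (\<lambda>h. F' h / F x)) (at x within S)"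
proof -
  have F0: "F x \<noteq> 0" using eq[OF x] by (metis exp_not_eq_zero)
  have "((\<lambda>y. F y / F x) has_derivative (\<lambda>h. F' h / F x)) (at x within S)"
    by (rule bounded_linear.has_derivative[OF bounded_linear_divide F])
  moreover have "(Ln has_derivative (*) 1) (at (F x / F x))"
    using F0 has_field_derivative_Ln[of 1] by (simp add: has_field_derivative_def)
  ultimately have "((\<lambda>y. Ln (F y / F x)) has_derivative (\<lambda>h. 1 * (F' h / F x))) (at x within S)"
    by (rule has_derivative_compose)
  hence 1: "((\<lambda>y. g x + Ln (F y / F x)) has_derivative (\<lambda>h. F' h / F x)) (at x within S)"
    by (auto intro: has_derivative_add_const has_derivative_eq_rhs[OF has_derivative_add[OF has_derivative_const]])
  have "\<forall>\<^sub>F y in at x within S. dist (g y) (g x) < pi"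
    using g unfolding continuous_within by (rule tendstoD) simp
  moreover have "\<forall>\<^sub>F y in at x within S. y \<in> S" by (simp add: eventually_at_filter)
  ultimately have ev: "\<forall>\<^sub>F y in at x within S. g x + Ln (F y / F x) = g y"
  proof eventually_elim
    case (elim y)
    have "\<bar>Im (g y - g x)\<bar> < pi"
      using elim(1) abs_Im_le_cmod[of "g y - g x"] by (simp add: dist_norm)
    hence "Ln (exp (g y - g x)) = g y - g x" by (intro Ln_exp) auto
    thus ?case using eq[OF elim(2)] eq[OF x] by (simp add: exp_diff)
  qed
  show ?thesis by (rule has_derivative_transform_eventually[OF 1 ev]) (use eq[OF x] F0 x in auto)
qed

text \<open>The values lie in a discrete set with spacing \<open>2 * pi\<close>, so continuity on a
  connected set forces a constant.\<close>

lemma cont_exp_eq_1: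
  fixes h :: "'a :: topological_space \<Rightarrow> complex"
  assumes "connected S" "continuous_on S h" "\<And>x. x \<in> S \<Longrightarrow> exp (h x) = 1" "x0 \<in> S" "h x0 = 0" "x \<in> S"
  shows "h x = 0"
proof -
  have "h constant_on S"
  proof (rule continuous_discrete_range_constant[OF assms(1,2)])
    fix x assume x: "x \<in> S"
    show "\<exists>e>0. \<forall>y. y \<in> S \<and> h y \<noteq> h x \<longrightarrow> e \<le> cmod (h y - h x)"
    proof (intro exI[of _ "2 * pi"] conjI allI impI)
      fix y assume y: "y \<in> S \<and> h y \<noteq> h x"
      obtain n m :: int where n: "Re (h x) = 0" "Im (h x) = of_int (2 * n) * pi"
        and m: "Re (h y) = 0" "Im (h y) = of_int (2 * m) * pi"
        using assms(3)[OF x] assms(3)[of y] y unfolding exp_eq_1 by blast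
      have "n \<noteq> m" using y n m by (auto simp: complex_eq_iff)
      hence "1 \<le> \<bar>m - n\<bar>" by linarith
      hence "1 \<le> \<bar>real_of_int (m - n)\<bar>" by linarith
      hence "2 * pi * 1 \<le> 2 * pi * \<bar>real_of_int (m - n)\<bar>" by (intro mult_left_mono) auto
      also have "... = \<bar>2 * pi * real_of_int (m - n)\<bar>" by (simp add: abs_mult)
      also have "... = \<bar>Im (h y - h x)\<bar>"
      proof -
        have "2 * pi * real_of_int (m - n) = Im (h y - h x)" using n m by (simp add: algebra_simps)
        thus ?thesis by (rule arg_cong)
      qed
      also have "... \<le> cmod (h y - h x)" by (rule abs_Im_le_cmod)
      finally show "2 * pi \<le> cmod (h y - h x)" by simp
    qed auto
  qed
  thus ?thesis using assms(4-6) unfolding constant_on_def by metis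
qed

context smooth_potential
begin

text \<open>The Riccati flow over one period maps the closed unit disc into itself, so Brouwer
  yields a periodic solution, on the real axis as well.\<close>

lemma \<sigma>_fixed_point:
  assumes "Im \<mu> \<ge> 0" obtains c where "cmod c \<le> 1" "\<sigma> \<mu> c 1 = c"
proof -
  have "\<exists>x\<in>cball 0 1. \<sigma> \<mu> x 1 = x"
  proof (rule brouwer)
    show "continuous_on (cball 0 1) (\<lambda>x. \<sigma> \<mu> x 1)" by (intro continuous_intros) (use assms in auto)
    show "(\<lambda>x. \<sigma> \<mu> x 1) \<in> cball 0 1 \<rightarrow> cball 0 1" using \<sigma>_le[OF assms] by (auto simp: Pi_iff)
  qed auto
  thus ?thesis using that by auto
qed

text \<open>A fixed point makes \<open>(1, c)\<close> an eigenvector of the monodromy matrix; the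
  second claim is the characteristic equation of its eigenvalue.\<close>

lemma fixed_point_eigenvalue:
  assumes "Im \<mu> \<ge> 0" "cmod c \<le> 1" "\<sigma> \<mu> c 1 = c"
  shows "uu False \<mu> c 1 = c * uu True \<mu> c 1"
    and "(uu True \<mu> c 1)\<^sup>2 - \<Delta> \<mu> * uu True \<mu> c 1 + 1 = 0"
proof -
  show 1: "uu False \<mu> c 1 = c * uu True \<mu> c 1"
    using assms(3) uu_True_nonzero[OF assms(1,2), of 1] by (simp add: \<sigma>_def field_simps)
  define A B C D w where "A = fm True True \<mu> 1" and "B = fm True False \<mu> 1"
    and "C = fm False True \<mu> 1" and "D = fm False False \<mu> 1" and w: "w = uu True \<mu> c 1"
  have e: "A + c * B - w = 0" "C + c * D - c * w = 0" "A * D - B * C = 1" "\<Delta> \<mu> = A + D"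
    using 1 fm_det[of 1 \<mu>] by (simp_all add: uu_def \<Delta>_def A_def B_def C_def D_def w)
  have "w\<^sup>2 - (A + D) * w + 1 = (A + c * B - w) * (D - w) - B * (C + c * D - c * w) + (1 - (A * D - B * C))"
    by (simp add: algebra_simps power2_eq_square)
  hence "w\<^sup>2 - (A + D) * w + 1 = 0" by (simp only: e) simp
  thus "(uu True \<mu> c 1)\<^sup>2 - \<Delta> \<mu> * uu True \<mu> c 1 + 1 = 0" unfolding e(4) w .
qed

lemma \<Delta>_eq_cos:
  assumes "Im \<mu> \<ge> 0" "cmod c \<le> 1" "\<sigma> \<mu> c 1 = c"
  shows "\<Delta> \<mu> = 2 * cos (K \<mu> c)"
proof -
  define w where "w = uu True \<mu> c 1"
  have w0: "w \<noteq> 0" using uu_True_nonzero[OF assms(1,2), of 1] by (simp add: w_def)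
  have "w\<^sup>2 - \<Delta> \<mu> * w + 1 = 0" using fixed_point_eigenvalue(2)[OF assms] by (simp add: w_def)
  hence "\<Delta> \<mu> = w + inverse w" using w0 by (simp add: field_simps power2_eq_square)
  also have "w = exp (- \<i> * K \<mu> c)" using exp_K[OF assms(1,2)] by (simp add: w_def)
  finally show ?thesis by (simp add: cos_exp_eq exp_minus)
qed

text \<open>Over one period \<open>EE\<close> strictly increases, while on an eigenvector it is
  multiplied by the squared modulus of the eigenvalue. A unimodular \<open>c\<close>, and likewise
  an eigenvalue of modulus at most one, would contradict this.\<close>

lemma fixed_point_hyperbolic:
  assumes "Im \<mu> > 0" "cmod c \<le> 1" "\<sigma> \<mu> c 1 = c"
  shows "cmod c < 1" "cmod (uu True \<mu> c 1) > 1"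
proof -
  define w where "w = uu True \<mu> c 1"
  have "EE \<mu> c 1 = (cmod w)\<^sup>2 * (1 - (cmod c)\<^sup>2)"
    using fixed_point_eigenvalue(1)[OF less_imp_le[OF assms(1)] assms(2,3)]
    by (simp add: EE_def w_def norm_mult power_mult_distrib algebra_simps)
  moreover have "EE \<mu> c 0 < EE \<mu> c 1" using assms by (intro EE_strict_mono) auto
  ultimately have lt: "1 - (cmod c)\<^sup>2 < (cmod w)\<^sup>2 * (1 - (cmod c)\<^sup>2)" by (simp add: EE_0)
  have c2: "(cmod c)\<^sup>2 \<le> 1" using assms by (simp add: power_le_one)
  hence "(cmod c)\<^sup>2 \<noteq> 1" using lt by auto
  hence c3: "(cmod c)\<^sup>2 < 1" using c2 by simp
  thus "cmod c < 1" using assms(2) by (metis less_eq_real_def order_less_irrefl power_one)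
  have "1 < (cmod w)\<^sup>2" using lt c3 by (simp add: mult_less_cancel_right2)
  thus "cmod (uu True \<mu> c 1) > 1" unfolding w_def by (metis norm_ge_zero not_le power_le_one)
qed

lemma \<Delta>_cnj: "\<Delta> (cnj \<mu>) = cnj (\<Delta> \<mu>)"
  using fm_cnj[of 1 True True \<mu>] fm_cnj[of 1 False False \<mu>] by (simp add: \<Delta>_def)

lemma \<Delta>_holomorphic [holomorphic_intros]: "\<Delta> holomorphic_on S"
  unfolding \<Delta>_def[abs_def] by (intro holomorphic_intros) auto

text \<open>Otherwise the eigenvalue would be a double root of its characteristic equation and hence
  have modulus one. This is the absence of nonreal periodic eigenvalues.\<close>

lemma \<Delta>_not_4:
  assumes "Im \<mu> \<noteq> 0" shows "(\<Delta> \<mu>)\<^sup>2 \<noteq> 4"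
proof -
  have *: "(\<Delta> \<mu>)\<^sup>2 \<noteq> 4" if \<mu>: "Im \<mu> > 0" for \<mu>
  proof
    assume 4: "(\<Delta> \<mu>)\<^sup>2 = 4"
    obtain c where c: "cmod c \<le> 1" "\<sigma> \<mu> c 1 = c" using \<sigma>_fixed_point[of \<mu>] \<mu> by auto
    have "((uu True \<mu> c 1)\<^sup>2 - 1)\<^sup>2 = 0"
      using fixed_point_eigenvalue(2)[OF less_imp_le[OF \<mu>] c] 4 by algebra
    hence "(cmod (uu True \<mu> c 1))\<^sup>2 = 1" by (metis eq_iff_diff_eq_0 norm_one norm_power zero_eq_power2)
    thus False using fixed_point_hyperbolic(2)[OF \<mu> c] by (simp add: power2_eq_1_iff)
  qed
  show ?thesis
  proof (cases "Im \<mu> > 0")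
    case False
    hence "(\<Delta> (cnj \<mu>))\<^sup>2 \<noteq> 4" using assms by (intro *) auto
    thus ?thesis unfolding \<Delta>_cnj by (metis complex_cnj_cnj complex_cnj_numeral complex_cnj_power)
  qed (use * in auto)
qed

section \<open>Real spectral parameter: the monodromy matrix in SU(1,1) and its phase\<close>

definition ma :: "real \<Rightarrow> complex" where "ma t = fm True True (of_real t) 1"
definition mb :: "real \<Rightarrow> complex" where "mb t = fm True False (of_real t) 1"

lemma fm_real: "fm False False (of_real t) 1 = cnj (ma t)" "fm False True (of_real t) 1 = cnj (mb t)"
  using fm_cnj[of 1 True True "of_real t"] fm_cnj[of 1 True False "of_real t"] by (simp_all add: ma_def mb_def)

lemma ma_mb: "(cmod (ma t))\<^sup>2 = 1 + (cmod (mb t))\<^sup>2"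
proof -
  have "ma t * cnj (ma t) - mb t * cnj (mb t) = 1"
    using fm_det[of 1 "of_real t"] by (simp add: fm_real ma_def[symmetric] mb_def[symmetric])
  hence "complex_of_real ((cmod (ma t))\<^sup>2) = of_real (1 + (cmod (mb t))\<^sup>2)"
    unfolding complex_norm_square[symmetric] of_real_add of_real_power by (simp add: algebra_simps complex_norm_square)
  thus ?thesis unfolding of_real_eq_iff .
qed

lemma ma_nonzero: "ma t \<noteq> 0"
proof
  assume "ma t = 0"
  hence "0 = 1 + (cmod (mb t))\<^sup>2" using ma_mb[of t] by simp
  thus False by (smt (verit) zero_le_power2)
qed

lemma \<Delta>_real: "\<Delta> (of_real t) = of_real (2 * Re (ma t))"
  by (simp add: \<Delta>_def fm_real ma_def[symmetric] complex_add_cnj)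

lemma uu_real: "uu True (of_real t) c 1 = ma t + c * mb t" by (simp add: uu_def ma_def mb_def)

text \<open>A continuous branch of minus the argument of \<open>ma t + c * mb t\<close>, normalised
  by being close to \<open>t\<close> for large \<open>t\<close>. This normalisation is what numbers
  the gaps.\<close>

definition dd :: "real \<Rightarrow> complex \<Rightarrow> real" where "dd t c = Re (K (of_real t) c)"

lemma uu_dd:
  assumes "cmod c \<le> 1"
  shows "ma t + c * mb t = of_real (cmod (ma t + c * mb t)) * cis (- dd t c)"
    and "ma t + c * mb t \<noteq> 0"
proof -
  have e: "ma t + c * mb t = exp (- \<i> * K (of_real t) c)"
    using exp_K[of "of_real t" c] assms by (simp add: uu_real)
  thus "ma t + c * mb t = of_real (cmod (ma t + c * mb t)) * cis (- dd t c)"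
    unfolding e by (subst exp_eq_polar) (simp add: dd_def)
  show "ma t + c * mb t \<noteq> 0" unfolding e by simp
qed

lemma continuous_on_dd [continuous_intros]:
  assumes "continuous_on S f" "continuous_on S g" "\<And>x. x \<in> S \<Longrightarrow> cmod (g x) \<le> 1"
  shows "continuous_on S (\<lambda>x. dd (f x) (g x))"
  unfolding dd_def by (intro continuous_intros assms) auto

lemma dd_bound: "cmod c \<le> 1 \<Longrightarrow> \<bar>dd t c - t\<bar> \<le> Q1"
  using order_trans[OF abs_Re_le_cmod K_bound[of "of_real t" c]] by (simp add: dd_def)

lemma dd_asymp: "cmod c \<le> 1 \<Longrightarrow> t \<noteq> 0 \<Longrightarrow> \<bar>dd t c - t\<bar> \<le> C0 / \<bar>t\<bar>"
  using order_trans[OF abs_Re_le_cmod K_asymp[of "of_real t" c]] by (simp add: dd_def)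

text \<open>Dividing by the value at \<open>c = 0\<close> leaves \<open>1 + r * c\<close> with
  \<open>cmod r < 1\<close>, a point of the right half plane; so every phase is within
  \<open>pi / 2\<close> of the central one.\<close>

lemma dd_spread:
  assumes "cmod c \<le> 1" "cmod c' \<le> 1"
  shows "\<bar>dd t c - dd t c'\<bar> < pi"
proof -
  define r where "r = mb t / ma t"
  have r: "cmod r < 1"
  proof -
    have "(cmod (mb t))\<^sup>2 < (cmod (ma t))\<^sup>2" using ma_mb[of t] by simp
    hence "cmod (mb t) < cmod (ma t)" by (rule power2_less_imp_less) simp
    thus ?thesis using ma_nonzero[of t] by (simp add: r_def norm_divide)
  qed
  have pos: "Re (1 + r * c) > 0" if "cmod c \<le> 1" for c
  proof -
    have "cmod (r * c) < 1" using r that mult_mono[of "cmod r" "cmod r" "cmod c" 1]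
      by (simp add: norm_mult)
    thus ?thesis using abs_Re_le_cmod[of "r * c"] by simp
  qed
  have *: "K (of_real t) c - K (of_real t) 0 = \<i> * Ln (1 + r * c)" if c: "cmod c \<le> 1" for c
  proof -
    let ?h = "\<lambda>c. - \<i> * (K (of_real t) c - K (of_real t) 0) - Ln (1 + r * c)"
    have "?h c = 0"
    proof (rule cont_exp_eq_1[of "cball 0 1" ?h 0])
      show "continuous_on (cball 0 1) ?h"
        by (intro continuous_intros) (use pos in \<open>force simp: complex_nonpos_Reals_iff\<close>)+
      fix x :: complex assume "x \<in> cball 0 1"
      hence x: "cmod x \<le> 1" by simp
      have nz: "1 + r * x \<noteq> 0" using pos[OF x] by (metis less_irrefl zero_complex.simps(1))
      have hx: "?h x = (- \<i> * K (of_real t) x) - (- \<i> * K (of_real t) 0) - Ln (1 + r * x)"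
        by (simp add: algebra_simps)
      have "exp (?h x) = exp (- \<i> * K (of_real t) x) / exp (- \<i> * K (of_real t) 0) / (1 + r * x)"
        unfolding hx exp_diff exp_Ln[OF nz] ..
      also have "... = (ma t + x * mb t) / (ma t) / (1 + r * x)"
        using exp_K[of "of_real t" x] exp_K[of "of_real t" 0] x by (simp add: uu_real)
      also have "(ma t + x * mb t) / (ma t) = 1 + r * x"
        using ma_nonzero[of t] by (simp add: r_def field_simps)
      finally show "exp (?h x) = 1" using nz by simp
    qed (use c in auto)
    hence "- \<i> * (K (of_real t) c - K (of_real t) 0) = Ln (1 + r * c)" by simp
    hence "\<i> * (- \<i> * (K (of_real t) c - K (of_real t) 0)) = \<i> * Ln (1 + r * c)" by simp
    thus ?thesis by (simp add: algebra_simps)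
  qed
  have half: "\<bar>dd t c - dd t 0\<bar> < pi / 2" if c: "cmod c \<le> 1" for c
  proof -
    have "dd t c - dd t 0 = - Im (Ln (1 + r * c))"
      using arg_cong[OF *[OF c], of Re] by (simp add: dd_def)
    thus ?thesis using Re_Ln_pos_lt_imp[OF pos[OF c]] by simp
  qed
  show ?thesis using half[OF assms(1)] half[OF assms(2)] by linarith
qed

text \<open>For unimodular \<open>c\<close> it turns \<open>EE\<close> after one period into the
  difference of squared moduli of one holomorphic function at \<open>z\<close> and at its
  conjugate.\<close>

lemma fm_cnj_uu:
  assumes "cmod c = 1"
  shows "cmod (uu False z c 1) = cmod (uu True (cnj z) c 1)"
proof -
  have cc: "c * cnj c = 1" using assms by (simp add: complex_norm_square[symmetric])
  have "uu False z c 1 = c * cnj (uu True (cnj z) c 1)"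
    using fm_cnj[of 1 True True "cnj z"] fm_cnj[of 1 True False "cnj z"] cc
    by (simp add: uu_def algebra_simps)
  thus ?thesis using assms by (simp add: norm_mult)
qed

text \<open>The squared length of the solution has a positive minimum on the compact rectangle, and
  it is the rate at which \<open>EE\<close> grows; at \<open>x = 0\<close> the form vanishes for
  unimodular \<open>c\<close>.\<close>

lemma EE_growth:
  assumes c: "cmod c = 1"
  obtains m where "m > 0" "\<And>y. 0 < y \<Longrightarrow> y \<le> 1 \<Longrightarrow> 2 * y * m \<le> EE (Complex t y) c 1"
proof -
  let ?N = "\<lambda>p. (cmod (uu True (Complex t (fst p)) c (snd p)))\<^sup>2 + (cmod (uu False (Complex t (fst p)) c (snd p)))\<^sup>2"
  have "continuous_on ({0..1} \<times> {0..1}) ?N" unfolding Complex_eq by (intro continuous_intros) auto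
  then obtain p where p: "p \<in> {0..1} \<times> {0..1}" "\<And>r. r \<in> {0..1} \<times> {0..1} \<Longrightarrow> ?N p \<le> ?N r"
    using continuous_attains_inf[of "{0..1} \<times> {0..1}" ?N] compact_Times[of "{0..1::real}" "{0..1::real}"] by auto
  have pos: "?N p > 0"
    using uu_nonzero[of "snd p" "Complex t (fst p)" c] p(1) by (auto simp: sum_power2_gt_zero_iff)
  show ?thesis
  proof (rule that[OF pos])
    fix y :: real assume y: "0 < y" "y \<le> 1"
    have "EE (Complex t y) c 0 - 2 * y * ?N p * 0 \<le> EE (Complex t y) c 1 - 2 * y * ?N p * 1"
    proof (rule DERIV_nonneg_imp_increasing_open[of 0 1])
      fix x :: real assume x: "0 < x" "x < 1"
      have "((\<lambda>x. EE (Complex t y) c x - 2 * y * ?N p * x) has_real_derivative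
        2 * Im (Complex t y) * ((cmod (uu True (Complex t y) c x))\<^sup>2 + (cmod (uu False (Complex t y) c x))\<^sup>2)
          - 2 * y * ?N p) (at x)"
        by (intro DERIV_diff EE_deriv_at DERIV_cmult_Id) (use x in auto)
      moreover have "?N p \<le> ?N (y, x)" using p(2)[of "(y, x)"] x y by auto
      hence "0 \<le> 2 * Im (Complex t y) * ((cmod (uu True (Complex t y) c x))\<^sup>2 + (cmod (uu False (Complex t y) c x))\<^sup>2)
          - 2 * y * ?N p"
        using y by simp
      ultimately show "\<exists>d. ((\<lambda>x. EE (Complex t y) c x - 2 * y * ?N p * x) has_real_derivative d) (at x) \<and> 0 \<le> d"
        by blast
    qed (auto intro!: continuous_intros continuous_on_EE)
    thus "2 * y * ?N p \<le> EE (Complex t y) c 1" using c by (simp add: EE_0)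
  qed
qed

text \<open>With \<open>F\<close> the first component, the derivative of the phase is
  \<open>Re (\<i> * (F' / F))\<close>. Up to the positive factor \<open>4 * (cmod F)\<^sup>2\<close>
  this is the derivative at \<open>y = 0\<close> of the squared modulus at height \<open>y\<close>
  minus that at height \<open>- y\<close>, which \<open>EE_growth\<close> keeps positive.\<close>

lemma dd_deriv_pos:
  assumes c: "cmod c = 1"
  shows "\<exists>D. ((\<lambda>t. dd t c) has_real_derivative D) (at t) \<and> D > 0"
proof -
  let ?F = "\<lambda>z. uu True z c 1"
  have hol: "?F holomorphic_on UNIV" unfolding uu_def by (intro holomorphic_intros) auto
  define F F' where "F = ?F (of_real t)" and "F' = deriv ?F (of_real t)"
  have dF: "(?F has_field_derivative F') (at (of_real t))"
    unfolding F'_def using hol by (simp add: holomorphic_derivI)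
  have F0: "F \<noteq> 0" using uu_True_nonzero[of "of_real t" c 1] c by (simp add: F_def)
  have "((\<lambda>t. - \<i> * K (of_real t) c) has_derivative (\<lambda>h. (h *\<^sub>R F') / ?F (of_real t))) (at t)"
  proof (rule has_derivative_log)
    have "continuous_on UNIV (\<lambda>t. - \<i> * K (of_real t) c)"
      by (intro continuous_intros) (use c in auto)
    thus "continuous (at t) (\<lambda>t. - \<i> * K (of_real t) c)"
      by (simp add: continuous_on_eq_continuous_at)
    show "exp (- \<i> * K (of_real y) c) = ?F (of_real y)" for y
      using exp_K[of "of_real y" c] c by simp
    show "((\<lambda>x. ?F (of_real x)) has_derivative (\<lambda>h. h *\<^sub>R F')) (at t)"
      using has_vector_derivative_real_field[OF dF] by (simp add: has_vector_derivative_def)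
  qed auto
  hence "((\<lambda>t. - \<i> * K (of_real t) c) has_vector_derivative (F' / F)) (at t)"
    by (simp add: has_vector_derivative_def F_def scaleR_conv_of_real)
  hence "((\<lambda>t. \<i> * (- \<i> * K (of_real t) c)) has_vector_derivative \<i> * (F' / F)) (at t)"
    by (rule has_vector_derivative_mult_right)
  hence "((\<lambda>t. K (of_real t) c) has_vector_derivative \<i> * (F' / F)) (at t)"
    by (simp add: mult.assoc[symmetric])
  hence D: "((\<lambda>t. dd t c) has_real_derivative Re (\<i> * (F' / F))) (at t)"
    unfolding dd_def by (simp add: has_vector_derivative_complex_iff has_real_derivative_iff_has_vector_derivative)
  let ?G = "\<lambda>y. (cmod (?F (Complex t y)))\<^sup>2 - (cmod (?F (Complex t (- y))))\<^sup>2"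
  obtain m where m: "m > 0" "\<And>y. 0 < y \<Longrightarrow> y \<le> 1 \<Longrightarrow> 2 * y * m \<le> EE (Complex t y) c 1"
    using EE_growth[OF c, of t] by blast
  have Gm: "2 * y * m \<le> ?G y" if "0 < y" "y \<le> 1" for y
    using m(2)[OF that] fm_cnj_uu[OF c, of "Complex t y"] by (simp add: EE_def complex_cnj)
  have dz: "((\<lambda>y. ?F (Complex t (s * y))) has_vector_derivative (of_real s * \<i>) * F') (at 0)" for s :: real
  proof -
    have "((\<lambda>y. Complex t (s * y)) has_vector_derivative of_real s * \<i>) (at 0)"
      unfolding Complex_eq has_vector_derivative_def
      by (auto intro!: derivative_eq_intros simp: scaleR_conv_of_real)
    moreover have "(?F has_field_derivative F') (at (Complex t (s * 0)))"
      using dF by (simp add: complex_of_real_def)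
    ultimately show ?thesis
      using field_vector_diff_chain_within[of "\<lambda>y. Complex t (s * y)" "of_real s * \<i>" 0 UNIV ?F F']
      by (auto simp: o_def intro: has_field_derivative_at_within)
  qed
  have dG: "(?G has_real_derivative 2 * Re (cnj F * (\<i> * F')) - 2 * Re (cnj F * (- \<i> * F'))) (at 0)"
    using DERIV_diff[OF has_real_derivative_cmod_power2[OF dz[of 1]] has_real_derivative_cmod_power2[OF dz[of "-1"]]]
    by (simp add: F_def complex_of_real_def)
  have "((\<lambda>y. (?G y - ?G 0) / (y - 0)) \<longlongrightarrow> 2 * Re (cnj F * (\<i> * F')) - 2 * Re (cnj F * (- \<i> * F'))) (at_right 0)"
    using dG unfolding has_field_derivative_iff by (rule tendsto_mono[rotated]) (simp add: at_le)
  moreover have "\<forall>\<^sub>F y in at_right 0. 2 * m \<le> (?G y - ?G 0) / (y - 0)"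
    using eventually_at_right_real[OF zero_less_one]
  proof eventually_elim
    case (elim y)
    thus ?case using Gm[of y] by (simp add: field_simps)
  qed
  ultimately have "2 * m \<le> 2 * Re (cnj F * (\<i> * F')) - 2 * Re (cnj F * (- \<i> * F'))"
    by (rule tendsto_lowerbound) simp
  moreover have "cnj F * (- \<i> * F') = - (cnj F * (\<i> * F'))" by simp
  ultimately have "2 * m \<le> 4 * Re (cnj F * (\<i> * F'))" by (simp only: uminus_complex.sel)
  hence "0 < Re (cnj F * (\<i> * F'))" using m(1) by linarith
  moreover have "Re (\<i> * (F' / F)) = Re (cnj F * (\<i> * F')) / (cmod F)\<^sup>2"
  proof -
    have "\<i> * (F' / F) = (cnj F * (\<i> * F')) / of_real ((cmod F)\<^sup>2)"
      unfolding complex_norm_square using F0 by (simp add: field_simps)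
    thus ?thesis by (simp only: Re_divide_of_real)
  qed
  ultimately show ?thesis using D F0 by auto
qed

lemma dd_strict_mono:
  assumes "cmod c = 1" "s < t" shows "dd s c < dd t c"
  using DERIV_pos_imp_increasing[OF assms(2), of "\<lambda>t. dd t c"] dd_deriv_pos[OF assms(1)] by blast

end

section \<open>Gaps and the periodic spectrum\<close>

context smooth_potential
begin

text \<open>The closed gap with index \<open>n\<close>, described by the phase alone. Its infimum
  and supremum turn out to be the two periodic eigenvalues with that index, so their numbering is
  built in.\<close>

definition GG :: "int \<Rightarrow> real set"
  where "GG n = {t. \<exists>c. cmod c = 1 \<and> dd t c = of_int n * pi}"

lemma GG_bound: "t \<in> GG n \<Longrightarrow> \<bar>t - of_int n * pi\<bar> \<le> Q1"
proof -
  assume "t \<in> GG n"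
  then obtain c where "cmod c = 1" "dd t c = of_int n * pi" by (auto simp: GG_def)
  thus ?thesis using dd_bound[of c t] by (simp add: abs_minus_commute)
qed

lemma GG_asymp: "t \<in> GG n \<Longrightarrow> t \<noteq> 0 \<Longrightarrow> \<bar>t - of_int n * pi\<bar> \<le> C0 / \<bar>t\<bar>"
proof -
  assume "t \<in> GG n" "t \<noteq> 0"
  then obtain c where "cmod c = 1" "dd t c = of_int n * pi" by (auto simp: GG_def)
  thus ?thesis using dd_asymp[of c t] \<open>t \<noteq> 0\<close> by (simp add: abs_minus_commute)
qed

lemma dd_IVT:
  assumes c: "cmod c = 1" and t: "y \<le> dd t c"
  obtains s where "s \<le> t" "dd s c = y"
proof -
  \<comment> \<open>So far to the left \<open>dd_bound\<close> forces the phase below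
    \<open>y\<close>.\<close>
  let ?a = "min t (y - Q1)"
  have "dd ?a c \<le> ?a + Q1" using dd_bound[of c ?a] c by auto
  hence "dd ?a c \<le> y" by auto
  moreover have "continuous_on {?a..t} (\<lambda>t. dd t c)" by (intro continuous_intros) (use c in auto)
  ultimately obtain s where "?a \<le> s" "s \<le> t" "dd s c = y"
    using IVT'[of "\<lambda>t. dd t c" ?a y t] t by auto
  thus ?thesis using that by blast
qed

lemma dd_IVT2:
  assumes c: "cmod c = 1" and t: "dd t c \<le> y"
  obtains s where "t \<le> s" "dd s c = y"
proof -
  let ?a = "max t (y + Q1)"
  have "?a - Q1 \<le> dd ?a c" using dd_bound[of c ?a] c by auto
  hence "y \<le> dd ?a c" by auto
  moreover have "continuous_on {t..?a} (\<lambda>t. dd t c)" by (intro continuous_intros) (use c in auto)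
  ultimately obtain s where "t \<le> s" "s \<le> ?a" "dd s c = y"
    using IVT'[of "\<lambda>t. dd t c" t y ?a] t by auto
  thus ?thesis using that by blast
qed

lemma GG_nonempty: "GG n \<noteq> {}"
proof -
  obtain s where "dd s 1 = of_int n * pi"
  proof (cases "dd 0 1 \<le> of_int n * pi")
    case True
    thus ?thesis using dd_IVT2[of 1 0 "of_int n * pi"] that by auto
  next
    case False
    thus ?thesis using dd_IVT[of 1 "of_int n * pi" 0] that by auto
  qed
  hence "s \<in> GG n" unfolding GG_def by (intro CollectI exI[of _ 1]) simp
  thus ?thesis by blast
qed

text \<open>It is the projection of a compact set of pairs: the phase is continuous in both
  variables and \<open>GG_bound\<close> confines the first.\<close>

lemma GG_compact: "compact (GG n)"
proof -
  let ?I = "{of_int n * pi - Q1..of_int n * pi + Q1} \<times> sphere (0::complex) 1"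
  let ?S = "{p \<in> ?I. dd (fst p) (snd p) = of_int n * pi}"
  have "continuous_on ?I (\<lambda>p. dd (fst p) (snd p))" by (intro continuous_intros) auto
  hence "closedin (top_of_set ?I) ?S"
    using continuous_closedin_preimage_constant[of ?I "\<lambda>p. dd (fst p) (snd p)" "of_int n * pi"]
    by (simp add: conj_commute)
  hence "compact ?S"
    by (rule closedin_compact[rotated]) (intro compact_Times compact_Icc compact_sphere)
  hence "compact (fst ` ?S)" by (intro compact_continuous_image continuous_intros)
  also have "fst ` ?S = GG n"
  proof (intro equalityI subsetI)
    fix t assume "t \<in> GG n"
    moreover from this obtain c where "cmod c = 1" "dd t c = of_int n * pi" by (auto simp: GG_def)
    ultimately have "(t, c) \<in> ?S" using GG_bound[of t n] by (auto simp: abs_le_iff)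
    thus "t \<in> fst ` ?S" by force
  qed (auto simp: GG_def)
  finally show ?thesis .
qed

definition lm :: "int \<Rightarrow> real" where "lm n = Inf (GG n)"
definition lp :: "int \<Rightarrow> real" where "lp n = Sup (GG n)"

lemma lm_in: "lm n \<in> GG n" and lp_in: "lp n \<in> GG n" unfolding lm_def lp_def
  using GG_compact[of n] GG_nonempty[of n]
  by (auto intro!: closed_contains_Inf closed_contains_Sup compact_imp_closed
    bounded_imp_bdd_below bounded_imp_bdd_above compact_imp_bounded)

lemma lm_le: "t \<in> GG n \<Longrightarrow> lm n \<le> t" and lp_ge: "t \<in> GG n \<Longrightarrow> t \<le> lp n"
  unfolding lm_def lp_def using GG_compact[of n]
  by (auto intro!: cInf_lower cSup_upper bounded_imp_bdd_below bounded_imp_bdd_above compact_imp_bounded)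

lemma lm_le_lp: "lm n \<le> lp n" using lm_le[OF lp_in] .

text \<open>A phase above \<open>n * pi\<close> at the left end would have crossed that level
  further to the left, since phases follow \<open>t\<close> up to a bounded error.\<close>

lemma dd_lm: assumes c: "cmod c = 1" shows "dd (lm n) c \<le> of_int n * pi"
proof (rule ccontr)
  assume *: "\<not> ?thesis"
  then obtain s where s: "s \<le> lm n" "dd s c = of_int n * pi"
    using dd_IVT[OF c, of "of_int n * pi" "lm n"] by auto
  hence "s \<in> GG n" using c by (auto simp: GG_def)
  hence "s = lm n" using s lm_le[of s n] by auto
  thus False using * s by auto
qed

lemma dd_lp: assumes c: "cmod c = 1" shows "of_int n * pi \<le> dd (lp n) c"
proof (rule ccontr)
  assume *: "\<not> ?thesis"
  then obtain s where s: "lp n \<le> s" "dd s c = of_int n * pi"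
    using dd_IVT2[OF c, of "lp n" "of_int n * pi"] by auto
  hence "s \<in> GG n" using c by (auto simp: GG_def)
  hence "s = lp n" using s lp_ge[of s n] by auto
  thus False using * s by auto
qed

lemma dd_mono: "cmod c = 1 \<Longrightarrow> s \<le> t \<Longrightarrow> dd s c \<le> dd t c"
  using dd_strict_mono[of c s t] by (cases "s = t") auto

lemma lm_eqI:
  assumes "t \<in> GG n" "\<And>c. cmod c = 1 \<Longrightarrow> dd t c \<le> of_int n * pi" shows "t = lm n"
proof (rule ccontr)
  assume "t \<noteq> lm n"
  hence "lm n < t" using lm_le[OF assms(1)] by simp
  moreover obtain c where c: "cmod c = 1" "dd (lm n) c = of_int n * pi" using lm_in by (auto simp: GG_def)
  ultimately have "of_int n * pi < dd t c" using dd_strict_mono[of c "lm n" t] by auto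
  thus False using assms(2)[OF c(1)] by simp
qed

lemma lp_eqI:
  assumes "t \<in> GG n" "\<And>c. cmod c = 1 \<Longrightarrow> of_int n * pi \<le> dd t c" shows "t = lp n"
proof (rule ccontr)
  assume "t \<noteq> lp n"
  hence "t < lp n" using lp_ge[OF assms(1)] by simp
  moreover obtain c where c: "cmod c = 1" "dd (lp n) c = of_int n * pi" using lp_in by (auto simp: GG_def)
  ultimately have "dd t c < of_int n * pi" using dd_strict_mono[of c t "lp n"] by auto
  thus False using assms(2)[OF c(1)] by simp
qed

text \<open>If the gaps overlapped or came in the wrong order, two phases at \<open>lm k\<close>
  would differ by at least \<open>pi\<close>, against \<open>dd_spread\<close>.\<close>

lemma lp_less_lm: assumes "n < k" shows "lp n < lm k"
proof (rule ccontr)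
  assume "\<not> ?thesis"
  hence le: "lm k \<le> lp n" by simp
  obtain c where c: "cmod c = 1" "dd (lm k) c = of_int k * pi" using lm_in by (auto simp: GG_def)
  obtain c' where c': "cmod c' = 1" "dd (lp n) c' = of_int n * pi" using lp_in by (auto simp: GG_def)
  have "dd (lm k) c' \<le> of_int n * pi" using dd_mono[OF c'(1) le] c' by simp
  moreover have "of_int n + 1 \<le> real_of_int k" using assms by linarith
  hence "of_int n * pi + pi \<le> of_int k * pi"
    using mult_right_mono[of "of_int n + 1" "real_of_int k" pi] by (simp add: algebra_simps)
  ultimately show False using dd_spread[of c c' "lm k"] c c' by auto
qed

lemma GG_disjoint: assumes "t \<in> GG n" "t \<in> GG k" shows "n = k"
  using lp_less_lm[of n k] lp_less_lm[of k n] lm_le[OF assms(1)] lm_le[OF assms(2)] lp_ge[OF assms(1)] lp_ge[OF assms(2)]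
  by linarith

text \<open>The sign \<open>(- 1) ^ n\<close>, written as a cosine so that it matches the addition
  formulas for phases and needs no case distinction for negative \<open>n\<close>.\<close>

definition sg :: "int \<Rightarrow> real" where "sg n = cos (of_int n * pi)"

lemma sg_sq: "sg n * sg n = 1" and sg_cases: "sg n = 1 \<or> sg n = -1"
proof -
  have "(sin (of_int n * pi))\<^sup>2 + (cos (of_int n * pi))\<^sup>2 = 1" by (rule sin_cos_squared_add)
  moreover have "sin (of_int n * pi) = 0" by (simp add: sin_zero_iff_int2)
  ultimately show "sg n * sg n = 1" by (simp add: sg_def power2_eq_square)
  thus "sg n = 1 \<or> sg n = -1" by (metis square_eq_1_iff)
qed

lemma Im_uu_dd:
  assumes "cmod c \<le> 1"
  shows "sg n * Im (ma t + c * mb t) = - cmod (ma t + c * mb t) * sin (dd t c - of_int n * pi)"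
    and "sg n * Re (ma t + c * mb t) = cmod (ma t + c * mb t) * cos (dd t c - of_int n * pi)"
proof -
  have s: "sin (of_int n * pi) = 0" by (simp add: sin_zero_iff_int2)
  define r where "r = cmod (ma t + c * mb t)"
  have e: "ma t + c * mb t = of_real r * cis (- dd t c)" using uu_dd(1)[OF assms] by (simp add: r_def)
  have "Im (ma t + c * mb t) = - r * sin (dd t c)" unfolding e by simp
  thus "sg n * Im (ma t + c * mb t) = - cmod (ma t + c * mb t) * sin (dd t c - of_int n * pi)"
    by (simp add: sin_diff s sg_def r_def)
  have "Re (ma t + c * mb t) = r * cos (dd t c)" unfolding e by simp
  thus "sg n * Re (ma t + c * mb t) = cmod (ma t + c * mb t) * cos (dd t c - of_int n * pi)"
    by (simp add: cos_diff s sg_def r_def)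
qed

text \<open>At an endpoint of a gap the phase \<open>dd t c\<close> has an extremum at an eigenvector, so that
  \<open>Im (ma t + c * mb t)\<close> does not change sign.\<close>

lemma endpoint_aux:
  fixes e :: real
  assumes e: "e = 1 \<or> e = -1" and c0: "cmod c0 = 1" "dd t c0 = of_int n * pi"
    and le: "\<And>c. cmod c = 1 \<Longrightarrow> e * (dd t c - of_int n * pi) \<le> 0"
  shows "e * sg n * Im (ma t) = cmod (mb t)" and "Re (ma t) = sg n"
proof -
  have es: "sin (e * x) = e * sin x" for x using e by auto
  have nn: "0 \<le> e * sg n * Im (ma t + c * mb t)" if c: "cmod c = 1" for c
  proof -
    have "\<bar>dd t c - of_int n * pi\<bar> < pi" using dd_spread[of c c0 t] c c0 by simp
    hence "0 \<le> sin (- (e * (dd t c - of_int n * pi)))" using le[OF c] e by (intro sin_ge_zero) auto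
    hence "0 \<le> - e * sin (dd t c - of_int n * pi)" unfolding sin_minus es by simp
    hence "0 \<le> cmod (ma t + c * mb t) * (- e * sin (dd t c - of_int n * pi))"
      by (rule mult_nonneg_nonneg[OF norm_ge_zero])
    also have "... = e * (sg n * Im (ma t + c * mb t))" using Im_uu_dd(1)[of c n t] c by simp
    finally show ?thesis by simp
  qed
  have 0: "sg n * Im (ma t + c0 * mb t) = 0" "sg n * Re (ma t + c0 * mb t) > 0"
    using Im_uu_dd[of c0 n t] c0 uu_dd(2)[of c0 t] by auto
  have s0: "sg n \<noteq> 0" using sg_cases[of n] by auto
  have I0: "Im (ma t) = - Im (c0 * mb t)" using 0 s0 by auto
  have "cmod (mb t) \<le> e * sg n * Im (ma t)"
  proof (cases "mb t = 0")
    case True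
    thus ?thesis using nn[OF c0(1)] by simp
  next
    case False
    define c where "c = - \<i> * of_real (e * sg n * cmod (mb t)) / mb t"
    have es: "(e * sg n) * (e * sg n) = 1" using e sg_sq[of n] by auto
    have "cmod c = \<bar>e * sg n\<bar>" using False by (simp add: c_def norm_mult norm_divide abs_mult)
    also have "... = 1" using e sg_cases[of n] by auto
    finally have "cmod c = 1" .
    moreover have "c * mb t = - \<i> * of_real (e * sg n * cmod (mb t))" using False by (simp add: c_def)
    ultimately have "0 \<le> e * sg n * (Im (ma t) - e * sg n * cmod (mb t))" using nn[of c] by simp
    also have "... = e * sg n * Im (ma t) - (e * sg n) * (e * sg n) * cmod (mb t)" by (simp add: algebra_simps)
    finally show ?thesis unfolding es by simp
  qed
  moreover have "e * sg n * Im (ma t) \<le> cmod (mb t)"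
  proof -
    have "e * sg n * Im (ma t) \<le> \<bar>Im (ma t)\<bar>" using e sg_cases[of n] by auto
    also have "... \<le> cmod (c0 * mb t)" unfolding I0 using abs_Im_le_cmod[of "c0 * mb t"] by simp
    finally show ?thesis using c0 by (simp add: norm_mult)
  qed
  ultimately show 1: "e * sg n * Im (ma t) = cmod (mb t)" by simp
  have "(e * sg n * Im (ma t))\<^sup>2 = (Im (ma t))\<^sup>2" using e sg_cases[of n] by auto
  hence Im2: "(Im (ma t))\<^sup>2 = (cmod (mb t))\<^sup>2" using 1 by simp
  hence "(Re (ma t))\<^sup>2 = 1" using ma_mb[of t] by (simp add: cmod_power2)
  hence R: "Re (ma t) = 1 \<or> Re (ma t) = -1" by (simp add: power2_eq_1_iff)
  have "(cmod (c0 * mb t))\<^sup>2 = (cmod (mb t))\<^sup>2" using c0 by (simp add: norm_mult)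
  also have "... = (Im (c0 * mb t))\<^sup>2" unfolding Im2[symmetric] I0 by (rule power2_minus)
  finally have "(Re (c0 * mb t))\<^sup>2 = 0" unfolding cmod_power2 by linarith
  hence "Re (c0 * mb t) = 0" by simp
  hence "sg n * Re (ma t) > 0" using 0(2) by simp
  thus "Re (ma t) = sg n" using R sg_cases[of n] by auto
qed

lemma lm_facts: "sg n * Im (ma (lm n)) = cmod (mb (lm n))" "Re (ma (lm n)) = sg n"
proof -
  obtain c where c: "cmod c = 1" "dd (lm n) c = of_int n * pi" using lm_in by (auto simp: GG_def)
  show "sg n * Im (ma (lm n)) = cmod (mb (lm n))" "Re (ma (lm n)) = sg n"
    using endpoint_aux[of 1, OF _ c] dd_lm[of _ n] by auto
qed

lemma lp_facts: "- sg n * Im (ma (lp n)) = cmod (mb (lp n))" "Re (ma (lp n)) = sg n"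
proof -
  obtain c where c: "cmod c = 1" "dd (lp n) c = of_int n * pi" using lp_in by (auto simp: GG_def)
  show "- sg n * Im (ma (lp n)) = cmod (mb (lp n))" "Re (ma (lp n)) = sg n"
    using endpoint_aux[of "-1", OF _ c] dd_lp[of _ n] by auto
qed

text \<open>By \<open>ma_mb\<close> the hypothesis means that the imaginary part of
  \<open>ma t\<close> is at most \<open>cmod (mb t)\<close> in size, so a rotation of
  \<open>mb t\<close> can cancel it.\<close>

lemma in_GG_if:
  assumes "\<bar>Re (ma t)\<bar> \<ge> 1"
  obtains n c where "cmod c = 1" "dd t c = of_int n * pi"
    "Im (ma t + c * mb t) = 0"
proof -
  have le: "\<bar>Im (ma t)\<bar> \<le> cmod (mb t)"
  proof -
    have "1 \<le> (Re (ma t))\<^sup>2" using assms by (metis abs_le_square_iff abs_one one_power2)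
    hence "(Im (ma t))\<^sup>2 \<le> (cmod (mb t))\<^sup>2" using ma_mb[of t] by (simp add: cmod_power2)
    thus ?thesis by (metis abs_le_square_iff abs_norm_cancel)
  qed
  obtain c where c: "cmod c = 1" "Im (ma t + c * mb t) = 0"
  proof (cases "mb t = 0")
    case True
    thus ?thesis using le that[of 1] by simp
  next
    case False
    define x where "x = - Im (ma t) / cmod (mb t)"
    have x: "\<bar>x\<bar> \<le> 1" using le False by (simp add: x_def abs_divide divide_le_eq_1)
    define w where "w = Complex (sqrt (1 - x\<^sup>2)) x"
    have x2: "x\<^sup>2 \<le> 1" using x by (simp add: abs_square_le_1)
    have "cmod w = 1" using x2 by (simp add: w_def cmod_def)
    hence "cmod (w * of_real (cmod (mb t)) / mb t) = 1" using False by (simp add: norm_mult norm_divide)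
    moreover have "Im (ma t + w * of_real (cmod (mb t)) / mb t * mb t) = 0"
      using False by (simp add: w_def x_def)
    ultimately show ?thesis by (rule that)
  qed
  have "sg 0 * Im (ma t + c * mb t) = - cmod (ma t + c * mb t) * sin (dd t c - of_int 0 * pi)"
    using Im_uu_dd(1)[of c 0 t] c by simp
  hence "sin (dd t c) = 0" using c uu_dd(2)[of c t] by auto
  then obtain n :: int where "dd t c = of_int n * pi" unfolding sin_zero_iff_int2 by blast
  thus ?thesis using that c by blast
qed

lemma \<Delta>_sq_real: "(\<Delta> (of_real t))\<^sup>2 = 4 \<longleftrightarrow> \<bar>Re (ma t)\<bar> = 1"
proof -
  have "(\<Delta> (of_real t))\<^sup>2 = of_real ((2 * Re (ma t))\<^sup>2)" by (simp add: \<Delta>_real)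
  hence "(\<Delta> (of_real t))\<^sup>2 = 4 \<longleftrightarrow> complex_of_real ((2 * Re (ma t))\<^sup>2) = of_real 4" by simp
  also have "... \<longleftrightarrow> (2 * Re (ma t))\<^sup>2 = 2\<^sup>2" unfolding of_real_eq_iff by simp
  also have "... \<longleftrightarrow> \<bar>Re (ma t)\<bar> = 1" unfolding power2_eq_iff by auto
  finally show ?thesis .
qed

text \<open>Here the imaginary part of \<open>ma t\<close> has exactly the size of
  \<open>mb t\<close>, so \<open>Im (ma t + c * mb t)\<close> keeps its sign on the whole unit
  circle. All phases then lie on one side of \<open>n * pi\<close>, and by \<open>lm_eqI\<close> and
  \<open>lp_eqI\<close> this characterises the ends of a gap.\<close>

lemma endpoint_if:
  assumes "\<bar>Re (ma t)\<bar> = 1"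
  obtains n where "t \<in> GG n" "sg n * Im (ma t) \<ge> 0 \<Longrightarrow> t = lm n" "sg n * Im (ma t) \<le> 0 \<Longrightarrow> t = lp n"
proof -
  obtain n c where c: "cmod c = 1" "dd t c = of_int n * pi" "Im (ma t + c * mb t) = 0"
    by (rule in_GG_if[of t]) (use assms in auto)
  have G: "t \<in> GG n" using c by (auto simp: GG_def)
  have "(Re (ma t))\<^sup>2 = 1" using assms by (simp add: power2_eq_1_iff abs_eq_iff')
  hence "(Im (ma t))\<^sup>2 = (cmod (mb t))\<^sup>2" using ma_mb[of t] by (simp add: cmod_power2)
  hence Im: "\<bar>Im (ma t)\<bar> = cmod (mb t)" using power2_eq_imp_eq[of "\<bar>Im (ma t)\<bar>" "cmod (mb t)"] by simp
  have key: "e * (dd t c' - of_int n * pi) \<le> 0"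
    if e: "e = 1 \<or> e = -1" and c': "cmod c' = 1" and s: "e * (sg n * Im (ma t)) \<ge> 0" for e c'
  proof (rule ccontr)
    assume "\<not> ?thesis"
    moreover have "\<bar>dd t c' - of_int n * pi\<bar> < pi" using dd_spread[of c' c t] c c' by simp
    ultimately have "0 < sin (e * (dd t c' - of_int n * pi))" using e by (intro sin_gt_zero) auto
    moreover have "sin (e * x) = e * sin x" for x using e by auto
    ultimately have "0 < e * sin (dd t c' - of_int n * pi)" by simp
    hence "0 < cmod (ma t + c' * mb t) * (e * sin (dd t c' - of_int n * pi))"
      using uu_dd(2)[of c' t] c' by simp
    hence "e * (sg n * Im (ma t + c' * mb t)) < 0" using Im_uu_dd(1)[of c' n t] c' by (simp add: algebra_simps)
    moreover have "\<bar>Im (c' * mb t)\<bar> \<le> cmod (mb t)"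
      using abs_Im_le_cmod[of "c' * mb t"] c' by (simp add: norm_mult)
    hence "- cmod (mb t) \<le> Im (c' * mb t)" "Im (c' * mb t) \<le> cmod (mb t)" by linarith+
    hence "- cmod (mb t) \<le> e * (sg n * Im (c' * mb t))"
      using e sg_cases[of n] by (elim disjE) simp_all
    moreover have "e * (sg n * Im (ma t)) = cmod (mb t)"
      using s e sg_cases[of n] unfolding Im[symmetric] by (elim disjE) simp_all
    ultimately show False by (simp only: plus_complex.sel distrib_left)
  qed
  show ?thesis
  proof (rule that[OF G])
    assume *: "sg n * Im (ma t) \<ge> 0"
    show "t = lm n"
    proof (rule lm_eqI[OF G])
      fix c' :: complex assume "cmod c' = 1"
      thus "dd t c' \<le> of_int n * pi" using key[of 1 c'] * by simp
    qed
  next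
    assume *: "sg n * Im (ma t) \<le> 0"
    show "t = lp n"
    proof (rule lp_eqI[OF G])
      fix c' :: complex assume "cmod c' = 1"
      thus "of_int n * pi \<le> dd t c'" using key[of "-1" c'] * by simp
    qed
  qed
qed

text \<open>Geometrically double eigenvalues are those with \<open>mb t = 0\<close>, and these are
  exactly the points to which both ends of a gap collapse.\<close>

lemma multiplicity_real:
  "card {n. lm n = t} + card {n. lp n = t} = eigenvalue_mult pot (of_real t)"
proof (cases "\<bar>Re (ma t)\<bar> = 1")
  case False
  have "\<bar>Re (ma (lm n))\<bar> = 1" "\<bar>Re (ma (lp n))\<bar> = 1" for n
    unfolding lm_facts(2) lp_facts(2) using sg_cases[of n] by auto
  hence "lm n \<noteq> t" "lp n \<noteq> t" for n using False by blast+
  thus ?thesis using False by (simp add: eigenvalue_mult_eq \<Delta>_sq_real)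
next
  case True
  then obtain n where n: "t \<in> GG n" "sg n * Im (ma t) \<ge> 0 \<Longrightarrow> t = lm n" "sg n * Im (ma t) \<le> 0 \<Longrightarrow> t = lp n"
    by (rule endpoint_if) blast
  have m: "lm k = t \<Longrightarrow> k = n" "lp k = t \<Longrightarrow> k = n" for k
    using GG_disjoint[OF n(1), of k] lm_in[of k] lp_in[of k] by blast+
  have zero: "fm True False (of_real t) 1 = 0 \<and> fm False True (of_real t) 1 = 0 \<longleftrightarrow> mb t = 0"
    by (simp add: fm_real mb_def[symmetric])
  show ?thesis
  proof (cases "mb t = 0")
    case mb: True
    have "(Re (ma t))\<^sup>2 = 1" using True by (simp add: power2_eq_1_iff abs_eq_iff')
    hence "Im (ma t) = 0" using ma_mb[of t] mb by (simp add: cmod_power2)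
    hence "lm n = t" "lp n = t" using n(2,3) by simp_all
    hence "{k. lm k = t} = {n}" "{k. lp k = t} = {n}" using m by blast+
    thus ?thesis using True mb zero by (simp add: eigenvalue_mult_eq \<Delta>_sq_real)
  next
    case mb: False
    have nb: "\<not> (t = lm n \<and> t = lp n)"
    proof
      assume *: "t = lm n \<and> t = lp n"
      have "sg n * Im (ma t) = cmod (mb t)" using lm_facts(1)[of n, folded conjunct1[OF *]] .
      moreover have "- sg n * Im (ma t) = cmod (mb t)" using lp_facts(1)[of n, folded conjunct2[OF *]] .
      ultimately show False using mb by simp
    qed
    show ?thesis
    proof (cases "t = lm n")
      case t: True
      hence "{k. lm k = t} = {n}" "{k. lp k = t} = {}" using m nb by blast+
      thus ?thesis using True mb zero by (simp add: eigenvalue_mult_eq \<Delta>_sq_real)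
    next
      case t: False
      hence "t = lp n" using n by linarith
      hence "{k. lm k = t} = {}" "{k. lp k = t} = {n}" using m t by blast+
      thus ?thesis using True mb zero by (simp add: eigenvalue_mult_eq \<Delta>_sq_real)
    qed
  qed
qed

lemma band_\<Delta>:
  assumes "\<And>n. t \<notin> GG n" shows "\<bar>Re (ma t)\<bar> < 1"
proof (rule ccontr)
  assume "\<not> ?thesis"
  hence "\<bar>Re (ma t)\<bar> \<ge> 1" by simp
  then obtain n c where "cmod c = 1" "dd t c = of_int n * pi" by (rule in_GG_if)
  thus False using assms[of n] by (auto simp: GG_def)
qed

end

section \<open>Uniqueness of the enumeration of the spectrum\<close>

lemma summable_on_int_inverse_square: "(\<lambda>n::int. 1 / (1 + \<bar>real_of_int n\<bar>)\<^sup>2) summable_on UNIV"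
proof -
  let ?f = "\<lambda>n::int. 1 / (1 + \<bar>real_of_int n\<bar>)\<^sup>2"
  have s: "summable (\<lambda>n::nat. 1 / (1 + real n)\<^sup>2)"
    using inverse_squares_sums[THEN sums_summable] by (simp add: add.commute)
  have n: "(\<lambda>n::nat. 1 / (1 + real n)\<^sup>2) summable_on UNIV"
    by (rule norm_summable_imp_summable_on) (use s in simp)
  have "?f summable_on range int" using n by (subst summable_on_reindex) (auto simp: o_def)
  moreover have "?f summable_on range (\<lambda>n. - int n)"
    using n by (subst summable_on_reindex) (auto simp: o_def inj_on_def)
  ultimately have "?f summable_on (range int \<union> range (\<lambda>n. - int n))" by (rule summable_on_union)
  moreover have "range int \<union> range (\<lambda>n. - int n) = UNIV"
    by (auto simp: image_iff) (metis int_cases2)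
  ultimately show ?thesis by simp
qed

lemma summable_on_imp_eventually_small:
  fixes f :: "int \<Rightarrow> real"
  assumes "f summable_on UNIV" "\<And>n. f n \<ge> 0" "e > 0"
  obtains N where "\<And>n. \<bar>n\<bar> \<ge> N \<Longrightarrow> f n < e"
proof -
  have "finite {n. f n \<ge> e}"
  proof (rule ccontr)
    assume "infinite {n. f n \<ge> e}"
    then obtain F where F: "finite F" "card F = nat \<lceil>infsum f UNIV / e\<rceil> + 1" "F \<subseteq> {n. f n \<ge> e}"
      using infinite_arbitrarily_large by blast
    have "infsum f UNIV / e < real (card F)" unfolding F(2) by linarith
    hence "infsum f UNIV < (\<Sum>n\<in>F. e)" using assms(3) by (simp add: field_simps)
    also have "... \<le> sum f F" by (rule sum_mono) (use F in auto)
    also have "... \<le> infsum f UNIV" by (rule finite_sum_le_infsum) (use assms F in auto)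
    finally show False by simp
  qed
  hence "bdd_above (abs ` {n. f n \<ge> e})" by simp
  then obtain N where N: "\<And>n. f n \<ge> e \<Longrightarrow> \<bar>n\<bar> \<le> N" by (auto simp: bdd_above_def)
  show ?thesis
  proof (rule that[of "N + 1"])
    fix n assume "\<bar>n\<bar> \<ge> N + 1"
    thus "f n < e" using N[of n] by linarith
  qed
qed

text \<open>Of the square summability only this is kept: far out the entry with index
  \<open>n\<close> lies within half a spacing of \<open>n * pi\<close>. That decides on which side
  of \<open>- (of_int N + 1/2) * pi\<close> it lies and so fixes the numbering.\<close>

definition interlaced :: "(int \<Rightarrow> real) \<Rightarrow> (int \<Rightarrow> real) \<Rightarrow> int \<Rightarrow> bool"
  where "interlaced a a' N0 \<longleftrightarrow> (\<forall>n. a n \<le> a' n \<and> a' n < a (n + 1)) \<and>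
    (\<forall>n. \<bar>n\<bar> \<ge> N0 \<longrightarrow> \<bar>a n - of_int n * pi\<bar> < pi / 2 \<and> \<bar>a' n - of_int n * pi\<bar> < pi / 2)"

definition interleave :: "(int \<Rightarrow> real) \<Rightarrow> (int \<Rightarrow> real) \<Rightarrow> int \<Rightarrow> real"
  where "interleave a a' k = (if even k then a (k div 2) else a' (k div 2))"

lemma card_vimage_sum:
  fixes a :: "int \<Rightarrow> real"
  assumes "finite S" "\<And>t. finite {n. a n = t}"
  shows "card {n. a n \<in> S} = (\<Sum>t\<in>S. card {n. a n = t})"
proof -
  have "{n. a n \<in> S} = (\<Union>t\<in>S. {n. a n = t})" by auto
  thus ?thesis by (simp only:) (rule card_UN_disjoint, use assms in auto)
qed

text \<open>Both sequences take every value equally often and exceed \<open>x\<close> from the same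
  index \<open>K\<close> on. If \<open>v k\<close> were larger than \<open>u k\<close>, then above
  \<open>x\<close> and up to \<open>u k\<close> there would be at least \<open>k - K + 1\<close>
  terms of \<open>u\<close> but at most \<open>k - K\<close> terms of \<open>v\<close>.\<close>

lemma enumeration_le:
  fixes u v :: "int \<Rightarrow> real"
  assumes mono: "mono u" "mono v" and fin: "\<And>t. finite {j. u j = t}" "\<And>t. finite {j. v j = t}"
    and cnt: "\<And>t. card {j. u j = t} = card {j. v j = t}"
    and K: "K \<le> k" "\<And>j. x < u j \<longleftrightarrow> K \<le> j" "\<And>j. x < v j \<longleftrightarrow> K \<le> j"
  shows "v k \<le> u k"
proof (rule ccontr)
  assume "\<not> v k \<le> u k"
  hence less: "u k < v k" by simp
  define T where "T w = {j. x < w j \<and> w j \<le> u k}" for w :: "int \<Rightarrow> real"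
  define S where "S = u ` T u \<union> v ` T v"
  have "T u \<subseteq> {K..k} \<union> {j. u j = u k}"
  proof
    fix j assume "j \<in> T u"
    thus "j \<in> {K..k} \<union> {j. u j = u k}"
      using K(2)[of j] monoD[OF mono(1), of k j] by (cases "j \<le> k") (simp_all add: T_def)
  qed
  hence fT: "finite (T u)" by (rule finite_subset) (simp add: fin)
  have "j < k" if "v j \<le> u k" for j using monoD[OF mono(2), of k j] that less by linarith
  hence Tv: "T v \<subseteq> {K..<k}" using K(3) by (auto simp: T_def)
  hence fS: "finite S" using fT by (auto simp: S_def intro: finite_subset)
  have "{j. u j \<in> S} = T u" "{j. v j \<in> S} = T v" by (auto simp: S_def T_def)
  hence "card (T u) = card (T v)"
    using card_vimage_sum[OF fS fin(1)] card_vimage_sum[OF fS fin(2)] cnt by simp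
  moreover have "{K..k} \<subseteq> T u" using monoD[OF mono(1), of _ k] K(2) by (auto simp: T_def)
  hence "card {K..k} \<le> card (T u)" by (rule card_mono[OF fT])
  moreover have "card (T v) \<le> card {K..<k}" using Tv by (intro card_mono) auto
  ultimately show False using K(1) by simp
qed

text \<open>The two ends of a gap become consecutive entries of one nondecreasing sequence, so that
  multiplicities add and a single counting argument treats both.\<close>

lemma interleave_facts:
  assumes "interlaced a a' N0"
  defines "u \<equiv> interleave a a'"
  shows "mono u" "finite {k. u k = t}" "card {k. u k = t} = card {n. a n = t} + card {n. a' n = t}"
    and "N \<ge> N0 \<Longrightarrow> N \<ge> 0 \<Longrightarrow> - (of_int N + 1/2) * pi < u k \<longleftrightarrow> - 2 * N \<le> k"
proof -
  have a: "a n \<le> a' n" "a' n < a (n + 1)" for n using assms(1) unfolding interlaced_def by blast+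
  have u: "u (2 * n) = a n" "u (2 * n + 1) = a' n" for n by (simp_all add: u_def interleave_def)
  have step: "u k \<le> u (k + 1)" "u k < u (k + 2)" for k
  proof -
    have "u k \<le> u (k + 1) \<and> u k < u (k + 2)"
    proof (cases "even k")
      case True
      then obtain n where k: "k = 2 * n" by blast
      show ?thesis using a[of n] u[of n] u(1)[of "n + 1"] by (simp add: k algebra_simps)
    next
      case False
      then obtain n where k: "k = 2 * n + 1" by (elim oddE)
      show ?thesis using a[of n] a[of "n + 1"] u[of n] u[of "n + 1"] by (simp add: k algebra_simps)
    qed
    thus "u k \<le> u (k + 1)" "u k < u (k + 2)" by auto
  qed
  have le: "u j \<le> u k" if "j \<le> k" for j k using that
  proof (induction k rule: int_ge_induct)
    case (step i)
    thus ?case using \<open>u i \<le> u (i + 1)\<close> by linarith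
  qed simp
  thus m: "mono u" by (simp add: monoI)
  show f: "finite {k. u k = t}"
  proof (cases "\<exists>k. u k = t")
    case True
    then obtain k where k: "u k = t" ..
    \<comment> \<open>Entries two apart are strictly ordered, so a value can be repeated only at
      neighbouring indices.\<close>
    have "\<not> k + 2 \<le> j \<and> \<not> j + 2 \<le> k" if "u j = t" for j
      using le[of "k + 2" j] le[of "j + 2" k] step(2)[of k] step(2)[of j] k that by auto
    hence "{k. u k = t} \<subseteq> {k - 2..k + 2}" by force
    thus ?thesis by (rule finite_subset) simp
  qed simp
  let ?A = "(\<lambda>n. 2 * n) ` {n. a n = t}" and ?B = "(\<lambda>n. 2 * n + 1) ` {n. a' n = t}"
  have "k \<in> ?A \<union> ?B" if "u k = t" for k using that u by (cases "even k") (auto elim!: evenE oddE)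
  hence e: "{k. u k = t} = ?A \<union> ?B" using u by auto
  hence "finite ?A" "finite ?B" using f by auto
  thus "card {k. u k = t} = card {n. a n = t} + card {n. a' n = t}"
    unfolding e by (subst card_Un_disjoint) (auto simp: card_image inj_on_def, presburger)
  assume N: "N \<ge> N0" "N \<ge> 0"
  note d = assms(1)[unfolded interlaced_def, THEN conjunct2, rule_format]
  let ?r = "- (of_int N + 1/2) * pi"
  have "\<bar>a (- N) - of_int (- N) * pi\<bar> < pi / 2" by (rule d[THEN conjunct1]) (use N in linarith)
  hence "?r < a (- N)" by (simp only: abs_less_iff) (simp add: algebra_simps)
  moreover have "\<bar>a' (- N - 1) - of_int (- N - 1) * pi\<bar> < pi / 2" by (rule d[THEN conjunct2]) (use N in linarith)
  hence "a' (- N - 1) \<le> ?r" by (simp only: abs_less_iff) (simp add: algebra_simps)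
  moreover have e: "2 * (- N) = - 2 * N" "2 * (- N - 1) + 1 = - 2 * N - 1" by simp_all
  ultimately have "?r < u (- 2 * N)" "u (- 2 * N - 1) \<le> ?r"
    using u(1)[of "- N", unfolded e] u(2)[of "- N - 1", unfolded e] by (simp_all only:)
  thus "- (of_int N + 1/2) * pi < u k \<longleftrightarrow> - 2 * N \<le> k"
    using le[of "- 2 * N" k] le[of k "- 2 * N - 1"] by linarith
qed

lemma interlaced_unique:
  assumes A: "interlaced a a' N0" and B: "interlaced b b' N0"
    and cnt: "\<And>t. card {n. a n = t} + card {n. a' n = t} = card {n. b n = t} + card {n. b' n = t}"
  shows "a = b" "a' = b'"
proof -
  note uA = interleave_facts[OF A] and uB = interleave_facts[OF B]
  have "interleave a a' k = interleave b b' k" for k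
  proof -
    define N where "N = max (max N0 0) \<bar>k\<bar>"
    have N: "N \<ge> N0" "N \<ge> 0" "- 2 * N \<le> k" by (auto simp: N_def)
    show ?thesis
    proof (rule antisym)
      show "interleave b b' k \<le> interleave a a' k"
        by (rule enumeration_le[OF uA(1) uB(1) uA(2) uB(2) _ N(3) uA(4)[OF N(1,2)] uB(4)[OF N(1,2)]])
          (simp only: uA(3) uB(3) cnt)
      show "interleave a a' k \<le> interleave b b' k"
        by (rule enumeration_le[OF uB(1) uA(1) uB(2) uA(2) _ N(3) uB(4)[OF N(1,2)] uA(4)[OF N(1,2)]])
          (simp only: uA(3) uB(3) cnt)
    qed
  qed
  from this[of "2 * n" for n] this[of "2 * n + 1" for n] show "a = b" "a' = b'"
    by (auto simp: interleave_def fun_eq_iff)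
qed

context smooth_potential
begin

lemma Q1_nonneg: "Q1 \<ge> 0"
  unfolding Q1_def by (rule integral_nonneg) (auto intro!: integrable_continuous_real continuous_intros)

lemma C0_nonneg: "C0 \<ge> 0" unfolding C0_def
  by (intro divide_nonneg_nonneg add_nonneg_nonneg mult_nonneg_nonneg integral_nonneg)
    (auto intro!: integrable_continuous_real continuous_intros)

definition C1 :: real where "C1 = C0 + Q1 * (1 + Q1)"

lemma C1_nonneg: "C1 \<ge> 0" using Q1_nonneg C0_nonneg by (simp add: C1_def)

text \<open>For \<open>n\<close> beyond \<open>Q1\<close> the point \<open>t\<close> is at least
  twice as large as \<open>n\<close>, and the decay \<open>C0 / \<bar>t\<bar>\<close> applies. For
  the other indices the crude bound \<open>Q1\<close> is paid for by the summand
  \<open>Q1 * (1 + Q1)\<close> of \<open>C1\<close>.\<close>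

lemma GG_dist:
  assumes t: "t \<in> GG n"
  shows "\<bar>t - of_int n * pi\<bar> \<le> C1 / (1 + \<bar>real_of_int n\<bar>)"
proof (cases "\<bar>real_of_int n\<bar> > Q1")
  case True
  hence "n \<noteq> 0" using Q1_nonneg by auto
  hence n1: "\<bar>real_of_int n\<bar> \<ge> 1" by linarith
  have "\<bar>real_of_int n * pi\<bar> \<ge> 3 * \<bar>real_of_int n\<bar>"
    using mult_right_mono[of 3 pi "\<bar>real_of_int n\<bar>"] pi_gt3 by (simp add: abs_mult algebra_simps)
  hence t2: "\<bar>t\<bar> \<ge> 2 * \<bar>real_of_int n\<bar>" using GG_bound[OF t] True by linarith
  hence "t \<noteq> 0" using n1 by auto
  hence "\<bar>t - of_int n * pi\<bar> \<le> C0 / \<bar>t\<bar>" by (rule GG_asymp[OF t])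
  also have "... \<le> C0 / (1 + \<bar>real_of_int n\<bar>)"
    using t2 n1 C0_nonneg by (intro divide_left_mono) auto
  also have "... \<le> C1 / (1 + \<bar>real_of_int n\<bar>)"
    using Q1_nonneg by (intro divide_right_mono) (auto simp: C1_def)
  finally show ?thesis .
next
  case False
  have "\<bar>t - of_int n * pi\<bar> * (1 + \<bar>real_of_int n\<bar>) \<le> Q1 * (1 + Q1)"
    using GG_bound[OF t] False Q1_nonneg by (intro mult_mono) auto
  also have "... \<le> C1" using C0_nonneg by (simp add: C1_def)
  finally show ?thesis by (simp add: field_simps)
qed

lemma GG_summable:
  assumes "\<And>n. f n \<in> GG n"
  shows "(\<lambda>n. (f n - of_int n * pi)\<^sup>2) summable_on UNIV"
proof (rule summable_on_comparison_test[OF summable_on_cmult_right[OF summable_on_int_inverse_square, of "C1\<^sup>2"]])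
  fix n :: int
  have "\<bar>f n - of_int n * pi\<bar>\<^sup>2 \<le> (C1 / (1 + \<bar>real_of_int n\<bar>))\<^sup>2"
    by (intro power_mono GG_dist assms) auto
  thus "(f n - of_int n * pi)\<^sup>2 \<le> C1\<^sup>2 * (1 / (1 + \<bar>real_of_int n\<bar>)\<^sup>2)" by (simp add: power_divide)
qed auto

lemma is_periodic_spectrum_lm_lp: "is_periodic_spectrum pot lm lp"
  unfolding is_periodic_spectrum_def
proof (intro conjI allI)
  fix n show "lm n \<le> lp n" "lp n < lm (n + 1)" by (rule lm_le_lp, rule lp_less_lm) simp
next
  fix \<mu> :: complex
  show "card {n. complex_of_real (lm n) = \<mu>} + card {n. complex_of_real (lp n) = \<mu>} = eigenvalue_mult pot \<mu>"
  proof (cases "Im \<mu> = 0")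
    case True
    hence \<mu>: "\<mu> = of_real (Re \<mu>)" by (simp add: complex_eq_iff)
    from multiplicity_real[of "Re \<mu>"] show ?thesis
      unfolding of_real_eq_iff[where ?'a = complex, symmetric] \<mu>[symmetric] .
  next
    case False
    hence "complex_of_real x \<noteq> \<mu>" for x by auto
    thus ?thesis using \<Delta>_not_4[OF False] by (simp add: eigenvalue_mult_eq)
  qed
qed (intro GG_summable lm_in lp_in)+

lemma is_periodic_spectrum_interlaced:
  assumes "is_periodic_spectrum \<phi> l l'"
  obtains N0 where "\<And>N. N \<ge> N0 \<Longrightarrow> interlaced l l' N"
proof -
  have s: "(\<lambda>n. (l n - of_int n * pi)\<^sup>2) summable_on UNIV" "(\<lambda>n. (l' n - of_int n * pi)\<^sup>2) summable_on UNIV"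
    using assms unfolding is_periodic_spectrum_def by blast+
  obtain N1 where N1: "\<And>n. \<bar>n\<bar> \<ge> N1 \<Longrightarrow> (l n - of_int n * pi)\<^sup>2 < (pi / 2)\<^sup>2"
    using summable_on_imp_eventually_small[OF s(1), of "(pi/2)\<^sup>2"] by auto
  obtain N2 where N2: "\<And>n. \<bar>n\<bar> \<ge> N2 \<Longrightarrow> (l' n - of_int n * pi)\<^sup>2 < (pi / 2)\<^sup>2"
    using summable_on_imp_eventually_small[OF s(2), of "(pi/2)\<^sup>2"] by auto
  have abs: "\<bar>x\<bar> < pi / 2" if "x\<^sup>2 < (pi / 2)\<^sup>2" for x :: real
    using power2_less_imp_less[of "\<bar>x\<bar>" "pi / 2"] that by simp
  show ?thesis
  proof (rule that[of "max N1 N2"])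
    fix N assume "N \<ge> max N1 N2"
    hence "N1 \<le> N" "N2 \<le> N" by auto
    moreover have "l n \<le> l' n" "l' n < l (n + 1)" for n
      using assms unfolding is_periodic_spectrum_def by blast+
    ultimately show "interlaced l l' N"
      unfolding interlaced_def by (intro conjI allI impI abs N1 N2) auto
  qed
qed

text \<open>Any admissible pair is interlaced beyond some index, and multiplicities prescribe how
  often each value occurs; the counting argument leaves no choice.\<close>

lemma periodic_spectrum_eq: "periodic_spectrum pot = (lm, lp)" unfolding periodic_spectrum_def
proof (rule the_equality)
  show "is_periodic_spectrum pot (fst (lm, lp)) (snd (lm, lp))"
    using is_periodic_spectrum_lm_lp by simp
next
  fix l assume l: "is_periodic_spectrum pot (fst l) (snd l)"
  obtain N1 where N1: "\<And>N. N \<ge> N1 \<Longrightarrow> interlaced (fst l) (snd l) N"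
    using is_periodic_spectrum_interlaced[OF l] by blast
  obtain N2 where N2: "\<And>N. N \<ge> N2 \<Longrightarrow> interlaced lm lp N"
    using is_periodic_spectrum_interlaced[OF is_periodic_spectrum_lm_lp] by blast
  have c: "card {n. a n = t} + card {n. a' n = t} = eigenvalue_mult pot (of_real t)"
    if "is_periodic_spectrum pot a a'" for a a' t
  proof -
    have "card {n. complex_of_real (a n) = of_real t} + card {n. complex_of_real (a' n) = of_real t}
        = eigenvalue_mult pot (of_real t)"
      using that unfolding is_periodic_spectrum_def by (elim conjE) (erule spec)
    thus ?thesis by (simp only: of_real_eq_iff)
  qed
  have i: "interlaced (fst l) (snd l) (max N1 N2)" "interlaced lm lp (max N1 N2)"
    by (rule N1 N2, simp)+
  have "fst l = lm" "snd l = lp"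
    by (rule interlaced_unique[OF i], simp only: c[OF l] c[OF is_periodic_spectrum_lm_lp])+
  thus "l = (lm, lp)" by (simp add: prod_eq_iff)
qed

lemma lam_eq: "lam_minus pot = lm" "lam_plus pot = lp"
  by (simp_all add: lam_minus_def lam_plus_def periodic_spectrum_eq)

end

section \<open>Standard roots and the canonical root\<close>

text \<open>The expression prescribed near infinity. It turns out to be holomorphic off the whole
  segment and is therefore the standard root itself.\<close>

definition sroot :: "real \<Rightarrow> real \<Rightarrow> complex \<Rightarrow> complex"
  where "sroot l r z = (of_real ((l + r) / 2) - z) *
    csqrt (1 - of_real ((r - l)\<^sup>2) / (4 * (of_real ((l + r) / 2) - z)\<^sup>2))"

lemma mem_real_segment:
  assumes "l \<le> r"
  shows "z \<in> closed_segment (complex_of_real l) (of_real r) \<longleftrightarrow> Im z = 0 \<and> l \<le> Re z \<and> Re z \<le> r"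
proof -
  have "closed_segment (complex_of_real l) (of_real r) = of_real ` {l..r}"
    unfolding closed_segment_of_real using assms by (simp add: closed_segment_eq_real_ivl)
  also have "z \<in> \<dots> \<longleftrightarrow> Im z = 0 \<and> l \<le> Re z \<and> Re z \<le> r" by (auto simp: image_iff complex_eq_iff)
  finally show ?thesis .
qed

lemma sroot_mid_nonzero:
  assumes lr: "l \<le> r" and z: "z \<notin> closed_segment (complex_of_real l) (of_real r)"
  shows "of_real ((l + r) / 2) - z \<noteq> 0"
proof
  assume "of_real ((l + r) / 2) - z = 0"
  hence e: "of_real ((l + r) / 2) = z" by (simp only: right_minus_eq)
  have "Im z = 0" "Re z = (l + r) / 2" unfolding e[symmetric] by simp_all
  thus False using z lr by (simp add: mem_real_segment)
qed

text \<open>If the radicand is a real \<open>x \<le> 0\<close>, then the squared distance vector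
  from \<open>z\<close> to the midpoint is the nonnegative real
  \<open>(r - l)\<^sup>2 / (4 * (1 - x))\<close>, at most the square of half the length; so
  \<open>z\<close> lies on the segment.\<close>

lemma sroot_arg:
  assumes lr: "l \<le> r" and z: "z \<notin> closed_segment (complex_of_real l) (of_real r)"
  shows "1 - of_real ((r - l)\<^sup>2) / (4 * (of_real ((l + r) / 2) - z)\<^sup>2) \<notin> \<real>\<^sub>\<le>\<^sub>0"
proof
  define w where "w = of_real ((l + r) / 2) - z"
  have w0: "w \<noteq> 0" using sroot_mid_nonzero[OF assms] by (simp add: w_def)
  assume "1 - of_real ((r - l)\<^sup>2) / (4 * (of_real ((l + r) / 2) - z)\<^sup>2) \<in> \<real>\<^sub>\<le>\<^sub>0"
  then obtain x where x: "x \<le> 0" "1 - of_real ((r - l)\<^sup>2) / (4 * w\<^sup>2) = of_real x"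
    unfolding w_def by (elim nonpos_Reals_cases) auto
  have "of_real ((r - l)\<^sup>2) / (4 * w\<^sup>2) = 1 - complex_of_real x" using x(2) by (simp add: algebra_simps)
  hence eq: "complex_of_real ((r - l)\<^sup>2) = of_real (4 * (1 - x)) * w\<^sup>2"
    using w0 by (simp add: field_simps)
  define y where "y = (r - l)\<^sup>2 / (4 * (1 - x))"
  have x1: "1 - x > 0" using x by simp
  have "w\<^sup>2 = complex_of_real ((r - l)\<^sup>2) / of_real (4 * (1 - x))"
    unfolding eq using x1 by (simp add: field_simps)
  hence w2: "w\<^sup>2 = of_real y" by (simp add: y_def)
  have y0: "y \<ge> 0" using x1 by (simp add: y_def)
  have "4 * y * 1 \<le> 4 * y * (1 - x)" using x y0 by (intro mult_left_mono) auto
  also have "... = y * (4 * (1 - x))" by (simp only: mult_ac)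
  also have "... = (r - l)\<^sup>2"
    unfolding y_def by (rule nonzero_eq_divide_eq[THEN iffD1, OF _ refl]) (use x1 in auto)
  finally have y1: "4 * y \<le> (r - l)\<^sup>2" by simp
  have ww: "(w - of_real (sqrt y)) * (w + of_real (sqrt y)) = 0"
  proof -
    have "(w - of_real (sqrt y)) * (w + of_real (sqrt y)) = w\<^sup>2 - of_real (sqrt y * sqrt y)"
      by (simp add: algebra_simps power2_eq_square del: real_sqrt_mult_self)
    moreover have "sqrt y * sqrt y = y" using y0 by simp
    ultimately show ?thesis by (simp only: w2 diff_self)
  qed
  have "(2 * sqrt y)\<^sup>2 \<le> (r - l)\<^sup>2" using y1 y0 by (simp add: power_mult_distrib)
  hence s: "2 * sqrt y \<le> r - l" using lr by (intro power2_le_imp_le[of "2 * sqrt y"]) auto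
  have s0: "0 \<le> sqrt y" using y0 by simp
  have ends: "l \<le> (l + r) / 2 - t \<and> (l + r) / 2 - t \<le> r \<and> l \<le> (l + r) / 2 + t \<and> (l + r) / 2 + t \<le> r"
    if "2 * t \<le> r - l" "0 \<le> t" for t :: real using that by (simp add: field_simps)
  have "w = of_real (sqrt y) \<or> w = - of_real (sqrt y)" using ww by (auto simp: add_eq_0_iff2)
  hence "z = of_real ((l + r) / 2 - sqrt y) \<or> z = of_real ((l + r) / 2 + sqrt y)"
    unfolding w_def by (auto simp: algebra_simps)
  hence "z \<in> closed_segment (complex_of_real l) (of_real r)"
  proof
    assume "z = of_real ((l + r) / 2 - sqrt y)"
    hence "Im z = 0" "Re z = (l + r) / 2 - sqrt y" by simp_all
    moreover have "l \<le> (l + r) / 2 - sqrt y" "(l + r) / 2 - sqrt y \<le> r"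
      using ends[OF s s0] by blast+
    ultimately show ?thesis by (simp only: mem_real_segment[OF lr])
  next
    assume "z = of_real ((l + r) / 2 + sqrt y)"
    hence "Im z = 0" "Re z = (l + r) / 2 + sqrt y" by simp_all
    moreover have "l \<le> (l + r) / 2 + sqrt y" "(l + r) / 2 + sqrt y \<le> r"
      using ends[OF s s0] by blast+
    ultimately show ?thesis by (simp only: mem_real_segment[OF lr])
  qed
  thus False using z by contradiction
qed

lemma sroot_holomorphic:
  assumes "l \<le> r" shows "sroot l r holomorphic_on (- closed_segment (complex_of_real l) (of_real r))"
  unfolding sroot_def[abs_def]
  by (intro holomorphic_intros) (use sroot_mid_nonzero[OF assms] sroot_arg[OF assms] in auto)

lemma sroot_square:
  assumes "l \<le> r" "z \<notin> closed_segment (complex_of_real l) (of_real r)"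
  shows "(sroot l r z)\<^sup>2 = (of_real r - z) * (of_real l - z)"
proof -
  define w where "w = of_real ((l + r) / 2) - z"
  have w0: "w \<noteq> 0" using sroot_mid_nonzero[OF assms] by (simp add: w_def)
  have "(sroot l r z)\<^sup>2 = w\<^sup>2 * (1 - of_real ((r - l)\<^sup>2) / (4 * w\<^sup>2))"
    by (simp add: sroot_def w_def power_mult_distrib)
  also have "... = w\<^sup>2 - (of_real ((r - l) / 2))\<^sup>2" using w0 by (simp add: field_simps power2_eq_square)
  also have "... = (w + of_real ((r - l) / 2)) * (w - of_real ((r - l) / 2))"
    by (simp add: algebra_simps power2_eq_square)
  also have "w + of_real ((r - l) / 2) = of_real r - z" by (simp add: w_def field_simps)
  also have "w - of_real ((r - l) / 2) = of_real l - z" by (simp add: w_def field_simps)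
  finally show ?thesis .
qed

text \<open>For \<open>c = csqrt (1 - u)\<close> one has
  \<open>cmod (c - 1) * cmod (c + 1) = cmod u\<close>, and \<open>cmod (c + 1) \<ge> 1\<close>
  because the principal root has nonnegative real part.\<close>

lemma sroot_approx:
  assumes "l \<le> r" "z \<notin> closed_segment (complex_of_real l) (of_real r)"
  shows "cmod (sroot l r z - (of_real ((l + r) / 2) - z)) \<le> (r - l)\<^sup>2 / (4 * cmod (of_real ((l + r) / 2) - z))"
proof -
  define w where "w = of_real ((l + r) / 2) - z"
  have w0: "w \<noteq> 0" using sroot_mid_nonzero[OF assms] by (simp add: w_def)
  define u where "u = complex_of_real ((r - l)\<^sup>2) / (4 * w\<^sup>2)"
  define c where "c = csqrt (1 - u)"
  have "c\<^sup>2 = 1 - u" by (simp add: c_def)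
  hence "(c - 1) * (c + 1) = - u" by (simp add: algebra_simps power2_eq_square)
  hence "cmod (c - 1) * cmod (c + 1) = cmod u" by (metis norm_minus_cancel norm_mult)
  moreover have "1 \<le> cmod (c + 1)"
  proof -
    have "0 \<le> Re c" unfolding c_def by (rule Re_csqrt)
    thus ?thesis using complex_Re_le_cmod[of "c + 1"] by simp
  qed
  ultimately have cu: "cmod (c - 1) \<le> cmod u"
    using mult_left_mono[of 1 "cmod (c + 1)" "cmod (c - 1)"] by simp
  have "sroot l r z - w = w * (c - 1)" by (simp add: sroot_def w_def c_def u_def algebra_simps)
  hence "cmod (sroot l r z - w) \<le> cmod w * cmod u" using cu by (simp add: norm_mult mult_left_mono)
  also have "... = (r - l)\<^sup>2 / (4 * cmod w)"
  proof -
    have "cmod u = (r - l)\<^sup>2 / (4 * (cmod w)\<^sup>2)"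
      unfolding u_def norm_divide norm_of_real norm_mult norm_power by simp
    thus ?thesis using w0 by (simp add: power2_eq_square)
  qed
  finally show ?thesis by (simp add: w_def)
qed

lemma sroot_cnj:
  assumes "l \<le> r" "z \<notin> closed_segment (complex_of_real l) (of_real r)"
  shows "sroot l r (cnj z) = cnj (sroot l r z)"
proof -
  have "cnj (csqrt (1 - of_real ((r - l)\<^sup>2) / (4 * (of_real ((l + r) / 2) - z)\<^sup>2))) =
     csqrt (1 - of_real ((r - l)\<^sup>2) / (4 * (of_real ((l + r) / 2) - cnj z)\<^sup>2))"
    by (subst cnj_csqrt[OF sroot_arg[OF assms]]) simp
  thus ?thesis by (simp add: sroot_def)
qed

text \<open>Analytic continuation from a neighbourhood of infinity gives uniqueness, the complement
  of a segment being connected.\<close>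

lemma standard_root_eq_sroot:
  assumes le: "lam_minus \<phi> n \<le> lam_plus \<phi> n" and z: "z \<notin> gap \<phi> n"
  shows "standard_root \<phi> n z = sroot (lam_minus \<phi> n) (lam_plus \<phi> n) z" unfolding standard_root_def
proof (rule the_equality)
  let ?l = "lam_minus \<phi> n" and ?r = "lam_plus \<phi> n"
  let ?s = "sroot ?l ?r"
  have gap: "gap \<phi> n = closed_segment (of_real ?l) (of_real ?r)" by (simp add: gap_def)
  have ev: "?s z = (of_real (gap_mid \<phi> n) - z) *
        csqrt (1 - of_real ((gap_length \<phi> n)\<^sup>2) / (4 * (of_real (gap_mid \<phi> n) - z)\<^sup>2))" for z
    by (simp only: sroot_def gap_mid_def gap_length_def)
  have "?s holomorphic_on (- gap \<phi> n)" unfolding gap by (rule sroot_holomorphic[OF le])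
  moreover have "\<forall>z\<in>- gap \<phi> n. (?s z)\<^sup>2 = (of_real ?r - z) * (of_real ?l - z)"
    unfolding gap by (intro ballI sroot_square[OF le]) blast
  moreover have "\<forall>\<^sub>F z in at_infinity. ?s z = (of_real (gap_mid \<phi> n) - z) *
        csqrt (1 - of_real ((gap_length \<phi> n)\<^sup>2) / (4 * (of_real (gap_mid \<phi> n) - z)\<^sup>2))"
    unfolding ev by simp
  ultimately show "\<exists>f. f holomorphic_on (- gap \<phi> n) \<and>
     (\<forall>z \<in> - gap \<phi> n.
        (f z)\<^sup>2 = (of_real (lam_plus \<phi> n) - z) * (of_real (lam_minus \<phi> n) - z)) \<and>
     (\<forall>\<^sub>F z in at_infinity. f z = (of_real (gap_mid \<phi> n) - z) *
        csqrt (1 - of_real ((gap_length \<phi> n)\<^sup>2) / (4 * (of_real (gap_mid \<phi> n) - z)\<^sup>2))) \<and>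
     f z = ?s z"
    by blast
  fix w assume "\<exists>f. f holomorphic_on (- gap \<phi> n) \<and>
     (\<forall>z \<in> - gap \<phi> n.
        (f z)\<^sup>2 = (of_real (lam_plus \<phi> n) - z) * (of_real (lam_minus \<phi> n) - z)) \<and>
     (\<forall>\<^sub>F z in at_infinity. f z = (of_real (gap_mid \<phi> n) - z) *
        csqrt (1 - of_real ((gap_length \<phi> n)\<^sup>2) / (4 * (of_real (gap_mid \<phi> n) - z)\<^sup>2))) \<and>
     f z = w"
  then obtain f where f: "f holomorphic_on (- gap \<phi> n)" "f z = w"
    "\<forall>\<^sub>F z in at_infinity. f z = ?s z" unfolding ev by blast
  obtain R where R: "\<And>z. R \<le> cmod z \<Longrightarrow> f z = ?s z"
    using f(3) unfolding eventually_at_infinity by blast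
  have bg: "bounded (gap \<phi> n)" unfolding gap by (rule compact_imp_bounded[OF compact_segment])
  obtain R' where R': "\<And>z. z \<in> gap \<phi> n \<Longrightarrow> cmod z \<le> R'" using bg unfolding bounded_iff by blast
  let ?U = "- cball (0::complex) (max R R')"
  have "f z = ?s z"
  proof (rule analytic_continuation_open[of ?U "- gap \<phi> n" f ?s])
    show "open ?U" by (intro open_Compl closed_cball)
    show "open (- gap \<phi> n)" unfolding gap by (intro open_Compl closed_segment)
    have "of_real (\<bar>max R R'\<bar> + 1) \<in> ?U" by simp
    thus "?U \<noteq> {}" by blast
    show "connected (- gap \<phi> n)"
      using bg unfolding gap by (rule connected_complement_bounded_convex) auto
    show "?U \<subseteq> - gap \<phi> n"
    proof (rule subsetI)
      fix y assume "y \<in> ?U"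
      hence "R' < cmod y" by simp
      thus "y \<in> - gap \<phi> n" using R'[of y] by auto
    qed
    show "f holomorphic_on - gap \<phi> n" by (rule f)
    show "?s holomorphic_on - gap \<phi> n" unfolding gap by (rule sroot_holomorphic[OF le])
    show "f y = ?s y" if "y \<in> ?U" for y using that by (intro R) simp
    show "z \<in> - gap \<phi> n" using z by simp
  qed
  thus "w = ?s z" using f(2) by simp
qed

section \<open>Division of entire functions by their zeros\<close>

lemma entire_divide:
  assumes f: "f holomorphic_on UNIV" "f a = 0"
  obtains g where "g holomorphic_on UNIV" "\<And>z. f z = (a - z) * g z"
proof (rule that)
  let ?g = "\<lambda>z. if z = a then deriv f a else (f z - f a) / (z - a)"
  have "?g holomorphic_on UNIV" by (rule pole_lemma[OF f(1)]) simp
  thus "(\<lambda>z. - ?g z) holomorphic_on UNIV" by (intro holomorphic_intros)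
  show "f z = (a - z) * (- ?g z)" for z using f(2) by (simp add: field_simps)
qed

lemma entire_divide_deriv:
  assumes "g holomorphic_on UNIV" "\<And>z. f z = (a - z) * g z"
  shows "deriv f a = - g a"
proof -
  have "((\<lambda>z. (a - z) * g z) has_field_derivative (0 - 1) * g a + deriv g a * (a - a)) (at a)"
    using assms(1) by (intro DERIV_mult' derivative_intros holomorphic_derivI[of g UNIV]) (auto simp: algebra_simps intro!: derivative_eq_intros)
  hence "((\<lambda>z. (a - z) * g z) has_field_derivative - g a) (at a)" by simp
  moreover have "f = (\<lambda>z. (a - z) * g z)" using assms(2) by blast
  ultimately show ?thesis by (simp add: DERIV_imp_deriv)
qed

text \<open>Pairs of zeros are split off one at a time. A coinciding pair can be split off twice
  because the derivative vanishes there as well.\<close>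

lemma entire_divide_prod:
  fixes a b :: "'i \<Rightarrow> complex"
  assumes fin: "finite I" and f: "f holomorphic_on UNIV"
    and dis: "\<And>i j. i \<in> I \<Longrightarrow> j \<in> I \<Longrightarrow> i \<noteq> j \<Longrightarrow> a i \<noteq> a j \<and> a i \<noteq> b j \<and> b i \<noteq> a j \<and> b i \<noteq> b j"
    and zero: "\<And>i. i \<in> I \<Longrightarrow> f (a i) = 0 \<and> f (b i) = 0 \<and> (a i = b i \<longrightarrow> deriv f (a i) = 0)"
  shows "\<exists>u. u holomorphic_on UNIV \<and> (\<forall>z. f z = u z * (\<Prod>i\<in>I. (a i - z) * (b i - z)))"
  using fin dis zero
proof (induction I rule: finite_induct)
  case empty
  thus ?case using f by auto
next
  case (insert i I)
  have "\<exists>u. u holomorphic_on UNIV \<and> (\<forall>z. f z = u z * (\<Prod>i\<in>I. (a i - z) * (b i - z)))"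
    by (rule insert.IH) (use insert.prems in auto)
  then obtain u where u: "u holomorphic_on UNIV" "\<And>z. f z = u z * (\<Prod>i\<in>I. (a i - z) * (b i - z))"
    by blast
  let ?P = "\<lambda>z. \<Prod>i\<in>I. (a i - z) * (b i - z)"
  have P: "?P (a i) \<noteq> 0" "?P (b i) \<noteq> 0"
    using insert.hyps insert.prems(1)[of _ i] by (auto simp: prod_zero_iff[OF insert.hyps(1)])
  have fi: "f (a i) = 0" "f (b i) = 0" "a i = b i \<Longrightarrow> deriv f (a i) = 0"
    using insert.prems(2)[of i] by auto
  have ua: "u (a i) = 0" using u(2)[of "a i"] fi(1) P(1) by simp
  obtain u1 where u1: "u1 holomorphic_on UNIV" "\<And>z. u z = (a i - z) * u1 z"
    using entire_divide[OF u(1) ua] by blast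
  have "u1 (b i) = 0"
  proof (cases "a i = b i")
    case False
    have "u (b i) = 0" using u(2)[of "b i"] fi(2) P(2) by simp
    thus ?thesis using u1(2)[of "b i"] False by simp
  next
    case True
    have hP: "?P holomorphic_on UNIV" by (intro holomorphic_intros)
    have "deriv f (a i) = - (u1 (a i) * ?P (a i))"
    proof (rule entire_divide_deriv)
      show "(\<lambda>z. u1 z * ?P z) holomorphic_on UNIV" by (intro holomorphic_intros u1)
      show "f z = (a i - z) * (u1 z * ?P z)" for z unfolding u(2) u1(2) by (simp only: mult.assoc)
    qed
    thus ?thesis using fi(3)[OF True] P(1) True by simp
  qed
  then obtain u2 where u2: "u2 holomorphic_on UNIV" "\<And>z. u1 z = (b i - z) * u2 z"
    using entire_divide[OF u1(1)] by blast
  have "f z = u2 z * (\<Prod>i\<in>insert i I. (a i - z) * (b i - z))" for z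
    unfolding u(2) u1(2) u2(2) prod.insert[OF insert.hyps] by (simp add: mult_ac)
  thus ?case using u2(1) by blast
qed

text \<open>A zero of the quotient in that strip would be a double zero of sine, where cosine would
  vanish too.\<close>

lemma sin_divide:
  obtains s where "s holomorphic_on UNIV"
    "\<And>z. sin z = s z * (\<Prod>m\<in>symi N. of_real (of_int m * pi) - z)"
    "\<And>z. \<bar>Re z\<bar> < (real N + 1) * pi \<Longrightarrow> s z \<noteq> 0"
proof -
  let ?I = "symi N"
  let ?p = "\<lambda>m::int. complex_of_real (of_int m * pi)"
  have gen: "\<exists>u. u holomorphic_on UNIV \<and> (\<forall>z. sin z = u z * (\<Prod>m\<in>J. ?p m - z))" if "finite J" for J :: "int set"
    using that
  proof (induction J rule: finite_induct)
    case empty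
    have "sin holomorphic_on UNIV" by (intro holomorphic_on_sin)
    thus ?case by auto
  next
    case (insert i J)
    then obtain u where u: "u holomorphic_on UNIV" "\<And>z. sin z = u z * (\<Prod>m\<in>J. ?p m - z)" by blast
    have "sin (?p i) = 0" unfolding sin_eq_0 by blast
    moreover have "(\<Prod>m\<in>J. ?p m - ?p i) \<noteq> 0" using insert.hyps by (auto simp: prod_zero_iff)
    ultimately have "u (?p i) = 0" using u(2)[of "?p i"] by simp
    then obtain u1 where u1: "u1 holomorphic_on UNIV" "\<And>z. u z = (?p i - z) * u1 z"
      using entire_divide[OF u(1)] by blast
    have "sin z = u1 z * (\<Prod>m\<in>insert i J. ?p m - z)" for z
      unfolding u(2) u1(2) prod.insert[OF insert.hyps] by (simp add: mult_ac)
    thus ?case using u1(1) by blast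
  qed
  obtain s where s: "s holomorphic_on UNIV" "\<And>z. sin z = s z * (\<Prod>m\<in>?I. ?p m - z)"
    using gen[of ?I] by auto
  have "s z \<noteq> 0" if z: "\<bar>Re z\<bar> < (real N + 1) * pi" for z
  proof
    assume s0: "s z = 0"
    hence "sin z = 0" using s(2)[of z] by simp
    then obtain j :: int where j: "z = ?p j" unfolding sin_eq_0 by blast
    have "\<bar>real_of_int j\<bar> * pi < (real N + 1) * pi" using z j by (simp add: abs_mult)
    hence "\<bar>real_of_int j\<bar> < real N + 1" by (simp add: mult_less_cancel_right)
    hence jI: "j \<in> ?I" by auto
    obtain s1 where s1: "s1 holomorphic_on UNIV" "\<And>x. s x = (z - x) * s1 x"
      using entire_divide[OF s(1) s0] by blast
    let ?Q = "\<lambda>x. \<Prod>m\<in>?I - {j}. ?p m - x"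
    have Q: "(\<Prod>m\<in>?I. ?p m - x) = (z - x) * ?Q x" for x
      using prod.remove[of ?I j "\<lambda>m. ?p m - x"] jI j by simp
    have "deriv sin z = - ((z - z) * (s1 z * ?Q z))"
    proof (rule entire_divide_deriv[where f = sin and a = z and g = "\<lambda>x. (z - x) * (s1 x * ?Q x)"])
      show "(\<lambda>x. (z - x) * (s1 x * ?Q x)) holomorphic_on UNIV" by (intro holomorphic_intros s1)
      show "sin x = (z - x) * ((z - x) * (s1 x * ?Q x))" for x
        unfolding s(2) Q s1(2) by (simp only: mult_ac)
    qed
    hence "deriv sin z = 0" by simp
    moreover have "deriv sin z = cos z" by (rule DERIV_imp_deriv[OF DERIV_sin])
    ultimately have "cos z = 0" by simp
    thus False using sin_cos_squared_add[of z] \<open>sin z = 0\<close> by simp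
  qed
  thus ?thesis using that s by blast
qed

lemma sym_interval_Suc:
  "{- int (Suc N)..int (Suc N)} = insert (- int (Suc N)) (insert (int (Suc N)) (symi N))" by auto

lemma sum_sym_interval_le:
  fixes f :: "nat \<Rightarrow> real"
  assumes "\<And>j. f j \<ge> 0"
  shows "(\<Sum>m\<in>symi N. f (nat \<bar>m\<bar>)) \<le> 2 * (\<Sum>j\<le>N. f j)"
proof (induction N)
  case 0
  thus ?case using assms[of 0] by simp
next
  case (Suc N)
  have "(\<Sum>m\<in>{- int (Suc N)..int (Suc N)}. f (nat \<bar>m\<bar>)) = f (Suc N) + (f (Suc N) + (\<Sum>m\<in>symi N. f (nat \<bar>m\<bar>)))"
    unfolding sym_interval_Suc by (subst sum.insert; simp del: of_nat_Suc)+
  thus ?case using Suc by simp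
qed

text \<open>The sum is of logarithmic size; the square root is a cruder bound that telescopes and
  still leaves decay after division by \<open>N\<close>.\<close>

lemma sum_inverse_le_sqrt: "(\<Sum>j\<le>N. 1 / (1 + real j)) \<le> 2 * sqrt (1 + real N)"
proof (induction N)
  case (Suc N)
  define a where "a = sqrt (1 + real N)"
  define b where "b = sqrt (1 + real (Suc N))"
  have a: "a \<ge> 0" "a\<^sup>2 = 1 + real N" and b: "b \<ge> 1" "b\<^sup>2 = 2 + real N" and ab: "a \<le> b"
    by (auto simp: a_def b_def)
  have "(b - a) * (b + a) = 1" using a b by (simp add: algebra_simps power2_eq_square)
  hence "1 \<le> (b - a) * (2 * b)" using mult_left_mono[of "b + a" "2 * b" "b - a"] ab by simp
  hence "1 / (b * b) \<le> (b - a) * (2 * b) / (b * b)" using b by (intro divide_right_mono) auto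
  also have "... = 2 * (b - a) / b" using b by (simp add: field_simps)
  also have "... \<le> 2 * (b - a) / 1" using ab b by (intro divide_left_mono) auto
  finally have "1 / (1 + real (Suc N)) \<le> 2 * b - 2 * a" using b by (simp add: power2_eq_square)
  thus ?case using Suc by (simp add: a_def b_def)
qed auto

section \<open>Estimates on the boundary of large squares\<close>

lemma cos_half_odd_pi: "\<bar>x\<bar> = (real N + 1/2) * pi \<Longrightarrow> cos x = 0"
proof -
  assume x: "\<bar>x\<bar> = (real N + 1/2) * pi"
  have "cos x = cos \<bar>x\<bar>" by (rule cos_abs_real[symmetric])
  also have "... = cos (real N * pi + pi / 2)" unfolding x by (simp add: algebra_simps)
  also have "... = 0" by (simp add: cos_add)
  finally show ?thesis .
qed

text \<open>Half-odd multiples of \<open>pi\<close> keep the boundary at a fixed distance from the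
  zeros of sine.\<close>

definition sq_box :: "nat \<Rightarrow> complex set"
  where "sq_box N = cbox (- Complex ((real N + 1/2) * pi) ((real N + 1/2) * pi)) (Complex ((real N + 1/2) * pi) ((real N + 1/2) * pi))"

lemma sq_box_mem: "z \<in> sq_box N \<longleftrightarrow> \<bar>Re z\<bar> \<le> (real N + 1/2) * pi \<and> \<bar>Im z\<bar> \<le> (real N + 1/2) * pi"
  by (auto simp: sq_box_def in_cbox_complex_iff abs_le_iff)

lemma frontier_sq_box:
  assumes "z \<in> frontier (sq_box N)"
  shows "\<bar>Re z\<bar> = (real N + 1/2) * pi \<or> \<bar>Im z\<bar> = (real N + 1/2) * pi"
    "\<bar>Re z\<bar> \<le> (real N + 1/2) * pi" "\<bar>Im z\<bar> \<le> (real N + 1/2) * pi"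
proof -
  have z: "z \<in> sq_box N" "z \<notin> box (- Complex ((real N + 1/2) * pi) ((real N + 1/2) * pi)) (Complex ((real N + 1/2) * pi) ((real N + 1/2) * pi))"
    using assms unfolding sq_box_def frontier_cbox by auto
  show *: "\<bar>Re z\<bar> \<le> (real N + 1/2) * pi" "\<bar>Im z\<bar> \<le> (real N + 1/2) * pi"
    using z(1) by (auto simp: sq_box_mem)
  show "\<bar>Re z\<bar> = (real N + 1/2) * pi \<or> \<bar>Im z\<bar> = (real N + 1/2) * pi"
    using z(2) * unfolding in_box_complex_iff by (simp; linarith)
qed

lemma X_ge: "(real N + 1/2) * pi \<ge> real N + 1/2" "(real N + 1/2) * pi \<ge> 3/2"
proof -
  have *: "(real N + 1/2) * 3 \<le> (real N + 1/2) * pi" using pi_gt3 by (intro mult_left_mono) auto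
  have "real N + 1/2 \<le> (real N + 1/2) * 3" by simp
  thus "(real N + 1/2) * pi \<ge> real N + 1/2" using * by (rule order_trans)
  have "3/2 \<le> (real N + 1/2) * 3" by simp
  thus "(real N + 1/2) * pi \<ge> 3/2" using * by (rule order_trans)
qed

lemma frontier_norm:
  assumes "z \<in> frontier (sq_box N)" shows "cmod z \<ge> real N + 1/2"
  using frontier_sq_box(1)[OF assms] X_ge(1)[of N] abs_Re_le_cmod[of z] abs_Im_le_cmod[of z] by linarith

text \<open>On the vertical sides the cosine of the real part vanishes; on the horizontal sides the
  hyperbolic part \<open>S\<close> is at least one and dominates.\<close>

lemma cot_bound:
  assumes "z \<in> frontier (sq_box N)"
  shows "sin z \<noteq> 0" "cmod (cos z) \<le> 2 * cmod (sin z)"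
proof -
  define S where "S = (exp (Im z) - inverse (exp (Im z)))\<^sup>2 / 4"
  have c: "(cmod (cos z))\<^sup>2 = (cos (Re z))\<^sup>2 + S" by (simp add: norm_cos_squared S_def)
  have s: "(cmod (sin z))\<^sup>2 = (sin (Re z))\<^sup>2 + S"
  proof -
    have "exp (2 * Im z) = (exp (Im z))\<^sup>2" by (rule exp_double)
    hence "(cmod (sin z))\<^sup>2 = ((exp (Im z))\<^sup>2 + inverse ((exp (Im z))\<^sup>2) - 2 * (1 - 2 * (sin (Re z))\<^sup>2)) / 4"
      by (simp only: norm_sin_squared cos_double_sin)
    also have "... = (sin (Re z))\<^sup>2 + S"
    proof -
      have "(E\<^sup>2 + inverse (E\<^sup>2) - 2 * (1 - 2 * t)) / 4 = t + (E - inverse E)\<^sup>2 / 4" if "E \<noteq> 0" for E t :: real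
        using that by (simp add: power2_eq_square field_simps)
      thus ?thesis unfolding S_def by simp
    qed
    finally show ?thesis .
  qed
  have S0: "S \<ge> 0" by (simp add: S_def)
  have main: "0 < (cmod (sin z))\<^sup>2 \<and> (cmod (cos z))\<^sup>2 \<le> 4 * (cmod (sin z))\<^sup>2"
  proof (cases "\<bar>Re z\<bar> = (real N + 1/2) * pi")
    case True
    hence "cos (Re z) = 0" by (rule cos_half_odd_pi)
    hence "(sin (Re z))\<^sup>2 = 1" using sin_cos_squared_add[of "Re z"] by simp
    thus ?thesis using c s S0 \<open>cos (Re z) = 0\<close> by simp
  next
    case False
    hence y: "\<bar>Im z\<bar> \<ge> 3/2" using frontier_sq_box(1)[OF assms] X_ge(2)[of N] by linarith
    have "2 \<le> \<bar>exp (Im z) - inverse (exp (Im z))\<bar>"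
    proof -
      have *: "2 \<le> exp t - inverse (exp t)" if "t \<ge> 3/2" for t :: real
      proof -
        have "exp t \<ge> 5/2" using exp_ge_add_one_self[of t] that by linarith
        moreover from this have "inverse (exp t) \<le> inverse (5/2)" by (intro le_imp_inverse_le) auto
        ultimately show ?thesis by simp
      qed
      show ?thesis
      proof (cases "Im z \<ge> 0")
        case True thus ?thesis using *[of "Im z"] y by simp
      next
        case False
        hence "2 \<le> exp (- Im z) - inverse (exp (- Im z))" using *[of "- Im z"] y by simp
        hence "2 \<le> inverse (exp (Im z)) - exp (Im z)" by (simp add: exp_minus)
        thus ?thesis by linarith
      qed
    qed
    hence "2\<^sup>2 \<le> (exp (Im z) - inverse (exp (Im z)))\<^sup>2"
      using abs_le_square_iff[of 2 "exp (Im z) - inverse (exp (Im z))"] by simp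
    hence "S \<ge> 1" by (simp add: S_def)
    moreover have "(cos (Re z))\<^sup>2 \<le> 1" by (simp add: abs_square_le_1)
    moreover have "(sin (Re z))\<^sup>2 \<ge> 0" by simp
    ultimately show ?thesis using c s by linarith
  qed
  thus "sin z \<noteq> 0" by auto
  have "(cmod (cos z))\<^sup>2 \<le> (2 * cmod (sin z))\<^sup>2" using main by (simp add: power_mult_distrib)
  thus "cmod (cos z) \<le> 2 * cmod (sin z)" by (rule power2_le_imp_le) simp
qed

lemma exp_minus_1_bound:
  fixes w :: complex assumes "cmod w \<le> 1" shows "cmod (exp w - 1) \<le> 3 * cmod w"
proof -
  have "cmod (exp w - exp 0) \<le> 3 * cmod (w - 0)"
  proof (rule field_differentiable_bound[of "cball 0 1" exp exp])
    fix z :: complex assume "z \<in> cball 0 1"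
    hence "exp (cmod z) \<le> exp 1" by simp
    thus "cmod (exp z) \<le> 3" using norm_exp[of z] exp_le by linarith
  qed (use assms in \<open>auto intro!: derivative_eq_intros\<close>)
  thus ?thesis by simp
qed

lemma sin_shift_ratio:
  assumes d: "cmod d \<le> 1" and s: "sin z \<noteq> 0" "cmod (cos z) \<le> 2 * cmod (sin z)"
  shows "cmod (sin (z + d) / sin z - 1) \<le> 9 * cmod d"
proof -
  let ?p = "exp (\<i> * d) - 1" and ?m = "exp (- (\<i> * d)) - 1"
  have p: "cmod ?p \<le> 3 * cmod d" "cmod ?m \<le> 3 * cmod d"
    using exp_minus_1_bound[of "\<i> * d"] exp_minus_1_bound[of "- (\<i> * d)"] d by (auto simp: norm_mult)
  have "cos d - 1 = (?p + ?m) / 2" by (simp add: cos_exp_eq field_simps)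
  hence c: "cmod (cos d - 1) \<le> 3 * cmod d"
  proof -
    assume *: "cos d - 1 = (?p + ?m) / 2"
    have "cmod (?p + ?m) \<le> 6 * cmod d" using norm_triangle_ineq[of ?p ?m] p by linarith
    thus ?thesis unfolding * norm_divide by simp
  qed
  have "sin d = (?p - ?m) / (2 * \<i>)" by (simp add: sin_exp_eq field_simps)
  hence sd: "cmod (sin d) \<le> 3 * cmod d"
  proof -
    assume *: "sin d = (?p - ?m) / (2 * \<i>)"
    have "cmod (?p - ?m) \<le> 6 * cmod d" using norm_triangle_ineq4[of ?p ?m] p by linarith
    thus ?thesis unfolding * norm_divide by (simp add: norm_mult)
  qed
  have "sin (z + d) / sin z - 1 = (cos d - 1) + sin d * (cos z / sin z)"
    using s(1) by (simp add: sin_add field_simps)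
  also have "cmod \<dots> \<le> cmod (cos d - 1) + cmod (sin d) * cmod (cos z / sin z)"
    using norm_triangle_ineq[of "cos d - 1" "sin d * (cos z / sin z)"] by (simp only: norm_mult)
  also have "cmod (cos z / sin z) \<le> 2" using s by (simp add: norm_divide field_simps)
  hence "cmod (sin d) * cmod (cos z / sin z) \<le> (3 * cmod d) * 2" using sd by (intro mult_mono) auto
  finally show ?thesis using c by linarith
qed

lemma prod_close_to_1:
  fixes a :: "'i \<Rightarrow> complex"
  assumes "finite I" "(\<Sum>i\<in>I. cmod (a i)) \<le> \<theta>"
  shows "cmod ((\<Prod>i\<in>I. 1 + a i) - 1) \<le> exp \<theta> - 1"
proof -
  have "cmod ((\<Prod>i\<in>I. 1 + a i) - 1) \<le> (\<Prod>i\<in>I. 1 + cmod (a i)) - 1" using assms(1)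
  proof (induction I rule: finite_induct)
    case (insert i I)
    let ?P = "\<Prod>i\<in>I. 1 + a i" and ?R = "\<Prod>i\<in>I. 1 + cmod (a i)"
    have P: "cmod ?P \<le> ?R"
      unfolding prod_norm[symmetric] by (intro prod_mono) (auto intro: norm_triangle_le)
    have "(1 + a i) * ?P - 1 = (?P - 1) + a i * ?P" by (simp add: algebra_simps)
    hence "cmod ((1 + a i) * ?P - 1) \<le> cmod (?P - 1) + cmod (a i) * cmod ?P"
      using norm_triangle_ineq[of "?P - 1" "a i * ?P"] by (simp only: norm_mult)
    also have "... \<le> (?R - 1) + cmod (a i) * ?R" by (intro add_mono insert.IH mult_left_mono P) auto
    finally show ?case using insert.hyps by (simp add: algebra_simps)
  qed simp
  also have "(\<Prod>i\<in>I. 1 + cmod (a i)) \<le> (\<Prod>i\<in>I. exp (cmod (a i)))"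
    by (intro prod_mono) (auto simp: exp_ge_add_one_self)
  also have "... = exp (\<Sum>i\<in>I. cmod (a i))" by (rule exp_sum[OF assms(1), symmetric])
  also have "... \<le> exp \<theta>" using assms(2) by simp
  finally show ?thesis by simp
qed

lemma ratio_close_to_1:
  assumes "e > 0"
  obtains d where "d > 0" "d \<le> 1" "\<And>x y y'. cmod (x - 1) < d \<Longrightarrow> cmod (y - 1) < d \<Longrightarrow> cmod (y' - 1) < d \<Longrightarrow>
    cmod (x\<^sup>2 / (y * y') - 1) < e"
proof -
  let ?f = "\<lambda>p :: complex \<times> complex \<times> complex. (fst p)\<^sup>2 / (fst (snd p) * snd (snd p))"
  have "isCont ?f (1, 1, 1)" by (intro continuous_intros) auto
  then obtain d where d: "d > 0" "\<And>p. dist p (1, 1, 1) < d \<Longrightarrow> dist (?f p) (?f (1, 1, 1)) < e"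
    using assms unfolding continuous_at_eps_delta by blast
  show ?thesis
  proof (rule that[of "min (d / 3) 1"])
    fix x y y' :: complex
    assume "cmod (x - 1) < min (d / 3) 1" "cmod (y - 1) < min (d / 3) 1" "cmod (y' - 1) < min (d / 3) 1"
    hence *: "cmod (x - 1) < d / 3" "cmod (y - 1) < d / 3" "cmod (y' - 1) < d / 3" by simp_all
    have "dist (x, y, y') (1, 1, 1) \<le> cmod (x - 1) + (cmod (y - 1) + cmod (y' - 1))"
      unfolding dist_norm using norm_Pair_le[of "x - 1" "(y - 1, y' - 1)"] norm_Pair_le[of "y - 1" "y' - 1"] by simp
    hence "dist (x, y, y') (1, 1, 1) < d" using * by linarith
    from d(2)[OF this] show "cmod (x\<^sup>2 / (y * y') - 1) < e" by (simp add: dist_norm)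
  qed (use d in auto)
qed

lemma pi_idx_nonzero [simp]: "pi_idx n \<noteq> 0" by (simp add: pi_idx_def)

text \<open>Euler's product with the factors for \<open>m\<close> and \<open>- m\<close> joined. The
  central factor is \<open>- z\<close>, since \<open>pi_idx 0 = 1\<close>, and it produces the minus
  sign.\<close>

lemma sin_sym_prod:
  "(\<lambda>N. \<Prod>m\<in>symi N. (of_real (of_int m * pi) - z) / pi_idx m) \<longlonglongrightarrow> - sin z"
proof -
  define w where "w = z / of_real pi"
  have z: "z = of_real pi * w" by (simp add: w_def)
  have "(\<Prod>m\<in>symi N. (of_real (of_int m * pi) - z) / pi_idx m)
     = - (of_real pi * w * (\<Prod>k=1..N. 1 - w\<^sup>2 / (of_nat k)\<^sup>2))" for N
  proof (induction N)
    case 0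
    thus ?case by (simp add: pi_idx_def z)
  next
    case (Suc N)
    let ?f = "\<lambda>m. (of_real (of_int m * pi) - z) / pi_idx m"
    have "(\<Prod>m\<in>{- int (Suc N)..int (Suc N)}. ?f m) = ?f (- int (Suc N)) * (?f (int (Suc N)) * (\<Prod>m\<in>symi N. ?f m))"
      unfolding sym_interval_Suc by (subst prod.insert; simp)+
    also have "?f (- int (Suc N)) = 1 + w / of_nat (Suc N)"
      by (simp add: pi_idx_def z field_simps del: of_nat_Suc)
    also have "?f (int (Suc N)) = 1 - w / of_nat (Suc N)"
      by (simp add: pi_idx_def z field_simps del: of_nat_Suc)
    also have "(1 + w / of_nat (Suc N)) * ((1 - w / of_nat (Suc N)) * (\<Prod>m\<in>symi N. ?f m))
       = (1 - w\<^sup>2 / (of_nat (Suc N))\<^sup>2) * (\<Prod>m\<in>symi N. ?f m)"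
    proof -
      have "(1 + u) * ((1 - u) * p) = (1 - u\<^sup>2) * p" for u p :: complex
        by (simp add: algebra_simps power2_eq_square)
      thus ?thesis unfolding power_divide[symmetric] .
    qed
    finally show ?case unfolding Suc.IH by (simp add: prod.nat_ivl_Suc' mult_ac del: of_nat_Suc)
  qed
  moreover have "(\<lambda>N. - (of_real pi * w * (\<Prod>k=1..N. 1 - w\<^sup>2 / (of_nat k)\<^sup>2))) \<longlonglongrightarrow> - sin z"
    unfolding z by (intro tendsto_minus sin_product_formula_complex)
  ultimately show ?thesis by simp
qed

context smooth_potential
begin

section \<open>Convergence of the canonical product\<close>

definition good :: "complex \<Rightarrow> bool" where "good z \<longleftrightarrow> (\<forall>m. z \<notin> gap pot m)"

lemma gap_eq: "gap pot m = closed_segment (of_real (lm m)) (of_real (lp m))"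
  by (simp add: gap_def lam_eq)

lemma mem_gap: "z \<in> gap pot m \<longleftrightarrow> Im z = 0 \<and> lm m \<le> Re z \<and> Re z \<le> lp m"
  unfolding gap_eq by (rule mem_real_segment[OF lm_le_lp])

lemma good_Im: "Im z \<noteq> 0 \<Longrightarrow> good z" by (simp add: good_def mem_gap)

lemma good_cnj: "good (cnj z) \<longleftrightarrow> good z" by (simp add: good_def mem_gap)

definition sr :: "int \<Rightarrow> complex \<Rightarrow> complex" where "sr m = sroot (lm m) (lp m)"

definition tau :: "int \<Rightarrow> real" where "tau m = (lm m + lp m) / 2"

lemma standard_root_eq: "good z \<Longrightarrow> standard_root pot m z = sr m z"
  using standard_root_eq_sroot[of pot m z] by (simp add: lam_eq lm_le_lp sr_def good_def)

lemma sr_square: "good z \<Longrightarrow> (sr m z)\<^sup>2 = (of_real (lp m) - z) * (of_real (lm m) - z)"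
  unfolding sr_def by (rule sroot_square[OF lm_le_lp]) (simp add: good_def gap_eq)

lemma sr_cnj: "good z \<Longrightarrow> sr m (cnj z) = cnj (sr m z)"
  unfolding sr_def by (rule sroot_cnj[OF lm_le_lp]) (simp add: good_def gap_eq)

lemma sr_holomorphic:
  assumes "\<And>z. z \<in> W \<Longrightarrow> good z" shows "sr m holomorphic_on W"
  unfolding sr_def
  by (rule holomorphic_on_subset[OF sroot_holomorphic[OF lm_le_lp]]) (use assms in \<open>auto simp: good_def gap_eq\<close>)

lemma lm_dist: "\<bar>lm m - of_int m * pi\<bar> \<le> C1 / (1 + \<bar>real_of_int m\<bar>)"
  and lp_dist: "\<bar>lp m - of_int m * pi\<bar> \<le> C1 / (1 + \<bar>real_of_int m\<bar>)"
  by (rule GG_dist[OF lm_in] GG_dist[OF lp_in])+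

lemma C1_le: "C1 / (1 + \<bar>real_of_int m\<bar>) \<le> C1" using C1_nonneg by (simp add: field_simps)

lemma tau_dist: "\<bar>tau m - of_int m * pi\<bar> \<le> C1 / (1 + \<bar>real_of_int m\<bar>)"
proof -
  have "\<bar>a - x\<bar> \<le> e \<Longrightarrow> \<bar>b - x\<bar> \<le> e \<Longrightarrow> \<bar>(a + b) / 2 - x\<bar> \<le> e" for a b x e :: real
    by (simp add: abs_le_iff field_simps)
  from this[OF lm_dist lp_dist] show ?thesis unfolding tau_def .
qed

lemma glen_bound: "0 \<le> lp m - lm m" "lp m - lm m \<le> 2 * (C1 / (1 + \<bar>real_of_int m\<bar>))"
  using lm_dist[of m] lp_dist[of m] lm_le_lp[of m] by linarith+

text \<open>\<open>C1\<close> pays for the displacement of the midpoint of a gap from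
  \<open>m * pi\<close>, its square for the width of the gap.\<close>

definition C2 :: real where "C2 = C1 + C1\<^sup>2"

lemma C2_nonneg: "C2 \<ge> 0" using C1_nonneg by (simp add: C2_def)

lemma sr_dist:
  assumes z: "good z" "cmod (of_real (tau m) - z) \<ge> 1"
  shows "cmod (sr m z - (of_real (of_int m * pi) - z)) \<le> C2 / (1 + \<bar>real_of_int m\<bar>)"
proof -
  define a where "a = 1 + \<bar>real_of_int m\<bar>"
  have a: "a \<ge> 1" by (simp add: a_def)
  let ?w = "of_real (tau m) - z"
  have "cmod (sr m z - ?w) \<le> (lp m - lm m)\<^sup>2 / (4 * cmod ?w)"
    unfolding sr_def tau_def by (rule sroot_approx[OF lm_le_lp]) (use z in \<open>simp add: good_def gap_eq\<close>)
  also have "... \<le> (2 * (C1 / a))\<^sup>2 / (4 * 1)"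
    using glen_bound[of m] z(2) by (intro frac_le power_mono) (auto simp: a_def)
  also have "... = C1\<^sup>2 / a\<^sup>2" by (simp add: power_mult_distrib power_divide)
  also have "... \<le> C1\<^sup>2 / a" using a by (intro divide_left_mono) (auto simp: power2_eq_square)
  finally have 1: "cmod (sr m z - ?w) \<le> C1\<^sup>2 / a" .
  have "cmod (?w - (of_real (of_int m * pi) - z)) = \<bar>tau m - of_int m * pi\<bar>"
  proof -
    have "?w - (of_real (of_int m * pi) - z) = of_real (tau m - of_int m * pi)" by simp
    thus ?thesis by (simp only: norm_of_real)
  qed
  hence 2: "cmod (?w - (of_real (of_int m * pi) - z)) \<le> C1 / a"
    using tau_dist[of m] by (simp add: a_def)
  have "cmod (sr m z - (of_real (of_int m * pi) - z)) \<le> cmod (sr m z - ?w) + cmod (?w - (of_real (of_int m * pi) - z))"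
  proof -
    have "sr m z - (of_real (of_int m * pi) - z) = (sr m z - ?w) + (?w - (of_real (of_int m * pi) - z))"
      by (simp add: algebra_simps)
    thus ?thesis by (simp only: norm_triangle_ineq)
  qed
  also have "... \<le> C1\<^sup>2 / a + C1 / a" using 1 2 by linarith
  also have "... = C2 / a" by (simp add: C2_def add_divide_distrib)
  finally show ?thesis by (simp add: a_def)
qed

definition PN :: "nat \<Rightarrow> complex \<Rightarrow> complex"
  where "PN N z = (\<Prod>m\<in>symi N. sr m z / pi_idx m)"

text \<open>The factors for \<open>k\<close> and \<open>- k\<close> taken together. A single one is
  only \<open>1 + O(1/k)\<close>; the pair is \<open>1 + O(1/k^2)\<close>, which turns symmetric
  partial products into an absolutely convergent product.\<close>

definition pfac :: "nat \<Rightarrow> complex \<Rightarrow> complex"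
  where "pfac k z = (if k = 0 then sr 0 z else
     (sr (- int k) z / pi_idx (- int k)) * (sr (int k) z / pi_idx (int k)))"

lemma PN_eq: "PN N z = (\<Prod>k<Suc N. 1 + (pfac k z - 1))"
proof (induction N)
  case 0 thus ?case by (simp add: PN_def pfac_def pi_idx_def)
next
  case (Suc N)
  have "PN (Suc N) z = (sr (- int (Suc N)) z / pi_idx (- int (Suc N))) *
      ((sr (int (Suc N)) z / pi_idx (int (Suc N))) * PN N z)"
    unfolding PN_def sym_interval_Suc by (subst prod.insert; simp)+
  hence "PN (Suc N) z = PN N z * pfac (Suc N) z" by (simp add: pfac_def mult_ac)
  thus ?case unfolding Suc.IH by simp
qed

lemma pfac_bound:
  assumes z: "good z" "cmod z \<le> R" and k: "real k \<ge> R + C1 + 1"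
  shows "cmod (pfac k z - 1) \<le> (2 * C2 + (R + C2)\<^sup>2) / (real k)\<^sup>2"
proof -
  have R0: "R \<ge> 0" using z(2) norm_ge_zero[of z] by linarith
  have k1: "real k \<ge> 1" using k R0 C1_nonneg by linarith
  hence k0: "k \<noteq> 0" by auto
  define p where "p = real k * pi"
  have p: "p \<ge> real k" unfolding p_def using pi_gt3 k1 by (simp add: mult_le_cancel_left1)
  have far: "cmod (of_real (tau m) - z) \<ge> 1" if "\<bar>of_int m * pi\<bar> = p" for m
  proof -
    have "\<bar>tau m - of_int m * pi\<bar> \<le> C1" using tau_dist[of m] C1_le[of m] by linarith
    hence "\<bar>tau m\<bar> \<ge> p - C1" using that by linarith
    moreover have "\<bar>tau m\<bar> \<le> cmod (of_real (tau m) - z) + cmod z"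
      using norm_triangle_sub[of "complex_of_real (tau m)" z] by simp
    ultimately show ?thesis using z(2) k p by linarith
  qed
  define x where "x = sr (int k) z - (of_real p - z)"
  define y where "y = sr (- int k) z - (- of_real p - z)"
  have x: "cmod x \<le> C2 / (1 + real k)"
    using sr_dist[OF z(1) far[of "int k"]] by (simp add: x_def p_def abs_mult)
  have y: "cmod y \<le> C2 / (1 + real k)"
    using sr_dist[OF z(1) far[of "- int k"]] by (simp add: y_def p_def abs_mult)
  have p0: "p > 0" using p k1 by linarith
  have pi1: "pi_idx (int k) = of_real p" "pi_idx (- int k) = - of_real p"
    using k0 by (simp_all add: pi_idx_def p_def)
  have "pfac k z = ((- of_real p - z + y) / (- of_real p)) * ((of_real p - z + x) / of_real p)"
    using k0 by (simp add: pfac_def pi1 x_def y_def)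
  \<comment> \<open>The terms of order \<open>z / p\<close> cancel. Only \<open>y - x\<close>,
    itself of order \<open>1 / k\<close>, keeps a factor \<open>p\<close>.\<close>
  also have "... - 1 = - ((of_real p * (y - x) + (x - z) * (y - z)) / (of_real p)\<^sup>2)"
    using p0 by (simp add: field_simps power2_eq_square)
  finally have "cmod (pfac k z - 1) = cmod (of_real p * (y - x) + (x - z) * (y - z)) / p\<^sup>2"
    using p0 by (simp only: norm_minus_cancel norm_divide norm_power norm_of_real abs_of_pos)
  also have "... \<le> (p * (2 * C2 / (1 + real k)) + (R + C2)\<^sup>2) / p\<^sup>2"
  proof (rule divide_right_mono)
    have C2k: "C2 / (1 + real k) \<le> C2" using C2_nonneg by (simp add: field_simps)
    have "cmod (of_real p * (y - x) + (x - z) * (y - z)) \<le> p * cmod (y - x) + cmod (x - z) * cmod (y - z)"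
      using norm_triangle_ineq[of "of_real p * (y - x)" "(x - z) * (y - z)"] p0 by (simp add: norm_mult)
    moreover have "cmod (y - x) \<le> 2 * C2 / (1 + real k)" using norm_triangle_ineq4[of y x] x y by simp
    hence "p * cmod (y - x) \<le> p * (2 * C2 / (1 + real k))" using p0 by (intro mult_left_mono) auto
    moreover have "cmod (x - z) \<le> R + C2" using norm_triangle_ineq4[of x z] x z(2) C2k by linarith
    moreover have "cmod (y - z) \<le> R + C2" using norm_triangle_ineq4[of y z] y z(2) C2k by linarith
    ultimately show "cmod (of_real p * (y - x) + (x - z) * (y - z)) \<le> p * (2 * C2 / (1 + real k)) + (R + C2)\<^sup>2"
      using mult_mono[of "cmod (x - z)" "R + C2" "cmod (y - z)" "R + C2"] R0 C2_nonneg
      by (simp add: power2_eq_square)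
  qed simp
  also have "... = 2 * C2 / ((1 + real k) * p) + (R + C2)\<^sup>2 / p\<^sup>2"
    using p0 by (simp add: add_divide_distrib power2_eq_square mult.commute)
  also have "... \<le> 2 * C2 / (real k)\<^sup>2 + (R + C2)\<^sup>2 / (real k)\<^sup>2"
  proof (intro add_mono divide_left_mono)
    show "(real k)\<^sup>2 \<le> (1 + real k) * p" using p k1 by (simp add: power2_eq_square mult_mono)
    show "(real k)\<^sup>2 \<le> p\<^sup>2" using p by (intro power_mono) auto
  qed (use C2_nonneg k1 p0 in auto)
  finally show ?thesis by (simp add: add_divide_distrib)
qed

lemma PN_uniformly_convergent:
  assumes A: "compact A" "\<And>z. z \<in> A \<Longrightarrow> good z"
  shows "uniform_limit A PN (\<lambda>z. lim (\<lambda>N. PN N z)) sequentially"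
proof -
  obtain R where R: "\<And>z. z \<in> A \<Longrightarrow> cmod z \<le> R"
    using compact_imp_bounded[OF A(1)] unfolding bounded_iff by blast
  have hol: "pfac k holomorphic_on (\<Inter>m. - gap pot m)" for k
  proof -
    have s: "sr m holomorphic_on (\<Inter>m. - gap pot m)" for m
      by (rule sr_holomorphic) (auto simp: good_def)
    show ?thesis unfolding pfac_def[abs_def] by (cases "k = 0") (auto intro!: holomorphic_intros s)
  qed
  have cont: "continuous_on A (\<lambda>z. pfac k z - 1)" for k
    by (intro continuous_intros continuous_on_subset[OF holomorphic_on_imp_continuous_on[OF hol]])
      (use A(2) in \<open>auto simp: good_def\<close>)
  have "uniformly_convergent_on A (\<lambda>N z. \<Sum>k<N. cmod (pfac k z - 1))"
  proof (rule Weierstrass_m_test'_ev[where M = "\<lambda>k. (2 * C2 + (R + C2)\<^sup>2) * inverse ((real k)\<^sup>2)"])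
    obtain k0 :: nat where k0: "R + C1 + 1 \<le> real k0" using real_arch_simple by blast
    show "\<forall>\<^sub>F k in sequentially. \<forall>z\<in>A. norm (cmod (pfac k z - 1)) \<le> (2 * C2 + (R + C2)\<^sup>2) * inverse ((real k)\<^sup>2)"
      unfolding eventually_sequentially
    proof (intro exI[of _ k0] allI impI ballI)
      fix k z assume "k0 \<le> k" "z \<in> A"
      thus "norm (cmod (pfac k z - 1)) \<le> (2 * C2 + (R + C2)\<^sup>2) * inverse ((real k)\<^sup>2)"
        using pfac_bound[of z R k] A(2) R k0 by (simp add: divide_inverse)
    qed
    show "summable (\<lambda>k. (2 * C2 + (R + C2)\<^sup>2) * inverse ((real k)\<^sup>2))"
      by (intro summable_mult inverse_power_summable) auto
  qed
  hence "uniformly_convergent_on A (\<lambda>N z. \<Prod>k<N. 1 + (pfac k z - 1))"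
    by (rule uniformly_convergent_on_prod[OF cont A(1)])
  then obtain l where "uniform_limit A (\<lambda>N z. \<Prod>k<N. 1 + (pfac k z - 1)) l sequentially"
    unfolding uniformly_convergent_on_def by blast
  hence "uniform_limit A (\<lambda>N z. \<Prod>k<Suc N. 1 + (pfac k z - 1)) l sequentially"
    by (rule filterlim_compose[OF _ filterlim_Suc])
  hence l: "uniform_limit A PN l sequentially" unfolding PN_eq[abs_def] .
  have "l z = lim (\<lambda>N. PN N z)" if "z \<in> A" for z
    using tendsto_uniform_limitI[OF l that] by (simp add: limI)
  thus ?thesis using l by (subst uniform_limit_cong'[of A PN PN _ l]) auto
qed

definition PP :: "complex \<Rightarrow> complex" where "PP z = lim (\<lambda>N. PN N z)"

lemma PN_tendsto: "good z \<Longrightarrow> (\<lambda>N. PN N z) \<longlonglongrightarrow> PP z"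
  using tendsto_uniform_limitI[OF PN_uniformly_convergent[of "{z}"]] by (simp add: PP_def)

lemma canonical_root_eq:
  assumes "good z" shows "canonical_root pot z = 2 * \<i> * PP z"
  by (simp add: canonical_root_def PP_def PN_def standard_root_eq[OF assms])

lemma PP_holomorphic:
  assumes W: "open W" "\<And>z. z \<in> W \<Longrightarrow> good z"
  shows "PP holomorphic_on W"
proof (rule holomorphic_uniform_sequence[OF W(1), of PN])
  show "PN N holomorphic_on W" for N
    unfolding PN_def[abs_def] by (intro holomorphic_intros sr_holomorphic W(2)) auto
  fix z assume "z \<in> W"
  then obtain d where d: "d > 0" "cball z d \<subseteq> W" using W(1) open_contains_cball by blast
  have "uniform_limit (cball z d) PN PP sequentially"
    unfolding PP_def[abs_def] by (rule PN_uniformly_convergent) (use d W in auto)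
  thus "\<exists>d>0. cball z d \<subseteq> W \<and> uniform_limit (cball z d) PN PP sequentially" using d by blast
qed

lemma PP_cnj:
  assumes "good z" shows "PP (cnj z) = cnj (PP z)"
proof -
  have "PN N (cnj z) = cnj (PN N z)" for N
    unfolding PN_def cnj_prod by (intro prod.cong refl) (simp add: sr_cnj[OF assms] pi_idx_def)
  hence "(\<lambda>N. PN N (cnj z)) \<longlonglongrightarrow> cnj (PP z)" using tendsto_cnj[OF PN_tendsto[OF assms]] by simp
  thus ?thesis using PN_tendsto[of "cnj z"] assms LIMSEQ_unique good_cnj by blast
qed

definition QN :: "nat \<Rightarrow> complex \<Rightarrow> complex"
  where "QN N z = (\<Prod>m\<in>symi N. (of_real (lm m) - z) * (of_real (lp m) - z) / (pi_idx m)\<^sup>2)"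

lemma PN_square: "good z \<Longrightarrow> (PN N z)\<^sup>2 = QN N z" unfolding PN_def QN_def prod_power_distrib
  by (intro prod.cong refl) (simp add: power_divide sr_square)

text \<open>At a collapsed gap the monodromy matrix is plus or minus the identity, so
  differentiating the determinant identity there gives a multiple of the derivative of the
  trace.\<close>

lemma double_endpoint: "lm m = lp m \<Longrightarrow> deriv \<Delta> (of_real (lm m)) = 0"
proof -
  assume eq: "lm m = lp m"
  define t where "t = lm m"
  have f: "sg m * Im (ma t) = cmod (mb t)" "- sg m * Im (ma t) = cmod (mb t)"
    using lm_facts(1)[of m] lp_facts(1)[of m, folded eq] by (simp_all add: t_def)
  hence "cmod (mb t) = 0" by linarith
  hence mb: "mb t = 0" by simp
  hence Im: "Im (ma t) = 0" using f(1) sg_cases[of m] by auto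
  let ?A = "\<lambda>\<mu>. fm True True \<mu> 1" and ?B = "\<lambda>\<mu>. fm True False \<mu> 1"
    and ?C = "\<lambda>\<mu>. fm False True \<mu> 1" and ?D = "\<lambda>\<mu>. fm False False \<mu> 1"
  let ?t = "complex_of_real t"
  have h: "((\<lambda>\<mu>. fm b c \<mu> 1) has_field_derivative deriv (\<lambda>\<mu>. fm b c \<mu> 1) ?t) (at ?t)" for b c
    by (rule holomorphic_derivI[of _ UNIV]) (auto intro!: holomorphic_intros)
  have v: "?A ?t = of_real (Re (ma t))" "?D ?t = of_real (Re (ma t))" "?B ?t = 0" "?C ?t = 0"
    using mb Im fm_real[of t] by (auto simp: ma_def[symmetric] mb_def[symmetric] complex_eq_iff)
  have d1: "((\<lambda>\<mu>. ?A \<mu> * ?D \<mu> - ?B \<mu> * ?C \<mu>) has_field_derivative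
     (?A ?t * deriv ?D ?t + deriv ?A ?t * ?D ?t) - (?B ?t * deriv ?C ?t + deriv ?B ?t * ?C ?t)) (at ?t)"
    by (intro DERIV_diff DERIV_mult' h)
  have fn: "(\<lambda>\<mu>. ?A \<mu> * ?D \<mu> - ?B \<mu> * ?C \<mu>) = (\<lambda>\<mu>. 1)" by (intro ext fm_det) simp
  have "((\<lambda>\<mu>::complex. 1::complex) has_field_derivative 0) (at ?t)" by (rule DERIV_const)
  from DERIV_unique[OF d1[unfolded fn] this]
  have "of_real (Re (ma t)) * (deriv ?D ?t + deriv ?A ?t) = 0"
    unfolding v by (simp add: algebra_simps)
  moreover have "Re (ma t) \<noteq> 0" using lm_facts(2)[of m] sg_cases[of m] by (auto simp: t_def)
  ultimately have "deriv ?A ?t + deriv ?D ?t = 0" by (simp add: add.commute)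
  moreover have "deriv \<Delta> ?t = deriv ?A ?t + deriv ?D ?t"
    unfolding \<Delta>_def[abs_def] by (intro DERIV_imp_deriv DERIV_add h)
  ultimately show ?thesis by (simp add: t_def)
qed

lemma \<Delta>_endpoint: "(\<Delta> (of_real (lm m)))\<^sup>2 = 4" "(\<Delta> (of_real (lp m)))\<^sup>2 = 4"
  unfolding \<Delta>_sq_real lm_facts(2) lp_facts(2) using sg_cases[of m] by auto

lemma \<Delta>_divide:
  obtains u where "u holomorphic_on UNIV"
    "\<And>z. 1 - (\<Delta> z)\<^sup>2 / 4 = u z * (\<Prod>m\<in>symi N. (of_real (lm m) - z) * (of_real (lp m) - z))"
proof -
  let ?f = "\<lambda>z. 1 - (\<Delta> z)\<^sup>2 / 4"
  have "\<exists>u. u holomorphic_on UNIV \<and> (\<forall>z. ?f z = u z * (\<Prod>m\<in>symi N. (of_real (lm m) - z) * (of_real (lp m) - z)))"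
  proof (rule entire_divide_prod)
    show "?f holomorphic_on UNIV" by (auto intro!: holomorphic_intros)
    fix i j :: int assume ij: "i \<noteq> j"
    have "lm i \<noteq> lm j \<and> lm i \<noteq> lp j \<and> lp i \<noteq> lm j \<and> lp i \<noteq> lp j"
      using lp_less_lm[of i j] lp_less_lm[of j i] lm_le_lp[of i] lm_le_lp[of j] ij by (cases "i < j") auto
    thus "complex_of_real (lm i) \<noteq> of_real (lm j) \<and> complex_of_real (lm i) \<noteq> of_real (lp j) \<and>
       complex_of_real (lp i) \<noteq> of_real (lm j) \<and> complex_of_real (lp i) \<noteq> of_real (lp j)"
      by simp
  next
    fix i :: int
    have "deriv ?f (of_real (lm i)) = 0" if "lm i = lp i"
    proof -
      have "(\<Delta> has_field_derivative 0) (at (of_real (lm i)))"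
        using holomorphic_derivI[of \<Delta> UNIV "of_real (lm i)"] double_endpoint[OF that] \<Delta>_holomorphic[of UNIV] by simp
      hence "(?f has_field_derivative 0 - (of_nat 2 * 0 * \<Delta> (of_real (lm i)) ^ (2 - 1)) / 4) (at (of_real (lm i)))"
        by (intro DERIV_diff DERIV_const DERIV_cdivide) (auto intro!: derivative_eq_intros)
      thus ?thesis by (simp add: DERIV_imp_deriv)
    qed
    thus "?f (of_real (lm i)) = 0 \<and> ?f (of_real (lp i)) = 0 \<and>
        (complex_of_real (lm i) = of_real (lp i) \<longrightarrow> deriv ?f (of_real (lm i)) = 0)"
      by (simp add: \<Delta>_endpoint)
  qed auto
  thus ?thesis using that by blast
qed

end

text \<open>Partial fractions reduce it to a harmonic sum. The two factors stand for the
  displacement of the \<open>j\<close>-th end point and for its distance to the boundary of the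
  square.\<close>

lemma sum_two_inverse_le:
  "(\<Sum>j\<le>N. 1 / ((1 + real j) * real (N + 1 - j))) \<le> 4 / sqrt (1 + real N)"
proof -
  have eq: "1 / ((1 + real j) * real (N + 1 - j)) = (1 / (1 + real j) + 1 / (1 + real (N - j))) / (real N + 2)"
    if "j \<le> N" for j
  proof -
    define a b where "a = 1 + real j" and "b = 1 + real (N - j)"
    have ab: "a > 0" "b > 0" "a + b = real N + 2" using that by (auto simp: a_def b_def of_nat_diff)
    have "real (N + 1 - j) = b" using that by (simp add: b_def of_nat_diff)
    moreover have "1 / (a * b) = (1 / a + 1 / b) / (a + b)"
    proof -
      have "1 / a + 1 / b = (a + b) / (a * b)" using ab(1,2) by (simp add: field_simps)
      moreover have "a + b \<noteq> 0" using ab(1,2) by linarith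
      ultimately show ?thesis by simp
    qed
    ultimately show ?thesis unfolding ab(3)[symmetric] a_def[symmetric] b_def[symmetric] by simp
  qed
  have rev: "(\<Sum>j\<le>N. 1 / (1 + real (N - j))) = (\<Sum>j\<le>N. 1 / (1 + real j))"
    using sum.nat_diff_reindex[of "\<lambda>i. 1 / (1 + real i)" "Suc N"]
    by (simp only: lessThan_Suc_atMost diff_Suc_Suc)
  have "(\<Sum>j\<le>N. 1 / ((1 + real j) * real (N + 1 - j))) = (\<Sum>j\<le>N. (1 / (1 + real j) + 1 / (1 + real (N - j))) / (real N + 2))"
    by (intro sum.cong refl eq) simp
  also have "... = (2 * (\<Sum>j\<le>N. 1 / (1 + real j))) / (real N + 2)"
    unfolding sum_divide_distrib[symmetric] sum.distrib rev by simp
  also have "... \<le> (2 * (2 * sqrt (1 + real N))) / (1 + real N)"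
    using sum_inverse_le_sqrt[of N] by (intro frac_le mult_left_mono) (auto intro!: sum_nonneg)
  also have "... = 4 / sqrt (1 + real N)" by (simp add: field_simps flip: power2_eq_square)
  finally show ?thesis .
qed

context smooth_potential
begin

section \<open>Product formula for the discriminant\<close>

lemma \<Delta>_kappa:
  assumes "z \<noteq> 0"
  obtains \<kappa> where "\<Delta> z = 2 * cos \<kappa>" "cmod (\<kappa> - z) \<le> C0 / cmod z"
proof -
  have *: "\<exists>\<kappa>. \<Delta> z = 2 * cos \<kappa> \<and> cmod (\<kappa> - z) \<le> C0 / cmod z" if zi: "Im z \<ge> 0" "z \<noteq> 0" for z
  proof -
    obtain c where "cmod c \<le> 1" "\<sigma> z c 1 = c" using \<sigma>_fixed_point[OF zi(1)] by blast
    thus ?thesis using \<Delta>_eq_cos[OF zi(1)] K_asymp[OF zi(1) _ zi(2)] by blast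
  qed
  show ?thesis
  proof (cases "Im z \<ge> 0")
    case True
    thus ?thesis using *[of z] assms that by blast
  next
    case False
    then obtain \<kappa> where k: "\<Delta> (cnj z) = 2 * cos \<kappa>" "cmod (\<kappa> - cnj z) \<le> C0 / cmod (cnj z)"
      using *[of "cnj z"] assms by auto
    show ?thesis
    proof (rule that[of "cnj \<kappa>"])
      have "\<Delta> z = cnj (\<Delta> (cnj z))" by (simp add: \<Delta>_cnj)
      thus "\<Delta> z = 2 * cos (cnj \<kappa>)" unfolding k(1) by (simp add: cnj_cos)
      have "cmod (cnj \<kappa> - z) = cmod (cnj (\<kappa> - cnj z))" by simp
      also have "... \<le> C0 / cmod z" using k(2) unfolding complex_mod_cnj .
      finally show "cmod (cnj \<kappa> - z) \<le> C0 / cmod z" .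
    qed
  qed
qed

lemma frontier_X:
  assumes z: "z \<in> frontier (sq_box N)" and N: "C0 \<le> real N + 1/2"
  obtains X where "1 - (\<Delta> z)\<^sup>2 / 4 = (sin z)\<^sup>2 * X\<^sup>2" "cmod (X - 1) \<le> 9 * (C0 / (real N + 1/2))"
proof -
  have nz: "cmod z \<ge> real N + 1/2" by (rule frontier_norm[OF z])
  have N0: "real N + 1/2 > 0" by simp
  hence "z \<noteq> 0" using nz by auto
  then obtain \<kappa> where k: "\<Delta> z = 2 * cos \<kappa>" "cmod (\<kappa> - z) \<le> C0 / cmod z" by (rule \<Delta>_kappa)
  have "C0 / cmod z \<le> C0 / (real N + 1/2)"
    using nz N0 C0_nonneg by (intro divide_left_mono mult_pos_pos) auto
  hence d: "cmod (\<kappa> - z) \<le> C0 / (real N + 1/2)" using k(2) by linarith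
  have "C0 / (real N + 1/2) \<le> 1" using N N0 by (subst divide_le_eq_1_pos) auto
  hence d1: "cmod (\<kappa> - z) \<le> 1" using d by linarith
  have s: "sin z \<noteq> 0" "cmod (cos z) \<le> 2 * cmod (sin z)" by (rule cot_bound[OF z])+
  show ?thesis
  proof (rule that[of "sin \<kappa> / sin z"])
    have "1 - (\<Delta> z)\<^sup>2 / 4 = 1 - (cos \<kappa>)\<^sup>2" unfolding k(1) by (simp add: power_mult_distrib)
    also have "... = (sin \<kappa>)\<^sup>2" using sin_cos_squared_add[of \<kappa>] by (simp add: algebra_simps)
    finally show "1 - (\<Delta> z)\<^sup>2 / 4 = (sin z)\<^sup>2 * (sin \<kappa> / sin z)\<^sup>2"
      using s by (simp add: power_divide)
    have "cmod (sin (z + (\<kappa> - z)) / sin z - 1) \<le> 9 * cmod (\<kappa> - z)" by (rule sin_shift_ratio[OF d1 s])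
    also have "... \<le> 9 * (C0 / (real N + 1/2))" using d by simp
    finally show "cmod (sin \<kappa> / sin z - 1) \<le> 9 * (C0 / (real N + 1/2))" by simp
  qed
qed

lemma frontier_mpi:
  assumes z: "z \<in> frontier (sq_box N)" and m: "m \<in> symi N"
  shows "cmod (of_real (of_int m * pi) - z) \<ge> real (N + 1 - nat \<bar>m\<bar>) / 2"
proof -
  define a where "a = \<bar>real_of_int m\<bar>"
  have aN: "a \<le> real N" using m by (auto simp: a_def)
  have a0: "a \<ge> 0" by (simp add: a_def)
  have "nat \<bar>m\<bar> \<le> N" using m by auto
  hence r: "real (N + 1 - nat \<bar>m\<bar>) = real N + 1 - a" by (simp add: of_nat_diff a_def)
  have mp: "\<bar>of_int m * pi\<bar> = a * pi" by (simp add: a_def abs_mult)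
  let ?X = "(real N + 1/2) * pi"
  have "?X - a * pi \<ge> real N + 1/2 - a"
  proof -
    have "(real N + 1/2 - a) * 1 \<le> (real N + 1/2 - a) * pi"
      using aN pi_gt3 by (intro mult_left_mono) auto
    thus ?thesis by (simp add: algebra_simps)
  qed
  moreover have "cmod (of_real (of_int m * pi) - z) \<ge> ?X - a * pi" using frontier_sq_box(1)[OF z]
  proof
    assume "\<bar>Re z\<bar> = ?X"
    moreover have "\<bar>Re (of_real (of_int m * pi) - z)\<bar> \<ge> \<bar>Re z\<bar> - \<bar>of_int m * pi\<bar>" by simp
    ultimately show ?thesis using abs_Re_le_cmod[of "of_real (of_int m * pi) - z"] mp by linarith
  next
    assume "\<bar>Im z\<bar> = ?X"
    moreover have "\<bar>Im (of_real (of_int m * pi) - z)\<bar> = \<bar>Im z\<bar>" by simp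
    moreover have "0 \<le> a * pi" using a0 by simp
    ultimately show ?thesis using abs_Im_le_cmod[of "of_real (of_int m * pi) - z"] by linarith
  qed
  ultimately have "cmod (of_real (of_int m * pi) - z) \<ge> real N + 1/2 - a" by linarith
  moreover have "real N + 1/2 - a \<ge> (real N + 1 - a) / 2" using aN by (simp add: field_simps)
  ultimately show ?thesis unfolding r by linarith
qed

text \<open>Moving the zeros from \<open>m * pi\<close> to nearby points changes the product on the
  boundary by a factor tending to one: the relative displacements add up to order
  \<open>1 / sqrt N\<close>.\<close>

lemma frontier_Y:
  assumes z: "z \<in> frontier (sq_box N)" and f: "\<And>m. \<bar>f m - of_int m * pi\<bar> \<le> C1 / (1 + \<bar>real_of_int m\<bar>)"
  obtains Y where "(\<Prod>m\<in>symi N. of_real (f m) - z) = (\<Prod>m\<in>symi N. of_real (of_int m * pi) - z) * Y"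
    "cmod (Y - 1) \<le> exp (16 * C1 / sqrt (1 + real N)) - 1"
    "(\<Prod>m\<in>symi N. of_real (of_int m * pi) - z) \<noteq> 0"
proof -
  let ?I = "symi N"
  define a where "a m = of_real (f m - of_int m * pi) / (of_real (of_int m * pi) - z)" for m
  have pos: "real (N + 1 - nat \<bar>m\<bar>) > 0" if "m \<in> ?I" for m using that by auto
  have nz: "of_real (of_int m * pi) - z \<noteq> 0" if "m \<in> ?I" for m
    using frontier_mpi[OF z that] pos[OF that] by auto
  have a: "cmod (a m) \<le> 2 * C1 * (1 / ((1 + real (nat \<bar>m\<bar>)) * real (N + 1 - nat \<bar>m\<bar>)))" if m: "m \<in> ?I" for m
  proof -
    define A B where "A = 1 + real (nat \<bar>m\<bar>)" and "B = real (N + 1 - nat \<bar>m\<bar>)"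
    have B: "B > 0" using pos[OF m] by (simp add: B_def)
    have A: "A > 0" by (simp add: A_def)
    have "cmod (a m) = \<bar>f m - of_int m * pi\<bar> / cmod (of_real (of_int m * pi) - z)"
      unfolding a_def norm_divide norm_of_real ..
    also have "... \<le> (C1 / A) / (B / 2)"
    proof (rule frac_le)
      show "0 \<le> C1 / A" using C1_nonneg A by simp
      show "\<bar>f m - of_int m * pi\<bar> \<le> C1 / A" using f[of m] by (simp add: A_def)
      show "0 < B / 2" using B by simp
      show "B / 2 \<le> cmod (of_real (of_int m * pi) - z)" using frontier_mpi[OF z m] by (simp add: B_def)
    qed
    also have "... = 2 * C1 * (1 / (A * B))" using A B by (simp add: field_simps)
    finally show ?thesis unfolding A_def B_def .
  qed
  have "(\<Sum>m\<in>?I. cmod (a m)) \<le> (\<Sum>m\<in>?I. 2 * C1 * (1 / ((1 + real (nat \<bar>m\<bar>)) * real (N + 1 - nat \<bar>m\<bar>))))"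
    by (rule sum_mono[OF a])
  also have "... \<le> 2 * (\<Sum>j\<le>N. 2 * C1 * (1 / ((1 + real j) * real (N + 1 - j))))"
    by (rule sum_sym_interval_le) (use C1_nonneg in auto)
  also have "... = 4 * C1 * (\<Sum>j\<le>N. 1 / ((1 + real j) * real (N + 1 - j)))"
    by (simp only: sum_distrib_left[symmetric])
  also have "... \<le> 4 * C1 * (4 / sqrt (1 + real N))"
    using sum_two_inverse_le[of N] C1_nonneg by (intro mult_left_mono) auto
  also have "... = 16 * C1 / sqrt (1 + real N)" by simp
  finally have s: "(\<Sum>m\<in>?I. cmod (a m)) \<le> 16 * C1 / sqrt (1 + real N)" .
  show ?thesis
  proof (rule that)
    show "cmod ((\<Prod>m\<in>?I. 1 + a m) - 1) \<le> exp (16 * C1 / sqrt (1 + real N)) - 1"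
      by (rule prod_close_to_1[OF _ s]) simp
    have "of_real (f m) - z = (of_real (of_int m * pi) - z) * (1 + a m)" if "m \<in> ?I" for m
      using nz[OF that] by (simp add: a_def field_simps)
    thus "(\<Prod>m\<in>?I. of_real (f m) - z) = (\<Prod>m\<in>?I. of_real (of_int m * pi) - z) * (\<Prod>m\<in>?I. 1 + a m)"
      unfolding prod.distrib[symmetric] by (intro prod.cong refl)
    show "(\<Prod>m\<in>?I. of_real (of_int m * pi) - z) \<noteq> 0" using nz by (simp add: prod_zero_iff)
  qed
qed

text \<open>Both functions with their zeros of index up to \<open>N\<close> divided out. The ratio
  \<open>u / s\<^sup>2\<close> is then holomorphic on the square, so the maximum principle carries
  boundary estimates to the inside.\<close>

definition quotients :: "nat \<Rightarrow> (complex \<Rightarrow> complex) \<Rightarrow> (complex \<Rightarrow> complex) \<Rightarrow> bool"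
  where "quotients N u s \<longleftrightarrow> u holomorphic_on UNIV \<and> s holomorphic_on UNIV \<and>
    (\<forall>z. 1 - (\<Delta> z)\<^sup>2 / 4 = u z * (\<Prod>m\<in>symi N. (of_real (lm m) - z) * (of_real (lp m) - z))) \<and>
    (\<forall>z. sin z = s z * (\<Prod>m\<in>symi N. of_real (of_int m * pi) - z)) \<and>
    (\<forall>z. \<bar>Re z\<bar> < (real N + 1) * pi \<longrightarrow> s z \<noteq> 0)"

lemma h_limit:
  assumes e: "e > 0"
  obtains N0 where "\<And>N u s z. N \<ge> N0 \<Longrightarrow> quotients N u s \<Longrightarrow> z \<in> sq_box N \<Longrightarrow> cmod (u z / (s z)\<^sup>2 - 1) \<le> e"
proof -
  obtain d where d0: "d > 0" "d \<le> 1" and d: "\<And>x y y'. cmod (x - 1) < d \<Longrightarrow> cmod (y - 1) < d \<Longrightarrow> cmod (y' - 1) < d \<Longrightarrow>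
    cmod (x\<^sup>2 / (y * y') - 1) < e"
    by (rule ratio_close_to_1[OF e]) blast
  have "filterlim (\<lambda>N. 1/2 + real N) at_top sequentially"
    by (rule filterlim_tendsto_add_at_top[OF tendsto_const filterlim_real_sequentially])
  hence "(\<lambda>N. C0 / (1/2 + real N)) \<longlonglongrightarrow> 0"
    by (intro tendsto_divide_0[OF tendsto_const] filterlim_at_top_imp_at_infinity)
  from tendsto_mult_right_zero[OF this, of 9]
  have X0: "(\<lambda>N. 9 * (C0 / (real N + 1/2))) \<longlonglongrightarrow> 0" by (simp only: add.commute)
  have sq: "filterlim (\<lambda>N. sqrt (1 + real N)) at_top sequentially"
    by (intro filterlim_compose[OF sqrt_at_top] filterlim_tendsto_add_at_top[OF tendsto_const filterlim_real_sequentially])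
  have "(\<lambda>N. 16 * C1 / sqrt (1 + real N)) \<longlonglongrightarrow> 0"
    by (intro tendsto_divide_0[OF tendsto_const] filterlim_at_top_imp_at_infinity sq)
  hence "(\<lambda>N. exp (16 * C1 / sqrt (1 + real N)) - 1) \<longlonglongrightarrow> exp 0 - 1"
    by (intro tendsto_diff tendsto_exp tendsto_const)
  hence Y0: "(\<lambda>N. exp (16 * C1 / sqrt (1 + real N)) - 1) \<longlonglongrightarrow> 0" by simp
  obtain N1 where N1: "\<And>N. N \<ge> N1 \<Longrightarrow> 9 * (C0 / (real N + 1/2)) < d"
    using order_tendstoD(2)[OF X0 d0(1)] unfolding eventually_sequentially by blast
  obtain N2 where N2: "\<And>N. N \<ge> N2 \<Longrightarrow> exp (16 * C1 / sqrt (1 + real N)) - 1 < d"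
    using order_tendstoD(2)[OF Y0 d0(1)] unfolding eventually_sequentially by blast
  obtain N3 :: nat where N3: "C0 \<le> real N3" using real_arch_simple by blast
  show ?thesis
  proof (rule that[of "max N1 (max N2 N3)"])
    fix N u s z
    assume N: "max N1 (max N2 N3) \<le> N" and q: "quotients N u s" and z: "z \<in> sq_box N"
    note hol = q[unfolded quotients_def, THEN conjunct1] q[unfolded quotients_def, THEN conjunct2, THEN conjunct1]
    have u: "1 - (\<Delta> z)\<^sup>2 / 4 = u z * (\<Prod>m\<in>symi N. (of_real (lm m) - z) * (of_real (lp m) - z))"
      and s: "sin z = s z * (\<Prod>m\<in>symi N. of_real (of_int m * pi) - z)"
      and s0: "\<bar>Re z\<bar> < (real N + 1) * pi \<Longrightarrow> s z \<noteq> 0" for z using q unfolding quotients_def by blast+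
    have snz: "s z \<noteq> 0" if "z \<in> sq_box N" for z
    proof (rule s0)
      have "(real N + 1/2) * pi < (real N + 1) * pi" by (intro mult_strict_right_mono) auto
      thus "\<bar>Re z\<bar> < (real N + 1) * pi" using that unfolding sq_box_mem by linarith
    qed
    have hh: "(\<lambda>z. u z / (s z)\<^sup>2 - 1) holomorphic_on sq_box N"
      by (intro holomorphic_intros holomorphic_on_subset[OF hol(1)] holomorphic_on_subset[OF hol(2)])
        (use snz in auto)
    have cl: "closure (sq_box N) = sq_box N" "bounded (sq_box N)" unfolding sq_box_def by auto
    show "cmod (u z / (s z)\<^sup>2 - 1) \<le> e"
    proof (rule maximum_modulus_frontier[OF _ _ cl(2) _ z])
      show "(\<lambda>z. u z / (s z)\<^sup>2 - 1) holomorphic_on interior (sq_box N)"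
        by (rule holomorphic_on_subset[OF hh interior_subset])
      show "continuous_on (closure (sq_box N)) (\<lambda>z. u z / (s z)\<^sup>2 - 1)"
        unfolding cl(1) by (rule holomorphic_on_imp_continuous_on[OF hh])
      fix y assume y: "y \<in> frontier (sq_box N)"
      have yb: "y \<in> sq_box N" using y cl(1) unfolding frontier_def by blast
      have "real N3 \<le> real N" using N by simp
      hence NN: "N1 \<le> N" "N2 \<le> N" "C0 \<le> real N + 1/2" using N N3 by simp_all
      obtain X where X: "1 - (\<Delta> y)\<^sup>2 / 4 = (sin y)\<^sup>2 * X\<^sup>2" "cmod (X - 1) \<le> 9 * (C0 / (real N + 1/2))"
        by (rule frontier_X[OF y NN(3)])
      let ?P = "\<Prod>m\<in>symi N. complex_of_real (of_int m * pi) - y"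
      obtain Y where Y: "(\<Prod>m\<in>symi N. of_real (lm m) - y) = ?P * Y"
        "cmod (Y - 1) \<le> exp (16 * C1 / sqrt (1 + real N)) - 1" "?P \<noteq> 0"
        by (rule frontier_Y[OF y lm_dist])
      obtain Y' where Y': "(\<Prod>m\<in>symi N. of_real (lp m) - y) = ?P * Y'"
        "cmod (Y' - 1) \<le> exp (16 * C1 / sqrt (1 + real N)) - 1" "?P \<noteq> 0"
        by (rule frontier_Y[OF y lp_dist])
      have lt: "cmod (X - 1) < d" "cmod (Y - 1) < d" "cmod (Y' - 1) < d"
        using X(2) Y(2) Y'(2) N1[OF NN(1)] N2[OF NN(2)] by linarith+
      have "u y * ((?P * Y) * (?P * Y')) = (s y * ?P)\<^sup>2 * X\<^sup>2"
        using X(1) unfolding u prod.distrib Y(1) Y'(1) unfolding s[of y] .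
      hence "?P\<^sup>2 * (u y * (Y * Y')) = ?P\<^sup>2 * ((s y)\<^sup>2 * X\<^sup>2)"
        by (simp add: algebra_simps power2_eq_square)
      hence eq: "u y * (Y * Y') = (s y)\<^sup>2 * X\<^sup>2" using Y(3) by simp
      have "Y \<noteq> 0" "Y' \<noteq> 0" using lt(2,3) d0(2) by auto
      hence "u y / (s y)\<^sup>2 = X\<^sup>2 / (Y * Y')" using eq snz[OF yb] by (simp add: field_simps)
      thus "cmod (u y / (s y)\<^sup>2 - 1) \<le> e" using d[OF lt] by simp
    qed
  qed
qed

text \<open>No factorisation theorem is involved: the partial products are compared with those of
  sine, whose limit is known, and \<open>h_limit\<close> says that the remaining quotients agree in
  the limit.\<close>

lemma QN_tendsto:
  assumes z: "Im z \<noteq> 0"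
  shows "(\<lambda>N. QN N z) \<longlonglongrightarrow> 1 - (\<Delta> z)\<^sup>2 / 4"
proof -
  have "\<exists>u s. quotients N u s" for N
  proof -
    obtain u where u: "u holomorphic_on UNIV"
      "\<And>z. 1 - (\<Delta> z)\<^sup>2 / 4 = u z * (\<Prod>m\<in>symi N. (of_real (lm m) - z) * (of_real (lp m) - z))"
      using \<Delta>_divide[of N] by blast
    obtain s where "s holomorphic_on UNIV" "\<And>z. sin z = s z * (\<Prod>m\<in>symi N. of_real (of_int m * pi) - z)"
      "\<And>z. \<bar>Re z\<bar> < (real N + 1) * pi \<Longrightarrow> s z \<noteq> 0" using sin_divide[of N] by blast
    with u show ?thesis unfolding quotients_def by blast
  qed
  then obtain u s where us: "\<And>N. quotients N (u N) (s N)" by metis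
  have sz: "sin z \<noteq> 0" using z by (auto simp: sin_eq_0)
  have h: "(\<lambda>N. u N z / (s N z)\<^sup>2) \<longlonglongrightarrow> 1"
  proof (rule LIMSEQ_I)
    fix e :: real assume "e > 0"
    hence e2: "e / 2 > 0" by simp
    obtain N0 where N0: "\<And>N u s z. N \<ge> N0 \<Longrightarrow> quotients N u s \<Longrightarrow> z \<in> sq_box N \<Longrightarrow> cmod (u z / (s z)\<^sup>2 - 1) \<le> e / 2"
      by (rule h_limit[OF e2]) blast
    obtain N1 :: nat where N1: "cmod z \<le> real N1" using real_arch_simple by blast
    show "\<exists>N0. \<forall>N\<ge>N0. cmod (u N z / (s N z)\<^sup>2 - 1) < e"
    proof (intro exI[of _ "max N0 N1"] allI impI)
      fix N assume N: "max N0 N1 \<le> N"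
      have "real N1 \<le> real N" using N by simp
      hence "cmod z \<le> (real N + 1/2) * pi" using N1 X_ge(1)[of N] by linarith
      hence "z \<in> sq_box N" using abs_Re_le_cmod[of z] abs_Im_le_cmod[of z] unfolding sq_box_mem by linarith
      moreover have "N0 \<le> N" using N by simp
      ultimately have "cmod (u N z / (s N z)\<^sup>2 - 1) \<le> e / 2" by (intro N0[OF _ us])
      thus "cmod (u N z / (s N z)\<^sup>2 - 1) < e" using \<open>e > 0\<close> by linarith
    qed
  qed
  let ?S = "\<lambda>N. \<Prod>m\<in>symi N. (of_real (of_int m * pi) - z) / pi_idx m"
  have S: "?S \<longlonglongrightarrow> - sin z" by (rule sin_sym_prod)
  have eq: "QN N z * (u N z / (s N z)\<^sup>2) = (1 - (\<Delta> z)\<^sup>2 / 4) * (?S N)\<^sup>2 / (sin z)\<^sup>2" for N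
  proof -
    let ?I = "symi N"
    define L where "L = (\<Prod>m\<in>?I. (of_real (lm m) - z) * (of_real (lp m) - z))"
    define P where "P = (\<Prod>m\<in>?I. of_real (of_int m * pi) - z)"
    define p where "p = (\<Prod>m\<in>?I. pi_idx m)"
    have p0: "p \<noteq> 0" by (simp add: p_def prod_zero_iff)
    have Q: "QN N z = L / p\<^sup>2" by (simp add: QN_def L_def p_def prod_dividef prod_power_distrib)
    have S: "?S N = P / p" by (simp add: P_def p_def prod_dividef)
    have si: "sin z = s N z * P" using us[of N] by (simp add: quotients_def P_def)
    have De: "1 - (\<Delta> z)\<^sup>2 / 4 = u N z * L" using us[of N] by (simp only: quotients_def L_def)
    have "s N z \<noteq> 0" "P \<noteq> 0" using si sz by auto
    thus ?thesis unfolding Q S De si using p0 by (simp add: field_simps power_mult_distrib)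
  qed
  have "(\<lambda>N. (1 - (\<Delta> z)\<^sup>2 / 4) * (?S N)\<^sup>2 / (sin z)\<^sup>2 / (u N z / (s N z)\<^sup>2)) \<longlonglongrightarrow>
     (1 - (\<Delta> z)\<^sup>2 / 4) * (- sin z)\<^sup>2 / (sin z)\<^sup>2 / 1"
    by (intro tendsto_intros S h) (use sz in auto)
  hence lim: "(\<lambda>N. (1 - (\<Delta> z)\<^sup>2 / 4) * (?S N)\<^sup>2 / (sin z)\<^sup>2 / (u N z / (s N z)\<^sup>2)) \<longlonglongrightarrow> 1 - (\<Delta> z)\<^sup>2 / 4"
    using sz by simp
  have "\<forall>\<^sub>F N in sequentially. u N z / (s N z)\<^sup>2 \<in> - {0}" by (rule topological_tendstoD[OF h]) auto
  hence "\<forall>\<^sub>F N in sequentially. (1 - (\<Delta> z)\<^sup>2 / 4) * (?S N)\<^sup>2 / (sin z)\<^sup>2 / (u N z / (s N z)\<^sup>2) = QN N z"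
  proof eventually_elim
    case (elim N)
    hence nz: "u N z / (s N z)\<^sup>2 \<noteq> 0" by blast
    show ?case unfolding eq[symmetric] by (rule nonzero_mult_div_cancel_right[OF nz])
  qed
  thus ?thesis using lim by (rule Lim_transform_eventually[rotated])
qed

lemma PP_square:
  assumes "Im z \<noteq> 0" shows "(PP z)\<^sup>2 = 1 - (\<Delta> z)\<^sup>2 / 4"
proof -
  have g: "good z" by (rule good_Im[OF assms])
  have "(\<lambda>N. (PN N z)\<^sup>2) \<longlonglongrightarrow> (PP z)\<^sup>2" by (intro tendsto_power PN_tendsto g)
  thus ?thesis using QN_tendsto[OF assms] unfolding PN_square[OF g] by (rule LIMSEQ_unique)
qed

end

section \<open>Quasi-momentum and actions\<close>

text \<open>The loops are joined by a path run in both directions. The resulting loop winds zero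
  times around every point of \<open>G\<close> and around every point outside the convex set
  \<open>U\<close>, so the global Cauchy theorem applies.\<close>

lemma same_winding_same_integral:
  assumes U: "open U" "convex U" "closed G" "connected (U - G)" and f: "f holomorphic_on U - G"
    and 1: "valid_path g" "pathfinish g = pathstart g" "path_image g \<subseteq> U - G"
    and 2: "valid_path h" "pathfinish h = pathstart h" "path_image h \<subseteq> U - G"
    and w: "\<And>z. z \<in> G \<Longrightarrow> winding_number g z = winding_number h z"
  shows "contour_integral g f = contour_integral h f"
proof -
  have o: "open (U - G)" using U by (simp add: open_Diff)
  have "pathstart g \<in> U - G" "pathstart h \<in> U - G"
    using 1(3) 2(3) pathstart_in_path_image[of g] pathstart_in_path_image[of h] by blast+
  then obtain p where p: "polynomial_function p" "path_image p \<subseteq> U - G" "pathstart p = pathstart g"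
    "pathfinish p = pathstart h" using connected_open_polynomial_connected[OF o U(4)] by blast
  have vp: "valid_path p" using p(1) by (rule valid_path_polynomial_function)
  have int: "f contour_integrable_on r" if "valid_path r" "path_image r \<subseteq> U - G" for r
    by (rule contour_integrable_holomorphic_simple[OF f o that])
  define l where "l = g +++ p +++ reversepath h +++ reversepath p"
  have l: "valid_path l" "pathfinish l = pathstart l" "path_image l \<subseteq> U - G"
    unfolding l_def using 1 2 p vp by (auto simp: path_image_join)
  have wl: "winding_number l z = winding_number g z - winding_number h z"
    if "z \<notin> path_image g" "z \<notin> path_image h" "z \<notin> path_image p" for z
    unfolding l_def using that 1 2 p vp
    by (simp add: winding_number_join path_image_join winding_number_reversepath valid_path_imp_path)
  have "(f has_contour_integral 0) l"
  proof (rule Cauchy_theorem_global[OF o f l])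
    fix z assume z: "z \<notin> U - G"
    show "winding_number l z = 0"
    proof (cases "z \<in> U")
      case True
      hence "z \<in> G" using z by blast
      thus ?thesis using w z 1 2 p by (subst wl) auto
    next
      case False
      thus ?thesis
        using l by (intro winding_number_zero_outside[OF _ U(2)]) (auto simp: valid_path_imp_path)
    qed
  qed
  moreover have "(f has_contour_integral (contour_integral g f + (contour_integral p f + (- contour_integral h f + - contour_integral p f)))) l"
    unfolding l_def using 1 2 p vp
    by (intro has_contour_integral_join has_contour_integral_reversepath has_contour_integral_integral int) auto
  ultimately have "contour_integral g f + (contour_integral p f + (- contour_integral h f + - contour_integral p f)) = 0"
    using has_contour_integral_unique by blast
  thus ?thesis by (simp add: algebra_simps)
qed

lemma has_contour_integral_linepath_same_Im_iff:
  assumes "a < b"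
  shows "(f has_contour_integral I) (linepath (Complex a y) (Complex b y)) \<longleftrightarrow>
    ((\<lambda>t. f (Complex t y)) has_integral I) {a..b}"
proof -
  have "linepath (Complex a y) (Complex b y) = (+) (\<i> * of_real y) \<circ> linepath (of_real a) (of_real b)"
    by (auto simp: fun_eq_iff linepath_def complex_eq_iff algebra_simps)
  hence "(f has_contour_integral I) (linepath (Complex a y) (Complex b y)) \<longleftrightarrow>
    ((\<lambda>t. f (t + \<i> * of_real y)) has_contour_integral I) (linepath (of_real a) (of_real b))"
    by (simp only: has_contour_integral_translate)
  also have "... \<longleftrightarrow> ((\<lambda>t. f (of_real t + \<i> * of_real y)) has_integral I) {a..b}"
    by (subst has_contour_integral_linepath_Reals_iff) (use assms in auto)
  finally show ?thesis by (simp add: Complex_eq)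
qed

context smooth_potential
begin

section \<open>The quasi-momentum in the upper half plane\<close>

abbreviation (input) upper :: "complex set" where "upper \<equiv> {z. Im z > 0}"

lemma open_upper: "open upper" by (rule open_halfspace_Im_gt)
lemma convex_upper: "convex upper" by (rule convex_halfspace_Im_gt)

text \<open>Chosen pointwise from Brouwer's theorem, hence without any regularity in
  \<open>z\<close>; that is recovered afterwards from the eigenvalue \<open>ww\<close>.\<close>

definition cc :: "complex \<Rightarrow> complex" where "cc z = (SOME c. cmod c \<le> 1 \<and> \<sigma> z c 1 = c)"
definition kk :: "complex \<Rightarrow> complex" where "kk z = K z (cc z)"
definition ww :: "complex \<Rightarrow> complex" where "ww z = uu True z (cc z) 1"

lemma cc: assumes "Im z > 0" shows "cmod (cc z) \<le> 1" "\<sigma> z (cc z) 1 = cc z"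
proof -
  have "Im z \<ge> 0" using assms by simp
  then obtain c where "cmod c \<le> 1 \<and> \<sigma> z c 1 = c" by (rule \<sigma>_fixed_point) blast
  hence "cmod (cc z) \<le> 1 \<and> \<sigma> z (cc z) 1 = cc z" unfolding cc_def by (rule someI)
  thus "cmod (cc z) \<le> 1" "\<sigma> z (cc z) 1 = cc z" by auto
qed

lemma ww_eq:
  assumes "Im z > 0"
  shows "cmod (ww z) > 1" "(ww z)\<^sup>2 - \<Delta> z * ww z + 1 = 0" "exp (- \<i> * kk z) = ww z"
    "\<Delta> z = 2 * cos (kk z)" "uu False z (cc z) 1 = cc z * ww z"
  using fixed_point_hyperbolic(2)[OF assms cc[OF assms]] fixed_point_eigenvalue[OF less_imp_le[OF assms] cc[OF assms]]
    exp_K[OF less_imp_le[OF assms] cc(1)[OF assms]] \<Delta>_eq_cos[OF less_imp_le[OF assms] cc[OF assms]]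
  by (simp_all add: ww_def kk_def)

lemma Im_kk: assumes "Im z > 0" shows "Im (kk z) > 0"
proof -
  have "cmod (ww z) = exp (Im (kk z))" unfolding ww_eq(3)[OF assms, symmetric] by simp
  thus ?thesis using ww_eq(1)[OF assms] by simp
qed

lemma kk_bound: "Im z > 0 \<Longrightarrow> cmod (kk z - z) \<le> Q1"
  unfolding kk_def by (rule K_bound[OF less_imp_le cc(1)])

text \<open>Allows the eigenvector equation to be solved for \<open>cc\<close>. In the case of
  equality the upper left entry of the monodromy matrix would be the inverse of \<open>ww\<close>,
  but its modulus is at least one because \<open>EE\<close> grows from the value one at
  \<open>c = 0\<close>.\<close>

lemma ww_ne: assumes "Im z > 0" shows "ww z \<noteq> fm False False z 1"
proof
  assume eq: "ww z = fm False False z 1"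
  have C: "fm False True z 1 = 0" using ww_eq(5)[OF assms] unfolding eq by (simp add: uu_def)
  hence AD: "fm True True z 1 * ww z = 1" using fm_det[of 1 z] by (simp add: eq)
  have "EE z 0 0 \<le> EE z 0 1" by (rule EE_mono) (use assms in auto)
  hence "1 \<le> (cmod (fm True True z 1))\<^sup>2" by (simp add: EE_def uu_def C fm_0)
  hence "1 \<le> cmod (fm True True z 1)" by (metis norm_ge_zero one_le_power power_one linorder_le_less_linear power_less_one_iff zero_less_numeral not_less)
  hence "1 * 1 < cmod (fm True True z 1) * cmod (ww z)"
    using ww_eq(1)[OF assms] by (intro mult_le_less_imp_less) auto
  thus False using AD by (metis less_irrefl mult_1 norm_mult norm_one)
qed

text \<open>On the simply connected half plane \<open>\<Delta>\<^sup>2 - 4\<close> has a holomorphic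
  root, giving two candidates with product one and moduli different from one. By connectedness the
  candidate outside the unit circle is the same everywhere.\<close>

lemma ww_holomorphic: "ww holomorphic_on upper"
proof -
  have nz: "(\<Delta> z)\<^sup>2 - 4 \<noteq> 0" if "z \<in> upper" for z using \<Delta>_not_4[of z] that by simp
  have "(\<lambda>z. (\<Delta> z)\<^sup>2 - 4) holomorphic_on upper" by (intro holomorphic_intros)
  from contractible_imp_holomorphic_sqrt[OF this convex_imp_contractible[OF convex_upper] nz]
  obtain r where r: "r holomorphic_on upper" "\<And>z. z \<in> upper \<Longrightarrow> (\<Delta> z)\<^sup>2 - 4 = (r z)\<^sup>2" by auto
  let ?w = "\<lambda>s z. (\<Delta> z + s * r z) / 2"
  have h: "?w s holomorphic_on upper" for s by (intro holomorphic_intros r) auto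
  have p1: "?w 1 z * ?w (-1) z = 1" if "z \<in> upper" for z
    using r(2)[OF that] by (simp add: algebra_simps power2_eq_square)
  have c: "ww z = ?w 1 z \<or> ww z = ?w (-1) z" if z: "z \<in> upper" for z
  proof -
    have "(ww z - ?w 1 z) * (ww z - ?w (-1) z) = (ww z)\<^sup>2 - \<Delta> z * ww z + ((\<Delta> z)\<^sup>2 - (r z)\<^sup>2) / 4"
      by (simp add: field_simps power2_eq_square)
    also have "... = 0" unfolding r(2)[OF z, symmetric] using ww_eq(2)[of z] z by simp
    finally show ?thesis by auto
  qed
  have ne1: "cmod (?w 1 z) \<noteq> 1" if z: "z \<in> upper" for z using p1[OF z] c[OF z] ww_eq(1)[of z] z
    by (metis less_irrefl mem_Collect_eq mult_1 norm_mult norm_one)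
  have conn: "connected ((\<lambda>z. cmod (?w 1 z)) ` upper)"
    by (rule connected_continuous_image[OF continuous_on_norm[OF holomorphic_on_imp_continuous_on[OF h]]
      convex_connected[OF convex_upper]])
  have "(\<forall>z\<in>upper. cmod (?w 1 z) > 1) \<or> (\<forall>z\<in>upper. cmod (?w 1 z) < 1)"
  proof (rule ccontr)
    assume "\<not> ?thesis"
    then obtain x y where xy: "x \<in> upper" "y \<in> upper" "cmod (?w 1 x) \<le> 1" "1 \<le> cmod (?w 1 y)"
      by (auto simp: not_less)
    have "1 \<in> (\<lambda>z. cmod (?w 1 z)) ` upper"
      using connectedD_interval[OF conn _ _ xy(3,4)] xy by blast
    thus False using ne1 by (auto)
  qed
  hence "(\<forall>z\<in>upper. ww z = ?w 1 z) \<or> (\<forall>z\<in>upper. ww z = ?w (-1) z)"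
  proof
    assume a: "\<forall>z\<in>upper. cmod (?w 1 z) > 1"
    have "ww z = ?w 1 z" if z: "z \<in> upper" for z
    proof -
      have "ww z \<noteq> ?w (-1) z"
      proof
        assume "ww z = ?w (-1) z"
        hence "cmod (?w 1 z) * cmod (ww z) = 1" using p1[OF z] by (metis norm_mult norm_one)
        moreover have "1 * 1 < cmod (?w 1 z) * cmod (ww z)"
          using ww_eq(1)[of z] a z by (intro mult_strict_mono) auto
        ultimately show False by simp
      qed
      thus ?thesis using c[OF z] by blast
    qed
    thus ?thesis by blast
  next
    assume a: "\<forall>z\<in>upper. cmod (?w 1 z) < 1"
    thus ?thesis using c ww_eq(1) by (metis less_asym mem_Collect_eq)
  qed
  thus ?thesis
  proof
    assume "\<forall>z\<in>upper. ww z = ?w 1 z"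
    thus ?thesis using h[of 1] by (metis (no_types, lifting) holomorphic_transform)
  next
    assume "\<forall>z\<in>upper. ww z = ?w (-1) z"
    thus ?thesis using h[of "-1"] by (metis (no_types, lifting) holomorphic_transform)
  qed
qed

text \<open>Continuity passes from the eigenvalue to the fixed point through the eigenvector
  equation, and from there to the integral \<open>K\<close>. This makes \<open>kk\<close> one
  continuous branch of the logarithm.\<close>

lemma continuous_on_kk: "continuous_on upper kk"
proof -
  have eq: "cc z = fm False True z 1 / (ww z - fm False False z 1)" if "z \<in> upper" for z
    using ww_eq(5)[of z] ww_ne[of z] that by (simp add: uu_def field_simps)
  have "continuous_on upper (\<lambda>z. fm False True z 1 / (ww z - fm False False z 1))"
    by (intro continuous_intros holomorphic_on_imp_continuous_on[OF ww_holomorphic]) (use ww_ne in auto)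
  hence "continuous_on upper cc" by (rule continuous_on_eq) (use eq in auto)
  thus ?thesis unfolding kk_def by (intro continuous_intros) (use cc in auto)
qed

lemma kk_holomorphic: "kk holomorphic_on upper"
proof -
  have "(\<lambda>z. - \<i> * kk z) holomorphic_on upper"
  proof (rule holomorphic_onI)
    fix z assume z: "z \<in> upper"
    have "(ww has_field_derivative deriv ww z) (at z)"
      by (rule holomorphic_derivI[OF ww_holomorphic open_upper z])
    hence "(ww has_derivative (*) (deriv ww z)) (at z within upper)"
      unfolding has_field_derivative_def by (rule has_derivative_at_withinI)
    moreover have "continuous (at z within upper) (\<lambda>z. - \<i> * kk z)"
      using continuous_on_mult_left[OF continuous_on_kk, of "- \<i>"] z by (simp add: continuous_on_eq_continuous_within)
    ultimately have "((\<lambda>z. - \<i> * kk z) has_derivative (\<lambda>h. deriv ww z * h / ww z)) (at z within upper)"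
      by (intro has_derivative_log z) (use ww_eq(3) in auto)
    hence "((\<lambda>z. - \<i> * kk z) has_field_derivative deriv ww z / ww z) (at z within upper)"
      unfolding has_field_derivative_def by (rule has_derivative_eq_rhs) (simp add: fun_eq_iff)
    thus "(\<lambda>z. - \<i> * kk z) field_differentiable at z within upper"
      unfolding field_differentiable_def by blast
  qed
  hence "(\<lambda>z. \<i> * (- \<i> * kk z)) holomorphic_on upper" by (rule holomorphic_on_mult[OF holomorphic_on_const])
  moreover have "(\<lambda>z. \<i> * (- \<i> * kk z)) = kk" by (simp add: fun_eq_iff flip: mult.assoc)
  ultimately show ?thesis by (simp only:)
qed

lemma kk_deriv: "Im z > 0 \<Longrightarrow> (kk has_field_derivative deriv kk z) (at z)"
  by (rule holomorphic_derivI[OF kk_holomorphic open_upper]) simp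

lemma deriv_\<Delta>: assumes "Im z > 0" shows "deriv \<Delta> z = - 2 * sin (kk z) * deriv kk z"
proof -
  have "((\<lambda>z. 2 * cos (kk z)) has_field_derivative 2 * (- sin (kk z) * deriv kk z)) (at z)"
    using kk_deriv[OF assms] by (auto intro!: derivative_eq_intros)
  hence "(\<Delta> has_field_derivative 2 * (- sin (kk z) * deriv kk z)) (at z)"
    by (rule has_field_derivative_transform_within_open[OF _ open_upper]) (use assms ww_eq(4) in auto)
  thus ?thesis by (simp add: DERIV_imp_deriv)
qed

lemma sin_kk_nonzero: assumes "Im z > 0" shows "sin (kk z) \<noteq> 0"
proof
  assume "sin (kk z) = 0"
  hence "(cos (kk z))\<^sup>2 = 1" using sin_cos_squared_add[of "kk z"] by simp
  hence "(\<Delta> z)\<^sup>2 = 4" unfolding ww_eq(4)[OF assms] by (simp add: power_mult_distrib)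
  thus False using \<Delta>_not_4[of z] assms by simp
qed

text \<open>The sign \<open>\<epsilon>\<close> is not determined here: it disappears because the actions are nonnegative.\<close>

lemma PP_eq_sin:
  obtains \<epsilon> :: real where "\<epsilon> = 1 \<or> \<epsilon> = -1" "\<And>z. Im z > 0 \<Longrightarrow> PP z = of_real \<epsilon> * sin (kk z)"
proof -
  let ?f = "\<lambda>z. PP z / sin (kk z)"
  have "continuous_on upper PP"
    by (rule holomorphic_on_imp_continuous_on[OF PP_holomorphic[OF open_upper]]) (auto intro: good_Im)
  hence c: "continuous_on upper ?f"
    by (intro continuous_intros continuous_on_kk) (use sin_kk_nonzero in auto)
  have pm: "?f z = 1 \<or> ?f z = -1" if "z \<in> upper" for z
  proof -
    have z: "Im z > 0" using that by simp
    have "(PP z)\<^sup>2 = 1 - (cos (kk z))\<^sup>2"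
      using PP_square[of z] z ww_eq(4)[OF z] by (simp add: power_mult_distrib)
    hence "(PP z)\<^sup>2 = (sin (kk z))\<^sup>2" by (simp add: sin_squared_eq)
    thus ?thesis using sin_kk_nonzero[OF z] by (auto simp: power2_eq_iff)
  qed
  have "?f constant_on upper"
    by (rule continuous_finite_range_constant[OF convex_connected[OF convex_upper] c])
       (rule finite_subset[of _ "{1,-1}"], use pm in blast, simp)
  then obtain e where e: "\<And>z. z \<in> upper \<Longrightarrow> ?f z = e" unfolding constant_on_def by blast
  have "e = 1 \<or> e = -1" using pm[of \<i>] e[of \<i>] by auto
  moreover have "PP z = e * sin (kk z)" if "Im z > 0" for z
    using e[of z] sin_kk_nonzero[OF that] that by (simp add: field_simps)
  ultimately show ?thesis using that[of 1] that[of "-1"] by auto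
qed

section \<open>Contour integrals around a gap\<close>

definition bp :: "int \<Rightarrow> real" where "bp n = (lp (n - 1) + lm n) / 2"

lemma bp: "lp (n - 1) < bp n" "bp n < lm n" "bp n < bp (n + 1)"
proof -
  have l: "lp (n - 1) < lm n" "lp n < lm (n + 1)" using lp_less_lm[of "n - 1" n] lp_less_lm[of n "n + 1"] by auto
  show 1: "lp (n - 1) < bp n" "bp n < lm n" using l by (simp_all add: bp_def)
  have "lp n < bp (n + 1)" using l by (simp add: bp_def)
  thus "bp n < bp (n + 1)" using 1 lm_le_lp[of n] by linarith
qed

definition strip :: "int \<Rightarrow> complex set" where "strip n = {z. lp (n - 1) < Re z \<and> Re z < lm (n + 1)}"

lemma strip_good: assumes "z \<in> strip n - gap pot n" shows "good z" unfolding good_def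
proof
  fix m
  have lp: "lp m \<le> lp (n - 1)" if "m < n"
    using lp_less_lm[of m "n - 1"] lm_le_lp[of "n - 1"] that by (cases "m = n - 1") auto
  have lm: "lm (n + 1) \<le> lm m" if "n < m"
    using lp_less_lm[of "n + 1" m] lm_le_lp[of "n + 1"] that by (cases "m = n + 1") auto
  consider "m < n" | "m = n" | "n < m" by linarith
  thus "z \<notin> gap pot m" using assms lp lm by cases (auto simp: mem_gap strip_def)
qed

text \<open>The strip without its gap is covered by four convex pieces, above, below, left and
  right, which overlap in turn; this gives connectedness.\<close>

lemma strip_props:
  shows "open (strip n)" "convex (strip n)" "closed (gap pot n)" "connected (strip n - gap pot n)"
    "open (strip n - gap pot n)"
proof -
  have eq: "strip n = {z. Re z > lp (n - 1)} \<inter> {z. Re z < lm (n + 1)}" by (auto simp: strip_def)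
  show o: "open (strip n)" unfolding eq by (intro open_Int open_halfspace_Re_gt open_halfspace_Re_lt)
  show "convex (strip n)" unfolding eq by (intro convex_Int convex_halfspace_Re_gt convex_halfspace_Re_lt)
  show c: "closed (gap pot n)" by (simp add: gap_def)
  show "open (strip n - gap pot n)" by (intro open_Diff o c)
  let ?A = "strip n \<inter> {z. Im z > 0}" and ?B = "strip n \<inter> {z. Im z < 0}"
  let ?L = "strip n \<inter> {z. Re z < lm n}" and ?R = "strip n \<inter> {z. Re z > lp n}"
  have cv: "convex ?A" "convex ?B" "convex ?L" "convex ?R"
    unfolding eq by (intro convex_Int convex_halfspace_Re_gt convex_halfspace_Re_lt
      convex_halfspace_Im_gt convex_halfspace_Im_lt)+
  have l: "lp (n - 1) < bp n" "bp n < lm n" "lp n < bp (n + 1)" "bp (n + 1) < lm (n + 1)" "lm n \<le> lp n"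
    using bp[of n] bp[of "n + 1"] lm_le_lp[of n] by auto
  have "Complex (bp n) 1 \<in> ?A \<inter> ?L" "Complex (bp n) (-1) \<in> (?A \<union> ?L) \<inter> ?B"
    "Complex (bp (n + 1)) 1 \<in> (?A \<union> ?L \<union> ?B) \<inter> ?R" using l by (auto simp: strip_def)
  hence "connected (?A \<union> ?L \<union> ?B \<union> ?R)" by (intro connected_Un convex_connected cv) blast+
  also have "?A \<union> ?L \<union> ?B \<union> ?R = strip n - gap pot n" by (auto simp: mem_gap not_le)
  finally show "connected (strip n - gap pot n)" .
qed

lemma bp_strip: "Re z = bp n \<Longrightarrow> z \<in> strip n - gap pot n" "Re z = bp (n + 1) \<Longrightarrow> z \<in> strip n - gap pot n"
  using bp[of n] bp[of "n + 1"] lm_le_lp[of n] by (auto simp: strip_def mem_gap)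

text \<open>At real points of the two adjacent bands the identity is a limit from the upper half
  plane, as \<open>PP\<close> is holomorphic across them.\<close>

lemma PP_square_strip: assumes z: "z \<in> strip n - gap pot n" shows "(PP z)\<^sup>2 = 1 - (\<Delta> z)\<^sup>2 / 4"
proof (cases "Im z = 0")
  case True
  have "continuous_on (strip n - gap pot n) PP"
    by (intro holomorphic_on_imp_continuous_on PP_holomorphic strip_props strip_good)
  hence "isCont PP z" using z strip_props(5) by (simp add: continuous_on_eq_continuous_at)
  moreover have "isCont \<Delta> z"
    using holomorphic_on_imp_continuous_on[OF \<Delta>_holomorphic[of UNIV]] by (simp add: continuous_on_eq_continuous_at)
  ultimately have c: "isCont (\<lambda>z. (PP z)\<^sup>2 - (1 - (\<Delta> z)\<^sup>2 / 4)) z" by (intro continuous_intros) auto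
  have t: "((\<lambda>y. z + \<i> * of_real y) \<longlongrightarrow> z) (at_right 0)" by (auto intro!: tendsto_eq_intros)
  have "((\<lambda>y. (PP (z + \<i> * of_real y))\<^sup>2 - (1 - (\<Delta> (z + \<i> * of_real y))\<^sup>2 / 4)) \<longlongrightarrow> (PP z)\<^sup>2 - (1 - (\<Delta> z)\<^sup>2 / 4)) (at_right 0)"
    by (rule isCont_tendsto_compose[OF c t])
  moreover have "\<forall>\<^sub>F y in at_right 0. (PP (z + \<i> * of_real y))\<^sup>2 - (1 - (\<Delta> (z + \<i> * of_real y))\<^sup>2 / 4) = 0"
    unfolding eventually_at_right_field by (intro exI[of _ 1]) (auto simp: PP_square True)
  hence "((\<lambda>y. (PP (z + \<i> * of_real y))\<^sup>2 - (1 - (\<Delta> (z + \<i> * of_real y))\<^sup>2 / 4)) \<longlongrightarrow> 0) (at_right 0)"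
    by (rule tendsto_eventually)
  ultimately have "(PP z)\<^sup>2 - (1 - (\<Delta> z)\<^sup>2 / 4) = 0" by (rule tendsto_unique[rotated]) simp
  thus ?thesis by simp
qed (rule PP_square)

lemma band_point: assumes "z \<in> strip n - gap pot n" "Im z = 0" shows "\<bar>Re (ma (Re z))\<bar> < 1"
proof (rule band_\<Delta>)
  fix m show "Re z \<notin> GG m"
    using lm_le[of "Re z" m] lp_ge[of "Re z" m] strip_good[OF assms(1)] assms(2) by (auto simp: good_def mem_gap)
qed

lemma PP_nonzero: assumes z: "z \<in> strip n - gap pot n" shows "PP z \<noteq> 0"
proof (cases "Im z = 0")
  case True
  hence "z = of_real (Re z)" by (simp add: complex_eq_iff)
  hence "(\<Delta> z)\<^sup>2 \<noteq> 4" using \<Delta>_sq_real[of "Re z"] band_point[OF z True] by (metis less_irrefl)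
  thus ?thesis using PP_square_strip[OF z] by auto
next
  case False
  thus ?thesis using PP_square[OF False] \<Delta>_not_4[OF False] by auto
qed

definition act :: "complex \<Rightarrow> complex"
  where "act z = z * deriv \<Delta> z / (2 * \<i> * PP z)"

lemma act_eq: "good z \<Longrightarrow> act z = z * deriv (discriminant pot) z / canonical_root pot z"
  by (simp add: act_def discriminant_eq canonical_root_eq)

lemma act_holomorphic: "act holomorphic_on strip n - gap pot n" unfolding act_def[abs_def]
  by (intro holomorphic_intros PP_holomorphic strip_props holomorphic_deriv strip_good)
     (use PP_nonzero in auto)

lemma deriv_\<Delta>_cnj: "deriv \<Delta> (cnj z) = cnj (deriv \<Delta> z)"
proof -
  have "(\<Delta> has_field_derivative deriv \<Delta> z) (at z)"
    using \<Delta>_holomorphic[of UNIV] by (simp add: holomorphic_derivI)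
  hence "(cnj \<circ> \<Delta> \<circ> cnj has_field_derivative cnj (deriv \<Delta> z)) (at (cnj z))"
    by (intro has_field_derivative_cnj_cnj) simp
  moreover have "cnj \<circ> \<Delta> \<circ> cnj = \<Delta>" by (simp add: fun_eq_iff \<Delta>_cnj)
  ultimately show ?thesis by (simp add: DERIV_imp_deriv)
qed

text \<open>The factor \<open>\<i>\<close> in the denominator makes the integrand odd under
  conjugation, so the two horizontal edges of a symmetric rectangle together contribute a real
  number.\<close>

lemma act_cnj: "good z \<Longrightarrow> act (cnj z) = - cnj (act z)" by (simp add: act_def deriv_\<Delta>_cnj PP_cnj)

definition rect :: "int \<Rightarrow> real \<Rightarrow> real \<Rightarrow> complex"
  where "rect n y = rectpath (Complex (bp n) (- y)) (Complex (bp (n + 1)) y)"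

lemma rect:
  assumes "y > 0"
  shows "valid_path (rect n y)" "pathfinish (rect n y) = pathstart (rect n y)"
    "path_image (rect n y) \<subseteq> strip n - gap pot n" "\<And>z. z \<in> gap pot n \<Longrightarrow> winding_number (rect n y) z = 1"
proof -
  show "valid_path (rect n y)" "pathfinish (rect n y) = pathstart (rect n y)" by (simp_all add: rect_def)
  have b: "lp (n - 1) < bp n" "bp n < lm n" "lp n < bp (n + 1)" "bp (n + 1) < lm (n + 1)" "lm n \<le> lp n"
    using bp[of n] bp[of "n + 1"] lm_le_lp[of n] by auto
  show "path_image (rect n y) \<subseteq> strip n - gap pot n"
    unfolding rect_def using assms b by (subst path_image_rectpath) (auto simp: strip_def mem_gap)
  show "winding_number (rect n y) z = 1" if "z \<in> gap pot n" for z
    unfolding rect_def using assms b that by (intro winding_number_rectpath) (auto simp: in_box_complex_iff mem_gap)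
qed

lemma act_integrable:
  "valid_path g \<Longrightarrow> path_image g \<subseteq> strip n - gap pot n \<Longrightarrow> act contour_integrable_on g"
  by (rule contour_integrable_holomorphic_simple[OF act_holomorphic strip_props(5)])

lemma act_winding:
  assumes g: "valid_path g" "pathfinish g = pathstart g" "path_image g \<subseteq> strip n - gap pot n"
    "\<And>z. z \<in> gap pot n \<Longrightarrow> winding_number g z = 1" and y: "y > 0"
  shows "contour_integral g act = contour_integral (rect n y) act"
  by (rule same_winding_same_integral[OF strip_props(1-4) act_holomorphic g(1-3) rect(1-3)[OF y]])
     (simp add: g(4) rect(4)[OF y])

text \<open>Circuits closer to the gap than its neighbours stay in the punctured strip, so they all
  give the integral over the rectangle. For uniqueness of the described value, a thin rectangle is
  exhibited that is a circuit for both admissible distances.\<close>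

lemma action_eq_rect:
  assumes y: "y > 0"
  shows "action pot n = contour_integral (rect n y) act / of_real pi"
proof -
  let ?G = "\<lambda>\<mu>. \<mu> * deriv (discriminant pot) \<mu> / canonical_root pot \<mu>"
  let ?v = "contour_integral (rect n y) act"
  define e0 where "e0 = min (lm n - lp (n - 1)) (lm (n + 1) - lp n)"
  have e0: "e0 > 0" using lp_less_lm[of "n - 1" n] lp_less_lm[of n "n + 1"] by (simp add: e0_def)
  have circ: "(?G has_contour_integral ?v) g"
    if g: "gap_circuit pot n e0 g" for g
  proof -
    have g1: "valid_path g" "pathfinish g = pathstart g" "\<And>z. z \<in> gap pot n \<Longrightarrow> winding_number g z = 1"
      using g by (auto simp: gap_circuit_def)
    have g2: "path_image g \<subseteq> strip n - gap pot n"
    proof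
      fix z assume "z \<in> path_image g"
      hence z: "z \<notin> gap pot n" "infdist z (gap pot n) < e0" using g by (auto simp: gap_circuit_def)
      have "gap pot n \<noteq> {}" by (simp add: gap_def)
      from infdist_attains_inf[OF strip_props(3) this] obtain x where x: "x \<in> gap pot n" "infdist z (gap pot n) = dist z x"
        by blast
      have "\<bar>Re z - Re x\<bar> < e0" using z x abs_Re_le_cmod[of "z - x"] by (simp add: dist_norm)
      moreover have "lm n \<le> Re x" "Re x \<le> lp n" using x by (auto simp: mem_gap)
      ultimately have "z \<in> strip n" unfolding strip_def e0_def mem_Collect_eq min_less_iff_conj by linarith
      thus "z \<in> strip n - gap pot n" using z by blast
    qed
    have "(act has_contour_integral contour_integral g act) g"
      by (rule has_contour_integral_integral[OF act_integrable[OF g1(1) g2]])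
    hence "(act has_contour_integral ?v) g" using act_winding[OF g1(1,2) g2 g1(3) y] by simp
    thus ?thesis by (rule has_contour_integral_eq) (use g2 strip_good act_eq in blast)
  qed
  have "(THE v. \<exists>\<epsilon>>0. \<forall>\<Gamma>. gap_circuit pot n \<epsilon> \<Gamma> \<longrightarrow> (?G has_contour_integral v) \<Gamma>) = ?v"
  proof (rule the_equality)
    show "\<exists>\<epsilon>>0. \<forall>\<Gamma>. gap_circuit pot n \<epsilon> \<Gamma> \<longrightarrow> (?G has_contour_integral ?v) \<Gamma>" using e0 circ by blast
    fix v assume "\<exists>\<epsilon>>0. \<forall>\<Gamma>. gap_circuit pot n \<epsilon> \<Gamma> \<longrightarrow> (?G has_contour_integral v) \<Gamma>"
    then obtain e where e: "e > 0" "\<And>\<Gamma>. gap_circuit pot n e \<Gamma> \<Longrightarrow> (?G has_contour_integral v) \<Gamma>" by blast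
    define d where "d = min e e0 / 4"
    have d: "d > 0" "2 * d < e" "2 * d < e0" using e(1) e0 by (simp_all add: d_def)
    define g where "g = rectpath (Complex (lm n - d) (- d)) (Complex (lp n + d) d)"
    have l: "lm n \<le> lp n" by (rule lm_le_lp)
    have gi: "\<bar>Im z\<bar> \<le> d" "lm n - d \<le> Re z" "Re z \<le> lp n + d" "z \<notin> gap pot n" if "z \<in> path_image g" for z
      using that d(1) l unfolding g_def by (subst (asm) path_image_rectpath; auto simp: mem_gap)+
    have near: "infdist z (gap pot n) \<le> 2 * d" if z: "z \<in> path_image g" for z
    proof -
      define t where "t = max (lm n) (min (lp n) (Re z))"
      have "of_real t \<in> gap pot n" using l by (auto simp: mem_gap t_def)
      hence "infdist z (gap pot n) \<le> dist z (of_real t)" by (rule infdist_le)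
      also have "... \<le> \<bar>Re z - t\<bar> + \<bar>Im z\<bar>" using cmod_le[of "z - of_real t"] by (simp add: dist_norm)
      also have "\<bar>Re z - t\<bar> \<le> d" using gi(2,3)[OF z] l d(1) by (simp add: t_def max_def min_def)
      finally show ?thesis using gi(1)[OF z] by linarith
    qed
    have gc: "gap_circuit pot n E g" if "2 * d < E" for E unfolding gap_circuit_def
    proof (intro conjI ballI)
      show "simple_path g" unfolding g_def using d(1) l by (intro simple_path_rectpath) auto
      show "winding_number g z = 1" if "z \<in> gap pot n" for z
        unfolding g_def using d(1) that by (intro winding_number_rectpath) (auto simp: in_box_complex_iff mem_gap)
      show "infdist z (gap pot n) < E" if "z \<in> path_image g" for z using near[OF that] \<open>2 * d < E\<close> by linarith
    qed (use gi(4) in \<open>auto simp: g_def\<close>)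
    show "v = ?v" using has_contour_integral_unique[OF e(2)[OF gc[OF d(2)]] circ[OF gc[OF d(3)]]] .
  qed
  thus ?thesis by (simp add: action_def)
qed

text \<open>With \<open>x\<close> the modulus of the eigenvalue \<open>w\<close>, the point
  \<open>\<Delta> = w + 1 / w\<close> lies on an ellipse with foci 2 and -2 whose focal distances
  add up to \<open>2 * (x + 1 / x)\<close>. Over a band this sum tends to 4, which forces
  \<open>x\<close> to 1 without any control of the real part of \<open>kk\<close>.\<close>

lemma Im_kk_tendsto:
  assumes t: "\<bar>Re (ma t)\<bar> < 1"
  shows "((\<lambda>y. Im (kk (Complex t y))) \<longlongrightarrow> 0) (at_right 0)"
proof -
  let ?s = "\<lambda>y. (cmod (\<Delta> (Complex t y) - 2) + cmod (\<Delta> (Complex t y) + 2)) / 2"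
  have ln: "Im (kk (Complex t y)) = ln ((?s y + sqrt ((?s y)\<^sup>2 - 4)) / 2)" if "y > 0" for y
  proof -
    define w where "w = ww (Complex t y)"
    define x where "x = cmod w"
    have i: "Im (Complex t y) > 0" using that by simp
    have x1: "x > 1" "x = exp (Im (kk (Complex t y)))"
      using ww_eq(1)[OF i] arg_cong[OF ww_eq(3)[OF i], of cmod] by (simp_all add: x_def w_def)
    have w0: "w \<noteq> 0" using x1 by (auto simp: x_def)
    have "w * \<Delta> (Complex t y) = w\<^sup>2 + 1" using ww_eq(2)[OF i] by (simp add: w_def algebra_simps)
    hence "\<Delta> (Complex t y) - 2 = (w - 1)\<^sup>2 / w" "\<Delta> (Complex t y) + 2 = (w + 1)\<^sup>2 / w"
      using w0 by (simp_all add: field_simps power2_eq_square)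
    hence "?s y = ((cmod (w - 1))\<^sup>2 + (cmod (w + 1))\<^sup>2) / x / 2"
      by (simp add: norm_divide norm_power x_def add_divide_distrib)
    also have "(cmod (w - 1))\<^sup>2 + (cmod (w + 1))\<^sup>2 = 2 * (x\<^sup>2 + 1)"
      unfolding x_def cmod_power2 by (simp add: power2_eq_square algebra_simps)
    finally have s: "?s y = x + 1 / x" using x1(1) by (simp add: field_simps power2_eq_square)
    have "(?s y)\<^sup>2 - 4 = (x - 1 / x)\<^sup>2" unfolding s using x1(1) by (simp add: field_simps power2_eq_square)
    moreover have "1 / x \<le> 1" using x1(1) by simp
    hence "x - 1 / x \<ge> 0" using x1(1) by linarith
    ultimately have "sqrt ((?s y)\<^sup>2 - 4) = x - 1 / x" by simp
    hence "(?s y + sqrt ((?s y)\<^sup>2 - 4)) / 2 = x" unfolding s by simp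
    thus ?thesis using x1(2) by (simp only: ln_exp)
  qed
  have cD: "isCont \<Delta> z" for z
    using holomorphic_on_imp_continuous_on[OF \<Delta>_holomorphic[of UNIV]] by (simp add: continuous_on_eq_continuous_at)
  have "((\<lambda>y. Complex t y) \<longlongrightarrow> Complex t 0) (at_right 0)" by (intro tendsto_Complex tendsto_const tendsto_ident_at)
  hence D: "((\<lambda>y. \<Delta> (Complex t y)) \<longlongrightarrow> of_real (2 * Re (ma t))) (at_right 0)"
    using isCont_tendsto_compose[OF cD, of _ "Complex t 0"] \<Delta>_real[of t] by (simp add: complex_of_real_def)
  have "(?s \<longlongrightarrow> (cmod (of_real (2 * Re (ma t)) - 2) + cmod (of_real (2 * Re (ma t)) + 2)) / 2) (at_right 0)"
    by (intro tendsto_intros D) auto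
  moreover have "(cmod (of_real (2 * Re (ma t)) - 2) + cmod (of_real (2 * Re (ma t)) + 2)) / 2 = 2"
  proof -
    have "cmod (of_real (2 * Re (ma t)) - 2) = 2 - 2 * Re (ma t)" "cmod (of_real (2 * Re (ma t)) + 2) = 2 + 2 * Re (ma t)"
      using abs_less_iff[THEN iffD1, OF t] norm_of_real[of "2 * Re (ma t) - 2", where 'a = complex]
        norm_of_real[of "2 * Re (ma t) + 2", where 'a = complex] by (simp_all del: norm_of_real)
    thus ?thesis by simp
  qed
  ultimately have s: "(?s \<longlongrightarrow> 2) (at_right 0)" by simp
  have "((\<lambda>y. ln ((?s y + sqrt ((?s y)\<^sup>2 - 4)) / 2)) \<longlongrightarrow> ln ((2 + sqrt (2\<^sup>2 - 4)) / 2)) (at_right 0)"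
    by (intro tendsto_intros s) auto
  hence "((\<lambda>y. ln ((?s y + sqrt ((?s y)\<^sup>2 - 4)) / 2)) \<longlongrightarrow> 0) (at_right 0)" by simp
  thus ?thesis
    by (rule Lim_transform_eventually) (use ln in \<open>auto simp: eventually_at_right_field intro!: exI[of _ 1]\<close>)
qed

lemma kk_line:
  assumes "y > 0" "a < b"
  shows "(\<lambda>t. kk (Complex t y)) integrable_on {a..b}"
    and "contour_integral (linepath (Complex a y) (Complex b y)) kk = integral {a..b} (\<lambda>t. kk (Complex t y))"
    and "path_image (linepath (Complex a y) (Complex b y)) \<subseteq> upper"
proof -
  show s: "path_image (linepath (Complex a y) (Complex b y)) \<subseteq> upper"
    unfolding path_image_linepath by (rule closed_segment_subset) (use assms convex_upper in auto)
  have "kk contour_integrable_on linepath (Complex a y) (Complex b y)"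
    by (rule contour_integrable_holomorphic_simple[OF kk_holomorphic open_upper valid_path_linepath s])
  from has_contour_integral_integral[OF this]
  have h: "((\<lambda>t. kk (Complex t y)) has_integral contour_integral (linepath (Complex a y) (Complex b y)) kk) {a..b}"
    unfolding has_contour_integral_linepath_same_Im_iff[OF assms(2)] .
  thus "(\<lambda>t. kk (Complex t y)) integrable_on {a..b}"
    "contour_integral (linepath (Complex a y) (Complex b y)) kk = integral {a..b} (\<lambda>t. kk (Complex t y))"
    by (auto simp: integral_unique has_integral_integrable)
qed

definition JJ :: "int \<Rightarrow> real \<Rightarrow> real"
  where "JJ n y = integral {bp n..bp (n + 1)} (\<lambda>t. Im (kk (Complex t y)))"

lemma JJ_nonneg: assumes "y > 0" shows "JJ n y \<ge> 0" unfolding JJ_def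
proof (rule integral_nonneg)
  show "(\<lambda>t. Im (kk (Complex t y))) integrable_on {bp n..bp (n + 1)}"
    using kk_line(1)[OF assms bp(3)[of n]] integrable_linear[OF _ bounded_linear_Im] by (simp add: o_def)
qed (use Im_kk[of "Complex _ y"] assms in \<open>simp add: less_imp_le\<close>)

text \<open>In the upper half plane the integrand is
  \<open>\<i> * of_real \<epsilon> * (z * deriv kk z)\<close>; integration by parts moves the
  derivative off \<open>kk\<close>.\<close>

lemma act_top:
  assumes y: "y > 0" and e: "\<epsilon> = 1 \<or> \<epsilon> = -1" "\<And>z. Im z > 0 \<Longrightarrow> PP z = of_real \<epsilon> * sin (kk z)" and ab: "a < b"
  shows "contour_integral (linepath (Complex a y) (Complex b y)) act =
    \<i> * of_real \<epsilon> * (Complex b y * kk (Complex b y) - Complex a y * kk (Complex a y) - integral {a..b} (\<lambda>t. kk (Complex t y)))"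
proof -
  let ?l = "linepath (Complex a y) (Complex b y)"
  have d: "((\<lambda>z. z * kk z) has_field_derivative kk z + z * deriv kk z) (at z within upper)" if "z \<in> upper" for z
    using has_field_derivative_at_within[OF DERIV_mult[OF DERIV_ident kk_deriv[of z]], of upper] that
    by (simp add: mult.commute)
  from contour_integral_primitive[OF d valid_path_linepath kk_line(3)[OF y ab]]
  have 1: "((\<lambda>z. kk z + z * deriv kk z) has_contour_integral (Complex b y * kk (Complex b y) - Complex a y * kk (Complex a y))) ?l"
    by simp
  have 2: "(kk has_contour_integral integral {a..b} (\<lambda>t. kk (Complex t y))) ?l"
    unfolding has_contour_integral_linepath_same_Im_iff[OF ab]
    using kk_line(1)[OF y ab] by (simp add: integrable_integral)
  have "((\<lambda>z. \<i> * of_real \<epsilon> * (kk z + z * deriv kk z - kk z)) has_contour_integral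
    \<i> * of_real \<epsilon> * (Complex b y * kk (Complex b y) - Complex a y * kk (Complex a y) - integral {a..b} (\<lambda>t. kk (Complex t y)))) ?l"
    by (intro has_contour_integral_lmul has_contour_integral_diff 1 2)
  hence "(act has_contour_integral
    \<i> * of_real \<epsilon> * (Complex b y * kk (Complex b y) - Complex a y * kk (Complex a y) - integral {a..b} (\<lambda>t. kk (Complex t y)))) ?l"
  proof (rule has_contour_integral_eq)
    fix z assume "z \<in> path_image ?l"
    hence z: "Im z > 0" using kk_line(3)[OF y ab] by blast
    have nz: "2 * \<i> * (of_real \<epsilon> * sin (kk z)) \<noteq> 0" using sin_kk_nonzero[OF z] e(1) by auto
    have ee: "complex_of_real \<epsilon> * of_real \<epsilon> = 1" using e(1) by auto
    have "\<i> * of_real \<epsilon> * (z * deriv kk z) * (2 * \<i> * (of_real \<epsilon> * sin (kk z))) =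
      (\<i> * \<i>) * (complex_of_real \<epsilon> * of_real \<epsilon>) * (2 * z * deriv kk z * sin (kk z))"
      by (simp only: ac_simps)
    also have "... = z * (- 2 * sin (kk z) * deriv kk z)" unfolding ee by simp
    finally have "\<i> * of_real \<epsilon> * (z * deriv kk z) = act z"
      unfolding act_def deriv_\<Delta>[OF z] e(2)[OF z] by (subst nonzero_eq_divide_eq[OF nz])
    thus "\<i> * of_real \<epsilon> * (kk z + z * deriv kk z - kk z) = act z" by simp
  qed
  thus ?thesis by (rule contour_integral_unique)
qed

text \<open>The vertical sides shrink to points of a band, near which the integrand is
  bounded.\<close>

lemma act_side:
  assumes x: "x = bp n \<or> x = bp (n + 1)"
  shows "\<exists>B. \<forall>y. 0 < y \<longrightarrow> y \<le> 1 \<longrightarrow>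
    cmod (contour_integral (linepath (Complex x (- y)) (Complex x y)) act) \<le> B * y \<and>
    cmod (contour_integral (linepath (Complex x y) (Complex x (- y))) act) \<le> B * y"
proof -
  let ?I = "closed_segment (Complex x (-1)) (Complex x 1)"
  have I: "?I = {z. Re z = x \<and> Im z \<in> {-1..1}}"
    by (subst closed_segment_same_Re) (simp_all add: closed_segment_eq_real_ivl)
  hence Re: "z \<in> ?I \<Longrightarrow> Re z = x" for z by simp
  have sub: "?I \<subseteq> strip n - gap pot n"
  proof
    fix z assume "z \<in> ?I"
    hence "Re z = bp n \<or> Re z = bp (n + 1)" using Re[of z] x by simp
    thus "z \<in> strip n - gap pot n" using bp_strip[of z n] by blast
  qed
  have "compact (act ` ?I)"
    by (intro compact_continuous_image continuous_on_subset[OF holomorphic_on_imp_continuous_on[OF act_holomorphic] sub]) simp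
  hence "\<exists>B. \<forall>z\<in>?I. cmod (act z) \<le> B" by (auto simp: bounded_iff dest!: compact_imp_bounded)
  then obtain B where B: "\<And>z. z \<in> ?I \<Longrightarrow> cmod (act z) \<le> B" by (elim exE) (rule that, erule bspec)
  have B0: "B \<ge> 0" using order_trans[OF norm_ge_zero B[of "Complex x 1"]] by simp
  show ?thesis
  proof (intro exI[of _ "2 * B"] allI impI conjI)
    fix y :: real assume y: "0 < y" "y \<le> 1"
    have sub2: "closed_segment (Complex x (- y)) (Complex x y) \<subseteq> ?I" "closed_segment (Complex x y) (Complex x (- y)) \<subseteq> ?I"
      unfolding I using y by (intro subsetI; subst (asm) closed_segment_same_Re; simp add: closed_segment_eq_real_ivl)+
    have bd: "cmod (contour_integral (linepath u v) act) \<le> B * cmod (v - u)" if "closed_segment u v \<subseteq> ?I" for u v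
    proof (rule contour_integral_bound_linepath)
      have "path_image (linepath u v) \<subseteq> strip n - gap pot n" unfolding path_image_linepath using that sub by (rule subset_trans)
      thus "act contour_integrable_on linepath u v" by (rule act_integrable[OF valid_path_linepath])
      show "cmod (act z) \<le> B" if "z \<in> closed_segment u v" for z
        by (rule B) (rule subsetD[OF \<open>closed_segment u v \<subseteq> ?I\<close> that])
    qed (rule B0)
    have n: "cmod (Complex x y - Complex x (- y)) = 2 * y" "cmod (Complex x (- y) - Complex x y) = 2 * y"
      using y by (simp_all add: cmod_def real_sqrt_mult)
    have "cmod (contour_integral (linepath (Complex x (- y)) (Complex x y)) act) \<le> B * cmod (Complex x y - Complex x (- y))"
      by (rule bd[OF sub2(1)])
    thus "cmod (contour_integral (linepath (Complex x (- y)) (Complex x y)) act) \<le> 2 * B * y" unfolding n by simp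
    have "cmod (contour_integral (linepath (Complex x y) (Complex x (- y))) act) \<le> B * cmod (Complex x (- y) - Complex x y)"
      by (rule bd[OF sub2(2)])
    thus "cmod (contour_integral (linepath (Complex x y) (Complex x (- y))) act) \<le> 2 * B * y" unfolding n by simp
  qed
qed

lemma Im_zk_tendsto:
  assumes t: "\<bar>Re (ma t)\<bar> < 1"
  shows "((\<lambda>y. Im (Complex t y * kk (Complex t y))) \<longlongrightarrow> 0) (at_right 0)"
proof -
  have "((\<lambda>y. y * Re (kk (Complex t y))) \<longlongrightarrow> 0) (at_right 0)"
  proof (rule Lim_null_comparison)
    show "\<forall>\<^sub>F y in at_right 0. norm (y * Re (kk (Complex t y))) \<le> y * (\<bar>t\<bar> + 1 + Q1)"
      unfolding eventually_at_right_field
    proof (intro exI[of _ 1] conjI allI impI)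
      fix y :: real assume y: "0 < y" "y < 1"
      have "\<bar>Re (kk (Complex t y) - Complex t y)\<bar> \<le> Q1"
        using order_trans[OF abs_Re_le_cmod kk_bound[of "Complex t y"]] y by simp
      hence "\<bar>Re (kk (Complex t y))\<bar> \<le> \<bar>t\<bar> + 1 + Q1" by simp
      thus "norm (y * Re (kk (Complex t y))) \<le> y * (\<bar>t\<bar> + 1 + Q1)" using y by (simp add: abs_mult)
    qed simp
    show "((\<lambda>y. y * (\<bar>t\<bar> + 1 + Q1)) \<longlongrightarrow> 0) (at_right 0)"
      by (rule tendsto_mult_left_zero) (rule tendsto_ident_at)
  qed
  from tendsto_add[OF tendsto_mult_right_zero[OF Im_kk_tendsto[OF t], of t] this]
  show ?thesis by (simp add: algebra_simps)
qed

text \<open>As the rectangle flattens, its sides contribute nothing, and neither do the boundary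
  terms of the integration by parts, whose imaginary parts tend to zero at band points. What remains
  is \<open>2 / pi * JJ n y\<close>, and nonnegativity of \<open>JJ\<close> removes the sign
  \<open>\<epsilon>\<close>.\<close>

lemma action_limit: "((\<lambda>y. 2 / pi * JJ n y) \<longlongrightarrow> \<bar>Re (action pot n)\<bar>) (at_right 0)"
proof -
  obtain \<epsilon> where e: "\<epsilon> = 1 \<or> \<epsilon> = -1" "\<And>z. Im z > 0 \<Longrightarrow> PP z = of_real \<epsilon> * sin (kk z)"
    using PP_eq_sin by blast
  define a b where "a = bp n" and "b = bp (n + 1)"
  have ab: "a < b" using bp(3)[of n] by (simp add: a_def b_def)
  define X where "X y = Im (Complex b y * kk (Complex b y)) - Im (Complex a y * kk (Complex a y))" for y
  define R where "R y = contour_integral (linepath (Complex b (- y)) (Complex b y)) act" for y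
  define L where "L y = contour_integral (linepath (Complex a y) (Complex a (- y))) act" for y
  have v: "of_real pi * action pot n = of_real (2 * \<epsilon> * (X y - JJ n y)) + R y + L y" if y: "y > 0" for y
  proof -
    let ?t = "linepath (Complex a y) (Complex b y)" and ?b = "linepath (Complex a (- y)) (Complex b (- y))"
    let ?T = "contour_integral ?t act"
    have sub: "path_image (rect n y) \<subseteq> strip n - gap pot n" by (rule rect[OF y])
    have r: "rect n y = ?b +++ linepath (Complex b (- y)) (Complex b y) +++ reversepath ?t +++ linepath (Complex a y) (Complex a (- y))"
      by (simp add: rect_def rectpath_def a_def b_def Let_def)
    have sb: "path_image ?b \<subseteq> strip n - gap pot n" "path_image (linepath (Complex b (- y)) (Complex b y)) \<subseteq> strip n - gap pot n"
      "path_image (reversepath ?t) \<subseteq> strip n - gap pot n" "path_image (linepath (Complex a y) (Complex a (- y))) \<subseteq> strip n - gap pot n"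
      using sub unfolding r by (simp_all add: path_image_join del: path_image_linepath)
    note sb = sb(1,2) sb(3)[unfolded path_image_reversepath] sb(4)
    have int: "act contour_integrable_on ?b" "act contour_integrable_on linepath (Complex b (- y)) (Complex b y)"
      "act contour_integrable_on ?t" "act contour_integrable_on linepath (Complex a y) (Complex a (- y))"
      by (rule act_integrable[OF valid_path_linepath], rule sb)+
    have "(act has_contour_integral contour_integral ?b act + (R y + (- ?T + L y))) (rect n y)"
      unfolding r R_def L_def
      by (intro has_contour_integral_join has_contour_integral_reversepath has_contour_integral_integral int) auto
    hence "contour_integral (rect n y) act = contour_integral ?b act + (R y + (- ?T + L y))" by (rule contour_integral_unique)
    moreover have "contour_integral ?b act = - cnj ?T"
    proof -
      have "?b = cnj \<circ> ?t" by (auto simp: fun_eq_iff linepath_def complex_eq_iff)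
      hence "contour_integral ?b act = cnj (contour_integral ?t (cnj \<circ> act \<circ> cnj))"
        by (simp add: contour_integral_cnj)
      also have "contour_integral ?t (cnj \<circ> act \<circ> cnj) = contour_integral ?t (\<lambda>z. - act z)"
        by (rule contour_integral_eq) (use sb(3) strip_good in \<open>force simp: act_cnj\<close>)
      also have "... = - ?T" by (rule contour_integral_neg)
      finally show ?thesis by simp
    qed
    moreover have "of_real pi * action pot n = contour_integral (rect n y) act"
      using action_eq_rect[OF y, of n] by simp
    ultimately have A: "of_real pi * action pot n = - (?T + cnj ?T) + R y + L y" by (simp add: algebra_simps)
    have J: "JJ n y = Im (integral {a..b} (\<lambda>t. kk (Complex t y)))"
      unfolding JJ_def a_def[symmetric] b_def[symmetric]
      using integral_linear[OF kk_line(1)[OF y ab] bounded_linear_Im] by (simp add: o_def)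
    have "Re (\<i> * of_real \<epsilon> * W) = - \<epsilon> * Im W" for W by simp
    moreover have "?T = \<i> * of_real \<epsilon> * (Complex b y * kk (Complex b y) - Complex a y * kk (Complex a y) - integral {a..b} (\<lambda>t. kk (Complex t y)))"
      by (rule act_top[OF y e(1) _ ab]) (rule e(2))
    ultimately have "Re ?T = - \<epsilon> * (X y - JJ n y)"
      unfolding X_def J by (simp only: minus_complex.sel)
    hence "?T + cnj ?T = of_real (- (2 * \<epsilon> * (X y - JJ n y)))" unfolding complex_add_cnj by simp
    thus ?thesis using A by simp
  qed
  have nb: "\<bar>Re (ma a)\<bar> < 1" "\<bar>Re (ma b)\<bar> < 1"
    using band_point[of "of_real a" n] band_point[of "of_real b" n] bp_strip[of _ n] by (auto simp: a_def b_def)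
  have X: "(X \<longlongrightarrow> 0) (at_right 0)"
    unfolding X_def[abs_def] using tendsto_diff[OF Im_zk_tendsto[OF nb(2)] Im_zk_tendsto[OF nb(1)]] by simp
  have small: "(f \<longlongrightarrow> 0) (at_right 0)" if "\<And>y. 0 < y \<Longrightarrow> y \<le> 1 \<Longrightarrow> cmod (f y) \<le> B * y" for f and B :: real
  proof (rule Lim_null_comparison)
    show "\<forall>\<^sub>F y in at_right 0. cmod (f y) \<le> B * y"
      unfolding eventually_at_right_field using that by (intro exI[of _ 1]) auto
    show "((\<lambda>y. B * y) \<longlongrightarrow> 0) (at_right 0)" by (rule tendsto_mult_right_zero) (rule tendsto_ident_at)
  qed
  obtain BR where "\<And>y. 0 < y \<Longrightarrow> y \<le> 1 \<Longrightarrow> cmod (R y) \<le> BR * y" unfolding R_def b_def using act_side[of "bp (n + 1)" n] by blast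
  hence R: "(R \<longlongrightarrow> 0) (at_right 0)" by (rule small)
  obtain BL where "\<And>y. 0 < y \<Longrightarrow> y \<le> 1 \<Longrightarrow> cmod (L y) \<le> BL * y" unfolding L_def a_def using act_side[of "bp n" n] by blast
  hence L: "(L \<longlongrightarrow> 0) (at_right 0)" by (rule small)
  have "((\<lambda>y. 2 / pi * X y - \<epsilon> * Re (action pot n) + \<epsilon> / pi * (Re (R y) + Re (L y))) \<longlongrightarrow>
    2 / pi * 0 - \<epsilon> * Re (action pot n) + \<epsilon> / pi * (Re 0 + Re 0)) (at_right 0)"
    by (intro tendsto_intros X R L)
  hence lim: "((\<lambda>y. 2 / pi * X y - \<epsilon> * Re (action pot n) + \<epsilon> / pi * (Re (R y) + Re (L y))) \<longlongrightarrow> - \<epsilon> * Re (action pot n)) (at_right 0)"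
    by simp
  have eq: "2 / pi * X y - \<epsilon> * Re (action pot n) + \<epsilon> / pi * (Re (R y) + Re (L y)) = 2 / pi * JJ n y" if "y > 0" for y
  proof -
    have "pi * Re (action pot n) = 2 * \<epsilon> * (X y - JJ n y) + Re (R y) + Re (L y)"
      using arg_cong[OF v[OF that], of Re] by simp
    moreover have "\<epsilon> * \<epsilon> = 1" "pi * (1 / pi) = 1" using e(1) by auto
    ultimately have "2 * (1 / pi) * X y - \<epsilon> * Re (action pot n) + \<epsilon> * (1 / pi) * (Re (R y) + Re (L y)) = 2 * (1 / pi) * JJ n y"
      by algebra
    thus ?thesis by simp
  qed
  have lim2: "((\<lambda>y. 2 / pi * JJ n y) \<longlongrightarrow> - \<epsilon> * Re (action pot n)) (at_right 0)"
    by (rule Lim_transform_eventually[OF lim]) (use eq in \<open>auto simp: eventually_at_right_field intro!: exI[of _ 1]\<close>)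
  have "0 \<le> - \<epsilon> * Re (action pot n)" by (rule tendsto_lowerbound[OF lim2])
      (use JJ_nonneg in \<open>auto simp: eventually_at_right_field intro!: exI[of _ 1]\<close>)
  hence "- \<epsilon> * Re (action pot n) = \<bar>Re (action pot n)\<bar>" using e(1) by auto
  thus ?thesis using lim2 by simp
qed

end

section \<open>Trace formulas\<close>

lemma norm_power_diff_le:
  fixes z w :: complex
  assumes "cmod z \<le> M" "cmod w \<le> M" "0 \<le> M"
  shows "cmod (z ^ n - w ^ n) \<le> of_nat n * M ^ (n - 1) * cmod (z - w)"
proof (induction n)
  case (Suc n)
  have "z ^ Suc n - w ^ Suc n = z * (z ^ n - w ^ n) + (z - w) * w ^ n" by (simp add: algebra_simps)
  also have "cmod \<dots> \<le> cmod z * cmod (z ^ n - w ^ n) + cmod (z - w) * cmod w ^ n"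
    by (metis norm_mult norm_power norm_triangle_ineq)
  also have "... \<le> M * (of_nat n * M ^ (n - 1) * cmod (z - w)) + cmod (z - w) * M ^ n"
    by (intro add_mono mult_mono power_mono Suc assms) (use assms in auto)
  also have "... = of_nat (Suc n) * M ^ (Suc n - 1) * cmod (z - w)"
    by (cases n) (simp_all add: algebra_simps)
  finally show ?case .
qed simp

context smooth_potential
begin

text \<open>Differential polynomials in \<open>q 0\<close> and its conjugate. The class is closed
  under differentiation and consists of periodic functions, so no boundary terms arise.\<close>

inductive_set Sm :: "(real \<Rightarrow> complex) set" where
  Sm_q: "q k \<in> Sm"
| Sm_cnj: "(\<lambda>x. cnj (q k x)) \<in> Sm"
| Sm_const: "(\<lambda>x. c) \<in> Sm"
| Sm_add: "v \<in> Sm \<Longrightarrow> w \<in> Sm \<Longrightarrow> (\<lambda>x. v x + w x) \<in> Sm"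
| Sm_mult: "v \<in> Sm \<Longrightarrow> w \<in> Sm \<Longrightarrow> (\<lambda>x. v x * w x) \<in> Sm"

text \<open>Differentiation as a total operation on functions, which lets \<open>Ec\<close> be a
  primitive recursion without side conditions.\<close>

definition DD :: "(real \<Rightarrow> complex) \<Rightarrow> real \<Rightarrow> complex"
  where "DD w = (\<lambda>x. vector_derivative w (at x))"

lemma DD_eqI: "(\<And>x. (w has_vector_derivative w' x) (at x)) \<Longrightarrow> DD w = w'"
  by (auto simp: DD_def vector_derivative_at)

lemma Sm_deriv: assumes "w \<in> Sm" shows "(w has_vector_derivative DD w x) (at x)" "DD w \<in> Sm"
proof -
  have "\<exists>w'\<in>Sm. \<forall>x. (w has_vector_derivative w' x) (at x)" using assms
  proof induction
    case (Sm_q k)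
    thus ?case using q_deriv Sm.Sm_q by blast
  next
    case (Sm_cnj k)
    have "((\<lambda>x. cnj (q k x)) has_vector_derivative cnj (q (Suc k) x)) (at x)" for x
      by (rule has_vector_derivative_cnj[OF q_deriv])
    thus ?case using Sm.Sm_cnj[of "Suc k"] by (intro bexI[of _ "\<lambda>x. cnj (q (Suc k) x)"]) auto
  next
    case (Sm_const c)
    thus ?case using Sm.Sm_const[of 0] by (intro bexI[of _ "\<lambda>x. 0"]) auto
  next
    case (Sm_add v w)
    then obtain v' w' where "v' \<in> Sm" "w' \<in> Sm" "\<And>x. (v has_vector_derivative v' x) (at x)"
      "\<And>x. (w has_vector_derivative w' x) (at x)" by blast
    thus ?case by (intro bexI[of _ "\<lambda>x. v' x + w' x"] allI has_vector_derivative_add Sm.Sm_add)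
  next
    case (Sm_mult v w)
    then obtain v' w' where "v' \<in> Sm" "w' \<in> Sm" "\<And>x. (v has_vector_derivative v' x) (at x)"
      "\<And>x. (w has_vector_derivative w' x) (at x)" by blast
    thus ?case using Sm_mult.hyps
      by (intro bexI[of _ "\<lambda>x. v x * w' x + v' x * w x"] allI has_vector_derivative_mult Sm.Sm_add Sm.Sm_mult)
  qed
  then obtain w' where "w' \<in> Sm" and d: "\<And>x. (w has_vector_derivative w' x) (at x)" by blast
  moreover have "DD w = w'" by (rule DD_eqI[OF d])
  ultimately show "(w has_vector_derivative DD w x) (at x)" "DD w \<in> Sm" by simp_all
qed

lemma Sm_periodic: "w \<in> Sm \<Longrightarrow> w (x + 1) = w x" by (induction rule: Sm.induct) (auto simp: q_periodic)

lemma continuous_on_Sm: "w \<in> Sm \<Longrightarrow> continuous_on S w"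
  by (meson Sm_deriv(1) continuous_at_imp_continuous_on has_vector_derivative_continuous)

lemma Sm_integrable: "w \<in> Sm \<Longrightarrow> w integrable_on {0..1}"
  by (intro integrable_continuous_real continuous_on_Sm)

text \<open>The coefficients in \<open>\<integral> w \<sigma>\<^sup>p \<sim> \<Sum>\<^sub>i Ec i p w / (2\<i>z)\<^sup>i\<close> for the periodic solution \<open>\<sigma>\<close> of the
  Riccati equation, obtained by repeated integration by parts.\<close>

primrec Ec :: "nat \<Rightarrow> nat \<Rightarrow> (real \<Rightarrow> complex) \<Rightarrow> complex" where
  "Ec 0 = (\<lambda>p w. if p = 0 then integral {0..1} w else 0)"
| "Ec (Suc i) = (\<lambda>p w. if p = 0 then 0 else
     - (1 / of_nat p) * Ec i p (DD w) + \<i> * Ec i (p - 1) (\<lambda>x. w x * q 0 x)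
     + \<i> * Ec i (p + 1) (\<lambda>x. w x * cnj (q 0 x)))"

definition Ip :: "nat \<Rightarrow> (real \<Rightarrow> complex) \<Rightarrow> complex \<Rightarrow> complex"
  where "Ip p w z = integral {0..1} (\<lambda>x. w x * \<sigma> z (cc z) x ^ p)"

text \<open>This is \<open>parts\<close> for the fixed point of the period map: \<open>w\<close> and
  \<open>\<sigma>\<close> both return to their initial values, and the boundary terms
  cancel.\<close>

lemma Ip_step:
  assumes z: "Im z > 0" and w: "w \<in> Sm" and p: "p > 0"
  shows "Ip p w z = 1 / (2 * \<i> * z) * (- (1 / of_nat p) * Ip p (DD w) z + \<i> * Ip (p - 1) (\<lambda>x. w x * q 0 x) z
     + \<i> * Ip (p + 1) (\<lambda>x. w x * cnj (q 0 x)) z)"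
proof -
  have z0: "z \<noteq> 0" using z by auto
  have w10: "w 1 = w 0" using Sm_periodic[OF w, of 0] by simp
  have "w 1 * \<sigma> z (cc z) 1 ^ p - w 0 * cc z ^ p =
    Ip p (DD w) z + of_nat p * (2 * \<i> * z * Ip p w z - \<i> * Ip (p - 1) (\<lambda>x. w x * q 0 x) z - \<i> * Ip (p + 1) (\<lambda>x. w x * cnj (q 0 x)) z)"
    unfolding Ip_def
    using z p by (intro parts cc(1) continuous_on_Sm Sm_deriv(2) has_vector_derivative_at_within[OF Sm_deriv(1)] w) auto
  hence e: "Ip p (DD w) z + of_nat p * (2 * \<i> * z * Ip p w z - \<i> * Ip (p - 1) (\<lambda>x. w x * q 0 x) z - \<i> * Ip (p + 1) (\<lambda>x. w x * cnj (q 0 x)) z) = 0"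
    unfolding w10 cc(2)[OF z] by simp
  have p0: "(of_nat p :: complex) * (1 / of_nat p) = 1" using p by simp
  have "2 * \<i> * z * Ip p w z = - (1 / of_nat p) * Ip p (DD w) z + \<i> * Ip (p - 1) (\<lambda>x. w x * q 0 x) z
     + \<i> * Ip (p + 1) (\<lambda>x. w x * cnj (q 0 x)) z"
    using e p0 by algebra
  thus ?thesis using z0 by (simp add: field_simps)
qed

lemma Ip_bound:
  assumes z: "Im z > 0" and w: "w \<in> Sm"
  shows "cmod (Ip p w z) \<le> integral {0..1} (\<lambda>x. cmod (w x))" unfolding Ip_def
proof (rule norm_integral_le[OF continuous_on_Sm[OF w]])
  show "continuous_on {0..1} (\<lambda>x. \<sigma> z (cc z) x ^ p)"
    by (intro continuous_intros) (use z cc[OF z] in auto)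
  show "cmod (\<sigma> z (cc z) x ^ p) \<le> 1" if "x \<in> {0..1}" for x
    unfolding norm_power using z cc[OF z] that by (intro power_le_one \<sigma>_le) auto
qed

text \<open>Every use of \<open>Ip_step\<close> gains a factor \<open>1 / (2 * \<i> * z)\<close>.
  The remainder is uniform up to the real axis because \<open>\<sigma>\<close> stays in the unit
  disc.\<close>

lemma Ip_expansion:
  "w \<in> Sm \<Longrightarrow> \<exists>C. \<forall>z. Im z > 0 \<longrightarrow>
    cmod (Ip p w z - (\<Sum>i<n. Ec i p w / (2 * \<i> * z) ^ i)) \<le> C / cmod (2 * \<i> * z) ^ n"
proof (induction n arbitrary: p w)
  case 0
  thus ?case using Ip_bound by (intro exI[of _ "integral {0..1} (\<lambda>x. cmod (w x))"]) auto
next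
  case (Suc n)
  show ?case
  \<comment> \<open>For \<open>p = 0\<close> the integral does not depend on \<open>z\<close>, and
    the expansion consists of its first term.\<close>
  proof (cases "p = 0")
    case True
    have "(\<Sum>i<Suc n. Ec i p w / (2 * \<i> * z) ^ i) = integral {0..1} w" for z
      unfolding sum.lessThan_Suc_shift by (simp add: True)
    thus ?thesis by (intro exI[of _ 0]) (simp add: True Ip_def)
  next
    case False
    let ?q = "\<lambda>x. w x * q 0 x" and ?c = "\<lambda>x. w x * cnj (q 0 x)"
    define R where "R p w z = Ip p w z - (\<Sum>i<n. Ec i p w / (2 * \<i> * z) ^ i)" for p w z
    have s: "DD w \<in> Sm" "?q \<in> Sm" "?c \<in> Sm" using Suc.prems by (auto intro: Sm_deriv Sm.intros)
    obtain C1 where C1: "\<And>z. Im z > 0 \<Longrightarrow> cmod (R p (DD w) z) \<le> C1 / cmod (2 * \<i> * z) ^ n"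
      using Suc.IH[OF s(1), of p] unfolding R_def by blast
    obtain C2 where C2: "\<And>z. Im z > 0 \<Longrightarrow> cmod (R (p - 1) ?q z) \<le> C2 / cmod (2 * \<i> * z) ^ n"
      using Suc.IH[OF s(2), of "p - 1"] unfolding R_def by blast
    obtain C3 where C3: "\<And>z. Im z > 0 \<Longrightarrow> cmod (R (p + 1) ?c z) \<le> C3 / cmod (2 * \<i> * z) ^ n"
      using Suc.IH[OF s(3), of "p + 1"] unfolding R_def by blast
    show ?thesis
    proof (intro exI[of _ "C1 + C2 + C3"] allI impI)
      fix z assume z: "Im z > 0"
      let ?X = "1 / (2 * \<i> * z)"
      have "(\<Sum>i<Suc n. Ec i p w / (2 * \<i> * z) ^ i) = (\<Sum>i<n. Ec (Suc i) p w / (2 * \<i> * z) ^ Suc i)"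
        unfolding sum.lessThan_Suc_shift by (simp add: False)
      also have "... = ?X * (- (1 / of_nat p) * (\<Sum>i<n. Ec i p (DD w) / (2 * \<i> * z) ^ i)
        + \<i> * (\<Sum>i<n. Ec i (p - 1) ?q / (2 * \<i> * z) ^ i) + \<i> * (\<Sum>i<n. Ec i (p + 1) ?c / (2 * \<i> * z) ^ i))"
        unfolding sum_distrib_left sum.distrib[symmetric]
      proof (intro sum.cong refl)
        fix i
        have "(- (1 / P) * a + \<i> * b + \<i> * c) / u ^ Suc i = 1 / u * (- (1 / P) * (a / u ^ i) + \<i> * (b / u ^ i) + \<i> * (c / u ^ i))"
          for a b c u P :: complex by (simp add: add_divide_distrib diff_divide_distrib distrib_left right_diff_distrib)
        thus "Ec (Suc i) p w / (2 * \<i> * z) ^ Suc i = ?X * (- (1 / of_nat p) * (Ec i p (DD w) / (2 * \<i> * z) ^ i)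
          + \<i> * (Ec i (p - 1) ?q / (2 * \<i> * z) ^ i) + \<i> * (Ec i (p + 1) ?c / (2 * \<i> * z) ^ i))"
          by (simp only: Ec.simps False if_False)
      qed
      finally have "Ip p w z - (\<Sum>i<Suc n. Ec i p w / (2 * \<i> * z) ^ i) =
        ?X * (- (1 / of_nat p) * R p (DD w) z + \<i> * R (p - 1) ?q z + \<i> * R (p + 1) ?c z)"
        using False by (subst Ip_step[OF z Suc.prems]) (auto simp: R_def algebra_simps)
      also have "cmod \<dots> \<le> 1 / cmod (2 * \<i> * z) * (C1 / cmod (2 * \<i> * z) ^ n + C2 / cmod (2 * \<i> * z) ^ n + C3 / cmod (2 * \<i> * z) ^ n)"
        unfolding norm_mult norm_divide norm_one
      proof (intro mult_left_mono norm_add_rule_thm)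
        have "cmod (- (1 / of_nat p)) \<le> 1" using False by (simp add: norm_divide)
        hence "cmod (- (1 / of_nat p) * R p (DD w) z) \<le> 1 * cmod (R p (DD w) z)"
          unfolding norm_mult by (rule mult_right_mono) simp
        thus "cmod (- (1 / of_nat p) * R p (DD w) z) \<le> C1 / (cmod 2 * cmod \<i> * cmod z) ^ n"
          using C1[OF z] by (simp add: norm_mult)
      qed (use C2[OF z] C3[OF z] in \<open>auto simp: norm_mult\<close>)
      also have "... = (C1 + C2 + C3) / cmod (2 * \<i> * z) ^ Suc n"
        by (simp add: add_divide_distrib distrib_left)
      finally show "cmod (Ip p w z - (\<Sum>i<Suc n. Ec i p w / (2 * \<i> * z) ^ i)) \<le> (C1 + C2 + C3) / cmod (2 * \<i> * z) ^ Suc n" .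
    qed
  qed
qed

definition ck :: "nat \<Rightarrow> complex" where "ck i = - Ec i 1 (\<lambda>x. cnj (q 0 x)) / (2 * \<i>) ^ i"

lemma kk_expansion:
  obtains C where "C \<ge> 0" "\<And>z. Im z > 0 \<Longrightarrow> cmod (kk z - z - (\<Sum>i<n. ck i / z ^ i)) \<le> C / cmod z ^ n"
proof -
  let ?w = "\<lambda>x. cnj (q 0 x)"
  obtain C where C: "\<And>z. Im z > 0 \<Longrightarrow> cmod (Ip 1 ?w z - (\<Sum>i<n. Ec i 1 ?w / (2 * \<i> * z) ^ i)) \<le> C / cmod (2 * \<i> * z) ^ n"
    using Ip_expansion[OF Sm_cnj[of 0], of 1 n] by blast
  show ?thesis
  proof (rule that[of "max C 0 / 2 ^ n"])
    fix z assume z: "Im z > 0"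
    have "kk z - z = - Ip 1 ?w z" by (simp add: kk_def K_def Ip_def)
    moreover have "(\<Sum>i<n. ck i / z ^ i) = - (\<Sum>i<n. Ec i 1 ?w / (2 * \<i> * z) ^ i)"
      unfolding sum_negf[symmetric] by (intro sum.cong refl) (simp add: ck_def power_mult_distrib)
    ultimately have "cmod (kk z - z - (\<Sum>i<n. ck i / z ^ i)) = cmod (Ip 1 ?w z - (\<Sum>i<n. Ec i 1 ?w / (2 * \<i> * z) ^ i))"
      by (simp add: norm_minus_commute)
    also have "... \<le> C / cmod (2 * \<i> * z) ^ n" by (rule C[OF z])
    also have "... \<le> max C 0 / cmod (2 * \<i> * z) ^ n" by (intro divide_right_mono) auto
    also have "... = max C 0 / 2 ^ n / cmod z ^ n" by (simp add: norm_mult power_mult_distrib)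
    finally show "cmod (kk z - z - (\<Sum>i<n. ck i / z ^ i)) \<le> max C 0 / 2 ^ n / cmod z ^ n" .
  qed simp
qed

lemma bp_bounds: "of_int (n - 1) * pi - Q1 \<le> bp n" "bp n \<le> of_int n * pi + Q1"
proof -
  have "\<bar>lp (n - 1) - of_int (n - 1) * pi\<bar> \<le> Q1" "\<bar>lm n - of_int n * pi\<bar> \<le> Q1"
    using GG_bound[OF lp_in] GG_bound[OF lm_in] by blast+
  thus "of_int (n - 1) * pi - Q1 \<le> bp n" "bp n \<le> of_int n * pi + Q1" using bp(1,2)[of n] by linarith+
qed

lemma bp_band: "\<bar>Re (ma (bp n))\<bar> < 1"
  using band_point[of "of_real (bp n)" n] bp_strip(1)[of "of_real (bp n)" n] by simp

text \<open>The points \<open>bp n\<close> lie in bands and tend to infinity. There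
  \<open>Im kk\<close> vanishes in the limit at the real axis, so the first coefficient with a
  nonzero imaginary part would contradict the expansion.\<close>

lemma ck_real: "Im (ck j) = 0"
proof (induction j rule: less_induct)
  case (less j)
  obtain C where C: "C \<ge> 0" "\<And>z. Im z > 0 \<Longrightarrow> cmod (kk z - z - (\<Sum>i<Suc j. ck i / z ^ i)) \<le> C / cmod z ^ Suc j"
    by (rule kk_expansion[of "Suc j"]) blast
  have *: "\<bar>Im (ck j)\<bar> * t \<le> C" if t: "t > 0" "\<bar>Re (ma t)\<bar> < 1" for t :: real
  proof -
    let ?f = "\<lambda>y. Im (kk (Complex t y)) - y - Im (\<Sum>i<Suc j. ck i / Complex t y ^ i)"
    have l: "((\<lambda>y. Complex t y) \<longlongrightarrow> of_real t) (at_right 0)"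
      unfolding complex_of_real_def by (intro tendsto_Complex tendsto_const tendsto_ident_at)
    have "(?f \<longlongrightarrow> 0 - 0 - Im (\<Sum>i<Suc j. ck i / of_real t ^ i)) (at_right 0)"
      by (intro tendsto_intros Im_kk_tendsto t l) (use t in auto)
    moreover have "\<forall>\<^sub>F y in at_right 0. \<bar>?f y\<bar> \<le> C / t ^ Suc j" unfolding eventually_at_right_field
    proof (intro exI[of _ 1] conjI allI impI)
      fix y :: real assume y: "0 < y" "y < 1"
      have "\<bar>?f y\<bar> = \<bar>Im (kk (Complex t y) - Complex t y - (\<Sum>i<Suc j. ck i / Complex t y ^ i))\<bar>" by simp
      also have "... \<le> C / cmod (Complex t y) ^ Suc j"
        by (rule order_trans[OF abs_Im_le_cmod C(2)]) (use y in simp)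
      also have "... \<le> C / t ^ Suc j"
        using t C(1) abs_Re_le_cmod[of "Complex t y"] by (intro divide_left_mono power_mono mult_pos_pos zero_less_power) auto
      finally show "\<bar>?f y\<bar> \<le> C / t ^ Suc j" .
    qed simp
    ultimately have "\<bar>0 - 0 - Im (\<Sum>i<Suc j. ck i / of_real t ^ i)\<bar> \<le> C / t ^ Suc j"
      by (intro tendsto_upperbound[OF tendsto_rabs]) auto
    moreover have "Im (\<Sum>i<Suc j. ck i / of_real t ^ i) = Im (ck j) / t ^ j"
      using less by (simp add: of_real_power[symmetric] del: of_real_power)
    ultimately have "\<bar>Im (ck j)\<bar> / t ^ j \<le> C / t ^ Suc j" using t by (simp add: abs_divide)
    thus ?thesis using t by (simp add: field_simps)
  qed
  show "Im (ck j) = 0"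
  proof (rule ccontr)
    assume "Im (ck j) \<noteq> 0"
    hence pos: "\<bar>Im (ck j)\<bar> > 0" by simp
    obtain n :: nat where n: "(C + 1) / \<bar>Im (ck j)\<bar> + 1 + Q1 + pi \<le> real n" using real_arch_simple by blast
    have "of_int (int n - 1) * 1 \<le> of_int (int n - 1) * pi" using n C(1) pos pi_gt3 Q1_nonneg
    proof (intro mult_left_mono)
      have "0 \<le> (C + 1) / \<bar>Im (ck j)\<bar>" using C(1) by (intro divide_nonneg_nonneg) auto
      hence "1 \<le> real n" using n Q1_nonneg pi_gt_zero by linarith
      thus "0 \<le> real_of_int (int n - 1)" by simp
    qed simp
    hence "real n - 1 - Q1 \<le> bp (int n)" using bp_bounds(1)[of "int n"] by simp
    hence b: "(C + 1) / \<bar>Im (ck j)\<bar> \<le> bp (int n)" using n pi_gt_zero by linarith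
    moreover have "0 < (C + 1) / \<bar>Im (ck j)\<bar>" using C(1) pos by simp
    ultimately have "\<bar>Im (ck j)\<bar> * bp (int n) \<le> C" by (intro * bp_band) linarith
    moreover have "C + 1 \<le> \<bar>Im (ck j)\<bar> * bp (int n)" using b pos by (simp add: divide_le_eq mult.commute)
    ultimately show False by linarith
  qed
qed

text \<open>Normalised to be the limit of the moments of \<open>Im kk\<close> with weight
  \<open>2 / pi * t ^ (2 * l)\<close>, the same factor as in the formula for the actions.\<close>

definition Tl :: "nat \<Rightarrow> real" where "Tl l = - 2 * Re (ck (2 * l + 1))"

text \<open>A primitive of the part of \<open>z ^ (2 * l) * kk z\<close> that decays no faster than
  \<open>1 / z\<close>. Taking the logarithm of \<open>- \<i> * z\<close> puts the cut on the
  negative imaginary axis, so boundary values exist at every nonzero real point.\<close>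

definition prim :: "nat \<Rightarrow> complex \<Rightarrow> complex"
  where "prim l z = z ^ (2 * l + 2) / of_nat (2 * l + 2) + (\<Sum>i<2*l+1. ck i * (z ^ (2 * l + 1 - i) / of_nat (2 * l + 1 - i)))
    + ck (2 * l + 1) * Ln (- \<i> * z)"

definition pdr :: "nat \<Rightarrow> complex \<Rightarrow> complex"
  where "pdr l z = z ^ (2 * l + 1) + (\<Sum>i<2*l+1. ck i * z ^ (2 * l - i)) + ck (2 * l + 1) / z"

lemma upper_slit: "Im z > 0 \<Longrightarrow> - \<i> * z \<notin> \<real>\<^sub>\<le>\<^sub>0" by (simp add: complex_nonpos_Reals_iff)

lemma prim_deriv: assumes z: "- \<i> * z \<notin> \<real>\<^sub>\<le>\<^sub>0" shows "(prim l has_field_derivative pdr l z) (at z within S)"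
proof -
  have p: "((\<lambda>z. z ^ Suc n / of_nat (Suc n)) has_field_derivative z ^ n) (at z within S)" for n
    by (rule derivative_eq_intros refl)+ (simp_all add: field_simps del: of_nat_Suc)
  have "((\<lambda>z. Ln (- \<i> * z)) has_field_derivative - \<i> * 1 * inverse (- \<i> * z)) (at z within S)"
    by (rule derivative_eq_intros refl z | simp add: field_simps)+
  moreover have "z \<noteq> 0" using z by auto
  hence "- \<i> * 1 * inverse (- \<i> * z) = 1 / z" by (simp add: field_simps)
  ultimately have L: "((\<lambda>z. Ln (- \<i> * z)) has_field_derivative 1 / z) (at z within S)" by (simp only:)
  have "((\<lambda>z. ck i * (z ^ (2 * l + 1 - i) / of_nat (2 * l + 1 - i))) has_field_derivative ck i * z ^ (2 * l - i)) (at z within S)"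
    if "i < 2 * l + 1" for i
  proof -
    have "2 * l + 1 - i = Suc (2 * l - i)" using that by simp
    thus ?thesis by (simp only:) (rule DERIV_cmult[OF p])
  qed
  hence "((\<lambda>z. \<Sum>i<2*l+1. ck i * (z ^ (2 * l + 1 - i) / of_nat (2 * l + 1 - i))) has_field_derivative
     (\<Sum>i<2*l+1. ck i * z ^ (2 * l - i))) (at z within S)"
    by (intro DERIV_sum) simp
  moreover have "2 * l + 2 = Suc (2 * l + 1)" by simp
  ultimately have "((\<lambda>z. z ^ (2 * l + 2) / of_nat (2 * l + 2) + (\<Sum>i<2*l+1. ck i * (z ^ (2 * l + 1 - i) / of_nat (2 * l + 1 - i)))
    + ck (2 * l + 1) * Ln (- \<i> * z)) has_field_derivative
    z ^ (2 * l + 1) + (\<Sum>i<2*l+1. ck i * z ^ (2 * l - i)) + ck (2 * l + 1) * (1 / z)) (at z within S)"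
    by (simp only:) (intro DERIV_add DERIV_cmult L p)
  thus ?thesis unfolding prim_def[abs_def] pdr_def by simp
qed

lemma pdr_eq: assumes "z \<noteq> 0" shows "z ^ (2 * l) * (z + (\<Sum>i<2*l+2. ck i / z ^ i)) = pdr l z"
proof -
  have "z ^ (2 * l) * (\<Sum>i<2*l+1. ck i / z ^ i) = (\<Sum>i<2*l+1. ck i * z ^ (2 * l - i))"
    unfolding sum_distrib_left
  proof (intro sum.cong refl)
    fix i assume "i \<in> {..<2*l+1}"
    hence "z ^ (2 * l) = z ^ (2 * l - i) * z ^ i" by (simp flip: power_add)
    thus "z ^ (2 * l) * (ck i / z ^ i) = ck i * z ^ (2 * l - i)" using assms by simp
  qed
  moreover have "(\<Sum>i<2*l+2. ck i / z ^ i) = (\<Sum>i<2*l+1. ck i / z ^ i) + ck (2 * l + 1) / z ^ (2 * l + 1)"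
    using sum.lessThan_Suc[of "\<lambda>i. ck i / z ^ i" "2 * l + 1"] by simp
  moreover have "z ^ (2 * l) * (ck (2 * l + 1) / z ^ (2 * l + 1)) = ck (2 * l + 1) / z" using assms by simp
  ultimately show ?thesis unfolding pdr_def by (simp only: distrib_left) (simp add: algebra_simps)
qed

text \<open>All coefficients are real, so only the logarithm contributes an imaginary part:
  \<open>- pi / 2\<close> on the right and \<open>pi / 2\<close> on the left of 0. The trace is the
  difference of the two.\<close>

lemma prim_tendsto:
  assumes t: "t \<noteq> 0"
  shows "((\<lambda>y. Im (prim l (Complex t y))) \<longlongrightarrow> - sgn t * pi / 2 * Re (ck (2 * l + 1))) (at_right 0)"
proof -
  have lim: "((\<lambda>y. Complex t y) \<longlongrightarrow> of_real t) (at_right 0)"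
    unfolding complex_of_real_def by (intro tendsto_Complex tendsto_const tendsto_ident_at)
  have sl: "- \<i> * of_real t \<notin> \<real>\<^sub>\<le>\<^sub>0" using t by (simp add: complex_nonpos_Reals_iff)
  have "((\<lambda>y. prim l (Complex t y)) \<longlongrightarrow> prim l (of_real t)) (at_right 0)"
    by (rule isCont_tendsto_compose[OF DERIV_isCont[OF prim_deriv[OF sl]] lim])
  from tendsto_Im[OF this]
  have "((\<lambda>y. Im (prim l (Complex t y))) \<longlongrightarrow> Im (prim l (of_real t))) (at_right 0)" .
  moreover have "Im (prim l (of_real t)) = - sgn t * pi / 2 * Re (ck (2 * l + 1))"
  proof -
    have c: "ck i = of_real (Re (ck i))" for i by (simp add: complex_eq_iff ck_real)
    have 1: "complex_of_real t ^ (2 * l + 2) / of_nat (2 * l + 2) = of_real (t ^ (2 * l + 2) / of_nat (2 * l + 2))" by simp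
    have 2: "(\<Sum>i<2*l+1. ck i * (complex_of_real t ^ (2 * l + 1 - i) / of_nat (2 * l + 1 - i))) =
      of_real (\<Sum>i<2*l+1. Re (ck i) * (t ^ (2 * l + 1 - i) / of_nat (2 * l + 1 - i)))"
      unfolding of_real_sum by (intro sum.cong refl) (subst c, simp)
    have 3: "Im (Ln (- \<i> * of_real t)) = - sgn t * pi / 2"
    proof (cases "t > 0")
      case True
      thus ?thesis using Ln_times_of_real[of t "- \<i>"] by (simp add: mult.commute)
    next
      case False
      hence "- t > 0" using t by simp
      hence "Ln (of_real (- t) * \<i>) = of_real (ln (- t)) + Ln \<i>" by (simp only: Ln_times_of_real Ln_of_real complex_i_not_zero not_False_eq_True)
      thus ?thesis using False t by (simp add: mult.commute)
    qed
    have "Im (ck (2 * l + 1) * Ln (- \<i> * of_real t)) = Re (ck (2 * l + 1)) * (- sgn t * pi / 2)"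
      unfolding 3[symmetric] using ck_real[of "2 * l + 1"] by (simp del: add_Suc_right add_2_eq_Suc add_2_eq_Suc')
    thus ?thesis unfolding prim_def 1 2 by (simp del: of_real_divide of_real_power of_real_sum sum.lessThan_Suc)
  qed
  ultimately show ?thesis by simp
qed

text \<open>A direct estimate on the line fails near 0 as \<open>y\<close> shrinks. Cauchy's theorem
  moves the path to three sides of a rectangle on which \<open>cmod z \<ge> M\<close>, of total
  length at most \<open>20 * M\<close>.\<close>

lemma remainder_integral:
  assumes g: "g holomorphic_on upper" "\<And>z. Im z > 0 \<Longrightarrow> cmod (g z) \<le> C / (cmod z)\<^sup>2"
    and N: "0 < y" "y < M" "M \<le> b" "M \<le> - a" "b - a \<le> 18 * M"
  shows "cmod (contour_integral (linepath (Complex a y) (Complex b y)) g) \<le> 20 * C / M"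
proof -
  let ?B = "linepath (Complex a y) (Complex b y)" and ?R = "linepath (Complex b y) (Complex b M)"
    and ?T = "linepath (Complex b M) (Complex a M)" and ?L = "linepath (Complex a M) (Complex a y)"
  have M0: "M > 0" using N by simp
  have sub: "closed_segment u v \<subseteq> upper" if "Im u > 0" "Im v > 0" for u v
    by (rule closed_segment_subset) (use that convex_upper in auto)
  have int: "g contour_integrable_on linepath u v" if "Im u > 0" "Im v > 0" for u v
    by (rule contour_integrable_holomorphic_simple[OF g(1) open_upper valid_path_linepath]) (use sub[OF that] in simp)
  have C0: "C \<ge> 0"
  proof -
    have "0 \<le> C / (cmod \<i>)\<^sup>2" by (rule order_trans[OF norm_ge_zero g(2)]) simp
    thus ?thesis by simp
  qed
  have bd: "cmod (contour_integral (linepath u v) g) \<le> C / M\<^sup>2 * cmod (v - u)"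
    if "Im u > 0" "Im v > 0" "\<And>z. z \<in> closed_segment u v \<Longrightarrow> M \<le> cmod z" for u v
  proof (rule contour_integral_bound_linepath[OF int[OF that(1,2)]])
    fix z assume z: "z \<in> closed_segment u v"
    have "Im z > 0" using sub[OF that(1,2)] z by blast
    hence "cmod (g z) \<le> C / (cmod z)\<^sup>2" by (rule g(2))
    also have "... \<le> C / M\<^sup>2" using that(3)[OF z] M0 C0 by (intro divide_left_mono power_mono mult_pos_pos zero_less_power) auto
    finally show "cmod (g z) \<le> C / M\<^sup>2" .
  qed (use C0 in simp)
  have sR: "M \<le> cmod z" if "z \<in> closed_segment (Complex b y) (Complex b M)" for z
    using that N abs_Re_le_cmod[of z] by (auto simp: closed_segment_same_Re)
  have sL: "M \<le> cmod z" if "z \<in> closed_segment (Complex a M) (Complex a y)" for z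
    using that N abs_Re_le_cmod[of z] by (auto simp: closed_segment_same_Re)
  have sT: "M \<le> cmod z" if "z \<in> closed_segment (Complex b M) (Complex a M)" for z
    using that N abs_Im_le_cmod[of z] by (auto simp: closed_segment_same_Im)
  have "(g has_contour_integral 0) (?B +++ ?R +++ ?T +++ ?L)"
    by (rule Cauchy_theorem_convex_simple[OF g(1) convex_upper])
      (use N M0 in \<open>auto simp: path_image_join dest: subsetD[OF sub, rotated 2]\<close>)
  moreover have "(g has_contour_integral (contour_integral ?B g + (contour_integral ?R g + (contour_integral ?T g + contour_integral ?L g)))) (?B +++ ?R +++ ?T +++ ?L)"
    by (intro has_contour_integral_join has_contour_integral_integral int) (use N M0 in auto)
  ultimately have "contour_integral ?B g + (contour_integral ?R g + (contour_integral ?T g + contour_integral ?L g)) = 0"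
    using has_contour_integral_unique by blast
  hence "contour_integral ?B g = - (contour_integral ?R g + contour_integral ?T g + contour_integral ?L g)"
    by (simp add: add_eq_0_iff2 algebra_simps)
  hence "cmod (contour_integral ?B g) \<le> cmod (contour_integral ?R g) + cmod (contour_integral ?T g) + cmod (contour_integral ?L g)"
    unfolding norm_minus_cancel by (metis norm_minus_cancel norm_triangle_mono norm_triangle_ineq order_refl)
  also have "... \<le> C / M\<^sup>2 * M + C / M\<^sup>2 * (18 * M) + C / M\<^sup>2 * M"
  proof (intro add_mono)
    have d: "cmod (Complex b M - Complex b y) \<le> M" "cmod (Complex a y - Complex a M) \<le> M"
      "cmod (Complex a M - Complex b M) \<le> 18 * M" using N by (simp_all add: cmod_def)
    have c: "C / M\<^sup>2 \<ge> 0" using C0 by simp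
    show "cmod (contour_integral ?R g) \<le> C / M\<^sup>2 * M"
      by (rule order_trans[OF bd mult_left_mono[OF d(1) c]]) (use N M0 sR in auto)
    show "cmod (contour_integral ?T g) \<le> C / M\<^sup>2 * (18 * M)"
      by (rule order_trans[OF bd mult_left_mono[OF d(3) c]]) (use N M0 sT in auto)
    show "cmod (contour_integral ?L g) \<le> C / M\<^sup>2 * M"
      by (rule order_trans[OF bd mult_left_mono[OF d(2) c]]) (use N M0 sL in auto)
  qed
  also have "... = 20 * C / M" using M0 by (simp add: power2_eq_square)
  finally show ?thesis .
qed

text \<open>The width is at most \<open>2 * pi * (N + 1) + 2 * Q1\<close>; with
  \<open>pi < 4\<close>, \<open>Q1 \<le> N\<close> and \<open>N \<ge> 1\<close> this gives the
  factor 18.\<close>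

lemma bp_range:
  assumes N: "real N \<ge> Q1" "N \<ge> 1"
  shows "real N \<le> bp (int N + 1)" "real N \<le> - bp (- int N)" "bp (int N + 1) - bp (- int N) \<le> 18 * real N"
proof -
  have n1: "1 \<le> real N" using N by simp
  have r: "real N * 3 \<le> real N * pi" "real N * pi \<le> real N * 4"
    by (rule mult_left_mono; use pi_gt3 pi_less_4 in simp)+
  define x where "x = real N * pi"
  note r = r[folded x_def]
  have "real N * pi - Q1 \<le> bp (int N + 1)" "bp (int N + 1) \<le> (real N + 1) * pi + Q1"
    "(- real N - 1) * pi - Q1 \<le> bp (- int N)" "bp (- int N) \<le> - real N * pi + Q1"
    using bp_bounds[of "int N + 1"] bp_bounds[of "- int N"] by simp_all
  hence "x - Q1 \<le> bp (int N + 1)" "bp (int N + 1) \<le> x + pi + Q1"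
    "- x - pi - Q1 \<le> bp (- int N)" "bp (- int N) \<le> - x + Q1" by (simp_all add: x_def algebra_simps)
  thus "real N \<le> bp (int N + 1)" "real N \<le> - bp (- int N)" "bp (int N + 1) - bp (- int N) \<le> 18 * real N"
    using r N(1) n1 pi_less_4 by linarith+
qed

lemma line_integral:
  assumes y: "y > 0" and ab: "a < b" and C: "\<And>z. Im z > 0 \<Longrightarrow> cmod (kk z - z - (\<Sum>i<2*l+2. ck i / z ^ i)) \<le> C / cmod z ^ (2 * l + 2)"
    and N: "y < M" "M \<le> b" "M \<le> - a" "b - a \<le> 18 * M"
  shows "(\<lambda>t. Complex t y ^ (2 * l) * kk (Complex t y)) integrable_on {a..b}"
    "cmod (integral {a..b} (\<lambda>t. Complex t y ^ (2 * l) * kk (Complex t y)) - (prim l (Complex b y) - prim l (Complex a y))) \<le> 20 * C / M"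
proof -
  let ?l = "linepath (Complex a y) (Complex b y)"
  let ?h = "\<lambda>z. z ^ (2 * l) * kk z"
  define g where "g z = z ^ (2 * l) * (kk z - z - (\<Sum>i<2*l+2. ck i / z ^ i))" for z
  have g: "?h z = pdr l z + g z" if "Im z > 0" for z
  proof -
    have "z \<noteq> 0" using that by auto
    have "x * (k - z - S) = x * k - x * (z + S)" for x k S :: complex by (simp only: algebra_simps)
    hence "g z = ?h z - pdr l z" unfolding g_def pdr_eq[OF \<open>z \<noteq> 0\<close>, symmetric] by (simp only:)
    thus ?thesis by simp
  qed
  have hg: "g holomorphic_on upper" unfolding g_def by (intro holomorphic_intros kk_holomorphic) auto
  have bg: "cmod (g z) \<le> C / (cmod z)\<^sup>2" if z: "Im z > 0" for z
  proof -
    have z0: "cmod z > 0" using z by auto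
    have "cmod (g z) \<le> cmod z ^ (2 * l) * (C / cmod z ^ (2 * l + 2))"
      unfolding g_def norm_mult norm_power by (intro mult_left_mono C z) simp
    thus ?thesis using z0 by (simp add: power_add power2_eq_square)
  qed
  have G: "cmod (contour_integral ?l g) \<le> 20 * C / M"
    by (rule remainder_integral[OF hg _ y]) (use bg N in auto)
  have ig: "(g has_contour_integral contour_integral ?l g) ?l"
    by (intro has_contour_integral_integral contour_integrable_holomorphic_simple[OF hg open_upper] kk_line(3) y ab) simp
  have ip: "(pdr l has_contour_integral (prim l (Complex b y) - prim l (Complex a y))) ?l"
    using contour_integral_primitive[OF prim_deriv[OF upper_slit] valid_path_linepath kk_line(3)[OF y ab]] by simp
  have "((\<lambda>z. pdr l z + g z) has_contour_integral (prim l (Complex b y) - prim l (Complex a y)) + contour_integral ?l g) ?l"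
    by (rule has_contour_integral_add[OF ip ig])
  hence "(?h has_contour_integral (prim l (Complex b y) - prim l (Complex a y)) + contour_integral ?l g) ?l"
    by (rule has_contour_integral_eq) (use g kk_line(3)[OF y ab] in force)
  hence I: "((\<lambda>t. Complex t y ^ (2 * l) * kk (Complex t y)) has_integral (prim l (Complex b y) - prim l (Complex a y)) + contour_integral ?l g) {a..b}"
    unfolding has_contour_integral_linepath_same_Im_iff[OF ab] .
  thus "(\<lambda>t. Complex t y ^ (2 * l) * kk (Complex t y)) integrable_on {a..b}" by (rule has_integral_integrable)
  show "cmod (integral {a..b} (\<lambda>t. Complex t y ^ (2 * l) * kk (Complex t y)) - (prim l (Complex b y) - prim l (Complex a y))) \<le> 20 * C / M"
    unfolding integral_unique[OF I] using G by simp
qed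

lemma kk_norm: assumes "Im z > 0" shows "cmod (kk z) \<le> cmod z + Q1"
  using norm_triangle_sub[of "kk z" z] kk_bound[OF assms] by linarith

text \<open>The moments carry the real weight \<open>t ^ n\<close>, Cauchy's theorem the complex one
  at height \<open>y\<close>; on a fixed interval they differ by a multiple of
  \<open>y\<close>.\<close>

lemma power_line_diff:
  assumes y: "0 < y" "y < 1" and ab: "a < b" "\<bar>a\<bar> + 1 \<le> M" "\<bar>b\<bar> + 1 \<le> M"
    and i: "(\<lambda>t. Complex t y ^ n * kk (Complex t y)) integrable_on {a..b}"
  shows "(\<lambda>t. t ^ n * Im (kk (Complex t y))) integrable_on {a..b}"
    "\<bar>integral {a..b} (\<lambda>t. t ^ n * Im (kk (Complex t y))) - Im (integral {a..b} (\<lambda>t. Complex t y ^ n * kk (Complex t y)))\<bar>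
      \<le> real n * M ^ (n - 1) * y * (M + Q1) * (b - a)"
proof -
  let ?k = "\<lambda>t. kk (Complex t y)"
  have M: "M \<ge> 0" using ab by simp
  have ck: "continuous_on {a..b} ?k"
    by (rule continuous_on_compose2[OF continuous_on_kk]) (use y in \<open>auto intro!: continuous_intros\<close>)
  thus i2: "(\<lambda>t. t ^ n * Im (?k t)) integrable_on {a..b}"
    by (intro integrable_continuous_real continuous_intros)
  have i1: "(\<lambda>t. Im (Complex t y ^ n * ?k t)) integrable_on {a..b}"
    using integrable_linear[OF i bounded_linear_Im] by (simp add: o_def)
  have "Im (integral {a..b} (\<lambda>t. Complex t y ^ n * ?k t)) = integral {a..b} (\<lambda>t. Im (Complex t y ^ n * ?k t))"
    using integral_linear[OF i bounded_linear_Im] by (simp add: o_def)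
  hence "integral {a..b} (\<lambda>t. t ^ n * Im (?k t)) - Im (integral {a..b} (\<lambda>t. Complex t y ^ n * ?k t)) =
    integral {a..b} (\<lambda>t. t ^ n * Im (?k t) - Im (Complex t y ^ n * ?k t))"
    by (simp only: Henstock_Kurzweil_Integration.integral_diff[OF i2 i1])
  also have "\<bar>\<dots>\<bar> \<le> real n * M ^ (n - 1) * y * (M + Q1) * (b - a)" unfolding real_norm_def[symmetric]
  proof (rule order_trans[OF integral_bound])
    show "continuous_on {a..b} (\<lambda>t. t ^ n * Im (?k t) - Im (Complex t y ^ n * ?k t))"
      unfolding Complex_eq by (intro continuous_intros ck[unfolded Complex_eq])
    fix t assume t: "t \<in> {a..b}"
    have tm: "\<bar>t\<bar> \<le> M" "\<bar>t\<bar> + 1 \<le> M" using t ab by (auto simp: abs_le_iff)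
    have zm: "cmod (Complex t y) \<le> M" using cmod_le[of "Complex t y"] tm y by simp
    have "t ^ n * Im (?k t) - Im (Complex t y ^ n * ?k t) = Im ((of_real t ^ n - Complex t y ^ n) * ?k t)"
      by (simp add: left_diff_distrib of_real_power[symmetric] del: of_real_power)
    also have "\<bar>\<dots>\<bar> \<le> cmod (of_real t ^ n - Complex t y ^ n) * cmod (?k t)"
      using abs_Im_le_cmod by (metis norm_mult)
    also have "... \<le> (real n * M ^ (n - 1) * cmod (of_real t - Complex t y)) * (M + Q1)"
      using kk_norm[of "Complex t y"] zm tm y M Q1_nonneg
      by (intro mult_mono norm_power_diff_le) (auto intro!: mult_nonneg_nonneg)
    also have "cmod (of_real t - Complex t y) = y" using y by (simp add: cmod_def)
    finally show "norm (t ^ n * Im (?k t) - Im (Complex t y ^ n * ?k t)) \<le> real n * M ^ (n - 1) * y * (M + Q1)" by simp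
  qed (use ab in auto)
  finally show "\<bar>integral {a..b} (\<lambda>t. t ^ n * Im (?k t)) - Im (integral {a..b} (\<lambda>t. Complex t y ^ n * ?k t))\<bar>
      \<le> real n * M ^ (n - 1) * y * (M + Q1) * (b - a)" .
qed

definition Tr :: "nat \<Rightarrow> nat \<Rightarrow> real \<Rightarrow> real"
  where "Tr l N y = 2 / pi * integral {bp (- int N)..bp (int N + 1)} (\<lambda>t. t ^ (2 * l) * Im (kk (Complex t y)))"

text \<open>The order of limits matters: the remainder is of order \<open>1 / N\<close> uniformly
  for small \<open>y\<close>, while the boundary values of \<open>prim\<close> are reached as
  \<open>y\<close> tends to 0 with \<open>N\<close> fixed.\<close>

lemma trace_limit:
  assumes "e > 0"
  obtains N0 where "\<And>N. N \<ge> N0 \<Longrightarrow> \<forall>\<^sub>F y in at_right 0. \<bar>Tr l N y - Tl l\<bar> \<le> e"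
proof -
  obtain C where C: "C \<ge> 0" "\<And>z. Im z > 0 \<Longrightarrow> cmod (kk z - z - (\<Sum>i<2*l+2. ck i / z ^ i)) \<le> C / cmod z ^ (2 * l + 2)"
    by (rule kk_expansion[of "2 * l + 2"]) blast
  obtain N0 :: nat where N0: "Q1 + 1 + 40 * C / e \<le> real N0" using real_arch_simple by blast
  show ?thesis
  proof (rule that[of N0])
    fix N assume "N0 \<le> N"
    hence "Q1 + 1 + 40 * C / e \<le> real N" using N0 by simp
    moreover have "0 \<le> 40 * C / e" using assms C(1) by simp
    ultimately have n: "real N \<ge> Q1" "1 \<le> real N" "40 * C / e \<le> real N" using Q1_nonneg by linarith+
    hence N: "real N \<ge> Q1" "N \<ge> 1" by simp_all
    have "40 * C \<le> real N * e" using n(3) assms by (simp add: divide_le_eq)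
    hence CN: "20 * C / real N \<le> e / 2" using n(2) by (simp add: field_simps)
    define a b where "a = bp (- int N)" and "b = bp (int N + 1)"
    note r = bp_range[OF N, folded a_def b_def]
    have ab: "a < b" "a < 0" "b > 0" using r n(2) by linarith+
    define M where "M = \<bar>a\<bar> + \<bar>b\<bar> + 1"
    define f where "f y = real (2 * l) * M ^ (2 * l - 1) * y * (M + Q1) * (b - a)" for y
    define h where "h y = Im (prim l (Complex b y)) - Im (prim l (Complex a y)) + pi * Re (ck (2 * l + 1))" for y
    have "(h \<longlongrightarrow> (- sgn b * pi / 2 * Re (ck (2 * l + 1))) - (- sgn a * pi / 2 * Re (ck (2 * l + 1))) + pi * Re (ck (2 * l + 1))) (at_right 0)"
      unfolding h_def by (intro tendsto_intros prim_tendsto) (use ab in auto)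
    hence h: "(h \<longlongrightarrow> 0) (at_right 0)" using ab by simp
    have f: "(f \<longlongrightarrow> 0) (at_right 0)" unfolding f_def by (auto intro!: tendsto_eq_intros)
    have "((\<lambda>y. \<bar>h y\<bar> + f y) \<longlongrightarrow> \<bar>0\<bar> + 0) (at_right 0)" by (intro tendsto_intros h f)
    hence "\<forall>\<^sub>F y in at_right 0. \<bar>h y\<bar> + f y < e / 2" using assms by (intro order_tendstoD(2)[of _ "\<bar>0\<bar> + 0"]) auto
    moreover have "\<forall>\<^sub>F y in at_right 0. (0::real) < y \<and> y < 1"
      unfolding eventually_at_right_field by (intro exI[of _ 1]) auto
    ultimately show "\<forall>\<^sub>F y in at_right 0. \<bar>Tr l N y - Tl l\<bar> \<le> e"
    proof eventually_elim
      case (elim y)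
      hence y: "0 < y" "y < 1" by auto
      let ?J = "integral {a..b} (\<lambda>t. Complex t y ^ (2 * l) * kk (Complex t y))"
      let ?I = "integral {a..b} (\<lambda>t. t ^ (2 * l) * Im (kk (Complex t y)))"
      have yN: "y < real N" using y n(2) by linarith
      note li = line_integral[OF y(1) ab(1) C(2) yN r]
      have 1: "\<bar>?I - Im ?J\<bar> \<le> f y"
        unfolding f_def by (rule power_line_diff(2)[OF y ab(1) _ _ li(1)]) (auto simp: M_def)
      have "\<bar>Im (?J - (prim l (Complex b y) - prim l (Complex a y)))\<bar> \<le> 20 * C / real N"
        by (rule order_trans[OF abs_Im_le_cmod li(2)])
      hence 2: "\<bar>Im ?J - (h y - pi * Re (ck (2 * l + 1)))\<bar> \<le> 20 * C / real N" by (simp add: h_def)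
      have T: "Tr l N y - Tl l = 2 / pi * (?I + pi * Re (ck (2 * l + 1)))"
        unfolding Tr_def a_def[symmetric] b_def[symmetric] Tl_def by (simp add: distrib_left)
      have 3: "\<bar>?I + pi * Re (ck (2 * l + 1))\<bar> \<le> e" using 1 2 elim(1) CN by linarith
      have "\<bar>Tr l N y - Tl l\<bar> = 2 / pi * \<bar>?I + pi * Re (ck (2 * l + 1))\<bar>" unfolding T abs_mult by simp
      also have "... \<le> 1 * \<bar>?I + pi * Re (ck (2 * l + 1))\<bar>"
        using pi_gt3 by (intro mult_right_mono) (auto simp: divide_le_eq)
      finally show ?case using 3 by simp
    qed
  qed
qed

section \<open>Comparison of weighted sums of actions with the traces\<close>

definition act_n :: "int \<Rightarrow> real" where "act_n n = \<bar>Re (action pot n)\<bar>"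

lemma act_n_tendsto: "((\<lambda>y. 2 / pi * JJ n y) \<longlongrightarrow> act_n n) (at_right 0)"
  unfolding act_n_def by (rule action_limit)

lemma act_n_nonneg: "act_n n \<ge> 0" by (simp add: act_n_def)

lemma bp_mono: "n \<le> k \<Longrightarrow> bp n \<le> bp k"
proof (induction k rule: int_ge_induct)
  case (step i)
  thus ?case using bp(3)[of i] by linarith
qed simp

lemma integral_bp:
  assumes "\<And>a b. f integrable_on {a..b}"
  shows "integral {bp (- int N)..bp (int N + 1)} f = (\<Sum>n\<in>symi N. integral {bp n..bp (n + 1)} (f :: real \<Rightarrow> real))"
proof -
  have "integral {bp (- int N)..bp (- int N + int k)} f = (\<Sum>n\<in>{- int N..<- int N + int k}. integral {bp n..bp (n + 1)} f)" for k
  proof (induction k)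
    case (Suc k)
    let ?i = "- int N + int k"
    have "{- int N..<- int N + int (Suc k)} = insert ?i {- int N..<?i}" by auto
    hence "(\<Sum>n\<in>{- int N..<- int N + int (Suc k)}. integral {bp n..bp (n + 1)} f) =
      integral {bp ?i..bp (?i + 1)} f + integral {bp (- int N)..bp ?i} f" using Suc by simp
    also have "... = integral {bp (- int N)..bp (?i + 1)} f"
      using Henstock_Kurzweil_Integration.integral_combine[of "bp (- int N)" "bp ?i" "bp (?i + 1)" f] bp_mono[of "- int N" ?i] bp_mono[of ?i "?i + 1"] assms
      by simp
    finally show ?case by (simp add: ac_simps)
  qed simp
  from this[of "2 * N + 1"] show ?thesis
    using atLeastLessThanPlusOne_atLeastAtMost_int[of "- int N" "int N"] by (simp add: ac_simps)
qed

lemma power_add_le: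
  fixes a b c :: real
  assumes "0 \<le> a" "0 \<le> b" "0 \<le> c" "a \<le> b + c"
  shows "a ^ k \<le> 2 ^ k * (b ^ k + c ^ k)"
proof -
  have "a ^ k \<le> (2 * max b c) ^ k" using assms by (intro power_mono) auto
  also have "... = 2 ^ k * max b c ^ k" by (simp add: power_mult_distrib)
  also have "... \<le> 2 ^ k * (b ^ k + c ^ k)" using assms by (intro mult_left_mono) (auto simp: max_def)
  finally show ?thesis .
qed

lemma band_dist:
  assumes "t \<in> {bp n..bp (n + 1)}"
  shows "pi * \<bar>of_int n\<bar> \<le> \<bar>t\<bar> + (pi + Q1)" "\<bar>t\<bar> \<le> pi * (\<bar>of_int n\<bar> + 1) + Q1"
proof -
  have "of_int (n - 1) * pi - Q1 \<le> t" "t \<le> of_int (n + 1) * pi + Q1"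
    using assms bp_bounds(1)[of n] bp_bounds(2)[of "n + 1"] by (auto intro: order_trans)
  hence "\<bar>t - of_int n * pi\<bar> \<le> pi + Q1" by (simp add: abs_le_iff algebra_simps)
  moreover have "\<bar>of_int n * pi\<bar> = pi * \<bar>of_int n\<bar>" by (simp add: abs_mult)
  ultimately show "pi * \<bar>of_int n\<bar> \<le> \<bar>t\<bar> + (pi + Q1)" "\<bar>t\<bar> \<le> pi * (\<bar>of_int n\<bar> + 1) + Q1"
    unfolding distrib_left by linarith+
qed

lemma continuous_on_Im_kk:
  assumes "y > 0" shows "continuous_on S (\<lambda>t. Im (kk (Complex t y)))"
  by (intro continuous_intros continuous_on_compose2[OF continuous_on_kk])
    (use assms in \<open>auto simp: Complex_eq intro!: continuous_intros\<close>)

lemma Im_kk_integrable: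
  assumes "y > 0" shows "(\<lambda>t. t ^ k * Im (kk (Complex t y))) integrable_on {a..b}"
  by (intro integrable_continuous_real continuous_intros continuous_on_Im_kk assms)

text \<open>Since \<open>Im kk\<close> is positive, a pointwise inequality of weights on each
  interval integrates to an inequality between sums over gaps and moments.\<close>

lemma weighted_le:
  assumes y: "y > 0" and w: "\<And>n t. t \<in> {bp n..bp (n + 1)} \<Longrightarrow> w n \<le> c * t ^ (2 * l) + d"
  shows "(\<Sum>n\<in>symi N. w n * (2 / pi * JJ n y)) \<le> c * Tr l N y + d * Tr 0 N y"
proof -
  let ?k = "\<lambda>t. Im (kk (Complex t y))"
  note i = Im_kk_integrable[OF y]
  have i0: "?k integrable_on {a..b}" for a b using i[of 0] by simp
  have "w n * JJ n y \<le> c * integral {bp n..bp (n + 1)} (\<lambda>t. t ^ (2 * l) * ?k t) + d * JJ n y" for n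
  proof -
    have "w n * JJ n y = integral {bp n..bp (n + 1)} (\<lambda>t. w n * ?k t)" by (simp add: JJ_def)
    also have "... \<le> integral {bp n..bp (n + 1)} (\<lambda>t. c * (t ^ (2 * l) * ?k t) + d * ?k t)"
    proof (rule integral_le)
      fix t assume "t \<in> {bp n..bp (n + 1)}"
      hence "w n * ?k t \<le> (c * t ^ (2 * l) + d) * ?k t" using Im_kk[of "Complex t y"] y by (intro mult_right_mono w) auto
      thus "w n * ?k t \<le> c * (t ^ (2 * l) * ?k t) + d * ?k t" by (simp add: algebra_simps)
    qed (intro integrable_continuous_real continuous_intros continuous_on_Im_kk y)+
    also have "... = integral {bp n..bp (n + 1)} (\<lambda>t. c * (t ^ (2 * l) * ?k t)) + integral {bp n..bp (n + 1)} (\<lambda>t. d * ?k t)"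
      by (rule Henstock_Kurzweil_Integration.integral_add) (intro integrable_continuous_real continuous_intros continuous_on_Im_kk y)+
    finally show ?thesis by (simp add: JJ_def)
  qed
  hence "2 / pi * (\<Sum>n\<in>symi N. w n * JJ n y) \<le>
    2 / pi * (\<Sum>n\<in>symi N. c * integral {bp n..bp (n + 1)} (\<lambda>t. t ^ (2 * l) * ?k t) + d * JJ n y)"
    by (intro mult_left_mono sum_mono) auto
  also have "... = c * Tr l N y + d * Tr 0 N y"
    using integral_bp[OF i, of N "2 * l"] integral_bp[OF i0, of N]
    by (simp add: Tr_def JJ_def sum.distrib sum_distrib_left[symmetric] algebra_simps)
  finally show ?thesis by (simp add: sum_distrib_left ac_simps)
qed

lemma weighted_ge:
  assumes y: "y > 0" and w: "\<And>n t. t \<in> {bp n..bp (n + 1)} \<Longrightarrow> t ^ (2 * l) \<le> w n"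
  shows "Tr l N y \<le> (\<Sum>n\<in>symi N. w n * (2 / pi * JJ n y))"
proof -
  let ?k = "\<lambda>t. Im (kk (Complex t y))"
  note i = Im_kk_integrable[OF y]
  have i0: "?k integrable_on {a..b}" for a b using i[of 0] by simp
  have "integral {bp n..bp (n + 1)} (\<lambda>t. t ^ (2 * l) * ?k t) \<le> w n * JJ n y" for n
  proof -
    have "integral {bp n..bp (n + 1)} (\<lambda>t. t ^ (2 * l) * ?k t) \<le> integral {bp n..bp (n + 1)} (\<lambda>t. w n * ?k t)"
    proof (rule integral_le)
      fix t assume "t \<in> {bp n..bp (n + 1)}"
      thus "t ^ (2 * l) * ?k t \<le> w n * ?k t" using Im_kk[of "Complex t y"] y by (intro mult_right_mono w) auto
    qed (intro integrable_continuous_real continuous_intros continuous_on_Im_kk y)+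
    thus ?thesis by (simp add: JJ_def)
  qed
  hence "2 / pi * (\<Sum>n\<in>symi N. integral {bp n..bp (n + 1)} (\<lambda>t. t ^ (2 * l) * ?k t)) \<le>
    2 / pi * (\<Sum>n\<in>symi N. w n * JJ n y)"
    by (intro mult_left_mono sum_mono) auto
  thus ?thesis
    unfolding Tr_def integral_bp[OF i, of N "2 * l"] by (simp add: sum_distrib_left ac_simps)
qed

lemma even_power_abs: "t ^ (2 * l) = \<bar>t\<bar> ^ (2 * l)" for t :: real by (simp add: power_mult)

text \<open>The sum is first extended to a cutoff \<open>M\<close> at which both moments are near
  their limits, the added summands being nonnegative; then \<open>y\<close> tends to 0 in a finite
  sum. The moment of order 0 pays for the distance of an interval point from
  \<open>n * pi\<close>.\<close>

lemma actions_le_trace: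
  "(\<Sum>n\<in>symi N. (pi * \<bar>real_of_int n\<bar>) ^ (2 * l) * act_n n) \<le> 2 ^ (2 * l) * (Tl l + (pi + Q1) ^ (2 * l) * Tl 0)"
proof (rule field_le_epsilon)
  fix e :: real assume e: "e > 0"
  let ?w = "\<lambda>n. (pi * \<bar>real_of_int n\<bar>) ^ (2 * l)"
  define c d where "c = (2::real) ^ (2 * l)" and "d = 2 ^ (2 * l) * (pi + Q1) ^ (2 * l)"
  have cd: "c \<ge> 0" "d \<ge> 0" using Q1_nonneg by (simp_all add: c_def d_def)
  define e' where "e' = e / (c + d + 1)"
  have e': "e' > 0" "(c + d) * e' \<le> e" using e cd by (simp_all add: e'_def field_simps)
  obtain N1 where N1: "\<And>N. N \<ge> N1 \<Longrightarrow> \<forall>\<^sub>F y in at_right 0. \<bar>Tr l N y - Tl l\<bar> \<le> e'" by (rule trace_limit[OF e'(1)]) blast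
  obtain N2 where N2: "\<And>N. N \<ge> N2 \<Longrightarrow> \<forall>\<^sub>F y in at_right 0. \<bar>Tr 0 N y - Tl 0\<bar> \<le> e'" by (rule trace_limit[OF e'(1)]) blast
  define M where "M = max N (max N1 N2)"
  have M: "M \<ge> N1" "M \<ge> N2" "N \<le> M" by (auto simp: M_def)
  have "(\<Sum>n\<in>symi N. ?w n * act_n n) \<le> (\<Sum>n\<in>symi M. ?w n * act_n n)"
    using M by (intro sum_mono2) (auto simp: act_n_nonneg)
  also have "... \<le> c * (Tl l + e') + d * (Tl 0 + e')"
  proof (rule tendsto_upperbound)
    show "((\<lambda>y. \<Sum>n\<in>symi M. ?w n * (2 / pi * JJ n y)) \<longlongrightarrow> (\<Sum>n\<in>symi M. ?w n * act_n n)) (at_right 0)"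
      by (intro tendsto_sum tendsto_mult_left act_n_tendsto)
    have "\<forall>\<^sub>F y in at_right 0. (0::real) < y"
      unfolding eventually_at_right_field by (intro exI[of _ 1]) auto
    with N1[OF M(1)] N2[OF M(2)] show "\<forall>\<^sub>F y in at_right 0. (\<Sum>n\<in>symi M. ?w n * (2 / pi * JJ n y)) \<le> c * (Tl l + e') + d * (Tl 0 + e')"
    proof eventually_elim
      case (elim y)
      have "(\<Sum>n\<in>symi M. ?w n * (2 / pi * JJ n y)) \<le> c * Tr l M y + d * Tr 0 M y"
      proof (rule weighted_le[OF elim(3)])
        fix n t assume "t \<in> {bp n..bp (n + 1)}"
        from power_add_le[OF _ _ _ band_dist(1)[OF this], of "2 * l"] Q1_nonneg
        show "?w n \<le> c * t ^ (2 * l) + d" unfolding c_def d_def even_power_abs[of t] by (simp add: distrib_left)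
      qed
      also have "... \<le> c * (Tl l + e') + d * (Tl 0 + e')"
        using elim(1,2) cd by (intro add_mono mult_left_mono) auto
      finally show ?case .
    qed
  qed simp
  also have "... = 2 ^ (2 * l) * (Tl l + (pi + Q1) ^ (2 * l) * Tl 0) + (c + d) * e'"
    by (simp add: c_def d_def algebra_simps)
  finally show "(\<Sum>n\<in>symi N. ?w n * act_n n) \<le> 2 ^ (2 * l) * (Tl l + (pi + Q1) ^ (2 * l) * Tl 0) + e"
    using e'(2) by linarith
qed

lemma trace_le_actions:
  assumes S: "\<And>N. (\<Sum>n\<in>symi N. ((pi * (\<bar>real_of_int n\<bar> + 1)) ^ (2 * l) + Q1 ^ (2 * l)) * act_n n) \<le> S"
  shows "Tl l \<le> 2 ^ (2 * l) * S"
proof (rule field_le_epsilon)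
  fix e :: real assume e: "e > 0"
  let ?w = "\<lambda>n. 2 ^ (2 * l) * ((pi * (\<bar>real_of_int n\<bar> + 1)) ^ (2 * l) + Q1 ^ (2 * l))"
  obtain N where N: "\<And>M. M \<ge> N \<Longrightarrow> \<forall>\<^sub>F y in at_right 0. \<bar>Tr l M y - Tl l\<bar> \<le> e" by (rule trace_limit[OF e]) blast
  have "Tl l - e \<le> (\<Sum>n\<in>symi N. ?w n * act_n n)"
  proof (rule tendsto_lowerbound)
    show "((\<lambda>y. \<Sum>n\<in>symi N. ?w n * (2 / pi * JJ n y)) \<longlongrightarrow> (\<Sum>n\<in>symi N. ?w n * act_n n)) (at_right 0)"
      by (intro tendsto_sum tendsto_mult_left act_n_tendsto)
    have "\<forall>\<^sub>F y in at_right 0. (0::real) < y"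
      unfolding eventually_at_right_field by (intro exI[of _ 1]) auto
    with N[OF order_refl] show "\<forall>\<^sub>F y in at_right 0. Tl l - e \<le> (\<Sum>n\<in>symi N. ?w n * (2 / pi * JJ n y))"
    proof eventually_elim
      case (elim y)
      have "Tr l N y \<le> (\<Sum>n\<in>symi N. ?w n * (2 / pi * JJ n y))"
      proof (rule weighted_ge[OF elim(2)])
        fix n t assume "t \<in> {bp n..bp (n + 1)}"
        from power_add_le[OF _ _ _ band_dist(2)[OF this], of "2 * l"] Q1_nonneg
        show "t ^ (2 * l) \<le> ?w n" by (simp add: even_power_abs[symmetric])
      qed
      thus ?case using elim(1) by linarith
    qed
  qed simp
  also have "... = 2 ^ (2 * l) * (\<Sum>n\<in>symi N. ((pi * (\<bar>real_of_int n\<bar> + 1)) ^ (2 * l) + Q1 ^ (2 * l)) * act_n n)"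
    by (simp add: sum_distrib_left mult.assoc)
  also have "... \<le> 2 ^ (2 * l) * S" by (intro mult_left_mono S) simp
  finally show "Tl l \<le> 2 ^ (2 * l) * S + e" by linarith
qed

end

section \<open>Interpolation estimates\<close>

text \<open>Weighted arithmetic-geometric mean with the norms enlarged by \<open>e\<close>; letting
  \<open>e\<close> tend to 0 avoids division by a vanishing norm.\<close>

lemma integral_Cauchy_Schwarz:
  fixes f g :: "real \<Rightarrow> real"
  assumes f: "continuous_on {0..1} f" and g: "continuous_on {0..1} g"
  shows "integral {0..1} (\<lambda>x. f x * g x) \<le> sqrt (integral {0..1} (\<lambda>x. (f x)\<^sup>2)) * sqrt (integral {0..1} (\<lambda>x. (g x)\<^sup>2))"
proof -
  define F G where "F = sqrt (integral {0..1} (\<lambda>x. (f x)\<^sup>2))" and "G = sqrt (integral {0..1} (\<lambda>x. (g x)\<^sup>2))"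
  have F: "F \<ge> 0" "integral {0..1} (\<lambda>x. (f x)\<^sup>2) = F\<^sup>2" and G: "G \<ge> 0" "integral {0..1} (\<lambda>x. (g x)\<^sup>2) = G\<^sup>2"
    unfolding F_def G_def
    by (auto intro!: real_sqrt_pow2[symmetric] integral_nonneg integrable_continuous_real continuous_intros f g)
  have *: "integral {0..1} (\<lambda>x. f x * g x) \<le> (F + e) * (G + e)" if e: "e > 0" for e
  proof -
    define a b where "a = F + e" and "b = G + e"
    have ab: "a > 0" "b > 0" "F \<le> a" "G \<le> b" using F G e by (auto simp: a_def b_def)
    have "integral {0..1} (\<lambda>x. f x * g x) \<le> integral {0..1} (\<lambda>x. b / (2 * a) * (f x)\<^sup>2 + a / (2 * b) * (g x)\<^sup>2)"
    proof (rule integral_le)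
      fix x
      have "0 \<le> (b * f x - a * g x)\<^sup>2 / (2 * a * b)" using ab by simp
      also have "... = b / (2 * a) * (f x)\<^sup>2 + a / (2 * b) * (g x)\<^sup>2 - f x * g x"
        using ab by (simp add: field_simps power2_eq_square)
      finally show "f x * g x \<le> b / (2 * a) * (f x)\<^sup>2 + a / (2 * b) * (g x)\<^sup>2" by simp
    qed (intro integrable_continuous_real continuous_intros f g)+
    also have "... = integral {0..1} (\<lambda>x. b / (2 * a) * (f x)\<^sup>2) + integral {0..1} (\<lambda>x. a / (2 * b) * (g x)\<^sup>2)"
      by (rule Henstock_Kurzweil_Integration.integral_add) (intro integrable_continuous_real continuous_intros f g)+
    also have "... = b / (2 * a) * F\<^sup>2 + a / (2 * b) * G\<^sup>2" by (simp only: integral_mult_right F(2) G(2))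
    also have "... \<le> b / (2 * a) * a\<^sup>2 + a / (2 * b) * b\<^sup>2"
      using ab F(1) G(1) by (intro add_mono mult_left_mono power_mono) auto
    also have "... = a * b" using ab by (simp add: power2_eq_square)
    finally show ?thesis by (simp add: a_def b_def)
  qed
  have "((\<lambda>e. (F + e) * (G + e)) \<longlongrightarrow> (F + 0) * (G + 0)) (at_right 0)"
    by (intro tendsto_intros tendsto_ident_at)
  hence "integral {0..1} (\<lambda>x. f x * g x) \<le> (F + 0) * (G + 0)"
    by (rule tendsto_lowerbound) (use * in \<open>auto simp: eventually_at_right_field intro!: exI[of _ 1]\<close>)
  thus ?thesis by (simp add: F_def G_def)
qed

text \<open>A log-convex sequence is largest at an end. At the least index where a maximum above one
  is attained, the left neighbour is strictly smaller, which contradicts log-convexity.\<close>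

lemma log_convex_max:
  fixes b :: "nat \<Rightarrow> real"
  assumes b: "\<And>k. b k \<ge> 0" "\<And>k. (b (Suc k))\<^sup>2 \<le> b k * b (Suc (Suc k))" "b 0 \<le> 1" "b m \<le> 1" and k: "k \<le> m"
  shows "b k \<le> 1"
proof (rule ccontr)
  assume "\<not> b k \<le> 1"
  define S where "S = Max (b ` {..m})"
  have S: "b j \<le> S" if "j \<le> m" for j using that by (simp add: S_def)
  have S1: "S > 1" using S[OF k] \<open>\<not> b k \<le> 1\<close> by linarith
  have "S \<in> b ` {..m}" unfolding S_def by (rule Max_in) auto
  hence ex: "\<exists>j. j \<le> m \<and> b j = S" by auto
  define j where "j = (LEAST j. j \<le> m \<and> b j = S)"
  have j: "j \<le> m" "b j = S" using LeastI_ex[OF ex] by (auto simp: j_def)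
  have "j \<noteq> 0" "j \<noteq> m" using j(2) S1 b(3,4) by (metis not_less)+
  then obtain i where i: "j = Suc i" "Suc j \<le> m" using j(1) by (cases j) auto
  have "b i \<noteq> S" using not_less_Least[of i "\<lambda>j. j \<le> m \<and> b j = S"] i by (auto simp: j_def[symmetric])
  hence "b i < S" using S[of i] i by auto
  have "S\<^sup>2 \<le> b i * b (Suc j)" using b(2)[of i] i j by simp
  also have "... \<le> b i * S" using S[OF i(2)] b(1) by (intro mult_left_mono)
  also have "... < S\<^sup>2" using \<open>b i < S\<close> S1 by (simp add: power2_eq_square)
  finally show False by simp
qed

context smooth_potential
begin

section \<open>L2 norms of derivatives and integrals of monomials\<close>

definition an :: "nat \<Rightarrow> real" where "an k = sqrt (integral {0..1} (\<lambda>x. (cmod (q k x))\<^sup>2))"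

lemma an_nonneg: "an k \<ge> 0"
  unfolding an_def by (intro real_sqrt_ge_zero integral_nonneg integrable_continuous_real continuous_intros) auto

lemma an_square: "(an k)\<^sup>2 = integral {0..1} (\<lambda>x. (cmod (q k x))\<^sup>2)"
  unfolding an_def by (intro real_sqrt_pow2 integral_nonneg integrable_continuous_real continuous_intros) auto

lemma Q1_le_an: "Q1 \<le> an 0" using integral_Cauchy_Schwarz[of "\<lambda>x. cmod (q 0 x)" "\<lambda>x. 1"]
  by (auto simp: Q1_def an_def intro!: continuous_intros)

lemma an_product: "integral {0..1} (\<lambda>x. cmod (q j x) * cmod (q k x)) \<le> an j * an k"
  unfolding an_def by (rule integral_Cauchy_Schwarz) (intro continuous_intros)+

lemma Sm_parts:
  assumes "v \<in> Sm" "w \<in> Sm"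
  shows "integral {0..1} (\<lambda>x. DD v x * w x) = - integral {0..1} (\<lambda>x. v x * DD w x)"
proof -
  have c: "continuous_on {0..1} v" "continuous_on {0..1} w" "continuous_on {0..1} (DD v)" "continuous_on {0..1} (DD w)"
    by (intro continuous_on_Sm Sm_deriv(2) assms)+
  have "((\<lambda>x. v x * DD w x + DD v x * w x) has_integral v 1 * w 1 - v 0 * w 0) {0..1}"
    by (rule fundamental_theorem_of_calculus[OF zero_le_one has_vector_derivative_at_within])
      (rule has_vector_derivative_mult[OF Sm_deriv(1)[OF assms(1)] Sm_deriv(1)[OF assms(2)]])
  moreover have "v 1 = v 0" "w 1 = w 0" using Sm_periodic[OF assms(1), of 0] Sm_periodic[OF assms(2), of 0] by simp_all
  ultimately have "integral {0..1} (\<lambda>x. v x * DD w x + DD v x * w x) = 0" by (simp add: integral_unique)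
  moreover have "integral {0..1} (\<lambda>x. v x * DD w x + DD v x * w x) =
      integral {0..1} (\<lambda>x. v x * DD w x) + integral {0..1} (\<lambda>x. DD v x * w x)"
    by (rule Henstock_Kurzweil_Integration.integral_add) (intro integrable_continuous_real continuous_intros c)+
  ultimately show ?thesis by (simp add: add_eq_0_iff)
qed

text \<open>A pair encodes one factor of a monomial: the flag marks conjugation, the number is the
  order of the derivative.\<close>

definition ff :: "bool \<times> nat \<Rightarrow> real \<Rightarrow> complex"
  where "ff p x = (if fst p then cnj (q (snd p) x) else q (snd p) x)"

definition inc :: "bool \<times> nat \<Rightarrow> bool \<times> nat" where "inc p = (fst p, Suc (snd p))"

lemma ff_Sm: "ff p \<in> Sm" by (cases "fst p") (auto simp: ff_def[abs_def] intro: Sm.intros)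

lemma DD_ff: "DD (ff p) = ff (inc p)" by (rule DD_eqI, cases "fst p")
    (auto simp: ff_def[abs_def] inc_def intro: q_deriv has_vector_derivative_cnj[OF q_deriv])

lemma cmod_ff: "cmod (ff p x) = cmod (q (snd p) x)" by (simp add: ff_def)

definition mono :: "(bool \<times> nat) list \<Rightarrow> real \<Rightarrow> complex"
  where "mono \<beta> x = (\<Prod>p\<leftarrow>\<beta>. ff p x)"

lemma mono_simps [simp]: "mono [] = (\<lambda>x. 1)" "mono (p # \<beta>) = (\<lambda>x. ff p x * mono \<beta> x)"
  by (auto simp: mono_def[abs_def])

lemma mono_Sm: "mono \<beta> \<in> Sm" by (induction \<beta>) (auto intro: Sm.intros ff_Sm)

abbreviation ord :: "(bool \<times> nat) list \<Rightarrow> nat" where "ord \<beta> \<equiv> sum_list (map snd \<beta>)"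

text \<open>The terms of the Leibniz rule, kept as a list because their number enters the
  constants.\<close>

primrec dl :: "(bool \<times> nat) list \<Rightarrow> (bool \<times> nat) list list" where
  "dl [] = []"
| "dl (p # \<beta>) = (inc p # \<beta>) # map ((#) p) (dl \<beta>)"

lemma dl: "length (dl \<beta>) = length \<beta>" "\<gamma> \<in> set (dl \<beta>) \<Longrightarrow> length \<gamma> = length \<beta>" "\<gamma> \<in> set (dl \<beta>) \<Longrightarrow> ord \<gamma> = Suc (ord \<beta>)"
  by (induction \<beta> arbitrary: \<gamma>) (auto simp: inc_def)

lemma DD_mult: "v \<in> Sm \<Longrightarrow> w \<in> Sm \<Longrightarrow> DD (\<lambda>x. v x * w x) = (\<lambda>x. v x * DD w x + DD v x * w x)"
  by (intro DD_eqI has_vector_derivative_mult Sm_deriv)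

lemma DD_add: "v \<in> Sm \<Longrightarrow> w \<in> Sm \<Longrightarrow> DD (\<lambda>x. v x + w x) = (\<lambda>x. DD v x + DD w x)"
  by (intro DD_eqI has_vector_derivative_add Sm_deriv)

lemma DD_const: "DD (\<lambda>x. c) = (\<lambda>x. 0)" by (rule DD_eqI) auto

lemma DD_mono: "DD (mono \<beta>) = (\<lambda>x. \<Sum>\<gamma>\<leftarrow>dl \<beta>. mono \<gamma> x)"
proof (induction \<beta>)
  case (Cons p \<beta>)
  thus ?case by (simp add: DD_mult[OF ff_Sm mono_Sm] DD_ff sum_list_const_mult o_def fun_eq_iff)
qed (simp add: DD_const)

lemma Sm_sum_list: "set L \<subseteq> Sm \<Longrightarrow> (\<lambda>x. \<Sum>w\<leftarrow>L. w x) \<in> Sm" by (induction L) (auto intro: Sm.intros)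

lemma Ec_add: "v \<in> Sm \<Longrightarrow> w \<in> Sm \<Longrightarrow> Ec i p (\<lambda>x. v x + w x) = Ec i p v + Ec i p w"
proof (induction i arbitrary: p v w)
  case 0
  thus ?case by (simp add: Henstock_Kurzweil_Integration.integral_add Sm_integrable)
next
  case (Suc i)
  have s: "DD v \<in> Sm" "DD w \<in> Sm" "(\<lambda>x. v x * q 0 x) \<in> Sm" "(\<lambda>x. w x * q 0 x) \<in> Sm"
    "(\<lambda>x. v x * cnj (q 0 x)) \<in> Sm" "(\<lambda>x. w x * cnj (q 0 x)) \<in> Sm"
    using Suc.prems by (auto intro: Sm_deriv Sm.intros)
  show ?case
    by (simp add: DD_add[OF Suc.prems] distrib_right Suc.IH s) (simp add: algebra_simps add_divide_distrib)
qed

lemma Ec_zero: "Ec i p (\<lambda>x. 0) = 0" by (induction i arbitrary: p) (simp_all add: DD_const)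

lemma Ec_sum_list: "set L \<subseteq> Sm \<Longrightarrow> Ec i p (\<lambda>x. \<Sum>w\<leftarrow>L. w x) = (\<Sum>w\<leftarrow>L. Ec i p w)"
  by (induction L) (simp_all add: Ec_zero Ec_add Sm_sum_list)

lemma Ec_DD_mono: "Ec i p (DD (mono \<beta>)) = (\<Sum>\<gamma>\<leftarrow>dl \<beta>. Ec i p (mono \<gamma>))"
  using Ec_sum_list[of "map mono (dl \<beta>)" i p] by (auto simp: DD_mono o_def mono_Sm image_subset_iff)

lemma norm_sum_list_le:
  fixes f :: "'b \<Rightarrow> complex"
  assumes "\<And>x. x \<in> set L \<Longrightarrow> cmod (f x) \<le> B"
  shows "cmod (\<Sum>x\<leftarrow>L. f x) \<le> real (length L) * B" using assms
proof (induction L)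
  case (Cons a L)
  have "cmod (f a + (\<Sum>x\<leftarrow>L. f x)) \<le> B + real (length L) * B"
    using Cons by (intro norm_triangle_mono) auto
  thus ?case by (simp add: algebra_simps)
qed simp

text \<open>Assigning degree one to \<open>q\<close> and to \<open>d/dx\<close>, the coefficient \<open>Ec i p (mono \<beta>)\<close> is an integral of
  homogeneous polynomials of degree \<open>i\<close> plus the degree of \<open>mono \<beta>\<close>; each of them has at least
  \<open>p + length \<beta>\<close> factors.\<close>

lemma Ec_mono_bound:
  assumes B: "\<And>\<beta>. length \<beta> + ord \<beta> = N \<Longrightarrow> R \<le> length \<beta> \<Longrightarrow> cmod (integral {0..1} (mono \<beta>)) \<le> B" "0 \<le> B"
  shows "length \<beta> + ord \<beta> + i = N \<Longrightarrow> R \<le> length \<beta> + p \<Longrightarrow> cmod (Ec i p (mono \<beta>)) \<le> (real N + 2) ^ i * B"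
proof (induction i arbitrary: p \<beta>)
  case 0
  thus ?case using B by simp
next
  case (Suc i)
  let ?M = "(real N + 2) ^ i * B"
  have M: "?M \<ge> 0" using B(2) by simp
  show ?case
  proof (cases "p = 0")
    case False
    have 1: "cmod (Ec i p (DD (mono \<beta>))) \<le> real (length \<beta>) * ?M"
      unfolding Ec_DD_mono dl(1)[symmetric]
      by (intro norm_sum_list_le Suc.IH) (use Suc.prems dl(2,3)[of _ \<beta>] in auto)
    have 2: "cmod (Ec i (p - 1) (mono ((False, 0) # \<beta>))) \<le> ?M"
      by (rule Suc.IH) (use Suc.prems False in auto)
    have 3: "cmod (Ec i (p + 1) (mono ((True, 0) # \<beta>))) \<le> ?M"
      by (rule Suc.IH) (use Suc.prems False in auto)
    have e: "(\<lambda>x. mono \<beta> x * q 0 x) = mono ((False, 0) # \<beta>)" "(\<lambda>x. mono \<beta> x * cnj (q 0 x)) = mono ((True, 0) # \<beta>)"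
      by (simp_all add: ff_def mult.commute)
    have "Ec (Suc i) p (mono \<beta>) = - (1 / of_nat p) * Ec i p (DD (mono \<beta>)) + \<i> * Ec i (p - 1) (mono ((False, 0) # \<beta>))
      + \<i> * Ec i (p + 1) (mono ((True, 0) # \<beta>))"
      unfolding Ec.simps e using False by (simp only: if_False)
    also have "cmod \<dots> \<le> real (length \<beta>) * ?M + ?M + ?M"
    proof (intro norm_triangle_mono)
      have "cmod (- (1 / of_nat p) * Ec i p (DD (mono \<beta>))) \<le> 1 * cmod (Ec i p (DD (mono \<beta>)))"
        unfolding norm_mult using False by (intro mult_right_mono) (auto simp: norm_divide)
      thus "cmod (- (1 / of_nat p) * Ec i p (DD (mono \<beta>))) \<le> real (length \<beta>) * ?M" using 1 by linarith
    qed (use 2 3 in \<open>simp_all add: norm_mult del: mono_simps\<close>)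
    also have "... = (real (length \<beta>) + 2) * ?M" by (simp add: algebra_simps)
    also have "... \<le> (real N + 2) * ?M" using Suc.prems M by (intro mult_right_mono) auto
    finally show ?thesis by simp
  qed (use B(2) in simp)
qed

lemma cnj_Sm: "DD (\<lambda>x. cnj (q k x)) = (\<lambda>x. cnj (q (Suc k) x))" "DD (q k) = q (Suc k)"
  by (rule DD_eqI, rule has_vector_derivative_cnj[OF q_deriv]) (rule DD_eqI, rule q_deriv)

lemma integral_cnj_q: "integral {0..1} (\<lambda>x. cnj (q k x) * q k x) = of_real ((an k)\<^sup>2)"
proof -
  have "(\<lambda>x. cnj (q k x) * q k x) = (\<lambda>x. of_real ((cmod (q k x))\<^sup>2))"
    by (auto simp: complex_norm_square mult.commute simp del: of_real_power)
  thus ?thesis unfolding an_square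
    by (simp only:) (intro integral_unique has_integral_of_real integrable_integral integrable_continuous_real continuous_intros)
qed

lemma integral_cnj_shift:
  "integral {0..1} (\<lambda>x. cnj (q (j + i) x) * q l x) = (-1) ^ i * integral {0..1} (\<lambda>x. cnj (q j x) * q (l + i) x)"
proof (induction i arbitrary: l)
  case (Suc i)
  have "integral {0..1} (\<lambda>x. cnj (q (j + Suc i) x) * q l x) = - integral {0..1} (\<lambda>x. cnj (q (j + i) x) * q (Suc l) x)"
    using Sm_parts[OF Sm_cnj[of "j + i"] Sm_q[of l]] by (simp add: cnj_Sm)
  thus ?case using Suc[of "Suc l"] by simp
qed simp

text \<open>One integration by parts and Cauchy-Schwarz. Together with \<open>log_convex_max\<close>
  this is the interpolation inequality between the L2 norm and the top derivative.\<close>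

lemma an_log_convex: "(an (Suc k))\<^sup>2 \<le> an k * an (Suc (Suc k))"
proof -
  have "of_real ((an (Suc k))\<^sup>2) = - integral {0..1} (\<lambda>x. cnj (q (Suc (Suc k)) x) * q k x)"
    unfolding integral_cnj_q[symmetric] using integral_cnj_shift[of "Suc k" 1 k] by simp
  hence "(an (Suc k))\<^sup>2 = cmod (integral {0..1} (\<lambda>x. cnj (q (Suc (Suc k)) x) * q k x))"
    using norm_of_real[of "(an (Suc k))\<^sup>2", where 'a = complex] by (simp del: of_real_power norm_of_real)
  also have "... \<le> integral {0..1} (\<lambda>x. cmod (q (Suc (Suc k)) x) * cmod (q k x))"
    by (rule integral_norm_bound_integral)
      (auto intro!: integrable_continuous_real continuous_intros simp: norm_mult)
  also have "... \<le> an (Suc (Suc k)) * an k" by (rule an_product)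
  finally show ?thesis by (simp add: mult.commute)
qed

text \<open>The squared modulus is somewhere at most its mean, and its variation over the period is
  at most the integral of the modulus of its derivative.\<close>

lemma q_sup:
  assumes x: "x \<in> {0..1}"
  shows "(cmod (q k x))\<^sup>2 \<le> (an k)\<^sup>2 + 2 * an k * an (Suc k)"
proof -
  let ?F = "\<lambda>x. (cmod (q k x))\<^sup>2" and ?F' = "\<lambda>x. 2 * Re (cnj (q k x) * q (Suc k) x)"
  have cF: "continuous_on S ?F" "continuous_on S ?F'" for S by (intro continuous_intros)+
  have d: "(?F has_real_derivative ?F' x) (at x within S)" for x S
    by (rule has_real_derivative_cmod_power2[OF q_deriv_within])
  obtain x0 where x0: "x0 \<in> {0..1}" "\<And>y. y \<in> {0..1} \<Longrightarrow> ?F x0 \<le> ?F y"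
    using continuous_attains_inf[of "{0..1::real}" ?F] cF by auto
  have "integral {0..1} (\<lambda>x::real. ?F x0) \<le> integral {0..1} ?F"
    by (rule integral_le[OF _ _ x0(2)]) (intro integrable_continuous_real cF continuous_intros)+
  hence 1: "?F x0 \<le> (an k)\<^sup>2" by (simp add: an_square)
  have *: "\<bar>?F v - ?F u\<bar> \<le> integral {0..1} (\<lambda>x. 2 * (cmod (q k x) * cmod (q (Suc k) x)))" if uv: "0 \<le> u" "u \<le> v" "v \<le> 1" for u v
  proof -
    have "(?F' has_integral ?F v - ?F u) {u..v}"
      by (rule fundamental_theorem_of_calculus[OF uv(2)]) (rule d[unfolded has_real_derivative_iff_has_vector_derivative])
    hence "\<bar>?F v - ?F u\<bar> = norm (integral {u..v} ?F')" by (simp only: integral_unique real_norm_def)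
    also have "... \<le> integral {u..v} (\<lambda>x. 2 * (cmod (q k x) * cmod (q (Suc k) x)))"
    proof (rule integral_norm_bound_integral)
      show "norm (?F' x) \<le> 2 * (cmod (q k x) * cmod (q (Suc k) x))" for x
        using abs_Re_le_cmod[of "cnj (q k x) * q (Suc k) x"] by (simp add: norm_mult abs_mult del: times_complex.sel)
    qed (intro integrable_continuous_real cF continuous_intros)+
    also have "... \<le> integral {0..1} (\<lambda>x. 2 * (cmod (q k x) * cmod (q (Suc k) x)))"
      by (rule integral_subset_le) (use uv in \<open>auto intro!: integrable_continuous_real continuous_intros\<close>)
    finally show ?thesis .
  qed
  have "\<bar>?F x - ?F x0\<bar> \<le> integral {0..1} (\<lambda>x. 2 * (cmod (q k x) * cmod (q (Suc k) x)))"
    using *[of x x0] *[of x0 x] x x0(1) by (cases "x \<le> x0") (auto simp: abs_minus_commute)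
  also have "... \<le> 2 * (an k * an (Suc k))" using an_product[of k "Suc k"] by simp
  finally show ?thesis using 1 by linarith
qed

text \<open>The bound on \<open>an m\<close> is written as \<open>A \<kappa>\<^sup>2\<^sup>m\<close> so that, by interpolation, \<open>\<kappa>\<^sup>2\<close> is the cost of a derivative
  in \<open>L\<^sup>2\<close> and \<open>\<kappa>\<close> that of passing from \<open>L\<^sup>2\<close> to \<open>L\<^sup>\<infinity>\<close>.\<close>

definition bdd :: "nat \<Rightarrow> real \<Rightarrow> real \<Rightarrow> bool"
  where "bdd m A \<kappa> \<longleftrightarrow> A > 0 \<and> \<kappa> \<ge> 1 \<and> an 0 \<le> A \<and> an m \<le> A * \<kappa> ^ (2 * m)"

text \<open>Dividing by a geometric sequence preserves log-convexity, so the bounds at orders 0 and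
  \<open>m\<close> spread to all orders between.\<close>

lemma an_le:
  assumes b: "bdd m A \<kappa>" and k: "k \<le> m"
  shows "an k \<le> A * \<kappa> ^ (2 * k)"
proof -
  have A: "A > 0" "\<kappa> \<ge> 1" using b by (auto simp: bdd_def)
  hence pos: "A * \<kappa> ^ (2 * k) > 0" for k by simp
  have "an k / (A * \<kappa> ^ (2 * k)) \<le> 1"
  proof (rule log_convex_max[where b = "\<lambda>k. an k / (A * \<kappa> ^ (2 * k))" and m = m, OF _ _ _ _ k])
    show "0 \<le> an k / (A * \<kappa> ^ (2 * k))" for k using pos[of k] an_nonneg[of k] by simp
    show "(an (Suc k) / (A * \<kappa> ^ (2 * Suc k)))\<^sup>2 \<le> an k / (A * \<kappa> ^ (2 * k)) * (an (Suc (Suc k)) / (A * \<kappa> ^ (2 * Suc (Suc k))))" for k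
    proof -
      have "(A * \<kappa> ^ (2 * Suc k))\<^sup>2 = (A * \<kappa> ^ (2 * k)) * (A * \<kappa> ^ (2 * Suc (Suc k)))"
        by (simp add: power2_eq_square power_add[symmetric])
      thus ?thesis unfolding power_divide times_divide_times_eq
        by (metis an_log_convex divide_right_mono zero_le_power2)
    qed
    show "an 0 / (A * \<kappa> ^ (2 * 0)) \<le> 1" "an m / (A * \<kappa> ^ (2 * m)) \<le> 1"
      using b pos[of m] by (auto simp: bdd_def)
  qed
  thus ?thesis using pos[of k] by simp
qed

lemma q_le:
  assumes b: "bdd m A \<kappa>" and k: "k < m" and x: "x \<in> {0..1}"
  shows "cmod (q k x) \<le> 2 * A * \<kappa> ^ (2 * k + 1)"
proof (rule power2_le_imp_le)
  have A: "A > 0" "\<kappa> \<ge> 1" using b by (auto simp: bdd_def)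
  have "4 * k = 2 * k + 2 * k" by simp
  hence e: "\<kappa> ^ (4 * k) = \<kappa> ^ (2 * k) * \<kappa> ^ (2 * k)" "\<kappa> ^ (4 * k + 2) = \<kappa> ^ (2 * k) * \<kappa> ^ (2 * k) * \<kappa>\<^sup>2"
    "\<kappa> ^ (2 * Suc k) = \<kappa> ^ (2 * k) * \<kappa>\<^sup>2" by (simp_all only: power_add mult_Suc_right) (simp_all add: power2_eq_square)
  have "(cmod (q k x))\<^sup>2 \<le> (an k)\<^sup>2 + 2 * an k * an (Suc k)" by (rule q_sup[OF x])
  also have "... \<le> (A * \<kappa> ^ (2 * k))\<^sup>2 + 2 * (A * \<kappa> ^ (2 * k)) * (A * \<kappa> ^ (2 * Suc k))"
    using an_le[OF b, of k] an_le[OF b, of "Suc k"] k an_nonneg A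
    by (intro add_mono power_mono mult_mono) auto
  also have "... = A\<^sup>2 * \<kappa> ^ (4 * k) * 1 + 2 * (A\<^sup>2 * \<kappa> ^ (4 * k + 2))"
    unfolding e by (simp add: power2_eq_square)
  also have "... \<le> A\<^sup>2 * \<kappa> ^ (4 * k) * \<kappa>\<^sup>2 + 2 * (A\<^sup>2 * \<kappa> ^ (4 * k + 2))"
    using A by (intro add_mono mult_left_mono) (auto simp: one_le_power)
  also have "... = 3 * (A\<^sup>2 * \<kappa> ^ (4 * k + 2))" by (simp add: power_add power2_eq_square)
  also have "... \<le> 4 * (A\<^sup>2 * \<kappa> ^ (4 * k + 2))" using A by (intro mult_right_mono) auto
  also have "... = (2 * A * \<kappa> ^ (2 * k + 1))\<^sup>2"
    by (simp add: power2_eq_square power_add[symmetric] power_mult_distrib)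
  finally show "(cmod (q k x))\<^sup>2 \<le> (2 * A * \<kappa> ^ (2 * k + 1))\<^sup>2" .
  show "0 \<le> 2 * A * \<kappa> ^ (2 * k + 1)" using A by simp
qed

lemma mono_sup:
  assumes b: "bdd m A \<kappa>" and x: "x \<in> {0..1}"
  shows "(\<And>p. p \<in> set \<beta> \<Longrightarrow> snd p < m) \<Longrightarrow> cmod (mono \<beta> x) \<le> (2 * A) ^ length \<beta> * \<kappa> ^ (2 * ord \<beta> + length \<beta>)"
proof (induction \<beta>)
  case (Cons p \<beta>)
  have A: "A > 0" "\<kappa> \<ge> 1" using b by (auto simp: bdd_def)
  have "cmod (mono (p # \<beta>) x) = cmod (q (snd p) x) * cmod (mono \<beta> x)" by (simp add: norm_mult cmod_ff)
  also have "... \<le> (2 * A * \<kappa> ^ (2 * snd p + 1)) * ((2 * A) ^ length \<beta> * \<kappa> ^ (2 * ord \<beta> + length \<beta>))"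
    using Cons A by (intro mult_mono q_le[OF b _ x]) auto
  also have "... = (2 * A) ^ length (p # \<beta>) * \<kappa> ^ (2 * ord (p # \<beta>) + length (p # \<beta>))"
    by (simp add: power_add mult_ac distrib_left)
  finally show ?case .
qed simp

text \<open>Two factors are measured in L2 and the others in the supremum norm, which saves two
  powers of \<open>\<kappa>\<close> against \<open>mono_sup\<close> and lets those two have order
  \<open>m\<close>.\<close>

lemma mono_int:
  assumes b: "bdd m A \<kappa>" and p: "snd p \<le> m" "snd p' \<le> m" and \<beta>: "\<And>p. p \<in> set \<beta> \<Longrightarrow> snd p < m"
  shows "cmod (integral {0..1} (mono (p # p' # \<beta>))) \<le> (2 * A) ^ (length \<beta> + 2) * \<kappa> ^ (2 * ord (p # p' # \<beta>) + length \<beta>)"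
proof -
  have A: "A > 0" "\<kappa> \<ge> 1" using b by (auto simp: bdd_def)
  define S where "S = (2 * A) ^ length \<beta> * \<kappa> ^ (2 * ord \<beta> + length \<beta>)"
  have S: "S \<ge> 0" using A by (simp add: S_def)
  have "cmod (integral {0..1} (mono (p # p' # \<beta>))) \<le> integral {0..1} (\<lambda>x. S * (cmod (q (snd p) x) * cmod (q (snd p') x)))"
  proof (rule integral_norm_bound_integral)
    show "mono (p # p' # \<beta>) integrable_on {0..1}" by (rule Sm_integrable[OF mono_Sm])
    show "(\<lambda>x. S * (cmod (q (snd p) x) * cmod (q (snd p') x))) integrable_on {0..1}"
      by (intro integrable_continuous_real continuous_intros)
    fix x :: real assume x: "x \<in> {0..1}"
    have "cmod (mono \<beta> x) \<le> S" unfolding S_def by (rule mono_sup[OF b x \<beta>])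
    thus "cmod (mono (p # p' # \<beta>) x) \<le> S * (cmod (q (snd p) x) * cmod (q (snd p') x))"
      using mult_right_mono[of "cmod (mono \<beta> x)" S "cmod (q (snd p) x) * cmod (q (snd p') x)"]
      by (simp add: norm_mult cmod_ff mult_ac)
  qed
  also have "... \<le> S * (an (snd p) * an (snd p'))"
    using S an_product[of "snd p" "snd p'"] by (simp add: mult_left_mono)
  also have "... \<le> S * ((A * \<kappa> ^ (2 * snd p)) * (A * \<kappa> ^ (2 * snd p')))"
    using S A an_nonneg by (intro mult_left_mono mult_mono an_le[OF b] p) auto
  also have "... \<le> S * ((2 * A * \<kappa> ^ (2 * snd p)) * (2 * A * \<kappa> ^ (2 * snd p')))"
    using S A by (intro mult_left_mono mult_mono) auto
  also have "... = (2 * A) ^ (length \<beta> + 2) * \<kappa> ^ (2 * ord (p # p' # \<beta>) + length \<beta>)"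
    by (simp add: S_def power_add mult_ac distrib_left power2_eq_square)
  finally show ?thesis .
qed

text \<open>One factor carries \<open>m + j\<close> derivatives, more than are controlled, so
  \<open>j\<close> of them are moved to the other factors. The bound on
  \<open>j + ord \<beta>\<close> keeps those below order \<open>m\<close> throughout.\<close>

lemma mono_parts:
  assumes b: "bdd m A \<kappa>"
  shows "\<beta> \<noteq> [] \<Longrightarrow> j + ord \<beta> < m \<Longrightarrow>
    cmod (integral {0..1} (mono ((c, m + j) # \<beta>))) \<le> real (length \<beta>) ^ j * ((2 * A) ^ (length \<beta> + 1) * \<kappa> ^ (2 * (m + j + ord \<beta>) + length \<beta> - 1))"
proof (induction j arbitrary: \<beta>)
  case 0
  then obtain p' \<beta>' where \<beta>: "\<beta> = p' # \<beta>'" by (cases \<beta>) auto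
  have le: "snd p \<le> ord \<beta>" if "p \<in> set \<beta>" for p using that by (intro member_le_sum_list) auto
  have "snd p < m" if "p \<in> set \<beta>" for p using le[OF that] 0 by simp
  hence "cmod (integral {0..1} (mono ((c, m) # p' # \<beta>'))) \<le> (2 * A) ^ (length \<beta>' + 2) * \<kappa> ^ (2 * ord ((c, m) # p' # \<beta>') + length \<beta>')"
    by (intro mono_int[OF b]) (auto simp: \<beta> less_imp_le)
  thus ?case by (simp add: \<beta> del: mono_simps)
next
  case (Suc j)
  have A: "A > 0" "\<kappa> \<ge> 1" using b by (auto simp: bdd_def)
  let ?M = "real (length \<beta>) ^ j * ((2 * A) ^ (length \<beta> + 1) * \<kappa> ^ (2 * (m + Suc j + ord \<beta>) + length \<beta> - 1))"
  have eq: "(\<lambda>x. ff (c, m + j) x * DD (mono \<beta>) x) = (\<lambda>x. \<Sum>w\<leftarrow>map (\<lambda>\<gamma>. mono ((c, m + j) # \<gamma>)) (dl \<beta>). w x)"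
    by (simp add: DD_mono sum_list_const_mult o_def)
  have "integral {0..1} (mono ((c, m + Suc j) # \<beta>)) = - integral {0..1} (\<lambda>x. ff (c, m + j) x * DD (mono \<beta>) x)"
    using Sm_parts[OF ff_Sm[of "(c, m + j)"] mono_Sm[of \<beta>]] by (simp add: DD_ff inc_def)
  also have "integral {0..1} (\<lambda>x. ff (c, m + j) x * DD (mono \<beta>) x) =
     (\<Sum>w\<leftarrow>map (\<lambda>\<gamma>. mono ((c, m + j) # \<gamma>)) (dl \<beta>). integral {0..1} w)"
    unfolding eq using Ec_sum_list[of "map (\<lambda>\<gamma>. mono ((c, m + j) # \<gamma>)) (dl \<beta>)" 0 0] mono_Sm
    by (simp add: image_subset_iff del: mono_simps)
  finally have "cmod (integral {0..1} (mono ((c, m + Suc j) # \<beta>))) =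
    cmod (\<Sum>\<gamma>\<leftarrow>dl \<beta>. integral {0..1} (mono ((c, m + j) # \<gamma>)))" by (simp add: o_def del: mono_simps)
  also have "... \<le> real (length (dl \<beta>)) * ?M"
  proof (rule norm_sum_list_le)
    fix \<gamma> assume g: "\<gamma> \<in> set (dl \<beta>)"
    have l: "length \<gamma> = length \<beta>" "ord \<gamma> = Suc (ord \<beta>)" by (rule dl(2)[OF g], rule dl(3)[OF g])
    have "cmod (integral {0..1} (mono ((c, m + j) # \<gamma>))) \<le> real (length \<gamma>) ^ j * ((2 * A) ^ (length \<gamma> + 1) * \<kappa> ^ (2 * (m + j + ord \<gamma>) + length \<gamma> - 1))"
      by (rule Suc.IH) (use Suc.prems l in auto)
    thus "cmod (integral {0..1} (mono ((c, m + j) # \<gamma>))) \<le> ?M" unfolding l by simp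
  qed
  also have "... = real (length \<beta>) ^ Suc j * ((2 * A) ^ (length \<beta> + 1) * \<kappa> ^ (2 * (m + Suc j + ord \<beta>) + length \<beta> - 1))"
    by (simp add: dl)
  finally show ?case .
qed

text \<open>With at least four factors the total order is at most \<open>2 * m - 2\<close>, so at
  most one factor has order \<open>m\<close> or more; it is brought to the front for
  \<open>mono_parts\<close>.\<close>

lemma mono_bound:
  assumes b: "bdd m A \<kappa>" and \<beta>: "4 \<le> length \<beta>" "length \<beta> + ord \<beta> = 2 * m + 2"
  shows "cmod (integral {0..1} (mono \<beta>)) \<le> real (2 * m + 2) ^ m * ((2 * A) ^ length \<beta> * \<kappa> ^ (2 * ord \<beta> + length \<beta> - 2))"
proof -
  have A: "A > 0" "\<kappa> \<ge> 1" using b by (auto simp: bdd_def)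
  let ?T = "(2 * A) ^ length \<beta> * \<kappa> ^ (2 * ord \<beta> + length \<beta> - 2)"
  have T: "?T \<ge> 0" using A by simp
  have one: "1 \<le> real (2 * m + 2) ^ m" by (rule one_le_power) simp
  show ?thesis
  proof (cases "\<forall>p\<in>set \<beta>. snd p < m")
    case True
    obtain p p' \<beta>' where e: "\<beta> = p # p' # \<beta>'" using \<beta>(1) by (cases \<beta>; cases "tl \<beta>") auto
    have "cmod (integral {0..1} (mono (p # p' # \<beta>'))) \<le> (2 * A) ^ (length \<beta>' + 2) * \<kappa> ^ (2 * ord (p # p' # \<beta>') + length \<beta>')"
      by (rule mono_int[OF b]) (use True in \<open>auto simp: e less_imp_le\<close>)
    hence "cmod (integral {0..1} (mono \<beta>)) \<le> 1 * ?T" by (simp add: e del: mono_simps)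
    also have "... \<le> real (2 * m + 2) ^ m * ?T" by (rule mult_right_mono[OF one T])
    finally show ?thesis .
  next
    case False
    then obtain p where p: "p \<in> set \<beta>" "m \<le> snd p" by (auto simp: not_less)
    define \<gamma> j where "\<gamma> = remove1 p \<beta>" and "j = snd p - m"
    have ms: "mset \<beta> = mset (p # \<gamma>)" using p(1) by (simp add: \<gamma>_def)
    have l: "length \<beta> = Suc (length \<gamma>)" using p(1) by (simp add: \<gamma>_def length_remove1) (metis Suc_pred length_pos_if_in_set)
    have o: "ord \<beta> = snd p + ord \<gamma>"
    proof -
      have "mset (map snd \<beta>) = mset (map snd (p # \<gamma>))" unfolding mset_map ms ..
      thus ?thesis by (metis list.simps(9) sum_list.Cons sum_mset_sum_list)
    qed
    have m: "mono \<beta> = mono ((fst p, m + j) # \<gamma>)"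
    proof
      fix x
      have "mset (map (\<lambda>p. ff p x) \<beta>) = mset (map (\<lambda>p. ff p x) (p # \<gamma>))" unfolding mset_map ms ..
      hence "(\<Prod>p\<leftarrow>\<beta>. ff p x) = (\<Prod>p\<leftarrow>p # \<gamma>. ff p x)" by (metis prod_mset_prod_list)
      moreover have "(fst p, m + j) = p" using p(2) by (simp add: j_def prod_eq_iff)
      ultimately show "mono \<beta> x = mono ((fst p, m + j) # \<gamma>) x" unfolding mono_def by simp
    qed
    have js: "m + j = snd p" using p(2) by (simp add: j_def)
    have "\<gamma> \<noteq> []" using l \<beta>(1) by auto
    moreover have jm: "j + ord \<gamma> < m" using l o js \<beta> by linarith
    ultimately have "cmod (integral {0..1} (mono \<beta>)) \<le> real (length \<gamma>) ^ j * ((2 * A) ^ (length \<gamma> + 1) * \<kappa> ^ (2 * (m + j + ord \<gamma>) + length \<gamma> - 1))"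
      unfolding m by (rule mono_parts[OF b])
    also have "(2 * A) ^ (length \<gamma> + 1) * \<kappa> ^ (2 * (m + j + ord \<gamma>) + length \<gamma> - 1) = ?T" unfolding l o js by simp
    also have "real (length \<gamma>) ^ j * ?T \<le> real (2 * m + 2) ^ m * ?T"
    proof (rule mult_right_mono[OF _ T])
      have "real (length \<gamma>) ^ j \<le> real (2 * m + 2) ^ j" using l \<beta>(2) by (intro power_mono) auto
      also have "... \<le> real (2 * m + 2) ^ m" using jm by (intro power_increasing) auto
      finally show "real (length \<gamma>) ^ j \<le> real (2 * m + 2) ^ m" .
    qed
    finally show ?thesis .
  qed
qed

text \<open>The middle term of the recursion lowers \<open>p\<close> to 0, where \<open>Ec\<close>
  of positive index vanishes.\<close>

lemma Ec_1_Suc: "Ec (Suc (Suc i)) 1 (\<lambda>x. cnj (q j x)) =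
    - Ec (Suc i) 1 (\<lambda>x. cnj (q (Suc j) x)) + \<i> * Ec (Suc i) 2 (mono [(True, j), (True, 0)])"
proof -
  have m: "(\<lambda>x. cnj (q j x) * cnj (q 0 x)) = mono [(True, j), (True, 0)]" by (simp add: ff_def)
  have z: "Ec (Suc i) 0 v = 0" for v by simp
  have "Ec (Suc n) 1 v = - Ec n 1 (DD v) + \<i> * Ec n 0 (\<lambda>x. v x * q 0 x) + \<i> * Ec n 2 (\<lambda>x. v x * cnj (q 0 x))" for n v
    by (simp add: numeral_2_eq_2)
  from this[of "Suc i" "\<lambda>x. cnj (q j x)"] show ?thesis
    by (simp only: cnj_Sm m z mult_zero_right add_0_right)
qed

text \<open>The first branch of the recursion collects all derivatives on one factor and ends in the
  quadratic term. Each branch leaving it starts with \<open>p = 2\<close> and two factors, hence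
  leads to monomials with at least four, and counts as error.\<close>

lemma Ec_lead:
  assumes M: "\<forall>i'\<ge>1. \<forall>j'. i' + j' = n \<longrightarrow> cmod (Ec i' 2 (mono [(True, j'), (True, 0)])) \<le> M"
  shows "i + j = n \<Longrightarrow> cmod (Ec (Suc i) 1 (\<lambda>x. cnj (q j x)) - (-1) ^ i * \<i> * integral {0..1} (\<lambda>x. cnj (q n x) * q 0 x)) \<le> real i * M"
proof (induction i arbitrary: j)
  case 0
  thus ?case by simp
next
  case (Suc i)
  define I where "I = integral {0..1} (\<lambda>x. cnj (q n x) * q 0 x)"
  define e where "e = Ec (Suc i) 1 (\<lambda>x. cnj (q (Suc j) x))"
  define h where "h = Ec (Suc i) 2 (mono [(True, j), (True, 0)])"
  have 1: "cmod (e - (-1) ^ i * \<i> * I) \<le> real i * M"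
    unfolding e_def I_def by (rule Suc.IH) (use Suc.prems in linarith)
  have 2: "cmod h \<le> M"
    unfolding h_def using M Suc.prems by (metis One_nat_def Suc_le_mono le0 add_Suc)
  have 3: "Ec (Suc (Suc i)) 1 (\<lambda>x. cnj (q j x)) - (-1) ^ Suc i * \<i> * I = - (e - (-1) ^ i * \<i> * I) + \<i> * h"
    unfolding Ec_1_Suc e_def[symmetric] h_def[symmetric] by simp
  have 4: "cmod (- (e - (-1) ^ i * \<i> * I) + \<i> * h) \<le> cmod (e - (-1) ^ i * \<i> * I) + cmod h"
    using norm_triangle_ineq[of "- (e - (-1) ^ i * \<i> * I)" "\<i> * h"] by (simp only: norm_minus_cancel norm_mult norm_ii mult_1)
  have "cmod (Ec (Suc (Suc i)) 1 (\<lambda>x. cnj (q j x)) - (-1) ^ Suc i * \<i> * I) \<le> real i * M + M"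
    unfolding 3 by (rule order_trans[OF 4 add_mono[OF 1 2]])
  also have "... = real (Suc i) * M" by (simp add: algebra_simps)
  finally show ?case unfolding I_def .
qed

text \<open>Factor and sign come from
  \<open>(2 * \<i>) ^ (2 * l + 1) = 2 * \<i> * (- 4) ^ l\<close>.\<close>

lemma Tl_eq: "4 ^ l * Tl l = (-1) ^ l * Im (Ec (2 * l + 1) 1 (\<lambda>x. cnj (q 0 x)))"
proof -
  let ?E = "Ec (2 * l + 1) 1 (\<lambda>x. cnj (q 0 x))"
  have "(2 * \<i>) ^ (2 * l + 1) = (2 * \<i>) * ((2 * \<i>)\<^sup>2) ^ l" by (simp add: power_add power_mult)
  also have "(2 * \<i>)\<^sup>2 = - 4" by (simp add: power_mult_distrib)
  also have "(- 4 :: complex) ^ l = (-1) ^ l * 4 ^ l" by (simp flip: power_mult_distrib)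
  finally have d: "(2 * \<i>) ^ (2 * l + 1) = 2 * \<i> * ((-1) ^ l * 4 ^ l)" .
  have "complex_of_real (4 ^ l) * ck (2 * l + 1) = \<i> * of_real ((-1) ^ l) * ?E / 2"
    unfolding ck_def d by (cases "even l") (simp_all add: field_simps)
  from arg_cong[OF this, of Re] show ?thesis
    by (cases "even l") (simp_all add: Tl_def del: Ec.simps of_real_power add_Suc_right)
qed

lemma Tl_0: "Tl 0 = (an 0)\<^sup>2" using Tl_eq[of 0] integral_cnj_q[of 0] by (simp add: power2_eq_square)

text \<open>Here \<open>4 * Tl 1\<close> is \<open>(an 1)\<^sup>2\<close> plus the integral of the
  fourth power of the modulus. Dropping the latter costs nothing, so no power of \<open>an 0\<close>
  appears.\<close>

lemma Tl_1: "(an 1)\<^sup>2 \<le> 4 * Tl 1"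
proof -
  let ?w = "\<lambda>x. cnj (q 0 x) * cnj (q 0 x) * q 0 x * q 0 x"
  have "Ec (2 * 1 + 1) 1 (\<lambda>x. cnj (q 0 x)) = \<i> * integral {0..1} (\<lambda>x. cnj (q 2 x) * q 0 x) - \<i> * integral {0..1} ?w"
    by (simp add: cnj_Sm numeral_2_eq_2)
  also have "integral {0..1} (\<lambda>x. cnj (q 2 x) * q 0 x) = - of_real ((an 1)\<^sup>2)"
    unfolding integral_cnj_q[symmetric] using integral_cnj_shift[of 1 1 0] by (simp add: numeral_2_eq_2)
  also have "integral {0..1} ?w = of_real (integral {0..1} (\<lambda>x. (cmod (q 0 x)) ^ 4))"
  proof -
    have "?w = (\<lambda>x. of_real ((cmod (q 0 x)) ^ 4))"
    proof
      fix x
      have "?w x = (q 0 x * cnj (q 0 x))\<^sup>2" by (simp add: power2_eq_square)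
      also have "... = of_real ((cmod (q 0 x)) ^ 4)" by (simp add: complex_norm_square[symmetric])
      finally show "?w x = of_real ((cmod (q 0 x)) ^ 4)" .
    qed
    thus ?thesis
      by (simp only:) (intro integral_unique has_integral_of_real integrable_integral integrable_continuous_real continuous_intros)
  qed
  finally have E: "Ec (2 * 1 + 1) 1 (\<lambda>x. cnj (q 0 x)) = \<i> * - of_real ((an 1)\<^sup>2) - \<i> * of_real (integral {0..1} (\<lambda>x. (cmod (q 0 x)) ^ 4))" .
  have "0 \<le> integral {0..1} (\<lambda>x. (cmod (q 0 x)) ^ 4)"
    by (intro integral_nonneg integrable_continuous_real continuous_intros) auto
  thus ?thesis using Tl_eq[of 1] unfolding E by simp
qed

end

text \<open>The factors come from the number of branches in \<open>Ec_lead\<close>, the terms spread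
  by the recursion in \<open>Ec_mono_bound\<close> at degree \<open>2 * m + 2\<close>, the
  integrations by parts in \<open>mono_bound\<close>, and the powers of 2 from the supremum
  bounds.\<close>

definition Cm :: "nat \<Rightarrow> real"
  where "Cm m = real (2 * m) * ((real (2 * m + 2) + 2) ^ (2 * m) * (real (2 * m + 2) ^ m * 2 ^ (2 * m + 2)))"

text \<open>The second summand is the constant of the case of small \<open>\<kappa>\<close> in
  \<open>Tl_remainder'\<close>; the first absorbs the remaining quarter of
  \<open>(an 0)\<^sup>2\<close>.\<close>

definition CC :: "nat \<Rightarrow> real" where "CC m = 2 + 2 * Cm m * (8 * Cm m) ^ (4 * m)"

lemma Cm_ge_1: assumes "m \<ge> 1" shows "Cm m \<ge> 1"
proof -
  have "1 * (1 * (1 * 1)) \<le> Cm m"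
    unfolding Cm_def using assms by (intro mult_mono one_le_power) auto
  thus ?thesis by simp
qed

context smooth_potential
begin

text \<open>With \<open>t = A / \<kappa>\<close>, an error monomial with \<open>r + 2\<close>
  factors has size \<open>A\<^sup>2 * \<kappa> ^ (4 * m) * t ^ r\<close>. Homogeneity confines
  \<open>r\<close> to the range from 2 to \<open>2 * m\<close>, and the two extreme powers
  dominate.\<close>

lemma Tl_remainder:
  assumes b: "bdd m A \<kappa>" and m: "m \<ge> 1"
  shows "\<bar>4 ^ m * Tl m - (an m)\<^sup>2\<bar> \<le> Cm m * (A\<^sup>2 * \<kappa> ^ (4 * m) * ((A / \<kappa>)\<^sup>2 + (A / \<kappa>) ^ (2 * m)))"
proof -
  have A: "A > 0" "\<kappa> \<ge> 1" using b by (auto simp: bdd_def)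
  define t where "t = A / \<kappa>"
  have t: "t > 0" "A = t * \<kappa>" using A by (simp_all add: t_def)
  define P where "P = A\<^sup>2 * \<kappa> ^ (4 * m) * (t\<^sup>2 + t ^ (2 * m))"
  have P: "P \<ge> 0" using A t by (simp add: P_def)
  define B where "B = real (2 * m + 2) ^ m * (2 ^ (2 * m + 2) * P)"
  have B: "B \<ge> 0" using P by (simp add: B_def)
  define N where "N = 2 * m + 2"
  have bound: "cmod (integral {0..1} (mono \<beta>)) \<le> B" if \<beta>: "length \<beta> + ord \<beta> = N" "4 \<le> length \<beta>" for \<beta>
  proof -
    obtain r where r: "length \<beta> = r + 2" "2 \<le> r" using \<beta>(2) by (intro that[of "length \<beta> - 2"]) auto
    have rm: "r \<le> 2 * m" using r \<beta>(1) by (simp add: N_def)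
    have e: "2 * ord \<beta> + length \<beta> - 2 + r = 4 * m" using r \<beta>(1) by (simp add: N_def)
    have "t ^ r \<le> t\<^sup>2 + t ^ (2 * m)"
    proof (cases "t \<le> 1")
      case True
      hence "t ^ r \<le> t\<^sup>2" using r t by (intro power_decreasing) auto
      thus ?thesis using t by (simp add: add_increasing2)
    next
      case False
      hence "t ^ r \<le> t ^ (2 * m)" using rm by (intro power_increasing) auto
      thus ?thesis by (simp add: add_increasing)
    qed
    moreover have "(2 * A) ^ length \<beta> * \<kappa> ^ (2 * ord \<beta> + length \<beta> - 2) = 2 ^ length \<beta> * (A\<^sup>2 * \<kappa> ^ (4 * m) * t ^ r)"
    proof -
      have "(2 * A) ^ length \<beta> = 2 ^ length \<beta> * (A\<^sup>2 * (t ^ r * \<kappa> ^ r))"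
        unfolding power_mult_distrib r(1) power_add by (simp add: t(2) power_mult_distrib mult_ac)
      moreover have "\<kappa> ^ r * \<kappa> ^ (2 * ord \<beta> + length \<beta> - 2) = \<kappa> ^ (4 * m)"
        unfolding power_add[symmetric] e[symmetric] by (simp add: add.commute)
      ultimately show ?thesis by (simp add: mult_ac)
    qed
    moreover have "(2::real) ^ length \<beta> \<le> 2 ^ (2 * m + 2)" using r rm by (intro power_increasing) auto
    ultimately have "(2 * A) ^ length \<beta> * \<kappa> ^ (2 * ord \<beta> + length \<beta> - 2) \<le> 2 ^ (2 * m + 2) * P"
      unfolding P_def using A t by (simp only:) (intro mult_mono mult_left_mono; simp)
    hence "real (2 * m + 2) ^ m * ((2 * A) ^ length \<beta> * \<kappa> ^ (2 * ord \<beta> + length \<beta> - 2)) \<le> B"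
      unfolding B_def by (intro mult_left_mono) auto
    thus ?thesis using mono_bound[OF b \<beta>(2)] \<beta>(1) by (simp add: N_def)
  qed
  define M where "M = (real N + 2) ^ (2 * m) * B"
  have "cmod (Ec (Suc (2 * m)) 1 (\<lambda>x. cnj (q 0 x)) - (-1) ^ (2 * m) * \<i> * integral {0..1} (\<lambda>x. cnj (q (2 * m) x) * q 0 x)) \<le> real (2 * m) * M"
  proof (rule Ec_lead)
    show "\<forall>i'\<ge>1. \<forall>j'. i' + j' = 2 * m \<longrightarrow> cmod (Ec i' 2 (mono [(True, j'), (True, 0)])) \<le> M"
    proof (intro allI impI)
      fix i j :: nat assume ij: "1 \<le> i" "i + j = 2 * m"
      have "cmod (Ec i 2 (mono [(True, j), (True, 0)])) \<le> (real N + 2) ^ i * B"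
        by (rule Ec_mono_bound[OF bound B]) (use ij in \<open>auto simp: N_def\<close>)
      also have "... \<le> M" unfolding M_def using ij B by (intro mult_right_mono power_increasing) auto
      finally show "cmod (Ec i 2 (mono [(True, j), (True, 0)])) \<le> M" .
    qed
  qed simp
  also have "(-1) ^ (2 * m) * \<i> * integral {0..1} (\<lambda>x. cnj (q (2 * m) x) * q 0 x) = \<i> * of_real ((-1) ^ m * (an m)\<^sup>2)"
    using integral_cnj_shift[of m m 0] by (simp add: mult_2 integral_cnj_q)
  finally have "cmod (Ec (Suc (2 * m)) 1 (\<lambda>x. cnj (q 0 x)) - \<i> * of_real ((-1) ^ m * (an m)\<^sup>2)) \<le> real (2 * m) * M" .
  hence "\<bar>Im (Ec (Suc (2 * m)) 1 (\<lambda>x. cnj (q 0 x)) - \<i> * of_real ((-1) ^ m * (an m)\<^sup>2))\<bar> \<le> real (2 * m) * M"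
    by (rule order_trans[OF abs_Im_le_cmod])
  hence "\<bar>Im (Ec (Suc (2 * m)) 1 (\<lambda>x. cnj (q 0 x))) - (-1) ^ m * (an m)\<^sup>2\<bar> \<le> real (2 * m) * M"
    by (simp del: Ec.simps)
  moreover have "\<bar>4 ^ m * Tl m - (an m)\<^sup>2\<bar> = \<bar>Im (Ec (Suc (2 * m)) 1 (\<lambda>x. cnj (q 0 x))) - (-1) ^ m * (an m)\<^sup>2\<bar>"
    unfolding Tl_eq by (cases "even m") (simp_all del: Ec.simps add: abs_minus_commute)
  moreover have "real (2 * m) * M = Cm m * P" by (simp add: M_def B_def Cm_def N_def mult_ac)
  ultimately show ?thesis unfolding P_def t_def by simp
qed

text \<open>\<open>\<kappa>\<close> is chosen so that \<open>A\<^sup>2 * \<kappa> ^ (4 * m)\<close>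
  equals \<open>B = A\<^sup>2 + (an m)\<^sup>2\<close>. For \<open>\<kappa>\<close> large against
  \<open>1 + A\<close> the remainder is at most a quarter of \<open>B\<close>; otherwise
  \<open>\<kappa>\<close> itself is bounded by a multiple of \<open>1 + A\<close>. The strict
  inequality keeps \<open>A\<close> positive even for the zero potential.\<close>

lemma Tl_remainder':
  assumes m: "m \<ge> 1" and A: "A > an 0"
  shows "\<bar>4 ^ m * Tl m - (an m)\<^sup>2\<bar> \<le> (A\<^sup>2 + (an m)\<^sup>2) / 4 + 2 * Cm m * (8 * Cm m) ^ (4 * m) * (A\<^sup>2 * (1 + A) ^ (4 * m))"
proof -
  have A0: "A > 0" using A an_nonneg[of 0] by linarith
  define B where "B = A\<^sup>2 + (an m)\<^sup>2"
  define \<kappa> where "\<kappa> = root (4 * m) (B / A\<^sup>2)"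
  have BA: "B / A\<^sup>2 \<ge> 1" using A0 by (simp add: B_def)
  have \<kappa>: "\<kappa> \<ge> 1" unfolding \<kappa>_def using BA m by simp
  have "\<kappa> ^ (4 * m) = B / A\<^sup>2" unfolding \<kappa>_def by (rule real_root_pow_pos2) (use BA m in auto)
  hence B: "A\<^sup>2 * \<kappa> ^ (4 * m) = B" using A0 by simp
  have "(an m)\<^sup>2 \<le> (A * \<kappa> ^ (2 * m))\<^sup>2"
  proof -
    have "(A * \<kappa> ^ (2 * m))\<^sup>2 = A\<^sup>2 * \<kappa> ^ (4 * m)" by (simp add: power_mult_distrib flip: power_mult)
    thus ?thesis unfolding B by (simp add: B_def)
  qed
  hence "an m \<le> A * \<kappa> ^ (2 * m)" by (rule power2_le_imp_le) (use A0 \<kappa> in simp)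
  hence b: "bdd m A \<kappa>" using A A0 \<kappa> by (simp add: bdd_def)
  define t where "t = A / \<kappa>"
  have t: "t \<ge> 0" "t \<le> A" "A = t * \<kappa>" using A0 \<kappa> by (simp_all add: t_def field_simps)
  note R = Tl_remainder[OF b m, folded t_def, unfolded B]
  have C: "Cm m \<ge> 1" by (rule Cm_ge_1[OF m])
  \<comment> \<open>The factor 8 makes \<open>Cm m * (2 / K)\<close> equal to a quarter.\<close>
  define K where "K = 8 * Cm m"
  have K: "K \<ge> 8" using C by (simp add: K_def)
  have B0: "B \<ge> 0" by (simp add: B_def)
  show ?thesis
  proof (cases "\<kappa> \<ge> K * (1 + A)")
    case True
    have "t * K \<le> 1"
    proof -
      have "A * K \<le> \<kappa>" using True K A0 by (simp add: algebra_simps)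
      thus ?thesis using \<kappa> by (simp add: t_def divide_le_eq)
    qed
    hence tK: "t \<le> 1 / K" using K by (simp add: field_simps)
    hence t1: "t \<le> 1" using K by (simp add: order_trans)
    have "t\<^sup>2 \<le> t ^ 1" "t ^ (2 * m) \<le> t ^ 1" using t t1 m by (intro power_decreasing; simp)+
    hence "t\<^sup>2 + t ^ (2 * m) \<le> 2 / K" using tK by simp
    hence "Cm m * (B * (t\<^sup>2 + t ^ (2 * m))) \<le> Cm m * (B * (2 / K))" using C B0 by (intro mult_left_mono) auto
    also have "... = B / 4" using C by (simp add: K_def)
    finally have "\<bar>4 ^ m * Tl m - (an m)\<^sup>2\<bar> \<le> B / 4" using R by linarith
    moreover have "0 \<le> 2 * Cm m * (8 * Cm m) ^ (4 * m) * (A\<^sup>2 * (1 + A) ^ (4 * m))" using C A0 by simp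
    ultimately show ?thesis unfolding B_def by linarith
  next
    case False
    let ?S = "(K * (1 + A)) ^ (4 * m)"
    have ks: "\<kappa> \<le> K * (1 + A)" using False by simp
    have As: "A \<le> K * (1 + A)" using K A0 mult_mono[of 1 K A "1 + A"] by simp
    \<comment> \<open>The power of \<open>t\<close> turns \<open>j\<close> of the factors
      \<open>\<kappa>\<close> into \<open>A\<close>, so only numbers below
      \<open>K * (1 + A)\<close> are multiplied.\<close>
    have *: "\<kappa> ^ (4 * m) * t ^ j \<le> ?S" if j: "j \<le> 4 * m" for j
    proof -
      have "\<kappa> ^ (4 * m) * t ^ j = \<kappa> ^ (4 * m - j) * A ^ j"
        using j unfolding t(3) power_mult_distrib by (simp add: mult_ac flip: power_add)
      also have "... \<le> (K * (1 + A)) ^ (4 * m - j) * (K * (1 + A)) ^ j"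
        using ks As \<kappa> A0 K by (intro mult_mono power_mono) auto
      also have "... = ?S" using j by (simp flip: power_add)
      finally show ?thesis .
    qed
    have "B * (t\<^sup>2 + t ^ (2 * m)) = A\<^sup>2 * (\<kappa> ^ (4 * m) * t\<^sup>2 + \<kappa> ^ (4 * m) * t ^ (2 * m))"
      unfolding B[symmetric] by (simp add: algebra_simps)
    also have "... \<le> A\<^sup>2 * (?S + ?S)" using m by (intro mult_left_mono add_mono *) auto
    finally have "Cm m * (B * (t\<^sup>2 + t ^ (2 * m))) \<le> Cm m * (A\<^sup>2 * (?S + ?S))" using C by (intro mult_left_mono) auto
    also have "... = 2 * Cm m * (8 * Cm m) ^ (4 * m) * (A\<^sup>2 * (1 + A) ^ (4 * m))"
      by (simp add: K_def power_mult_distrib)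
    finally have "\<bar>4 ^ m * Tl m - (an m)\<^sup>2\<bar> \<le> 2 * Cm m * (8 * Cm m) ^ (4 * m) * (A\<^sup>2 * (1 + A) ^ (4 * m))" using R by linarith
    moreover have "0 \<le> B / 4" using B0 by simp
    ultimately show ?thesis unfolding B_def[symmetric] by linarith
  qed
qed

text \<open>Lets \<open>A\<close> decrease to \<open>an 0\<close>, which may vanish.\<close>

lemma Tl_estimate:
  assumes m: "m \<ge> 1"
  shows "\<bar>4 ^ m * Tl m - (an m)\<^sup>2\<bar> \<le> (an m)\<^sup>2 / 4 + CC m * ((an 0)\<^sup>2 * (1 + an 0) ^ (4 * m))"
proof -
  let ?D = "2 * Cm m * (8 * Cm m) ^ (4 * m)"
  have "((\<lambda>A. (A\<^sup>2 + (an m)\<^sup>2) / 4 + ?D * (A\<^sup>2 * (1 + A) ^ (4 * m))) \<longlongrightarrow>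
    ((an 0)\<^sup>2 + (an m)\<^sup>2) / 4 + ?D * ((an 0)\<^sup>2 * (1 + an 0) ^ (4 * m))) (at_right (an 0))"
    by (intro tendsto_intros tendsto_ident_at) simp
  hence "\<bar>4 ^ m * Tl m - (an m)\<^sup>2\<bar> \<le> ((an 0)\<^sup>2 + (an m)\<^sup>2) / 4 + ?D * ((an 0)\<^sup>2 * (1 + an 0) ^ (4 * m))"
    by (rule tendsto_lowerbound) (use Tl_remainder'[OF m] in \<open>auto simp: eventually_at_right_field intro!: exI[of _ "an 0 + 1"]\<close>)
  moreover have "(an 0)\<^sup>2 * 1 \<le> (an 0)\<^sup>2 * (1 + an 0) ^ (4 * m)"
    using an_nonneg[of 0] by (intro mult_left_mono one_le_power) auto
  moreover have "X \<le> y / 4 + (2 + D) * z" if "X \<le> (a + y) / 4 + D * z" "a * 1 \<le> z" "0 \<le> a" for X a y z D :: real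
  proof -
    have "(a + y) / 4 = a / 4 + y / 4" by (rule add_divide_distrib)
    moreover have "a / 4 \<le> 2 * z" using that by simp
    ultimately show ?thesis using that(1) unfolding distrib_right by linarith
  qed
  ultimately show ?thesis unfolding CC_def by simp
qed

end

section \<open>Coordinates, truncation and continuity\<close>

lemma weight_eq: "weight (real m) n = (1 + 2 * pi * \<bar>real_of_int n\<bar>) ^ (2 * m)"
proof -
  have "1 + \<bar>2 * real_of_int n * pi\<bar> = 1 + 2 * pi * \<bar>real_of_int n\<bar>" by (simp add: abs_mult)
  moreover have "1 + 2 * pi * \<bar>real_of_int n\<bar> > 0" by (rule add_pos_nonneg) auto
  ultimately show ?thesis unfolding weight_def using powr_realpow[of "1 + 2 * pi * \<bar>real_of_int n\<bar>" "2 * m"] by simp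
qed

lemma weight_nonneg: "weight s n \<ge> 0" by (simp add: weight_def)

lemma sum_sym_tendsto:
  fixes f :: "int \<Rightarrow> real"
  assumes "f summable_on UNIV"
  shows "(\<lambda>N. \<Sum>n\<in>symi N. f n) \<longlonglongrightarrow> infsum f UNIV"
proof -
  have "filterlim (\<lambda>N. symi N) (finite_subsets_at_top UNIV) sequentially"
    unfolding filterlim_finite_subsets_at_top
  proof (intro allI impI)
    fix X :: "int set" assume "finite X \<and> X \<subseteq> UNIV"
    hence "\<exists>k. abs ` X \<subseteq> {..k}" using finite_int_iff_bounded_le by auto
    then obtain k where k: "\<And>x. x \<in> X \<Longrightarrow> \<bar>x\<bar> \<le> k" by (auto simp: image_subset_iff)
    show "\<forall>\<^sub>F N in sequentially. finite (symi N) \<and> X \<subseteq> (symi N) \<and> (symi N) \<subseteq> UNIV"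
      unfolding eventually_sequentially using k by (intro exI[of _ "nat k"]) fastforce
  qed
  thus ?thesis
    using has_sum_infsum[OF assms] unfolding has_sum_def by (rule filterlim_compose[rotated])
qed

lemma sum_sym_le_infsum:
  fixes f :: "int \<Rightarrow> real"
  assumes "f summable_on UNIV" "\<And>n. f n \<ge> 0"
  shows "(\<Sum>n\<in>symi N. f n) \<le> infsum f UNIV"
  using finite_sum_le_infsum[OF assms(1), of "symi N"] assms(2) by auto

definition cterm :: "real \<Rightarrow> coords \<Rightarrow> int \<Rightarrow> real"
  where "cterm s z n = weight s n * ((fst (z n))\<^sup>2 + (snd (z n))\<^sup>2)"

lemma cterm_summable: assumes "z \<in> hr s" shows "cterm s z summable_on UNIV"
  unfolding cterm_def[abs_def] distrib_left
  by (rule summable_on_add) (use assms in \<open>auto simp: hr_def\<close>)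

lemma coords_norm_eq: assumes "z \<in> hr s" shows "coords_norm s z = sqrt (infsum (cterm s z) UNIV)"
proof -
  have s: "(\<lambda>n. weight s n * (fst (z n))\<^sup>2) summable_on UNIV" "(\<lambda>n. weight s n * (snd (z n))\<^sup>2) summable_on UNIV"
    using assms by (auto simp: hr_def)
  have "infsum (cterm s z) UNIV = (\<Sum>\<^sub>\<infinity>n. weight s n * (fst (z n))\<^sup>2) + (\<Sum>\<^sub>\<infinity>n. weight s n * (snd (z n))\<^sup>2)"
    unfolding cterm_def[abs_def] distrib_left by (rule infsum_add[OF s])
  thus ?thesis unfolding coords_norm_def seq_norm_def by (simp add: infsum_nonneg weight_nonneg)
qed

lemma cterm_nonneg: "cterm s z n \<ge> 0" by (simp add: cterm_def weight_nonneg)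

lemma coords_norm_nonneg: "z \<in> hr s \<Longrightarrow> coords_norm s z \<ge> 0"
  by (simp add: coords_norm_eq infsum_nonneg cterm_nonneg)

lemma coords_norm_square: "z \<in> hr s \<Longrightarrow> (coords_norm s z)\<^sup>2 = infsum (cterm s z) UNIV"
  by (simp add: coords_norm_eq infsum_nonneg cterm_nonneg)

lemma coords_norm_tendsto:
  assumes "z \<in> hr s" shows "(\<lambda>N. sqrt (\<Sum>n\<in>symi N. cterm s z n)) \<longlonglongrightarrow> coords_norm s z"
  unfolding coords_norm_eq[OF assms] by (intro tendsto_real_sqrt sum_sym_tendsto cterm_summable assms)

text \<open>Both coordinates with their weights in one family, so that the triangle inequality is
  inherited from \<open>L2_set\<close>.\<close>

definition cvec :: "real \<Rightarrow> coords \<Rightarrow> int \<times> bool \<Rightarrow> real"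
  where "cvec s z p = sqrt (weight s (fst p)) * (if snd p then fst (z (fst p)) else snd (z (fst p)))"

lemma cvec_L2: "sqrt (\<Sum>n\<in>symi N. cterm s z n) = L2_set (cvec s z) ((symi N) \<times> UNIV)"
proof -
  have "(\<Sum>p\<in>symi N \<times> UNIV. (cvec s z p)\<^sup>2) = (\<Sum>n\<in>symi N. \<Sum>b\<in>UNIV. (cvec s z (n, b))\<^sup>2)"
    by (simp add: sum.cartesian_product)
  also have "... = (\<Sum>n\<in>symi N. cterm s z n)"
    by (intro sum.cong refl) (simp add: UNIV_bool cvec_def cterm_def power_mult_distrib weight_nonneg algebra_simps)
  finally show ?thesis by (simp add: L2_set_def)
qed

lemma hr_add: assumes "y \<in> hr s" "z \<in> hr s" shows "y + z \<in> hr s"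
proof -
  have bound: "weight s n * \<bar>a + b\<bar>\<^sup>2 \<le> 2 * (weight s n * \<bar>a\<bar>\<^sup>2) + 2 * (weight s n * \<bar>b\<bar>\<^sup>2)" for a b n
    using mult_left_mono[OF sum_squares_bound[of a b] weight_nonneg[of s n]]
    by (simp add: power2_eq_square algebra_simps)
  have "(\<lambda>n. weight s n * \<bar>f (y n) + f (z n)\<bar>\<^sup>2) summable_on UNIV" if "f = fst \<or> f = snd" for f
  proof (rule summable_on_comparison_test)
    show "(\<lambda>n. 2 * (weight s n * \<bar>f (y n)\<bar>\<^sup>2) + 2 * (weight s n * \<bar>f (z n)\<bar>\<^sup>2)) summable_on UNIV"
      by (intro summable_on_add summable_on_cmult_right) (use assms that in \<open>auto simp: hr_def\<close>)
  qed (use bound weight_nonneg in auto)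
  from this[of fst] this[of snd] show ?thesis by (simp add: hr_def plus_fun_def)
qed

lemma coords_norm_add_le:
  assumes "y \<in> hr s" "z \<in> hr s"
  shows "coords_norm s (y + z) \<le> coords_norm s y + coords_norm s z"
proof (rule LIMSEQ_le[OF coords_norm_tendsto[OF hr_add[OF assms]]
    tendsto_add[OF coords_norm_tendsto[OF assms(1)] coords_norm_tendsto[OF assms(2)]]])
  have "cvec s (y + z) = (\<lambda>p. cvec s y p + cvec s z p)" by (auto simp: cvec_def fun_eq_iff distrib_left)
  thus "\<exists>N0. \<forall>N\<ge>N0. sqrt (\<Sum>n\<in>symi N. cterm s (y + z) n)
      \<le> sqrt (\<Sum>n\<in>symi N. cterm s y n) + sqrt (\<Sum>n\<in>symi N. cterm s z n)"
    unfolding cvec_L2 by (simp add: L2_set_triangle_ineq)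
qed

lemma hr_diff: "y \<in> hr s \<Longrightarrow> z \<in> hr s \<Longrightarrow> y - z \<in> hr s"
  and coords_norm_diff_le: "y \<in> hr s \<Longrightarrow> z \<in> hr s \<Longrightarrow> coords_norm s (y - z) \<le> coords_norm s y + coords_norm s z"
  using hr_add[of y s "- z"] coords_norm_add_le[of y s "- z"]
  by (simp_all add: hr_def coords_norm_def seq_norm_def)

lemma hr_zero: "0 \<in> hr s" and coords_norm_zero: "coords_norm s 0 = 0"
  by (simp_all add: hr_def coords_norm_def seq_norm_def)

lemma hr_sum: "(\<And>k. k \<in> I \<Longrightarrow> f k \<in> hr s) \<Longrightarrow> (\<Sum>k\<in>I. f k) \<in> hr s"
  by (induction I rule: infinite_finite_induct) (auto intro: hr_zero hr_add)

lemma coords_norm_sum_le: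
  "(\<And>k. k \<in> I \<Longrightarrow> f k \<in> hr s) \<Longrightarrow> coords_norm s (\<Sum>k\<in>I. f k) \<le> (\<Sum>k\<in>I. coords_norm s (f k))"
proof (induction I rule: infinite_finite_induct)
  case (insert k I)
  have "coords_norm s (f k + (\<Sum>k\<in>I. f k)) \<le> coords_norm s (f k) + coords_norm s (\<Sum>k\<in>I. f k)"
    by (intro coords_norm_add_le hr_sum insert.prems) auto
  also have "... \<le> coords_norm s (f k) + (\<Sum>k\<in>I. coords_norm s (f k))"
    using insert.IH insert.prems by simp
  finally show ?case by (simp only: sum.insert[OF insert.hyps])
qed (simp_all add: coords_norm_zero)

text \<open>The value at \<open>h = 0\<close> of the power series is \<open>F x\<close> only modulo the kernel of the seminorm.\<close>

lemma real_analytic_continuous: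
  assumes an: "real_analytic_map E p (hr s) (coords_norm s) F" and x: "x \<in> E" "0 \<in> E" "p 0 = 0"
    and h: "\<And>N. h N \<in> E" "\<And>N. p (h N) \<ge> 0" "(\<lambda>N. p (h N)) \<longlonglongrightarrow> 0" and xh: "\<And>N. x + h N \<in> E"
  shows "(\<lambda>N. coords_norm s (F (x + h N))) \<longlonglongrightarrow> coords_norm s (F x)"
proof -
  let ?q = "coords_norm s"
  obtain r C A where r: "r > 0" and A: "\<And>k. bounded_multilinear_form E p (hr s) ?q k (C k) (A k)"
    and sum: "summable (\<lambda>k. C k * r ^ k)"
    and lim: "\<And>h. h \<in> E \<Longrightarrow> p h < r \<Longrightarrow> (\<lambda>N. ?q (F (x + h) - (\<Sum>k<N. A k (replicate k h)))) \<longlonglongrightarrow> 0"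
    using an x(1) unfolding real_analytic_map_def by blast
  have FG: "F y \<in> hr s" if "y \<in> E" for y using an that by (simp add: real_analytic_map_def)
  have AG: "A k (replicate k h) \<in> hr s" "?q (A k (replicate k h)) \<le> C k * p h ^ k" if "h \<in> E" for k h
  proof -
    have "set (replicate k h) \<subseteq> E \<and> length (replicate k h) = k" using that by auto
    hence "A k (replicate k h) \<in> hr s \<and> ?q (A k (replicate k h)) \<le> C k * (\<Prod>h\<leftarrow>replicate k h. p h)"
      using A[of k] unfolding bounded_multilinear_form_def by blast
    moreover have "(\<Prod>h\<leftarrow>replicate k h. p h) = p h ^ k" by (induction k) auto
    ultimately show "A k (replicate k h) \<in> hr s" "?q (A k (replicate k h)) \<le> C k * p h ^ k" by auto
  qed
  have step: "?q (F (x + h) - A 0 []) \<le> suminf (\<lambda>k. C k * p h ^ k) - C 0" if h: "h \<in> E" "x + h \<in> E" "0 \<le> p h" "p h < r" for h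
  proof -
    let ?S = "\<lambda>N. \<Sum>k<N. A k (replicate k h)"
    have S: "?S N \<in> hr s" for N by (intro hr_sum AG(1) h)
    have sm: "summable (\<lambda>k. C k * p h ^ k)" by (rule powser_inside[OF sum]) (use h r in auto)
    have lm: "(\<lambda>N. ?q (F (x + h) - ?S (Suc N)) + ((\<Sum>k<Suc N. C k * p h ^ k) - C 0)) \<longlonglongrightarrow> 0 + (suminf (\<lambda>k. C k * p h ^ k) - C 0)"
      by (intro tendsto_add tendsto_diff tendsto_const LIMSEQ_Suc[OF lim] LIMSEQ_Suc[OF summable_LIMSEQ[OF sm]] h)
    have "?q (F (x + h) - A 0 []) \<le> ?q (F (x + h) - ?S (Suc N)) + ((\<Sum>k<Suc N. C k * p h ^ k) - C 0)" for N
    proof -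
      let ?R = "\<Sum>k<N. A (Suc k) (replicate (Suc k) h)"
      have R: "?R \<in> hr s" by (intro hr_sum AG(1) h)
      have e: "?S (Suc N) = A 0 [] + ?R" unfolding sum.lessThan_Suc_shift by simp
      have "F (x + h) - A 0 [] = (F (x + h) - ?S (Suc N)) + ?R" unfolding e by simp
      hence "?q (F (x + h) - A 0 []) \<le> ?q (F (x + h) - ?S (Suc N)) + ?q ?R"
        by (simp only: coords_norm_add_le[OF hr_diff[OF FG[OF h(2)] S[of "Suc N"]] R])
      also have "?q ?R \<le> (\<Sum>k<N. ?q (A (Suc k) (replicate (Suc k) h)))" by (intro coords_norm_sum_le AG(1) h)
      also have "... \<le> (\<Sum>k<N. C (Suc k) * p h ^ Suc k)" by (intro sum_mono AG(2) h)
      also have "... = (\<Sum>k<Suc N. C k * p h ^ k) - C 0" unfolding sum.lessThan_Suc_shift by simp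
      finally show ?thesis by (simp only: add.left_commute add_le_cancel_left order_refl)
    qed
    thus ?thesis using LIMSEQ_le_const[OF lm] by simp
  qed
  have c: "isCont (\<lambda>t. suminf (\<lambda>k. C k * t ^ k)) 0" by (rule isCont_powser[OF sum]) (use r in simp)
  have s0: "suminf (\<lambda>k. C k * 0 ^ k) = C 0" by (rule powser_zero)
  have A0: "A 0 [] \<in> hr s" using AG(1)[OF x(2), of 0] by simp
  have Fx0: "?q (F x - A 0 []) \<le> 0" using step[of 0] x r s0 by simp
  have "(\<lambda>N. suminf (\<lambda>k. C k * p (h N) ^ k) - C 0) \<longlonglongrightarrow> suminf (\<lambda>k. C k * 0 ^ k) - C 0"
    by (intro tendsto_diff tendsto_const isCont_tendsto_compose[OF c h(3)])
  hence lim0: "(\<lambda>N. suminf (\<lambda>k. C k * p (h N) ^ k) - C 0) \<longlonglongrightarrow> 0" unfolding s0 by simp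
  have "\<forall>\<^sub>F N in sequentially. p (h N) < r" using order_tendstoD(2)[OF h(3) r] .
  hence ev: "\<forall>\<^sub>F N in sequentially. norm (?q (F (x + h N)) - ?q (F x)) \<le> suminf (\<lambda>k. C k * p (h N) ^ k) - C 0"
  proof eventually_elim
    case (elim N)
    have 1: "?q (F (x + h N) - A 0 []) \<le> suminf (\<lambda>k. C k * p (h N) ^ k) - C 0" by (rule step[OF h(1) xh h(2) elim])
    have G: "F (x + h N) \<in> hr s" "F x \<in> hr s" by (intro FG xh x)+
    have u: "?q y \<le> ?q (y - A 0 []) + ?q (A 0 [])" if "y \<in> hr s" for y
      using coords_norm_add_le[OF hr_diff[OF that A0] A0] by simp
    have l: "?q (A 0 []) \<le> ?q (y - A 0 []) + ?q y" if "y \<in> hr s" for y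
      using coords_norm_diff_le[OF that hr_diff[OF that A0]] by (simp add: add.commute)
    show ?case using 1 Fx0 u[OF G(1)] l[OF G(1)] u[OF G(2)] l[OF G(2)] by (simp add: abs_le_iff)
  qed
  have "(\<lambda>N. ?q (F (x + h N)) - ?q (F x)) \<longlonglongrightarrow> 0" by (rule Lim_null_comparison[OF ev lim0])
  thus ?thesis by (simp add: LIM_zero_iff)
qed

text \<open>The constant of \<open>actions_upper\<close>; its square root is the constant of the
  first estimate.\<close>

definition Kc :: "nat \<Rightarrow> real" where "Kc m = 2 * 4 ^ m * (2 + 16 ^ m * (2 + CC m + 16 ^ m))"

lemma CC_ge_2: assumes "m \<ge> 1" shows "CC m \<ge> 2" using Cm_ge_1[OF assms] by (simp add: CC_def)

section \<open>Two-sided bounds for weighted sums of actions\<close>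

context smooth_potential
begin

lemma two_pow: "(2::real) ^ (2 * m) = 4 ^ m" "(4::real) ^ (2 * m) = 16 ^ m"
  by (simp_all add: power_mult)

text \<open>The weight is dominated by multiples of one and of
  \<open>(pi * \<bar>n\<bar>) ^ (2 * m)\<close>, so both moments enter. The displacement factor
  \<open>(pi + Q1) ^ (2 * m)\<close> is harmless because \<open>Q1\<close> is at most
  \<open>an 0\<close>.\<close>

lemma actions_upper:
  assumes m: "m \<ge> 1"
  shows "(\<Sum>n\<in>symi N. weight (real m) n * (2 * act_n n)) \<le> Kc m * ((an m)\<^sup>2 + (an 0)\<^sup>2 * (1 + an 0) ^ (4 * m))"
proof -
  define Z where "Z = (an 0)\<^sup>2 * (1 + an 0) ^ (4 * m)"
  have a0: "an 0 \<ge> 0" by (rule an_nonneg)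
  have Z: "(an 0)\<^sup>2 \<le> Z" "0 \<le> Z"
    using mult_left_mono[of 1 "(1 + an 0) ^ (4 * m)" "(an 0)\<^sup>2"] a0 by (simp_all add: Z_def)
  have C: "CC m \<ge> 2" by (rule CC_ge_2[OF m])
  have T: "Tl m \<le> 2 * (an m)\<^sup>2 + CC m * Z"
  \<comment> \<open>\<open>Tl_estimate\<close> controls \<open>4 ^ m * Tl m\<close>; discarding the
    factor \<open>4 ^ m\<close> requires a sign.\<close>
  proof (cases "Tl m \<ge> 0")
    case True
    hence "1 * Tl m \<le> 4 ^ m * Tl m" by (intro mult_right_mono) auto
    thus ?thesis using Tl_estimate[OF m, folded Z_def] zero_le_power2[of "an m"] by linarith
  next
    case False
    moreover have "0 \<le> 2 * (an m)\<^sup>2 + CC m * Z" using C Z by simp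
    ultimately show ?thesis by linarith
  qed
  have Q: "(pi + Q1) ^ (2 * m) * (an 0)\<^sup>2 \<le> 16 ^ m * Z"
  proof -
    have "(pi + Q1) ^ (2 * m) \<le> (4 * (1 + an 0)) ^ (2 * m)"
      using Q1_le_an Q1_nonneg pi_less_4 a0 by (intro power_mono) auto
    also have "... = 16 ^ m * (1 + an 0) ^ (2 * m)" unfolding power_mult_distrib two_pow ..
    also have "... \<le> 16 ^ m * (1 + an 0) ^ (4 * m)" using a0 by (intro mult_left_mono power_increasing) auto
    finally have "(pi + Q1) ^ (2 * m) * (an 0)\<^sup>2 \<le> 16 ^ m * (1 + an 0) ^ (4 * m) * (an 0)\<^sup>2" by (rule mult_right_mono) simp
    thus ?thesis by (simp add: Z_def mult_ac)
  qed
  let ?I = "symi N" and ?u = "\<lambda>n. (pi * \<bar>real_of_int n\<bar>) ^ (2 * m)"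
  have w: "weight (real m) n \<le> 4 ^ m * (1 + 4 ^ m * ?u n)" for n
  proof -
    have "weight (real m) n \<le> 2 ^ (2 * m) * (1 ^ (2 * m) + (2 * (pi * \<bar>real_of_int n\<bar>)) ^ (2 * m))"
      unfolding weight_eq by (rule power_add_le) auto
    thus ?thesis by (simp only: power_mult_distrib two_pow power_one)
  qed
  have "(\<Sum>n\<in>?I. weight (real m) n * (2 * act_n n)) \<le> (\<Sum>n\<in>?I. 4 ^ m * (1 + 4 ^ m * ?u n) * (2 * act_n n))"
    by (intro sum_mono mult_right_mono w) (simp add: act_n_nonneg)
  also have "... = 2 * 4 ^ m * ((\<Sum>n\<in>?I. act_n n) + 4 ^ m * (\<Sum>n\<in>?I. ?u n * act_n n))"
    unfolding sum_distrib_left sum.distrib[symmetric] by (intro sum.cong refl) (simp add: algebra_simps)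
  also have "... \<le> 2 * 4 ^ m * (2 * Z + 4 ^ m * (4 ^ m * (2 * (an m)\<^sup>2 + CC m * Z + 16 ^ m * Z)))"
  proof (intro mult_left_mono add_mono)
    show "(\<Sum>n\<in>?I. act_n n) \<le> 2 * Z" using actions_le_trace[of 0 N] Z by (simp add: Tl_0)
    have "(\<Sum>n\<in>?I. ?u n * act_n n) \<le> 2 ^ (2 * m) * (Tl m + (pi + Q1) ^ (2 * m) * Tl 0)" by (rule actions_le_trace)
    also have "... \<le> 4 ^ m * (2 * (an m)\<^sup>2 + CC m * Z + 16 ^ m * Z)"
      unfolding two_pow Tl_0 by (intro mult_left_mono add_mono T Q) auto
    finally show "(\<Sum>n\<in>?I. ?u n * act_n n) \<le> 4 ^ m * (2 * (an m)\<^sup>2 + CC m * Z + 16 ^ m * Z)" .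
  qed auto
  also have "... = 2 * 4 ^ m * (2 * Z + 16 ^ m * (2 * (an m)\<^sup>2 + CC m * Z + 16 ^ m * Z))"
    by (simp add: mult.assoc[symmetric] power_mult_distrib[symmetric])
  also have "... \<le> 2 * 4 ^ m * (2 * ((an m)\<^sup>2 + Z) + 16 ^ m * ((2 + CC m + 16 ^ m) * ((an m)\<^sup>2 + Z)))"
  proof (intro mult_left_mono add_mono)
    have "0 \<le> CC m * (an m)\<^sup>2 + 16 ^ m * (an m)\<^sup>2 + 2 * Z" using C Z by simp
    thus "2 * (an m)\<^sup>2 + CC m * Z + 16 ^ m * Z \<le> (2 + CC m + 16 ^ m) * ((an m)\<^sup>2 + Z)"
      by (simp add: algebra_simps)
  qed auto
  also have "... = Kc m * ((an m)\<^sup>2 + Z)" unfolding Kc_def by (simp add: algebra_simps)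
  finally show ?thesis unfolding Z_def .
qed

text \<open>The converse comparison. The displacement now costs \<open>an 0 ^ (2 * m)\<close> times
  the unweighted mass, and the moment of order 0 bounds \<open>an 0\<close> itself.\<close>

lemma actions_lower:
  assumes X: "\<And>N. (\<Sum>n\<in>symi N. weight (real m) n * (2 * act_n n)) \<le> X"
    and Y: "\<And>N. (\<Sum>n\<in>symi N. weight 0 n * (2 * act_n n)) \<le> Y"
  shows "(an 0)\<^sup>2 \<le> Y" "Tl m \<le> 4 ^ m * (16 ^ m * X + (an 0) ^ (2 * m) * Y)"
proof -
  have Y': "(\<Sum>n\<in>symi N. 2 * act_n n) \<le> Y" for N using Y[of N] weight_eq[of 0] by simp
  have "Tl 0 \<le> 2 ^ (2 * 0) * Y" by (rule trace_le_actions) (use Y' in simp)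
  thus "(an 0)\<^sup>2 \<le> Y" by (simp add: Tl_0)
  have "Tl m \<le> 2 ^ (2 * m) * (16 ^ m * X + (an 0) ^ (2 * m) * Y)"
  proof (rule trace_le_actions)
    fix N
    let ?I = "symi N"
    have "(\<Sum>n\<in>?I. ((pi * (\<bar>real_of_int n\<bar> + 1)) ^ (2 * m) + Q1 ^ (2 * m)) * act_n n) \<le>
      (\<Sum>n\<in>?I. 16 ^ m * (weight (real m) n * (2 * act_n n)) + (an 0) ^ (2 * m) * (2 * act_n n))"
    proof (rule sum_mono)
      fix n
      have "pi * (\<bar>real_of_int n\<bar> + 1) \<le> 4 * (1 + 2 * pi * \<bar>real_of_int n\<bar>)"
      proof -
        have "0 \<le> pi * (\<bar>real_of_int n\<bar> * 7)" by simp
        hence "pi \<le> 4 + pi * (\<bar>real_of_int n\<bar> * 7)" using pi_less_4 by linarith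
        thus ?thesis by (simp add: algebra_simps)
      qed
      hence "(pi * (\<bar>real_of_int n\<bar> + 1)) ^ (2 * m) \<le> (4 * (1 + 2 * pi * \<bar>real_of_int n\<bar>)) ^ (2 * m)"
        by (intro power_mono) auto
      also have "... = 16 ^ m * weight (real m) n" unfolding power_mult_distrib two_pow weight_eq ..
      finally have 1: "(pi * (\<bar>real_of_int n\<bar> + 1)) ^ (2 * m) \<le> 16 ^ m * weight (real m) n" .
      have 2: "Q1 ^ (2 * m) \<le> an 0 ^ (2 * m)" by (intro power_mono Q1_le_an Q1_nonneg)
      have "((pi * (\<bar>real_of_int n\<bar> + 1)) ^ (2 * m) + Q1 ^ (2 * m)) * act_n n \<le> (16 ^ m * weight (real m) n + an 0 ^ (2 * m)) * (2 * act_n n)"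
        using act_n_nonneg[of n] weight_nonneg[of m n] an_nonneg[of 0] by (intro mult_mono add_mono 1 2) auto
      thus "((pi * (\<bar>real_of_int n\<bar> + 1)) ^ (2 * m) + Q1 ^ (2 * m)) * act_n n \<le> 16 ^ m * (weight (real m) n * (2 * act_n n)) + (an 0) ^ (2 * m) * (2 * act_n n)"
        by (simp only: distrib_right mult.assoc)
    qed
    also have "... = 16 ^ m * (\<Sum>n\<in>?I. weight (real m) n * (2 * act_n n)) + an 0 ^ (2 * m) * (\<Sum>n\<in>?I. 2 * act_n n)"
      by (simp only: sum.distrib sum_distrib_left)
    also have "... \<le> 16 ^ m * X + an 0 ^ (2 * m) * Y"
      using an_nonneg[of 0] by (intro add_mono mult_left_mono X Y') auto
    finally show "(\<Sum>n\<in>?I. ((pi * (\<bar>real_of_int n\<bar> + 1)) ^ (2 * m) + Q1 ^ (2 * m)) * act_n n) \<le> 16 ^ m * X + an 0 ^ (2 * m) * Y" .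
  qed
  thus "Tl m \<le> 4 ^ m * (16 ^ m * X + (an 0) ^ (2 * m) * Y)" unfolding two_pow .
qed

end

section \<open>Trigonometric polynomials and approximation\<close>

definition ee :: "int \<Rightarrow> real \<Rightarrow> complex" where "ee n x = exp (2 * \<i> * of_int n * of_real (pi * x))"

lemma ee_periodic: "ee n (x + 1) = ee n x"
proof -
  have "2 * \<i> * of_int n * of_real (pi * (x + 1)) = 2 * \<i> * of_int n * of_real (pi * x) + 2 * of_int n * of_real pi * \<i>"
    by (simp add: algebra_simps)
  moreover have "exp (2 * complex_of_int n * of_real pi * \<i>) = 1"
    using exp_integer_2pi[of "real_of_int n"] by simp
  ultimately show ?thesis unfolding ee_def by (simp only: exp_add mult_1_right)
qed

lemma ee_minus: "exp (- (2 * \<i> * of_int n * of_real (pi * x))) = ee (- n) x" by (simp add: ee_def)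

lemma ee_cnj: "cnj (ee n x) = ee (- n) x" by (simp add: ee_def exp_cnj)

lemma ee_mult: "ee n x * ee k x = ee (n + k) x" by (simp add: ee_def algebra_simps flip: exp_add)

lemma norm_ee: "cmod (ee n x) = 1" by (simp add: ee_def)

lemma ee_deriv: "(ee n has_vector_derivative (2 * \<i> * of_int n * of_real pi) * ee n x) (at x within S)"
proof -
  have "((\<lambda>z. exp ((2 * \<i> * of_int n * of_real pi) * z)) has_field_derivative (2 * \<i> * of_int n * of_real pi) * exp ((2 * \<i> * of_int n * of_real pi) * of_real x)) (at (of_real x))"
    by (auto intro!: derivative_eq_intros)
  from has_vector_derivative_real_field[OF this] show ?thesis
    by (simp add: ee_def[abs_def] mult.assoc)
qed

lemma continuous_on_ee [continuous_intros]: "continuous_on S (ee n)"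
  unfolding ee_def[abs_def] by (intro continuous_intros)

lemma ee_integral: "integral {0..1} (ee n) = (if n = 0 then 1 else 0)"
proof (cases "n = 0")
  case True
  thus ?thesis by (simp add: ee_def[abs_def])
next
  case False
  let ?a = "2 * \<i> * complex_of_int n * of_real pi"
  have "((\<lambda>x. ?a * ee n x) has_integral ee n 1 - ee n 0) {0..1}"
    by (rule fundamental_theorem_of_calculus) (auto intro: ee_deriv)
  hence "integral {0..1} (\<lambda>x. ?a * ee n x) = ee n 1 - ee n 0" by (rule integral_unique)
  also have "... = 0" using ee_periodic[of n 0] by simp
  finally have "?a * integral {0..1} (ee n) = 0" by (simp only: integral_mult_right)
  thus ?thesis using False by simp
qed

text \<open>All derivatives of a truncated Fourier series at once, which is the jet that the locale
  asks for.\<close>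

definition tq :: "(int \<Rightarrow> complex) \<Rightarrow> nat \<Rightarrow> nat \<Rightarrow> real \<Rightarrow> complex"
  where "tq c N k x = (\<Sum>n\<in>symi N. (2 * \<i> * of_int n * of_real pi) ^ k * c n * ee n x)"

interpretation tq: smooth_potential "tq c N" for c N
proof
  show "(tq c N k has_vector_derivative tq c N (Suc k) x) (at x)" for k x
  proof -
    have "(tq c N k has_vector_derivative (\<Sum>n\<in>symi N. ((2 * \<i> * of_int n * of_real pi) ^ k * c n) * ((2 * \<i> * of_int n * of_real pi) * ee n x))) (at x)"
      unfolding tq_def[abs_def] by (intro has_vector_derivative_sum has_vector_derivative_mult_right ee_deriv)
    moreover have "(\<Sum>n\<in>symi N. ((2 * \<i> * of_int n * of_real pi) ^ k * c n) * ((2 * \<i> * of_int n * of_real pi) * ee n x)) = tq c N (Suc k) x"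
      unfolding tq_def by (intro sum.cong refl) (simp add: mult_ac)
    ultimately show ?thesis by simp
  qed
  show "tq c N k (x + 1) = tq c N k x" for k x by (simp add: tq_def ee_periodic)
qed

lemma tq_coeff:
  "integral {0..1} (\<lambda>x. tq c N k x * ee (- n) x) = (if n \<in> symi N then (2 * \<i> * of_int n * of_real pi) ^ k * c n else 0)"
proof -
  let ?a = "\<lambda>j. (2 * \<i> * of_int j * of_real pi) ^ k * c j"
  have "integral {0..1} (\<lambda>x. tq c N k x * ee (- n) x) = integral {0..1} (\<lambda>x. \<Sum>j\<in>symi N. ?a j * ee (j - n) x)"
    unfolding tq_def sum_distrib_right by (simp add: mult.assoc ee_mult)
  also have "... = (\<Sum>j\<in>symi N. integral {0..1} (\<lambda>x. ?a j * ee (j - n) x))"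
    by (rule integral_sum) (auto intro!: integrable_continuous_real continuous_intros)
  also have "... = (\<Sum>j\<in>symi N. if j = n then ?a j else 0)"
    by (intro sum.cong refl) (simp add: ee_integral)
  finally show ?thesis by (simp add: sum.delta)
qed

lemma tq_an: "(tq.an c N k)\<^sup>2 = (\<Sum>n\<in>symi N. (2 * pi * \<bar>real_of_int n\<bar>) ^ (2 * k) * (cmod (c n))\<^sup>2)"
proof -
  let ?a = "\<lambda>j. (2 * \<i> * of_int j * of_real pi) ^ k * c j"
  have "complex_of_real ((tq.an c N k)\<^sup>2) = integral {0..1} (\<lambda>x. cnj (tq c N k x) * tq c N k x)"
    by (rule tq.integral_cnj_q[symmetric])
  also have "... = integral {0..1} (\<lambda>x. \<Sum>n\<in>symi N. cnj (?a n) * (tq c N k x * ee (- n) x))"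
  proof -
    have "cnj (tq c N k x) * z = (\<Sum>n\<in>symi N. cnj (?a n) * (z * ee (- n) x))" for x z
      unfolding tq_def cnj_sum sum_distrib_right by (intro sum.cong refl) (simp add: ee_cnj mult_ac)
    thus ?thesis by simp
  qed
  also have "... = (\<Sum>n\<in>symi N. integral {0..1} (\<lambda>x. cnj (?a n) * (tq c N k x * ee (- n) x)))"
    by (rule integral_sum) (auto intro!: integrable_continuous_real continuous_intros tq.continuous_on_q)
  also have "... = (\<Sum>n\<in>symi N. cnj (?a n) * ?a n)"
    by (intro sum.cong refl) (simp only: integral_mult_right tq_coeff, simp)
  also have "... = (\<Sum>n\<in>symi N. of_real ((2 * pi * \<bar>real_of_int n\<bar>) ^ (2 * k) * (cmod (c n))\<^sup>2))"
  proof (intro sum.cong refl)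
    fix n
    have "cnj (?a n) * ?a n = of_real ((cmod (?a n))\<^sup>2)" by (simp only: complex_norm_square mult.commute)
    also have "cmod (?a n) = (2 * pi * \<bar>real_of_int n\<bar>) ^ k * cmod (c n)" by (simp add: norm_mult norm_power mult_ac)
    also have "...\<^sup>2 = (2 * pi * \<bar>real_of_int n\<bar>) ^ (2 * k) * (cmod (c n))\<^sup>2" by (simp add: power_mult_distrib power_mult[symmetric] mult.commute)
    finally show "cnj (?a n) * ?a n = of_real ((2 * pi * \<bar>real_of_int n\<bar>) ^ (2 * k) * (cmod (c n))\<^sup>2)" .
  qed
  finally show ?thesis unfolding of_real_sum[symmetric] of_real_eq_iff .
qed

definition trunc :: "(int \<Rightarrow> complex) \<Rightarrow> nat \<Rightarrow> potential"
  where "trunc c N = (\<lambda>x. (cnj (tq c N 0 x), tq c N 0 x))"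

lemma tq_pot: "tq.pot c N = trunc c N" by (simp add: tq.pot_def trunc_def)

lemma LINT_continuous:
  fixes f :: "real \<Rightarrow> complex"
  assumes "continuous_on {0..1} f"
  shows "(LINT x:{0..1}|lborel. f x) = integral {0..1} f"
  by (rule set_borel_integral_eq_integral(2)[OF borel_integrable_atLeastAtMost'[OF assms]])

lemma trunc_fourier_plus: "fourier_plus (trunc c N) n = (if n \<in> symi N then c n else 0)"
  unfolding fourier_plus_def trunc_def ee_minus snd_conv
  by (subst LINT_continuous) (auto intro!: continuous_intros tq.continuous_on_q simp: tq_coeff)

lemma trunc_fourier_minus: "fourier_minus (trunc c N) n = cnj (fourier_plus (trunc c N) n)"
proof -
  have c: "continuous_on {0..1} (\<lambda>x. tq c N 0 x * ee (- n) x)"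
    by (intro continuous_intros tq.continuous_on_q)
  have "fourier_minus (trunc c N) n = integral {0..1} (\<lambda>x. cnj (tq c N 0 x * ee (- n) x))"
    unfolding fourier_minus_def trunc_def fst_conv ee_def[symmetric]
    by (subst LINT_continuous) (auto intro!: continuous_intros tq.continuous_on_q simp: ee_cnj)
  also have "... = cnj (integral {0..1} (\<lambda>x. tq c N 0 x * ee (- n) x))"
    using integral_linear[OF integrable_continuous_real[OF c] bounded_linear_cnj] by (simp add: o_def)
  finally show ?thesis by (simp add: tq_coeff trunc_fourier_plus)
qed

lemma continuous_on_trunc: "continuous_on S (trunc c N)"
  unfolding trunc_def by (intro continuous_intros tq.continuous_on_q)

lemma trunc_L2c: "trunc c N \<in> L2c" unfolding L2c_def
proof (intro CollectI conjI allI)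
  show "trunc c N \<in> borel_measurable borel" by (rule borel_measurable_continuous_onI[OF continuous_on_trunc])
  show "trunc c N (x + 1) = trunc c N x" for x by (simp add: trunc_def tq.q_periodic)
  show "set_integrable lborel {0..1} (\<lambda>x. (norm (trunc c N x))\<^sup>2)"
    by (intro borel_integrable_atLeastAtMost' continuous_intros continuous_on_trunc)
qed

lemma trunc_L2r: "trunc c N \<in> L2r" by (simp add: L2r_def trunc_L2c) (simp add: trunc_def)

lemma sobolev_term_nonneg: "sobolev_term s \<phi> n \<ge> 0" by (simp add: sobolev_term_def weight_nonneg)

lemma trunc_sobolev_term:
  "sobolev_term s (trunc c N) n = (if n \<in> symi N then weight s n * (2 * (cmod (c n))\<^sup>2) else 0)"
  by (simp add: sobolev_term_def trunc_fourier_minus trunc_fourier_plus)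

lemma has_sum_finite_support:
  fixes f :: "'a \<Rightarrow> real"
  assumes "finite I"
  shows "((\<lambda>n. if n \<in> I then f n else 0) has_sum (\<Sum>n\<in>I. f n)) UNIV"
  using has_sum_finite[OF assms, of f] by (subst has_sum_cong_neutral[where T = I and g = f]) auto

lemma trunc_has_sum:
  "(sobolev_term s (trunc c N) has_sum (\<Sum>n\<in>symi N. weight s n * (2 * (cmod (c n))\<^sup>2))) UNIV"
  using has_sum_finite_support[of "symi N" "\<lambda>n. weight s n * (2 * (cmod (c n))\<^sup>2)"]
  by (simp add: trunc_sobolev_term[abs_def])

lemma trunc_Hr: "trunc c N \<in> Hr s"
  using trunc_has_sum[of s c N] trunc_L2r by (auto simp: Hr_def Hc_def trunc_L2c summable_on_def)

lemma trunc_sobolev_norm: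
  "(sobolev_norm s (trunc c N))\<^sup>2 = (\<Sum>n\<in>symi N. weight s n * (2 * (cmod (c n))\<^sup>2))"
proof -
  have "infsum (sobolev_term s (trunc c N)) UNIV = (\<Sum>n\<in>symi N. weight s n * (2 * (cmod (c n))\<^sup>2))"
    by (rule infsumI[OF trunc_has_sum])
  thus ?thesis unfolding sobolev_norm_def by (simp add: sum_nonneg weight_nonneg)
qed

lemma measurable_fst_snd:
  assumes "\<phi> \<in> borel_measurable (borel :: real measure)"
  shows "(\<lambda>x. fst (\<phi> x) :: complex) \<in> borel_measurable borel" "(\<lambda>x. snd (\<phi> x) :: complex) \<in> borel_measurable borel"
proof -
  have "(fst :: complex \<times> complex \<Rightarrow> complex) \<in> borel_measurable borel" "(snd :: complex \<times> complex \<Rightarrow> complex) \<in> borel_measurable borel"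
    by (intro borel_measurable_continuous_onI continuous_on_fst continuous_on_snd continuous_on_id)+
  thus "(\<lambda>x. fst (\<phi> x) :: complex) \<in> borel_measurable borel" "(\<lambda>x. snd (\<phi> x) :: complex) \<in> borel_measurable borel"
    using measurable_compose[OF assms] by auto
qed

lemma L2c_integrable:
  assumes "\<phi> \<in> L2c" and p: "p = fst \<or> p = snd"
  shows "set_integrable lborel {0..1} (\<lambda>x. p (\<phi> x) * ee n x)"
proof -
  have m: "\<phi> \<in> borel_measurable borel" and i: "set_integrable lborel {0..1} (\<lambda>x. (norm (\<phi> x))\<^sup>2)"
    using assms by (auto simp: L2c_def)
  have pm: "(\<lambda>x. p (\<phi> x)) \<in> borel_measurable borel" using p measurable_fst_snd[OF m] by auto
  have em: "ee n \<in> borel_measurable borel" by (intro borel_measurable_continuous_onI continuous_intros)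
  have g: "set_integrable lborel {0..1} (\<lambda>x. 1 + (norm (\<phi> x))\<^sup>2)"
    by (rule set_integral_add[OF borel_integrable_atLeastAtMost' i]) (rule continuous_on_const)
  show ?thesis unfolding set_integrable_def
  proof (rule Bochner_Integration.integrable_bound[OF g[unfolded set_integrable_def]])
    show "(\<lambda>x. indicator {0..1} x *\<^sub>R (p (\<phi> x) * ee n x)) \<in> borel_measurable lborel"
      using pm em by simp
    have "cmod (p (\<phi> x)) \<le> 1 + (norm (\<phi> x))\<^sup>2" for x
    proof -
      have "cmod (p (\<phi> x)) \<le> norm (\<phi> x)" using p norm_fst_le[of "fst (\<phi> x)" "snd (\<phi> x)"] norm_snd_le[of "snd (\<phi> x)" "fst (\<phi> x)"] by auto
      moreover have "0 \<le> (norm (\<phi> x) - 1)\<^sup>2" by simp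
      hence "2 * norm (\<phi> x) \<le> 1 + (norm (\<phi> x))\<^sup>2" by (simp add: power2_diff)
      ultimately show ?thesis using norm_ge_zero[of "\<phi> x"] by linarith
    qed
    thus "AE x in lborel. norm (indicator {0..1} x *\<^sub>R (p (\<phi> x) * ee n x)) \<le> norm (indicator {0..1} x *\<^sub>R (1 + (norm (\<phi> x))\<^sup>2))"
      by (intro AE_I2) (auto simp: indicator_def norm_mult norm_ee intro: order_trans)
  qed
qed

lemma fourier_diff:
  assumes "\<phi> \<in> L2c" "\<psi> \<in> L2c"
  shows "fourier_plus (\<phi> - \<psi>) n = fourier_plus \<phi> n - fourier_plus \<psi> n"
    "fourier_minus (\<phi> - \<psi>) n = fourier_minus \<phi> n - fourier_minus \<psi> n"
  unfolding fourier_plus_def fourier_minus_def ee_minus ee_def[symmetric] minus_apply fst_diff snd_diff left_diff_distrib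
  by (rule set_integral_diff(2)[OF L2c_integrable[OF assms(1)] L2c_integrable[OF assms(2)]]; simp)+

lemma L2r_fourier:
  assumes "\<phi> \<in> L2r" shows "fourier_minus \<phi> n = cnj (fourier_plus \<phi> n)"
proof -
  have \<phi>: "\<phi> \<in> L2c" and ae: "AE x in lborel. fst (\<phi> x) = cnj (snd (\<phi> x))" using assms by (auto simp: L2r_def)
  have m: "\<phi> \<in> borel_measurable borel" using \<phi> by (simp add: L2c_def)
  have pm: "(\<lambda>x. fst (\<phi> x)) \<in> borel_measurable borel" "(\<lambda>x. cnj (snd (\<phi> x))) \<in> borel_measurable borel"
    using measurable_fst_snd[OF m] measurable_compose[OF measurable_fst_snd(2)[OF m] borel_measurable_continuous_onI[of cnj]]
    by (auto intro: continuous_intros)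
  have em: "ee n \<in> borel_measurable borel" by (intro borel_measurable_continuous_onI continuous_intros)
  have "fourier_minus \<phi> n = (LINT x:{0..1}|lborel. cnj (snd (\<phi> x)) * ee n x)"
    unfolding fourier_minus_def ee_def[symmetric] set_lebesgue_integral_def
    by (rule integral_cong_AE) (use pm em ae in auto)
  also have "... = (LINT x:{0..1}|lborel. cnj (snd (\<phi> x) * ee (- n) x))" by (simp add: ee_cnj)
  also have "... = cnj (LINT x:{0..1}|lborel. snd (\<phi> x) * ee (- n) x)"
    unfolding set_lebesgue_integral_def complex_cnj_scaleR[symmetric] by (rule Bochner_Integration.integral_cnj)
  finally show ?thesis unfolding fourier_plus_def ee_minus .
qed

lemma L2r_diff:
  assumes "\<phi> \<in> L2r" "\<psi> \<in> L2r" shows "\<phi> - \<psi> \<in> L2r"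
proof -
  have L: "\<phi> \<in> L2c" "\<psi> \<in> L2c" using assms by (auto simp: L2r_def)
  have m: "\<phi> \<in> borel_measurable borel" "\<psi> \<in> borel_measurable borel" using L by (auto simp: L2c_def)
  have i: "set_integrable lborel {0..1} (\<lambda>x. 2 * (norm (\<phi> x))\<^sup>2 + 2 * (norm (\<psi> x))\<^sup>2)"
    using L by (intro set_integral_add set_integrable_mult_right) (auto simp: L2c_def)
  have "\<phi> - \<psi> \<in> L2c" unfolding L2c_def
  proof (intro CollectI conjI allI)
    show d: "\<phi> - \<psi> \<in> borel_measurable borel" unfolding fun_diff_def by (rule borel_measurable_diff[OF m])
    show "(\<phi> - \<psi>) (x + 1) = (\<phi> - \<psi>) x" for x using L by (simp add: L2c_def)
    show "set_integrable lborel {0..1} (\<lambda>x. (norm ((\<phi> - \<psi>) x))\<^sup>2)" unfolding set_integrable_def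
    proof (rule Bochner_Integration.integrable_bound[OF i[unfolded set_integrable_def]])
      show "(\<lambda>x. indicator {0..1} x *\<^sub>R (norm ((\<phi> - \<psi>) x))\<^sup>2) \<in> borel_measurable lborel"
        using borel_measurable_diff[OF m] by simp
      have "(norm (a - b))\<^sup>2 \<le> 2 * (norm a)\<^sup>2 + 2 * (norm b)\<^sup>2" for a b :: "complex \<times> complex"
      proof -
        have "(norm (a - b))\<^sup>2 \<le> (norm a + norm b)\<^sup>2" by (intro power_mono norm_triangle_ineq4) simp
        moreover have "0 \<le> (norm a - norm b)\<^sup>2" by simp
        ultimately show ?thesis by (simp add: power2_eq_square algebra_simps)
      qed
      thus "AE x in lborel. norm (indicator {0..1} x *\<^sub>R (norm ((\<phi> - \<psi>) x))\<^sup>2) \<le> norm (indicator {0..1} x *\<^sub>R (2 * (norm (\<phi> x))\<^sup>2 + 2 * (norm (\<psi> x))\<^sup>2))"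
        by (intro AE_I2) (auto simp: indicator_def)
    qed
  qed
  moreover have "AE x in lborel. fst ((\<phi> - \<psi>) x) = cnj (snd ((\<phi> - \<psi>) x))"
    using assms by (auto simp: L2r_def)
  ultimately show ?thesis by (simp add: L2r_def)
qed

text \<open>The norm of the difference is the tail of a convergent sum. Real type matters: the
  coefficients of the second component determine those of the first.\<close>

lemma trunc_diff:
  assumes \<phi>: "\<phi> \<in> Hr s"
  defines "c \<equiv> fourier_plus \<phi>"
  shows "trunc c N - \<phi> \<in> Hr s"
    and "(\<lambda>N. sobolev_norm s (trunc c N - \<phi>)) \<longlonglongrightarrow> 0"
    and "(\<lambda>N. sobolev_norm s (trunc c N)) \<longlonglongrightarrow> sobolev_norm s \<phi>"
proof -
  have L: "\<phi> \<in> L2r" "\<phi> \<in> L2c" and sm: "sobolev_term s \<phi> summable_on UNIV" using \<phi> by (auto simp: Hr_def L2r_def Hc_def)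
  let ?f = "sobolev_term s \<phi>" and ?I = "\<lambda>N. symi N"
  have f: "?f n = weight s n * (2 * (cmod (c n))\<^sup>2)" for n
    by (simp add: sobolev_term_def L2r_fourier[OF L(1)] c_def)
  have t: "sobolev_term s (trunc c N - \<phi>) n = ?f n - (if n \<in> ?I N then ?f n else 0)" for N n
    by (simp add: sobolev_term_def fourier_diff[OF trunc_L2c L(2)] trunc_fourier_minus trunc_fourier_plus L2r_fourier[OF L(1)] c_def)
  have hs: "(sobolev_term s (trunc c N - \<phi>) has_sum (infsum ?f UNIV - (\<Sum>n\<in>?I N. ?f n))) UNIV" for N
    unfolding t[abs_def]
    using has_sum_add[OF has_sum_infsum[OF sm], of "\<lambda>n. - (if n \<in> ?I N then ?f n else 0)" "- (\<Sum>n\<in>?I N. ?f n)"]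
      has_sum_finite_support[of "?I N" ?f] by (simp only: has_sum_uminus finite_atLeastAtMost_int minus_minus simp_thms diff_conv_add_uminus)
  show "trunc c N - \<phi> \<in> Hr s"
    using L2r_diff[OF trunc_L2r L(1)] hs[of N] by (auto simp: Hr_def Hc_def L2r_def summable_on_def)
  have lim: "(\<lambda>N. \<Sum>n\<in>?I N. ?f n) \<longlonglongrightarrow> infsum ?f UNIV" by (rule sum_sym_tendsto[OF sm])
  have "sobolev_norm s (trunc c N - \<phi>) = sqrt (infsum ?f UNIV - (\<Sum>n\<in>?I N. ?f n))" for N
    unfolding sobolev_norm_def infsumI[OF hs] ..
  moreover have "(\<lambda>N. sqrt (infsum ?f UNIV - (\<Sum>n\<in>?I N. ?f n))) \<longlonglongrightarrow> sqrt (infsum ?f UNIV - infsum ?f UNIV)"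
    by (intro tendsto_intros lim)
  ultimately show "(\<lambda>N. sobolev_norm s (trunc c N - \<phi>)) \<longlonglongrightarrow> 0" by simp
  have "sobolev_norm s (trunc c N) = sqrt (\<Sum>n\<in>?I N. ?f n)" for N
    unfolding sobolev_norm_def infsumI[OF trunc_has_sum] f ..
  thus "(\<lambda>N. sobolev_norm s (trunc c N)) \<longlonglongrightarrow> sobolev_norm s \<phi>"
    unfolding sobolev_norm_def[of s \<phi>] by (simp add: tendsto_real_sqrt lim)
qed

lemma weight_mono: "s \<le> t \<Longrightarrow> weight s n \<le> weight t n" unfolding weight_def by (rule powr_mono) auto

lemma Hr_mono: assumes "\<phi> \<in> Hr t" "s \<le> t" shows "\<phi> \<in> Hr s"
proof -
  have "sobolev_term s \<phi> summable_on UNIV"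
  proof (rule summable_on_comparison_test)
    show "sobolev_term t \<phi> summable_on UNIV" using assms by (simp add: Hr_def Hc_def)
    show "sobolev_term s \<phi> n \<le> sobolev_term t \<phi> n" for n
      unfolding sobolev_term_def using weight_mono[OF assms(2)] by (intro mult_right_mono) auto
  qed (rule sobolev_term_nonneg)
  thus ?thesis using assms by (simp add: Hr_def Hc_def)
qed

lemma zero_Hr: "0 \<in> Hr s" and sobolev_norm_zero: "sobolev_norm s 0 = 0"
proof -
  have "trunc (\<lambda>n. 0) 0 = 0" by (auto simp: trunc_def fun_eq_iff tq_def zero_prod_def)
  thus "0 \<in> Hr s" using trunc_Hr[of "\<lambda>n. 0" 0 s] by simp
  show "sobolev_norm s 0 = 0" using trunc_sobolev_norm[of s "\<lambda>n. 0" 0] \<open>trunc (\<lambda>n. 0) 0 = 0\<close> by simp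
qed

lemma sobolev_norm_nonneg: "sobolev_norm s \<phi> \<ge> 0"
  unfolding sobolev_norm_def by (intro real_sqrt_ge_zero infsum_nonneg sobolev_term_nonneg)

text \<open>Analyticity in the norm of order \<open>m\<close> yields continuity along the increments
  from \<open>\<phi>\<close> to its truncations, which tend to zero in that norm.\<close>

lemma coords_norm_trunc_tendsto:
  assumes \<Omega>: "birkhoff_map \<Omega>" and \<phi>: "\<phi> \<in> Hr (real m)"
  shows "(\<lambda>N. coords_norm (real m) (\<Omega> (trunc (fourier_plus \<phi>) N))) \<longlonglongrightarrow> coords_norm (real m) (\<Omega> \<phi>)"
proof -
  let ?h = "\<lambda>N. trunc (fourier_plus \<phi>) N - \<phi>"
  have an: "real_analytic_map (Hr (real m)) (sobolev_norm (real m)) (hr (real m)) (coords_norm (real m)) \<Omega>"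
    using \<Omega> by (simp add: birkhoff_map_def bianalytic_diffeo_def)
  have e: "\<phi> + ?h N = trunc (fourier_plus \<phi>) N" for N by (simp add: fun_eq_iff)
  have "(\<lambda>N. coords_norm (real m) (\<Omega> (\<phi> + ?h N))) \<longlonglongrightarrow> coords_norm (real m) (\<Omega> \<phi>)"
    by (rule real_analytic_continuous[OF an \<phi>], unfold e)
      (rule zero_Hr sobolev_norm_zero trunc_diff(1,2)[OF \<phi>] sobolev_norm_nonneg trunc_Hr)+
  thus ?thesis unfolding e .
qed

lemma birkhoff_hr: assumes "birkhoff_map \<Omega>" "\<phi> \<in> Hr (real m)" shows "\<Omega> \<phi> \<in> hr (real m)"
  using assms by (simp add: birkhoff_map_def bianalytic_diffeo_def real_analytic_map_def)

text \<open>The squared radius of the coordinate pair is twice the action. Being a sum of squares it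
  is nonnegative, so it agrees with the absolute value in \<open>act_n\<close>.\<close>

lemma cterm_trunc:
  assumes "birkhoff_map \<Omega>"
  shows "cterm s (\<Omega> (trunc c N)) n = weight s n * (2 * tq.act_n c N n)"
proof -
  let ?z = "\<Omega> (trunc c N) n"
  have "complex_of_real (((fst ?z)\<^sup>2 + (snd ?z)\<^sup>2) / 2) = action (trunc c N) n"
    using assms trunc_Hr[of c N 0] unfolding birkhoff_map_def by blast
  hence "Re (action (trunc c N) n) = ((fst ?z)\<^sup>2 + (snd ?z)\<^sup>2) / 2" by (metis Re_complex_of_real)
  moreover have "((fst ?z)\<^sup>2 + (snd ?z)\<^sup>2) / 2 \<ge> 0" by simp
  ultimately have "tq.act_n c N n = ((fst ?z)\<^sup>2 + (snd ?z)\<^sup>2) / 2" by (simp only: tq.act_n_def tq_pot abs_of_nonneg)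
  thus ?thesis by (simp add: cterm_def)
qed

lemma coords_norm_mono:
  assumes "z \<in> hr s" "z \<in> hr t" "s \<le> t" shows "coords_norm s z \<le> coords_norm t z"
  unfolding coords_norm_eq[OF assms(1)] coords_norm_eq[OF assms(2)]
  by (intro real_sqrt_le_mono infsum_mono cterm_summable assms)
    (simp add: cterm_def mult_right_mono weight_mono[OF assms(3)])

lemma trunc_norm_facts:
  shows "tq.an c N 0 \<le> sobolev_norm 0 (trunc c N)"
    and "tq.an c N m \<le> sobolev_norm (real m) (trunc c N)"
    and "sobolev_norm 0 (trunc c N) \<le> sobolev_norm 1 (trunc c N)"
    and "(sobolev_norm (real m) (trunc c N))\<^sup>2 \<le> 2 * 4 ^ m * ((tq.an c N 0)\<^sup>2 + (tq.an c N m)\<^sup>2)"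
proof -
  have *: "tq.an c N k \<le> sobolev_norm (real k) (trunc c N)" for k
  proof (rule power2_le_imp_le)
    show "(tq.an c N k)\<^sup>2 \<le> (sobolev_norm (real k) (trunc c N))\<^sup>2"
      unfolding tq_an trunc_sobolev_norm
    proof (intro sum_mono mult_mono)
      show "(2 * pi * \<bar>real_of_int n\<bar>) ^ (2 * k) \<le> weight (real k) n" for n
        unfolding weight_eq by (intro power_mono) auto
    qed (auto simp: weight_nonneg)
  qed (rule sobolev_norm_nonneg)
  show "tq.an c N 0 \<le> sobolev_norm 0 (trunc c N)" using *[of 0] by simp
  show "tq.an c N m \<le> sobolev_norm (real m) (trunc c N)" by (rule *)
  show "sobolev_norm 0 (trunc c N) \<le> sobolev_norm 1 (trunc c N)"
  proof (rule power2_le_imp_le)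
    show "(sobolev_norm 0 (trunc c N))\<^sup>2 \<le> (sobolev_norm 1 (trunc c N))\<^sup>2"
      unfolding trunc_sobolev_norm by (intro sum_mono mult_right_mono weight_mono) auto
  qed (rule sobolev_norm_nonneg)
  have w: "weight (real m) n \<le> 4 ^ m * (1 + (2 * pi * \<bar>real_of_int n\<bar>) ^ (2 * m))" for n
    using tq.power_add_le[of "1 + 2 * pi * \<bar>real_of_int n\<bar>" 1 "2 * pi * \<bar>real_of_int n\<bar>" "2 * m"]
    unfolding weight_eq by (simp add: power_mult)
  have "(sobolev_norm (real m) (trunc c N))\<^sup>2 \<le> (\<Sum>n\<in>symi N. 4 ^ m * (1 + (2 * pi * \<bar>real_of_int n\<bar>) ^ (2 * m)) * (2 * (cmod (c n))\<^sup>2))"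
    unfolding trunc_sobolev_norm by (intro sum_mono mult_right_mono w) auto
  also have "... = 2 * 4 ^ m * ((tq.an c N 0)\<^sup>2 + (tq.an c N m)\<^sup>2)"
    unfolding tq_an sum.distrib[symmetric] sum_distrib_left by (intro sum.cong refl) (simp add: algebra_simps)
  finally show "(sobolev_norm (real m) (trunc c N))\<^sup>2 \<le> 2 * 4 ^ m * ((tq.an c N 0)\<^sup>2 + (tq.an c N m)\<^sup>2)" .
qed

lemma sqrt_sum_bound:
  fixes x a b K :: real
  assumes "x\<^sup>2 \<le> K * (a\<^sup>2 + b\<^sup>2)" "0 \<le> a" "0 \<le> b" "0 \<le> K"
  shows "x \<le> sqrt K * (a + b)"
proof (rule power2_le_imp_le)
  have "a\<^sup>2 + b\<^sup>2 \<le> (a + b)\<^sup>2" using assms by (simp add: power2_sum)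
  hence "K * (a\<^sup>2 + b\<^sup>2) \<le> K * (a + b)\<^sup>2" by (rule mult_left_mono[OF _ assms(4)])
  thus "x\<^sup>2 \<le> (sqrt K * (a + b))\<^sup>2" using assms by (simp add: power_mult_distrib)
qed (use assms in simp)

section \<open>The two estimates for trigonometric polynomials\<close>

lemma Kc_pos: "m \<ge> 1 \<Longrightarrow> Kc m > 0"
  using CC_ge_2[of m] unfolding Kc_def by (intro mult_pos_pos add_pos_pos) auto

definition Kd :: "nat \<Rightarrow> real" where "Kd m = 2 * 4 ^ m * (1 + 2 * 16 ^ m * (16 ^ m + 1 + CC m))"

lemma Kd_pos: "m \<ge> 1 \<Longrightarrow> Kd m > 0"
  using CC_ge_2[of m] unfolding Kd_def by (intro mult_pos_pos add_pos_pos) auto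

text \<open>The bound is obtained for squares, so the exponent \<open>4 * m\<close> becomes
  \<open>2 * m\<close>; inside that power the L2 norm is replaced by the larger norm of order
  one.\<close>

lemma trunc_upper:
  fixes c :: "int \<Rightarrow> complex" and N :: nat
  assumes \<Omega>: "birkhoff_map \<Omega>" and m: "m \<ge> 1"
  defines "P \<equiv> trunc c N"
  shows "coords_norm (real m) (\<Omega> P) \<le> sqrt (Kc m) *
    (sobolev_norm (real m) P + (1 + sobolev_norm 1 P) ^ (2 * m) * sobolev_norm 0 P)"
proof (rule sqrt_sum_bound)
  have z: "\<Omega> P \<in> hr (real m)" unfolding P_def by (rule birkhoff_hr[OF \<Omega> trunc_Hr])
  let ?a = "tq.an c N"
  note f = trunc_norm_facts(1,2,3)[where c = c and N = N, folded P_def]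
  have a0: "0 \<le> ?a k" for k by (rule tq.an_nonneg)
  have "(coords_norm (real m) (\<Omega> P))\<^sup>2 \<le> Kc m * ((?a m)\<^sup>2 + (?a 0)\<^sup>2 * (1 + ?a 0) ^ (4 * m))"
    unfolding coords_norm_square[OF z]
  proof (rule LIMSEQ_le_const2[OF sum_sym_tendsto[OF cterm_summable[OF z]]], intro exI allI impI)
    fix M
    show "(\<Sum>n\<in>symi M. cterm (real m) (\<Omega> P) n) \<le> Kc m * ((?a m)\<^sup>2 + (?a 0)\<^sup>2 * (1 + ?a 0) ^ (4 * m))"
      unfolding P_def cterm_trunc[OF \<Omega>] by (rule tq.actions_upper[OF m])
  qed
  also have "... \<le> Kc m * ((sobolev_norm (real m) P)\<^sup>2 + (sobolev_norm 0 P)\<^sup>2 * (1 + sobolev_norm 1 P) ^ (4 * m))"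
    using Kc_pos[OF m] a0 f(1,3)
    by (intro mult_left_mono add_mono mult_mono power_mono f) (auto simp: sobolev_norm_nonneg)
  also have "(sobolev_norm 0 P)\<^sup>2 * (1 + sobolev_norm 1 P) ^ (4 * m) = ((1 + sobolev_norm 1 P) ^ (2 * m) * sobolev_norm 0 P)\<^sup>2"
    by (simp add: power_mult_distrib power_mult[symmetric])
  finally show "(coords_norm (real m) (\<Omega> P))\<^sup>2 \<le> Kc m * ((sobolev_norm (real m) P)\<^sup>2 + ((1 + sobolev_norm 1 P) ^ (2 * m) * sobolev_norm 0 P)\<^sup>2)" .
qed (use Kc_pos[OF m] in \<open>auto simp: sobolev_norm_nonneg\<close>)

text \<open>After squaring, two error terms must fit under the exponent
  \<open>2 * (4 * m - 3)\<close>. The displacement term has exponent \<open>2 * m\<close> and fits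
  for every \<open>m \<ge> 1\<close>; the remainder in \<open>Tl_estimate\<close> has exponent
  \<open>4 * m\<close> and fits from \<open>m = 2\<close> on. For \<open>m = 1\<close> it is avoided
  by \<open>Tl_1\<close>.\<close>

lemma trunc_lower:
  fixes c :: "int \<Rightarrow> complex" and N :: nat
  assumes \<Omega>: "birkhoff_map \<Omega>" and m: "m \<ge> 1"
  defines "P \<equiv> trunc c N"
  shows "sobolev_norm (real m) P \<le> sqrt (Kd m) *
    (coords_norm (real m) (\<Omega> P) + (1 + coords_norm 1 (\<Omega> P)) ^ (4 * m - 3) * coords_norm 0 (\<Omega> P))"
proof (rule sqrt_sum_bound)
  have z: "\<Omega> P \<in> hr (real j)" for j unfolding P_def by (rule birkhoff_hr[OF \<Omega> trunc_Hr])
  have z0: "\<Omega> P \<in> hr 0" "\<Omega> P \<in> hr 1" using z[of 0] z[of 1] by simp_all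
  define X X0 X1 where "X = coords_norm (real m) (\<Omega> P)" and "X0 = coords_norm 0 (\<Omega> P)" and "X1 = coords_norm 1 (\<Omega> P)"
  have X: "0 \<le> X" "0 \<le> X0" "X0 \<le> X1"
    unfolding X_def X0_def X1_def by (auto intro!: coords_norm_nonneg coords_norm_mono z z0)
  let ?a = "tq.an c N"
  have a0: "0 \<le> ?a k" for k by (rule tq.an_nonneg)
  have X2: "X\<^sup>2 = infsum (cterm (real m) (\<Omega> P)) UNIV" "X0\<^sup>2 = infsum (cterm 0 (\<Omega> P)) UNIV"
    unfolding X_def X0_def by (intro coords_norm_square z z0)+
  have s1: "(\<Sum>n\<in>symi M. weight (real m) n * (2 * tq.act_n c N n)) \<le> X\<^sup>2" for M
    unfolding X2 cterm_trunc[OF \<Omega>, symmetric] P_def[symmetric]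
    by (rule sum_sym_le_infsum[OF cterm_summable[OF z] cterm_nonneg])
  have s2: "(\<Sum>n\<in>symi M. weight 0 n * (2 * tq.act_n c N n)) \<le> X0\<^sup>2" for M
    unfolding X2 cterm_trunc[OF \<Omega>, symmetric] P_def[symmetric]
    by (rule sum_sym_le_infsum[OF cterm_summable[OF z0(1)] cterm_nonneg])
  define Z where "Z = X0\<^sup>2 * (1 + X1) ^ (2 * (4 * m - 3))"
  have zp: "X0\<^sup>2 * (1 + X1) ^ k \<le> Z" if "k \<le> 2 * (4 * m - 3)" for k
    unfolding Z_def using X that by (intro mult_left_mono power_increasing) auto
  have low: "(?a 0)\<^sup>2 \<le> X0\<^sup>2" "tq.Tl c N m \<le> 4 ^ m * (16 ^ m * X\<^sup>2 + ?a 0 ^ (2 * m) * X0\<^sup>2)"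
    by (rule tq.actions_lower[OF s1 s2])+
  have aX: "?a 0 \<le> X0" by (rule power2_le_imp_le[OF low(1) X(2)])
  have Z0: "(?a 0)\<^sup>2 \<le> Z" "0 \<le> Z" using low(1) zp[of 0] X by (auto simp: Z_def)
  have "?a 0 ^ (2 * m) * X0\<^sup>2 \<le> (1 + X1) ^ (2 * m) * X0\<^sup>2"
    using aX X a0 by (intro mult_right_mono power_mono) auto
  also have "... \<le> Z" using zp[of "2 * m"] m by (simp add: mult.commute)
  finally have T: "tq.Tl c N m \<le> 4 ^ m * (16 ^ m * X\<^sup>2 + Z)"
    using low(2) by (smt (verit) mult_left_mono zero_le_power)
  have T': "4 ^ m * tq.Tl c N m \<le> 16 ^ m * (16 ^ m * X\<^sup>2 + Z)"
  proof -
    have "4 ^ m * tq.Tl c N m \<le> 4 ^ m * (4 ^ m * (16 ^ m * X\<^sup>2 + Z))" by (rule mult_left_mono[OF T]) simp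
    also have "... = 16 ^ m * (16 ^ m * X\<^sup>2 + Z)" by (simp add: mult.assoc[symmetric] power_mult_distrib[symmetric])
    finally show ?thesis .
  qed
  have C: "CC m \<ge> 2" by (rule CC_ge_2[OF m])
  have am: "(?a m)\<^sup>2 \<le> 2 * (16 ^ m * (16 ^ m * X\<^sup>2 + Z) + CC m * Z)"
  proof (cases "m = 1")
    case True
    have "0 \<le> CC m * Z" using C Z0 by simp
    moreover have "0 \<le> 16 ^ m * (16 ^ m * X\<^sup>2 + Z)" using Z0 by simp
    ultimately show ?thesis using tq.Tl_1[of c N] T' True by simp
  next
    case False
    have "(?a 0)\<^sup>2 * (1 + ?a 0) ^ (4 * m) \<le> X0\<^sup>2 * (1 + X1) ^ (4 * m)"
      using aX X a0 by (intro mult_mono power_mono low(1)) auto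
    also have "... \<le> Z" by (rule zp) (use False m in simp)
    finally have "CC m * ((?a 0)\<^sup>2 * (1 + ?a 0) ^ (4 * m)) \<le> CC m * Z" using C by (intro mult_left_mono) auto
    moreover have "0 \<le> 16 ^ m * (16 ^ m * X\<^sup>2 + Z)" "0 \<le> CC m * Z" using Z0 C by simp_all
    \<comment> \<open>The quarter of \<open>a\<close> on the right is absorbed; the resulting factor
      4/3 is rounded up to 2.\<close>
    moreover have "a \<le> 2 * (u + r)" if "\<bar>T - a\<bar> \<le> a / 4 + R" "R \<le> r" "T \<le> u" "0 \<le> u" "0 \<le> r" for a T R r u :: real
    proof -
      have "a - T \<le> a / 4 + R" using that(1) by (simp add: abs_le_iff)
      hence "4 * (a - T) \<le> 4 * (a / 4 + R)" by (rule mult_left_mono) simp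
      also have "... = a + 4 * R" by simp
      finally have "3 * a \<le> 4 * T + 4 * R" by simp
      moreover have "4 * T + 4 * R \<le> 4 * u + 4 * r" using that(2,3) by simp
      moreover have "4 * u + 4 * r \<le> 6 * u + 6 * r" using that(4,5) by simp
      ultimately have "3 * a \<le> 6 * u + 6 * r" by (rule order_trans[OF order_trans])
      also have "... = 3 * (2 * (u + r))" by simp
      finally show ?thesis by simp
    qed
    ultimately show ?thesis using tq.Tl_estimate[OF m, of c N] T' by blast
  qed
  have "(sobolev_norm (real m) P)\<^sup>2 \<le> 2 * 4 ^ m * ((?a 0)\<^sup>2 + (?a m)\<^sup>2)"
    unfolding P_def by (rule trunc_norm_facts(4))
  also have "... \<le> 2 * 4 ^ m * ((X\<^sup>2 + Z) + 2 * 16 ^ m * ((16 ^ m + 1 + CC m) * (X\<^sup>2 + Z)))"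
  proof (intro mult_left_mono add_mono)
    show "(?a 0)\<^sup>2 \<le> X\<^sup>2 + Z" using Z0 by (simp add: add_increasing)
    note am
    also have "2 * (16 ^ m * (16 ^ m * X\<^sup>2 + Z) + CC m * Z) \<le> 2 * (16 ^ m * (16 ^ m * X\<^sup>2 + Z) + 16 ^ m * (CC m * Z))"
      using C Z0 mult_right_mono[of 1 "16 ^ m" "CC m * Z"] by simp
    also have "... = 2 * 16 ^ m * (16 ^ m * X\<^sup>2 + (1 + CC m) * Z)" by (simp add: algebra_simps)
    also have "... \<le> 2 * 16 ^ m * ((16 ^ m + 1 + CC m) * (X\<^sup>2 + Z))"
    proof (rule mult_left_mono)
      have "0 \<le> (1 + CC m) * X\<^sup>2 + 16 ^ m * Z" using C Z0 by simp
      thus "16 ^ m * X\<^sup>2 + (1 + CC m) * Z \<le> (16 ^ m + 1 + CC m) * (X\<^sup>2 + Z)" by (simp add: algebra_simps)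
    qed simp
    finally show "(?a m)\<^sup>2 \<le> 2 * 16 ^ m * ((16 ^ m + 1 + CC m) * (X\<^sup>2 + Z))" .
  qed simp
  also have "... = Kd m * (X\<^sup>2 + Z)" by (simp add: Kd_def algebra_simps)
  also have "Z = ((1 + X1) ^ (4 * m - 3) * X0)\<^sup>2" by (simp add: Z_def power_mult_distrib power_mult[symmetric] mult.commute)
  finally show "(sobolev_norm (real m) P)\<^sup>2 \<le> Kd m * ((coords_norm (real m) (\<Omega> P))\<^sup>2 + ((1 + coords_norm 1 (\<Omega> P)) ^ (4 * m - 3) * coords_norm 0 (\<Omega> P))\<^sup>2)"
    unfolding X_def X0_def X1_def .
  show "0 \<le> coords_norm (real m) (\<Omega> P)" "0 \<le> (1 + coords_norm 1 (\<Omega> P)) ^ (4 * m - 3) * coords_norm 0 (\<Omega> P)"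
    using X unfolding X_def[symmetric] X0_def[symmetric] X1_def[symmetric] by simp_all
qed (use Kd_pos[OF m] in simp)

theorem theorem1p1:
  fixes m :: nat
  assumes "m \<ge> 1"
  shows "\<exists>c d :: real. c > 0 \<and> d > 0 \<and>
    (\<forall>\<Omega>. birkhoff_map \<Omega> \<longrightarrow> (\<forall>\<phi>\<in>Hr (real m).
       coords_norm (real m) (\<Omega> \<phi>)
         \<le> c * (sobolev_norm (real m) \<phi> + (1 + sobolev_norm 1 \<phi>) ^ (2 * m) * sobolev_norm 0 \<phi>) \<and>
       sobolev_norm (real m) \<phi>
         \<le> d * (coords_norm (real m) (\<Omega> \<phi>)
                + (1 + coords_norm 1 (\<Omega> \<phi>)) ^ (4 * m - 3) * coords_norm 0 (\<Omega> \<phi>))))"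
proof (rule exI[of _ "sqrt (Kc m)"], rule exI[of _ "sqrt (Kd m)"], intro conjI allI impI ballI)
  show "sqrt (Kc m) > 0" "sqrt (Kd m) > 0" using Kc_pos[OF assms] Kd_pos[OF assms] by simp_all
  fix \<Omega> \<phi> assume \<Omega>: "birkhoff_map \<Omega>" and \<phi>: "\<phi> \<in> Hr (real m)"
  let ?P = "trunc (fourier_plus \<phi>)"
  \<comment> \<open>Convergence is needed in the norms of order 0, 1 and \<open>m\<close>; the
    condition \<open>m \<ge> 1\<close> places the first two within reach of the given
    regularity.\<close>
  have H: "\<phi> \<in> Hr (real j)" if "j \<le> m" for j using Hr_mono[OF \<phi>] that by simp
  have S: "(\<lambda>N. sobolev_norm (real j) (?P N)) \<longlonglongrightarrow> sobolev_norm (real j) \<phi>" if "j \<le> m" for j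
    by (rule trunc_diff(3)[OF H[OF that]])
  have C: "(\<lambda>N. coords_norm (real j) (\<Omega> (?P N))) \<longlonglongrightarrow> coords_norm (real j) (\<Omega> \<phi>)" if "j \<le> m" for j
    by (rule coords_norm_trunc_tendsto[OF \<Omega> H[OF that]])
  have S01: "(\<lambda>N. sobolev_norm 0 (?P N)) \<longlonglongrightarrow> sobolev_norm 0 \<phi>" "(\<lambda>N. sobolev_norm 1 (?P N)) \<longlonglongrightarrow> sobolev_norm 1 \<phi>"
    using S[of 0] S[of 1] assms by simp_all
  have C01: "(\<lambda>N. coords_norm 0 (\<Omega> (?P N))) \<longlonglongrightarrow> coords_norm 0 (\<Omega> \<phi>)" "(\<lambda>N. coords_norm 1 (\<Omega> (?P N))) \<longlonglongrightarrow> coords_norm 1 (\<Omega> \<phi>)"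
    using C[of 0] C[of 1] assms by simp_all
  show "coords_norm (real m) (\<Omega> \<phi>) \<le> sqrt (Kc m) *
      (sobolev_norm (real m) \<phi> + (1 + sobolev_norm 1 \<phi>) ^ (2 * m) * sobolev_norm 0 \<phi>)"
  proof (rule LIMSEQ_le[OF C[OF order_refl]])
    show "(\<lambda>N. sqrt (Kc m) * (sobolev_norm (real m) (?P N) + (1 + sobolev_norm 1 (?P N)) ^ (2 * m) * sobolev_norm 0 (?P N))) \<longlonglongrightarrow>
      sqrt (Kc m) * (sobolev_norm (real m) \<phi> + (1 + sobolev_norm 1 \<phi>) ^ (2 * m) * sobolev_norm 0 \<phi>)"
      by (intro tendsto_intros S[OF order_refl] S01)
  qed (use trunc_upper[OF \<Omega> assms] in blast)
  show "sobolev_norm (real m) \<phi> \<le> sqrt (Kd m) *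
      (coords_norm (real m) (\<Omega> \<phi>) + (1 + coords_norm 1 (\<Omega> \<phi>)) ^ (4 * m - 3) * coords_norm 0 (\<Omega> \<phi>))"
  proof (rule LIMSEQ_le[OF S[OF order_refl]])
    show "(\<lambda>N. sqrt (Kd m) * (coords_norm (real m) (\<Omega> (?P N)) + (1 + coords_norm 1 (\<Omega> (?P N))) ^ (4 * m - 3) * coords_norm 0 (\<Omega> (?P N)))) \<longlonglongrightarrow>
      sqrt (Kd m) * (coords_norm (real m) (\<Omega> \<phi>) + (1 + coords_norm 1 (\<Omega> \<phi>)) ^ (4 * m - 3) * coords_norm 0 (\<Omega> \<phi>))"
      by (intro tendsto_intros C[OF order_refl] C01)
  qed (use trunc_lower[OF \<Omega> assms] in blast)
qed

end
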